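(* Let $\mathcal{C}$ be the monoidal category of finite dimensional complex $\mathfrak{sl}_2$-modules. Let $\mathcal{K}_1$ be the additive closure, in the BGG category $\mathcal{O}$ for $\mathfrak{sl}_2$, of the projective-injective modules $P(\lambda)$, $\lambda\in\{-1,-2,\dots\}$. For a fixed $\xi\in\mathbb{C}\setminus\{0\}$, let $M(\xi)$ be the quotient of $U(\mathfrak{sl}_2)$ by the left ideal generated by $\mathtt{c}$ and $e-\xi$, where $\mathtt{c}=(h+1)^2+4fe$; set $X_{-1}:=M(\xi)$ and, for $i\in\{1,2,\dots\}$, let $X_{-1-i}$ be the kernel of $(\mathtt{c}-i^2)^2$ acting on $L(i)\otimes_{\mathbb{C}}M(\xi)$; let $\mathcal{K}_2=\mathcal{K}_2(\xi)$ be the additive closure of all $X_j$, $j\in\{-1,-2,\dots\}$. With $\mathcal{C}$ acting by tensoring over $\mathbb{C}$, both $\mathcal{K}_1$ and $\mathcal{K}_2$ are simple transitive $\mathcal{C}$-module categories of type $C_\infty$.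
   Context: Everything is over $\mathbb{C}$; $\mathfrak{sl}_2$ has standard basis $e,f,h$. $\mathcal{C}$ is the monoidal category (under $\otimes_{\mathbb{C}}$) of finite dimensional $\mathfrak{sl}_2$-modules; for $m\in\mathbb{Z}_{\ge 0}$, $L(m)$ is the simple module of dimension $m+1$. For $\lambda\in\mathbb{C}$, $P(\lambda)$ is the indecomposable projective cover in $\mathcal{O}$ of the simple highest weight module $L(\lambda)$ with highest weight $\lambda$. The additive closure of a set of modules is the full subcategory of modules isomorphic to direct summands of finite direct sums of them. A $\mathcal{C}$-module category $\mathcal{M}$ is locally finitary if it is $\mathbb{C}$-linear, additive, idempotent split, Krull-Schmidt, has at most countably many indecomposable objects up to isomorphism, and has finite dimensional hom-spaces. It is simple transitive if it has no non-trivial $\mathcal{C}$-invariant ideals (ideals other than $0$ and $\mathcal{M}$). A locally finitary $\mathcal{C}$-module category is of type $C_\infty$ if its indecomposables, up to isomorphism, can be listed without repetition as $Y_1,Y_2,Y_3,\dots$ so that $L(1)\cdot Y_1\cong Y_2$, $L(1)\cdot Y_2\cong Y_1\oplus Y_1\oplus Y_3$, and $L(1)\cdot Y_i\cong Y_{i-1}\oplus Y_{i+1}$ for $i\geq 3$. *)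

theory Defs
  imports
    Complex_Main
    "HOL-Library.Poly_Mapping"
    "HOL-Library.Function_Algebras"
    "HOL-Library.Nat_Bijection"
    "HOL-Library.Countable_Set"
begin

section \<open>Linear categories\<close>

text \<open>
  All hom-spaces are linear subspaces of one ambient complex vector space \<open>'m\<close>, whose zero and sum
  are used for morphisms. \<open>Comp K g f\<close> is \<open>g\<close> after \<open>f\<close>. Hom-spaces for different pairs of
  objects may overlap (they all contain \<open>0\<close>), so no source or target can be read off a morphism.
\<close>

record ('o, 'm) linear_cat =
  Ob :: "'o set"
  Hom :: "'o \<Rightarrow> 'o \<Rightarrow> 'm set"
  Id :: "'o \<Rightarrow> 'm"
  Comp :: "'m \<Rightarrow> 'm \<Rightarrow> 'm"
  Scale :: "complex \<Rightarrow> 'm \<Rightarrow> 'm"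

locale linear_category =
  fixes K :: "('o, 'm::ab_group_add, 'z) linear_cat_scheme"
  assumes scale: "vector_space (Scale K)"
    and hom_subspace: "\<And>a b. a \<in> Ob K \<Longrightarrow> b \<in> Ob K \<Longrightarrow> module.subspace (Scale K) (Hom K a b)"
    and id_in_hom: "\<And>a. a \<in> Ob K \<Longrightarrow> Id K a \<in> Hom K a a"
    and comp_in_hom: "\<And>a b c f g. a \<in> Ob K \<Longrightarrow> b \<in> Ob K \<Longrightarrow> c \<in> Ob K \<Longrightarrow>
      f \<in> Hom K a b \<Longrightarrow> g \<in> Hom K b c \<Longrightarrow> Comp K g f \<in> Hom K a c"
    and comp_assoc: "\<And>a b c d f g h. a \<in> Ob K \<Longrightarrow> b \<in> Ob K \<Longrightarrow> c \<in> Ob K \<Longrightarrow> d \<in> Ob K \<Longrightarrow>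
      f \<in> Hom K a b \<Longrightarrow> g \<in> Hom K b c \<Longrightarrow> h \<in> Hom K c d \<Longrightarrow>
      Comp K h (Comp K g f) = Comp K (Comp K h g) f"
    and id_left: "\<And>a b f. a \<in> Ob K \<Longrightarrow> b \<in> Ob K \<Longrightarrow> f \<in> Hom K a b \<Longrightarrow> Comp K (Id K b) f = f"
    and id_right: "\<And>a b f. a \<in> Ob K \<Longrightarrow> b \<in> Ob K \<Longrightarrow> f \<in> Hom K a b \<Longrightarrow> Comp K f (Id K a) = f"
    and comp_add: "\<And>a b c f f' g g'. a \<in> Ob K \<Longrightarrow> b \<in> Ob K \<Longrightarrow> c \<in> Ob K \<Longrightarrow>
      f \<in> Hom K a b \<Longrightarrow> f' \<in> Hom K a b \<Longrightarrow> g \<in> Hom K b c \<Longrightarrow> g' \<in> Hom K b c \<Longrightarrow>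
      Comp K (g + g') f = Comp K g f + Comp K g' f \<and> Comp K g (f + f') = Comp K g f + Comp K g f'"
    and comp_scale: "\<And>a b c f g t. a \<in> Ob K \<Longrightarrow> b \<in> Ob K \<Longrightarrow> c \<in> Ob K \<Longrightarrow>
      f \<in> Hom K a b \<Longrightarrow> g \<in> Hom K b c \<Longrightarrow>
      Comp K (Scale K t g) f = Scale K t (Comp K g f) \<and> Comp K g (Scale K t f) = Scale K t (Comp K g f)"

definition isomorphism :: "('o, 'm, 'z) linear_cat_scheme \<Rightarrow> 'o \<Rightarrow> 'o \<Rightarrow> 'm \<Rightarrow> bool" where
  "isomorphism K a b f \<longleftrightarrow>
     f \<in> Hom K a b \<and> (\<exists>g\<in>Hom K b a. Comp K g f = Id K a \<and> Comp K f g = Id K b)"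

definition isomorphic :: "('o, 'm, 'z) linear_cat_scheme \<Rightarrow> 'o \<Rightarrow> 'o \<Rightarrow> bool" where
  "isomorphic K a b \<longleftrightarrow> (\<exists>f. isomorphism K a b f)"

text \<open>\<open>direct_sum K As D\<close>: \<open>D\<close> is a biproduct of the list \<open>As\<close> (a zero object if the list is empty).\<close>

definition direct_sum :: "('o, 'm::ab_group_add, 'z) linear_cat_scheme \<Rightarrow> 'o list \<Rightarrow> 'o \<Rightarrow> bool" where
  "direct_sum K As D \<longleftrightarrow> set As \<subseteq> Ob K \<and> D \<in> Ob K \<and>
     (\<exists>\<iota> \<pi>. (\<forall>k<length As. \<iota> k \<in> Hom K (As ! k) D \<and> \<pi> k \<in> Hom K D (As ! k)) \<and>
            (\<forall>k<length As. \<forall>l<length As. Comp K (\<pi> k) (\<iota> l) = (if k = l then Id K (As ! k) else 0)) \<and>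
            (\<Sum>k<length As. Comp K (\<iota> k) (\<pi> k)) = Id K D)"

abbreviation zero_object :: "('o, 'm::ab_group_add, 'z) linear_cat_scheme \<Rightarrow> 'o \<Rightarrow> bool" where
  "zero_object K \<equiv> direct_sum K []"

definition additive :: "('o, 'm::ab_group_add, 'z) linear_cat_scheme \<Rightarrow> bool" where
  "additive K \<longleftrightarrow> (\<forall>As. set As \<subseteq> Ob K \<longrightarrow> (\<exists>D. direct_sum K As D))"

definition idempotent_split :: "('o, 'm, 'z) linear_cat_scheme \<Rightarrow> bool" where
  "idempotent_split K \<longleftrightarrow> (\<forall>a\<in>Ob K. \<forall>e\<in>Hom K a a. Comp K e e = e \<longrightarrow>
     (\<exists>b\<in>Ob K. \<exists>r\<in>Hom K a b. \<exists>s\<in>Hom K b a. Comp K r s = Id K b \<and> Comp K s r = e))"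

text \<open>The endomorphism ring is nonzero and its non-units are closed under addition.\<close>

definition local_endomorphisms :: "('o, 'm::ab_group_add, 'z) linear_cat_scheme \<Rightarrow> 'o \<Rightarrow> bool" where
  "local_endomorphisms K a \<longleftrightarrow> Id K a \<noteq> 0 \<and>
     (\<forall>f\<in>Hom K a a. \<forall>g\<in>Hom K a a. isomorphism K a a (f + g) \<longrightarrow>
        isomorphism K a a f \<or> isomorphism K a a g)"

definition krull_schmidt :: "('o, 'm::ab_group_add, 'z) linear_cat_scheme \<Rightarrow> bool" where
  "krull_schmidt K \<longleftrightarrow>
     (\<forall>a\<in>Ob K. \<exists>As. direct_sum K As a \<and> (\<forall>b\<in>set As. local_endomorphisms K b))"

definition indecomposable :: "('o, 'm::ab_group_add, 'z) linear_cat_scheme \<Rightarrow> 'o \<Rightarrow> bool" where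
  "indecomposable K a \<longleftrightarrow> a \<in> Ob K \<and> \<not> zero_object K a \<and>
     (\<forall>b c. direct_sum K [b, c] a \<longrightarrow> zero_object K b \<or> zero_object K c)"

definition countably_many_indecomposables ::
    "('o, 'm::ab_group_add, 'z) linear_cat_scheme \<Rightarrow> bool" where
  "countably_many_indecomposables K \<longleftrightarrow>
     (\<exists>S. countable S \<and> (\<forall>a. indecomposable K a \<longrightarrow> (\<exists>b\<in>S. isomorphic K a b)))"

definition finite_dimensional_homs :: "('o, 'm::ab_group_add, 'z) linear_cat_scheme \<Rightarrow> bool" where
  "finite_dimensional_homs K \<longleftrightarrow>
     (\<forall>a\<in>Ob K. \<forall>b\<in>Ob K. \<exists>B. finite B \<and> Hom K a b \<subseteq> module.span (Scale K) B)"

definition additive_closure :: "('o, 'm::ab_group_add, 'z) linear_cat_scheme \<Rightarrow> 'o set \<Rightarrow> 'o set" where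
  "additive_closure K S =
     {V. \<exists>As D W. set As \<subseteq> S \<and> direct_sum K As D \<and> direct_sum K [V, W] D}"

definition ideal :: "('o, 'm::ab_group_add, 'z) linear_cat_scheme \<Rightarrow> ('o \<Rightarrow> 'o \<Rightarrow> 'm set) \<Rightarrow> bool" where
  "ideal K I \<longleftrightarrow>
     (\<forall>a\<in>Ob K. \<forall>b\<in>Ob K. I a b \<subseteq> Hom K a b \<and> module.subspace (Scale K) (I a b)) \<and>
     (\<forall>a\<in>Ob K. \<forall>b\<in>Ob K. \<forall>c\<in>Ob K. \<forall>f\<in>I a b. \<forall>g\<in>Hom K b c. Comp K g f \<in> I a c) \<and>
     (\<forall>a\<in>Ob K. \<forall>b\<in>Ob K. \<forall>c\<in>Ob K. \<forall>f\<in>Hom K a b. \<forall>g\<in>I b c. Comp K g f \<in> I a c)"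


section \<open>Monoidal categories and module categories\<close>

record ('c, 'd) monoidal_cat = "('c, 'd) linear_cat" +
  Tensor :: "'c \<Rightarrow> 'c \<Rightarrow> 'c"
  TensorM :: "'d \<Rightarrow> 'd \<Rightarrow> 'd"
  Unit :: "'c"
  Assoc :: "'c \<Rightarrow> 'c \<Rightarrow> 'c \<Rightarrow> 'd"
  LUnit :: "'c \<Rightarrow> 'd"
  RUnit :: "'c \<Rightarrow> 'd"

locale monoidal_linear_category = linear_category C
  for C :: "('c, 'd::ab_group_add, 'z) monoidal_cat_scheme" +
  assumes unit_ob: "Unit C \<in> Ob C"
    and tensor_ob: "\<And>X Y. X \<in> Ob C \<Longrightarrow> Y \<in> Ob C \<Longrightarrow> Tensor C X Y \<in> Ob C"
    and tensor_hom: "\<And>X X' Y Y' f g. X \<in> Ob C \<Longrightarrow> X' \<in> Ob C \<Longrightarrow> Y \<in> Ob C \<Longrightarrow> Y' \<in> Ob C \<Longrightarrow>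
      f \<in> Hom C X X' \<Longrightarrow> g \<in> Hom C Y Y' \<Longrightarrow>
      TensorM C f g \<in> Hom C (Tensor C X Y) (Tensor C X' Y')"
    and tensor_id: "\<And>X Y. X \<in> Ob C \<Longrightarrow> Y \<in> Ob C \<Longrightarrow>
      TensorM C (Id C X) (Id C Y) = Id C (Tensor C X Y)"
    and tensor_comp: "\<And>X X' X'' Y Y' Y'' f f' g g'.
      X \<in> Ob C \<Longrightarrow> X' \<in> Ob C \<Longrightarrow> X'' \<in> Ob C \<Longrightarrow> Y \<in> Ob C \<Longrightarrow> Y' \<in> Ob C \<Longrightarrow> Y'' \<in> Ob C \<Longrightarrow>
      f \<in> Hom C X X' \<Longrightarrow> f' \<in> Hom C X' X'' \<Longrightarrow> g \<in> Hom C Y Y' \<Longrightarrow> g' \<in> Hom C Y' Y'' \<Longrightarrow>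
      TensorM C (Comp C f' f) (Comp C g' g) = Comp C (TensorM C f' g') (TensorM C f g)"
    and tensor_add: "\<And>X X' Y Y' f f' g g'. X \<in> Ob C \<Longrightarrow> X' \<in> Ob C \<Longrightarrow> Y \<in> Ob C \<Longrightarrow> Y' \<in> Ob C \<Longrightarrow>
      f \<in> Hom C X X' \<Longrightarrow> f' \<in> Hom C X X' \<Longrightarrow> g \<in> Hom C Y Y' \<Longrightarrow> g' \<in> Hom C Y Y' \<Longrightarrow>
      TensorM C (f + f') g = TensorM C f g + TensorM C f' g \<and>
      TensorM C f (g + g') = TensorM C f g + TensorM C f g'"
    and tensor_scale: "\<And>X X' Y Y' f g t. X \<in> Ob C \<Longrightarrow> X' \<in> Ob C \<Longrightarrow> Y \<in> Ob C \<Longrightarrow> Y' \<in> Ob C \<Longrightarrow>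
      f \<in> Hom C X X' \<Longrightarrow> g \<in> Hom C Y Y' \<Longrightarrow>
      TensorM C (Scale C t f) g = Scale C t (TensorM C f g) \<and>
      TensorM C f (Scale C t g) = Scale C t (TensorM C f g)"
    and assoc_iso: "\<And>X Y Z. X \<in> Ob C \<Longrightarrow> Y \<in> Ob C \<Longrightarrow> Z \<in> Ob C \<Longrightarrow>
      isomorphism C (Tensor C (Tensor C X Y) Z) (Tensor C X (Tensor C Y Z)) (Assoc C X Y Z)"
    and assoc_natural: "\<And>X X' Y Y' Z Z' f g h.
      X \<in> Ob C \<Longrightarrow> X' \<in> Ob C \<Longrightarrow> Y \<in> Ob C \<Longrightarrow> Y' \<in> Ob C \<Longrightarrow> Z \<in> Ob C \<Longrightarrow> Z' \<in> Ob C \<Longrightarrow>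
      f \<in> Hom C X X' \<Longrightarrow> g \<in> Hom C Y Y' \<Longrightarrow> h \<in> Hom C Z Z' \<Longrightarrow>
      Comp C (Assoc C X' Y' Z') (TensorM C (TensorM C f g) h) =
      Comp C (TensorM C f (TensorM C g h)) (Assoc C X Y Z)"
    and lunit_iso: "\<And>X. X \<in> Ob C \<Longrightarrow> isomorphism C (Tensor C (Unit C) X) X (LUnit C X)"
    and lunit_natural: "\<And>X X' f. X \<in> Ob C \<Longrightarrow> X' \<in> Ob C \<Longrightarrow> f \<in> Hom C X X' \<Longrightarrow>
      Comp C (LUnit C X') (TensorM C (Id C (Unit C)) f) = Comp C f (LUnit C X)"
    and runit_iso: "\<And>X. X \<in> Ob C \<Longrightarrow> isomorphism C (Tensor C X (Unit C)) X (RUnit C X)"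
    and runit_natural: "\<And>X X' f. X \<in> Ob C \<Longrightarrow> X' \<in> Ob C \<Longrightarrow> f \<in> Hom C X X' \<Longrightarrow>
      Comp C (RUnit C X') (TensorM C f (Id C (Unit C))) = Comp C f (RUnit C X)"
    and pentagon: "\<And>W X Y Z. W \<in> Ob C \<Longrightarrow> X \<in> Ob C \<Longrightarrow> Y \<in> Ob C \<Longrightarrow> Z \<in> Ob C \<Longrightarrow>
      Comp C (TensorM C (Id C W) (Assoc C X Y Z))
        (Comp C (Assoc C W (Tensor C X Y) Z) (TensorM C (Assoc C W X Y) (Id C Z))) =
      Comp C (Assoc C W X (Tensor C Y Z)) (Assoc C (Tensor C W X) Y Z)"
    and triangle: "\<And>X Y. X \<in> Ob C \<Longrightarrow> Y \<in> Ob C \<Longrightarrow>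
      Comp C (TensorM C (Id C X) (LUnit C Y)) (Assoc C X (Unit C) Y) =
      TensorM C (RUnit C X) (Id C Y)"

record ('o, 'm, 'c, 'd) module_cat = "('o, 'm) linear_cat" +
  Act :: "'c \<Rightarrow> 'o \<Rightarrow> 'o"
  ActM :: "'d \<Rightarrow> 'm \<Rightarrow> 'm"
  ActAssoc :: "'c \<Rightarrow> 'c \<Rightarrow> 'o \<Rightarrow> 'm"
  ActUnit :: "'o \<Rightarrow> 'm"

locale module_category = C: monoidal_linear_category C + M: linear_category M
  for C :: "('c, 'd::ab_group_add, 'y) monoidal_cat_scheme"
    and M :: "('o, 'm::ab_group_add, 'c, 'd, 'z) module_cat_scheme" +
  assumes act_ob: "\<And>X A. X \<in> Ob C \<Longrightarrow> A \<in> Ob M \<Longrightarrow> Act M X A \<in> Ob M"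
    and act_hom: "\<And>X X' A A' f g. X \<in> Ob C \<Longrightarrow> X' \<in> Ob C \<Longrightarrow> A \<in> Ob M \<Longrightarrow> A' \<in> Ob M \<Longrightarrow>
      f \<in> Hom C X X' \<Longrightarrow> g \<in> Hom M A A' \<Longrightarrow> ActM M f g \<in> Hom M (Act M X A) (Act M X' A')"
    and act_id: "\<And>X A. X \<in> Ob C \<Longrightarrow> A \<in> Ob M \<Longrightarrow> ActM M (Id C X) (Id M A) = Id M (Act M X A)"
    and act_comp: "\<And>X X' X'' A A' A'' f f' g g'.
      X \<in> Ob C \<Longrightarrow> X' \<in> Ob C \<Longrightarrow> X'' \<in> Ob C \<Longrightarrow> A \<in> Ob M \<Longrightarrow> A' \<in> Ob M \<Longrightarrow> A'' \<in> Ob M \<Longrightarrow>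
      f \<in> Hom C X X' \<Longrightarrow> f' \<in> Hom C X' X'' \<Longrightarrow> g \<in> Hom M A A' \<Longrightarrow> g' \<in> Hom M A' A'' \<Longrightarrow>
      ActM M (Comp C f' f) (Comp M g' g) = Comp M (ActM M f' g') (ActM M f g)"
    and act_add: "\<And>X X' A A' f f' g g'. X \<in> Ob C \<Longrightarrow> X' \<in> Ob C \<Longrightarrow> A \<in> Ob M \<Longrightarrow> A' \<in> Ob M \<Longrightarrow>
      f \<in> Hom C X X' \<Longrightarrow> f' \<in> Hom C X X' \<Longrightarrow> g \<in> Hom M A A' \<Longrightarrow> g' \<in> Hom M A A' \<Longrightarrow>
      ActM M (f + f') g = ActM M f g + ActM M f' g \<and>
      ActM M f (g + g') = ActM M f g + ActM M f g'"
    and act_scale: "\<And>X X' A A' f g t. X \<in> Ob C \<Longrightarrow> X' \<in> Ob C \<Longrightarrow> A \<in> Ob M \<Longrightarrow> A' \<in> Ob M \<Longrightarrow>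
      f \<in> Hom C X X' \<Longrightarrow> g \<in> Hom M A A' \<Longrightarrow>
      ActM M (Scale C t f) g = Scale M t (ActM M f g) \<and>
      ActM M f (Scale M t g) = Scale M t (ActM M f g)"
    and act_assoc_iso: "\<And>X Y A. X \<in> Ob C \<Longrightarrow> Y \<in> Ob C \<Longrightarrow> A \<in> Ob M \<Longrightarrow>
      isomorphism M (Act M (Tensor C X Y) A) (Act M X (Act M Y A)) (ActAssoc M X Y A)"
    and act_assoc_natural: "\<And>X X' Y Y' A A' f g h.
      X \<in> Ob C \<Longrightarrow> X' \<in> Ob C \<Longrightarrow> Y \<in> Ob C \<Longrightarrow> Y' \<in> Ob C \<Longrightarrow> A \<in> Ob M \<Longrightarrow> A' \<in> Ob M \<Longrightarrow>
      f \<in> Hom C X X' \<Longrightarrow> g \<in> Hom C Y Y' \<Longrightarrow> h \<in> Hom M A A' \<Longrightarrow>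
      Comp M (ActAssoc M X' Y' A') (ActM M (TensorM C f g) h) =
      Comp M (ActM M f (ActM M g h)) (ActAssoc M X Y A)"
    and act_unit_iso: "\<And>A. A \<in> Ob M \<Longrightarrow> isomorphism M (Act M (Unit C) A) A (ActUnit M A)"
    and act_unit_natural: "\<And>A A' f. A \<in> Ob M \<Longrightarrow> A' \<in> Ob M \<Longrightarrow> f \<in> Hom M A A' \<Longrightarrow>
      Comp M (ActUnit M A') (ActM M (Id C (Unit C)) f) = Comp M f (ActUnit M A)"
    and act_pentagon: "\<And>X Y Z A. X \<in> Ob C \<Longrightarrow> Y \<in> Ob C \<Longrightarrow> Z \<in> Ob C \<Longrightarrow> A \<in> Ob M \<Longrightarrow>
      Comp M (ActM M (Id C X) (ActAssoc M Y Z A))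
        (Comp M (ActAssoc M X (Tensor C Y Z) A) (ActM M (Assoc C X Y Z) (Id M A))) =
      Comp M (ActAssoc M X Y (Act M Z A)) (ActAssoc M (Tensor C X Y) Z A)"
    and act_triangle: "\<And>X A. X \<in> Ob C \<Longrightarrow> A \<in> Ob M \<Longrightarrow>
      Comp M (ActM M (Id C X) (ActUnit M A)) (ActAssoc M X (Unit C) A) =
      ActM M (RUnit C X) (Id M A)"

definition locally_finitary ::
    "('c, 'd::ab_group_add, 'y) monoidal_cat_scheme \<Rightarrow>
     ('o, 'm::ab_group_add, 'c, 'd, 'z) module_cat_scheme \<Rightarrow> bool" where
  "locally_finitary C M \<longleftrightarrow> module_category C M \<and> additive M \<and> idempotent_split M \<and>
     krull_schmidt M \<and> countably_many_indecomposables M \<and> finite_dimensional_homs M"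

definition invariant_ideal ::
    "('c, 'd, 'y) monoidal_cat_scheme \<Rightarrow>
     ('o, 'm::ab_group_add, 'c, 'd, 'z) module_cat_scheme \<Rightarrow> ('o \<Rightarrow> 'o \<Rightarrow> 'm set) \<Rightarrow> bool" where
  "invariant_ideal C M I \<longleftrightarrow> ideal M I \<and>
     (\<forall>X\<in>Ob C. \<forall>a\<in>Ob M. \<forall>b\<in>Ob M. \<forall>f\<in>I a b. ActM M (Id C X) f \<in> I (Act M X a) (Act M X b))"

definition simple_transitive ::
    "('c, 'd::ab_group_add, 'y) monoidal_cat_scheme \<Rightarrow>
     ('o, 'm::ab_group_add, 'c, 'd, 'z) module_cat_scheme \<Rightarrow> bool" where
  "simple_transitive C M \<longleftrightarrow> locally_finitary C M \<and>
     (\<forall>I. invariant_ideal C M I \<longrightarrow>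
        (\<forall>a\<in>Ob M. \<forall>b\<in>Ob M. I a b = {0}) \<or> (\<forall>a\<in>Ob M. \<forall>b\<in>Ob M. I a b = Hom M a b))"

text \<open>
  The argument \<open>L1\<close> is the object of \<open>C\<close> whose action is described. A list
  \<open>[A, B, ...]\<close> stands for the direct sum of its members.
\<close>

definition type_C_infinity ::
    "('c, 'd::ab_group_add, 'y) monoidal_cat_scheme \<Rightarrow> 'c \<Rightarrow>
     ('o, 'm::ab_group_add, 'c, 'd, 'z) module_cat_scheme \<Rightarrow> bool" where
  "type_C_infinity C L1 M \<longleftrightarrow> locally_finitary C M \<and>
     (\<exists>Y :: nat \<Rightarrow> 'o.
        (\<forall>i\<ge>1. indecomposable M (Y i)) \<and>
        (\<forall>i\<ge>1. \<forall>j\<ge>1. isomorphic M (Y i) (Y j) \<longrightarrow> i = j) \<and>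
        (\<forall>a. indecomposable M a \<longrightarrow> (\<exists>i\<ge>1. isomorphic M a (Y i))) \<and>
        isomorphic M (Act M L1 (Y 1)) (Y 2) \<and>
        direct_sum M [Y 1, Y 1, Y 3] (Act M L1 (Y 2)) \<and>
        (\<forall>i\<ge>3. direct_sum M [Y (i - 1), Y (i + 1)] (Act M L1 (Y i))))"


section \<open>Modules over \<open>sl\<^sub>2\<close>\<close>

text \<open>
  Objects of a category have to live in one fixed type. We take the vector spaces with a basis
  indexed by a set \<open>B\<close> of natural numbers, realised as the finitely supported functions
  \<open>nat \<Rightarrow>\<^sub>0 complex\<close> that vanish outside \<open>B\<close>. Every complex vector space of at most countable
  dimension is isomorphic to one of these, and all modules of \<open>\<O>\<close>, all cyclic modules and all
  their tensor products with finite dimensional modules have at most countable dimension.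
\<close>

type_synonym vec = "nat \<Rightarrow>\<^sub>0 complex"

definition vscale :: "complex \<Rightarrow> vec \<Rightarrow> vec" where
  "vscale t v = Poly_Mapping.map ((*) t) v"

lemma lookup_vscale [simp]: "Poly_Mapping.lookup (vscale t v) i = t * Poly_Mapping.lookup v i"
  by (simp add: vscale_def Poly_Mapping.map.rep_eq when_def)

global_interpretation vec: vector_space vscale
  by unfold_locales (simp_all add: poly_mapping_eq_iff lookup_add fun_eq_iff algebra_simps)

definition basis_vec :: "nat \<Rightarrow> vec" where
  "basis_vec i = Poly_Mapping.single i 1"

definition vec_space :: "nat set \<Rightarrow> vec set" where
  "vec_space B = {v. Poly_Mapping.keys v \<subseteq> B}"

definition linear_extension :: "(nat \<Rightarrow> vec) \<Rightarrow> vec \<Rightarrow> vec" where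
  "linear_extension \<phi> v = (\<Sum>i\<in>Poly_Mapping.keys v. vscale (Poly_Mapping.lookup v i) (\<phi> i))"

text \<open>
  Linear maps from \<open>vec_space B\<close> to \<open>vec_space B'\<close>, made unique as functions on all vectors by
  requiring that they kill the basis vectors outside \<open>B\<close>.
\<close>

definition linear_maps :: "nat set \<Rightarrow> nat set \<Rightarrow> (vec \<Rightarrow> vec) set" where
  "linear_maps B B' = {T. Vector_Spaces.linear vscale vscale T \<and>
     (\<forall>v. T v \<in> vec_space B') \<and> (\<forall>i. i \<notin> B \<longrightarrow> T (basis_vec i) = 0)}"

definition id_map :: "nat set \<Rightarrow> vec \<Rightarrow> vec" where
  "id_map B = linear_extension (\<lambda>i. if i \<in> B then basis_vec i else 0)"

record sl2_module =
  basis :: "nat set"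
  act_e :: "vec \<Rightarrow> vec"
  act_f :: "vec \<Rightarrow> vec"
  act_h :: "vec \<Rightarrow> vec"

abbreviation space :: "sl2_module \<Rightarrow> vec set" where
  "space V \<equiv> vec_space (basis V)"

definition sl2_modules :: "sl2_module set" where
  "sl2_modules = {V. {act_e V, act_f V, act_h V} \<subseteq> linear_maps (basis V) (basis V) \<and>
     (\<forall>v. act_e V (act_f V v) - act_f V (act_e V v) = act_h V v) \<and>
     (\<forall>v. act_h V (act_e V v) - act_e V (act_h V v) = vscale 2 (act_e V v)) \<and>
     (\<forall>v. act_h V (act_f V v) - act_f V (act_h V v) = vscale (-2) (act_f V v))}"

definition sl2_hom :: "sl2_module \<Rightarrow> sl2_module \<Rightarrow> (vec \<Rightarrow> vec) set" where
  "sl2_hom V W = {T \<in> linear_maps (basis V) (basis W).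
     \<forall>v. T (act_e V v) = act_e W (T v) \<and> T (act_f V v) = act_f W (T v) \<and>
         T (act_h V v) = act_h W (T v)}"

definition map_scale :: "complex \<Rightarrow> (vec \<Rightarrow> vec) \<Rightarrow> vec \<Rightarrow> vec" where
  "map_scale t T = (\<lambda>v. vscale t (T v))"

text \<open>The pair \<open>(i, j)\<close> of basis indices is encoded as the number \<open>prod_encode (i, j)\<close>.\<close>

definition tensor_vec :: "vec \<Rightarrow> vec \<Rightarrow> vec" where
  "tensor_vec v w = (\<Sum>i\<in>Poly_Mapping.keys v. \<Sum>j\<in>Poly_Mapping.keys w.
     Poly_Mapping.single (prod_encode (i, j)) (Poly_Mapping.lookup v i * Poly_Mapping.lookup w j))"

definition tensor_map :: "(vec \<Rightarrow> vec) \<Rightarrow> (vec \<Rightarrow> vec) \<Rightarrow> vec \<Rightarrow> vec" where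
  "tensor_map S T = linear_extension
     (\<lambda>k. case prod_decode k of (i, j) \<Rightarrow> tensor_vec (S (basis_vec i)) (T (basis_vec j)))"

definition tensor_module :: "sl2_module \<Rightarrow> sl2_module \<Rightarrow> sl2_module" where
  "tensor_module V W = \<lparr>
     basis = prod_encode ` (basis V \<times> basis W),
     act_e = tensor_map (act_e V) (id_map (basis W)) + tensor_map (id_map (basis V)) (act_e W),
     act_f = tensor_map (act_f V) (id_map (basis W)) + tensor_map (id_map (basis V)) (act_f W),
     act_h = tensor_map (act_h V) (id_map (basis W)) + tensor_map (id_map (basis V)) (act_h W)\<rparr>"

definition trivial_module :: sl2_module where
  "trivial_module = \<lparr>basis = {0}, act_e = 0, act_f = 0, act_h = 0\<rparr>"

text \<open>\<open>(u \<otimes> v) \<otimes> w \<mapsto> u \<otimes> (v \<otimes> w)\<close>, \<open>1 \<otimes> v \<mapsto> v\<close> and \<open>v \<otimes> 1 \<mapsto> v\<close>.\<close>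

definition associator :: "sl2_module \<Rightarrow> sl2_module \<Rightarrow> sl2_module \<Rightarrow> vec \<Rightarrow> vec" where
  "associator U V W = linear_extension (\<lambda>n.
     if n \<in> basis (tensor_module (tensor_module U V) W) then
       (case prod_decode n of (m, k) \<Rightarrow> case prod_decode m of (i, j) \<Rightarrow>
          basis_vec (prod_encode (i, prod_encode (j, k))))
     else 0)"

definition left_unitor :: "sl2_module \<Rightarrow> vec \<Rightarrow> vec" where
  "left_unitor V = linear_extension (\<lambda>n.
     if n \<in> basis (tensor_module trivial_module V) then basis_vec (snd (prod_decode n)) else 0)"

definition right_unitor :: "sl2_module \<Rightarrow> vec \<Rightarrow> vec" where
  "right_unitor V = linear_extension (\<lambda>n.
     if n \<in> basis (tensor_module V trivial_module) then basis_vec (fst (prod_decode n)) else 0)"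

definition finite_dimensional_sl2_modules :: "(sl2_module, vec \<Rightarrow> vec) monoidal_cat" where
  "finite_dimensional_sl2_modules = \<lparr>
     Ob = {V \<in> sl2_modules. finite (basis V)}, Hom = sl2_hom, Id = (\<lambda>V. id_map (basis V)),
     Comp = (\<circ>), Scale = map_scale,
     Tensor = tensor_module, TensorM = tensor_map, Unit = trivial_module,
     Assoc = associator, LUnit = left_unitor, RUnit = right_unitor\<rparr>"

definition sl2_module_cat :: "(sl2_module, vec \<Rightarrow> vec, sl2_module, vec \<Rightarrow> vec) module_cat" where
  "sl2_module_cat = \<lparr>
     Ob = sl2_modules, Hom = sl2_hom, Id = (\<lambda>V. id_map (basis V)), Comp = (\<circ>), Scale = map_scale,
     Act = tensor_module, ActM = tensor_map, ActAssoc = associator, ActUnit = left_unitor\<rparr>"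

definition submodule :: "vec set \<Rightarrow> sl2_module \<Rightarrow> bool" where
  "submodule N V \<longleftrightarrow> N \<subseteq> space V \<and> vec.subspace N \<and>
     (\<forall>v\<in>N. act_e V v \<in> N \<and> act_f V v \<in> N \<and> act_h V v \<in> N)"

definition simple_module :: "sl2_module \<Rightarrow> bool" where
  "simple_module V \<longleftrightarrow> V \<in> sl2_modules \<and> space V \<noteq> {0} \<and>
     (\<forall>N. submodule N V \<longrightarrow> N = {0} \<or> N = space V)"

text \<open>
  Here and below, \<open>SOME\<close> picks a representative of the isomorphism class determined by
  the stated property.
\<close>

definition L_fd :: "nat \<Rightarrow> sl2_module" where
  "L_fd m = (SOME V. simple_module V \<and> finite (basis V) \<and> card (basis V) = m + 1)"


section \<open>Category \<open>\<O>\<close> and the category \<open>K\<^sub>1\<close>\<close>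

definition finitely_generated :: "sl2_module \<Rightarrow> bool" where
  "finitely_generated V \<longleftrightarrow>
     (\<exists>S. finite S \<and> S \<subseteq> space V \<and> (\<forall>N. submodule N V \<and> S \<subseteq> N \<longrightarrow> N = space V))"

definition weight_module :: "sl2_module \<Rightarrow> bool" where
  "weight_module V \<longleftrightarrow> vec.span {v \<in> space V. \<exists>\<mu>. act_h V v = vscale \<mu> v} = space V"

definition locally_e_finite :: "sl2_module \<Rightarrow> bool" where
  "locally_e_finite V \<longleftrightarrow>
     (\<forall>v\<in>space V. \<exists>B. finite B \<and> (\<forall>k. (act_e V ^^ k) v \<in> vec.span B))"

definition category_O :: "(sl2_module, vec \<Rightarrow> vec, sl2_module, vec \<Rightarrow> vec) module_cat" where
  "category_O = sl2_module_cat
     \<lparr>Ob := {V \<in> sl2_modules. finitely_generated V \<and> weight_module V \<and> locally_e_finite V}\<rparr>"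

definition L_hw :: "complex \<Rightarrow> sl2_module" where
  "L_hw \<mu> = (SOME V. simple_module V \<and>
     (\<exists>v\<in>space V. v \<noteq> 0 \<and> act_e V v = 0 \<and> act_h V v = vscale \<mu> v))"

definition surjective_hom :: "sl2_module \<Rightarrow> sl2_module \<Rightarrow> (vec \<Rightarrow> vec) \<Rightarrow> bool" where
  "surjective_hom V W p \<longleftrightarrow> p \<in> sl2_hom V W \<and> p ` space V = space W"

definition projective_in_O :: "sl2_module \<Rightarrow> bool" where
  "projective_in_O P \<longleftrightarrow> P \<in> Ob category_O \<and>
     (\<forall>A\<in>Ob category_O. \<forall>B\<in>Ob category_O. \<forall>g f. surjective_hom A B g \<and> f \<in> sl2_hom P B \<longrightarrow>
        (\<exists>f'\<in>sl2_hom P A. g \<circ> f' = f))"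

definition projective_cover_in_O :: "sl2_module \<Rightarrow> sl2_module \<Rightarrow> bool" where
  "projective_cover_in_O P V \<longleftrightarrow> projective_in_O P \<and>
     (\<exists>p. surjective_hom P V p \<and> (\<forall>N. submodule N P \<and> p ` N = space V \<longrightarrow> N = space P))"

definition P_cover :: "complex \<Rightarrow> sl2_module" where
  "P_cover \<mu> = (SOME Q. projective_cover_in_O Q (L_hw \<mu>))"

definition K1 :: "(sl2_module, vec \<Rightarrow> vec, sl2_module, vec \<Rightarrow> vec) module_cat" where
  "K1 = sl2_module_cat
     \<lparr>Ob := additive_closure category_O {P_cover (- of_nat n) |n. n \<ge> 1}\<rparr>"


section \<open>The enveloping algebra\<close>

datatype gen = Gen_e | Gen_f | Gen_h

datatype gen_word = Gen_Word "gen list"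

instantiation gen_word :: monoid_add
begin

definition zero_gen_word :: gen_word where "0 = Gen_Word []"

fun plus_gen_word :: "gen_word \<Rightarrow> gen_word \<Rightarrow> gen_word" where
  "Gen_Word xs + Gen_Word ys = Gen_Word (xs @ ys)"

instance
proof
  fix a b c :: gen_word
  show "a + b + c = a + (b + c)" by (cases a; cases b; cases c) simp
  show "0 + a = a" "a + 0 = a" by (cases a; simp add: zero_gen_word_def)+
qed

end

text \<open>The convolution product makes this the free unital algebra on \<open>e\<close>, \<open>f\<close>, \<open>h\<close>.\<close>

type_synonym free_algebra = "gen_word \<Rightarrow>\<^sub>0 complex"

definition free_gen :: "gen \<Rightarrow> free_algebra" where
  "free_gen g = Poly_Mapping.single (Gen_Word [g]) 1"

definition sl2_relators :: "free_algebra set" where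
  "sl2_relators =
    {free_gen Gen_e * free_gen Gen_f - free_gen Gen_f * free_gen Gen_e - free_gen Gen_h,
     free_gen Gen_h * free_gen Gen_e - free_gen Gen_e * free_gen Gen_h - 2 * free_gen Gen_e,
     free_gen Gen_h * free_gen Gen_f - free_gen Gen_f * free_gen Gen_h + 2 * free_gen Gen_f}"

text \<open>Closed under negation because \<open>a\<close> ranges over the whole free algebra.\<close>

inductive_set sl2_ideal :: "free_algebra set" where
  zero: "0 \<in> sl2_ideal"
| gen: "r \<in> sl2_relators \<Longrightarrow> a * r * b \<in> sl2_ideal"
| add: "x \<in> sl2_ideal \<Longrightarrow> y \<in> sl2_ideal \<Longrightarrow> x + y \<in> sl2_ideal"

lemma sl2_ideal_mult: "x \<in> sl2_ideal \<Longrightarrow> a * x * b \<in> sl2_ideal"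
proof (induction rule: sl2_ideal.induct)
  case zero
  then show ?case by (simp add: sl2_ideal.zero)
next
  case (gen r c d)
  then show ?case using sl2_ideal.gen[of r "a * c" "d * b"] by (simp add: mult.assoc)
next
  case (add x y)
  then show ?case by (simp add: sl2_ideal.add distrib_left distrib_right)
qed

lemma sl2_ideal_uminus: "x \<in> sl2_ideal \<Longrightarrow> - x \<in> sl2_ideal"
  using sl2_ideal_mult[of x "-1" 1] by simp

lemma sl2_ideal_diff: "x \<in> sl2_ideal \<Longrightarrow> y \<in> sl2_ideal \<Longrightarrow> x - y \<in> sl2_ideal"
  using sl2_ideal.add[OF _ sl2_ideal_uminus, of x y] by simp

lemma lookup_mult_zero_word:
  "Poly_Mapping.lookup (a * b) (0::gen_word) =
     Poly_Mapping.lookup a 0 * Poly_Mapping.lookup (b :: free_algebra) 0"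
proof -
  have split: "0 = l + q \<longleftrightarrow> l = 0 \<and> q = 0" for l q :: gen_word
    by (cases l; cases q) (auto simp: zero_gen_word_def)
  have "Poly_Mapping.lookup (a * b) 0 =
      (\<Sum>l. Poly_Mapping.lookup a l * (\<Sum>q. Poly_Mapping.lookup b q when 0 = l + q))"
    by (simp add: times_poly_mapping.rep_eq prod_fun_def)
  also have "\<dots> = (\<Sum>l. (Poly_Mapping.lookup a l * Poly_Mapping.lookup b 0) when l = 0)"
  proof (rule Sum_any.cong)
    fix l
    have "(\<Sum>q. Poly_Mapping.lookup b q when 0 = l + q) =
        (\<Sum>q. (Poly_Mapping.lookup b q when l = 0) when q = 0)"
      by (rule Sum_any.cong) (auto simp: split when_def)
    then show "Poly_Mapping.lookup a l * (\<Sum>q. Poly_Mapping.lookup b q when 0 = l + q) =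
        (Poly_Mapping.lookup a l * Poly_Mapping.lookup b 0 when l = 0)"
      by (simp add: when_def)
  qed
  finally show ?thesis by simp
qed

lemma sl2_ideal_lookup_zero_word: "x \<in> sl2_ideal \<Longrightarrow> Poly_Mapping.lookup x 0 = 0"
proof (induction rule: sl2_ideal.induct)
  case (gen r a b)
  have gen0: "Poly_Mapping.lookup (free_gen g) 0 = 0" for g
    by (simp add: free_gen_def lookup_single zero_gen_word_def)
  have "Poly_Mapping.lookup r 0 = 0"
    using gen
    by (auto simp: sl2_relators_def lookup_add lookup_minus lookup_mult_zero_word gen0)
  then show ?case by (simp add: lookup_mult_zero_word)
qed (simp_all add: lookup_add)

quotient_type U = free_algebra / "\<lambda>x y. x - y \<in> sl2_ideal"
proof (rule equivpI)
  show "reflp (\<lambda>x y. x - y \<in> sl2_ideal)"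
    by (simp add: reflp_def sl2_ideal.zero)
  show "symp (\<lambda>x y. x - y \<in> sl2_ideal)"
    using sl2_ideal_uminus by (fastforce simp: symp_def)
  show "transp (\<lambda>x y. x - y \<in> sl2_ideal)"
    using sl2_ideal.add by (fastforce simp: transp_def)
qed

instantiation U :: ring_1
begin

lift_definition zero_U :: U is 0 .

lift_definition one_U :: U is 1 .

lift_definition plus_U :: "U \<Rightarrow> U \<Rightarrow> U" is "(+)"
  using sl2_ideal.add by (fastforce simp: algebra_simps)

lift_definition uminus_U :: "U \<Rightarrow> U" is uminus
  using sl2_ideal_uminus by fastforce

lift_definition minus_U :: "U \<Rightarrow> U \<Rightarrow> U" is "(-)"
  using sl2_ideal_diff by (fastforce simp: algebra_simps)

lift_definition times_U :: "U \<Rightarrow> U \<Rightarrow> U" is "(*)"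
proof -
  fix a a' b b' :: free_algebra
  assume "a - a' \<in> sl2_ideal" "b - b' \<in> sl2_ideal"
  then have "1 * (a - a') * b + a' * (b - b') * 1 \<in> sl2_ideal"
    by (intro sl2_ideal.add sl2_ideal_mult)
  then show "a * b - a' * b' \<in> sl2_ideal" by (simp add: algebra_simps)
qed

instance
proof
  show "(0::U) \<noteq> 1"
    by transfer (use sl2_ideal_lookup_zero_word[of "0 - 1"] in \<open>auto simp: lookup_minus lookup_one\<close>)
qed (transfer; simp add: algebra_simps sl2_ideal.zero)+

end

lift_definition U_gen :: "gen \<Rightarrow> U" is free_gen .

lift_definition U_const :: "complex \<Rightarrow> U" is "Poly_Mapping.single 0" .

abbreviation U_e :: U where "U_e \<equiv> U_gen Gen_e"
abbreviation U_f :: U where "U_f \<equiv> U_gen Gen_f"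
abbreviation U_h :: U where "U_h \<equiv> U_gen Gen_h"

definition U_casimir :: U where
  "U_casimir = (U_h + 1) ^ 2 + 4 * (U_f * U_e)"


section \<open>The category \<open>K\<^sub>2\<close>\<close>

text \<open>
  \<open>V\<close> is the quotient of \<open>U\<close> by the left ideal \<open>I\<close>: there is a surjective homomorphism of
  \<open>U\<close>-modules from \<open>U\<close> to \<open>V\<close> with kernel \<open>I\<close>.
\<close>

definition U_quotient :: "U set \<Rightarrow> sl2_module \<Rightarrow> bool" where
  "U_quotient I V \<longleftrightarrow> V \<in> sl2_modules \<and>
     (\<exists>\<pi>. (\<forall>u w. \<pi> (u + w) = \<pi> u + \<pi> w) \<and> (\<forall>t u. \<pi> (U_const t * u) = vscale t (\<pi> u)) \<and>
          (\<forall>u. \<pi> (U_e * u) = act_e V (\<pi> u) \<and> \<pi> (U_f * u) = act_f V (\<pi> u) \<and>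
               \<pi> (U_h * u) = act_h V (\<pi> u)) \<and>
          range \<pi> = space V \<and> {u. \<pi> u = 0} = I)"

definition M_xi :: "complex \<Rightarrow> sl2_module" where
  "M_xi \<xi> = (SOME V. U_quotient {u * U_casimir + w * (U_e - U_const \<xi>) |u w. True} V)"

definition casimir :: "sl2_module \<Rightarrow> vec \<Rightarrow> vec" where
  "casimir V v = act_h V (act_h V v) + vscale 2 (act_h V v) + v + vscale 4 (act_f V (act_e V v))"

definition casimir_kernel :: "nat \<Rightarrow> sl2_module \<Rightarrow> vec set" where
  "casimir_kernel i V =
     {v \<in> space V. ((\<lambda>w. casimir V w - vscale (of_nat (i ^ 2)) w) ^^ 2) v = 0}"

text \<open>
  A submodule \<open>N\<close> of \<open>W\<close> carries no chosen basis and so is not itself an object;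
  \<open>V\<close> is an object isomorphic to it.
\<close>

definition is_submodule_copy :: "vec set \<Rightarrow> sl2_module \<Rightarrow> sl2_module \<Rightarrow> bool" where
  "is_submodule_copy N W V \<longleftrightarrow> V \<in> sl2_modules \<and>
     (\<exists>\<iota>\<in>sl2_hom V W. inj_on \<iota> (space V) \<and> \<iota> ` space V = N)"

text \<open>\<open>X_mod \<xi> i\<close> is the module with index \<open>-1 - i\<close>.\<close>

definition X_mod :: "complex \<Rightarrow> nat \<Rightarrow> sl2_module" where
  "X_mod \<xi> i = (if i = 0 then M_xi \<xi>
     else SOME V. is_submodule_copy (casimir_kernel i (tensor_module (L_fd i) (M_xi \<xi>)))
                    (tensor_module (L_fd i) (M_xi \<xi>)) V)"

definition K2 :: "complex \<Rightarrow> (sl2_module, vec \<Rightarrow> vec, sl2_module, vec \<Rightarrow> vec) module_cat" where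
  "K2 \<xi> = sl2_module_cat\<lparr>Ob := additive_closure sl2_module_cat (range (X_mod \<xi>))\<rparr>"

end

theory Submission
  imports Defs "HOL-Computational_Algebra.Polynomial" "HOL-Computational_Algebra.Fundamental_Theorem_Algebra"
begin

text \<open>
  Both categories are generated, under the action of \<open>L(1)\<close>, by one module \<open>N\<close> on which the Casimir
  element vanishes and whose endomorphisms are scalars: \<open>N = \<Delta>(-1)\<close> for \<open>K\<^sub>1\<close> and \<open>N = M(\<xi>)\<close> for
  \<open>K\<^sub>2\<close>. Let \<open>F = L(1) \<otimes> -\<close>, which is self-adjoint. The Casimir element of \<open>F V\<close> differs from that of
  \<open>V\<close> by a natural endomorphism of \<open>F V\<close>, whose spectral projections cut out of \<open>F X\<^sub>i\<close> a summand
  \<open>X\<^sub>i\<^sub>+\<^sub>1\<close>, starting with \<open>X\<^sub>0 = N\<close>. On \<open>X\<^sub>i\<close> the Casimir element is \<open>i\<^sup>2 + 2 i d\<close> with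
  \<open>d\<^sup>2 = 0\<close>, and adjunction gives \<open>End X\<^sub>i = \<langle>1, d\<rangle>\<close>, a local ring. This yields the
  fusion rules of type \<open>C\<^sub>\<infinity>\<close>, and any nonzero morphism between the \<open>X\<^sub>i\<close> generates the identity of
  \<open>N\<close> under the action, which is simple transitivity.
  By Weyl's theorem the whole category \<open>\<C>\<close> is obtained from \<open>F\<close>. It remains to identify the
  generators: \<open>L(i) \<otimes> N\<close> is \<open>X\<^sub>i\<close> plus summands \<open>X\<^sub>l\<close> with \<open>l < i\<close>, which the Casimir element separates, and
  for \<open>N = \<Delta>(-1)\<close> the module \<open>X\<^sub>n\<close> is projective in \<open>\<O>\<close> and covers \<open>L(-n-1)\<close>.
\<close>

text \<open>The natural endomorphism is \<open>am V\<close> = 1 + h \<otimes> h + 2 e \<otimes> f +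
  2 f \<otimes> e. It squares to the Casimir operator c of V, and the Casimir operator of
  \<open>F V\<close> is c + 1 + 2 \<open>am V\<close>. If c = (i + d)^2 with i > 0, the square roots
  i + d and -(i + d) separate, and \<open>F X\<close> splits into parts with Casimir operators (i +
  1 + d)^2 and (i - 1 + d)^2. If c = 0, the square root is merely nilpotent: \<open>F N\<close> does
  not split, \<open>am N\<close> itself is the d that all later stages inherit, and the
  two-dimensional End (F N) puts N twice into \<open>F (F N)\<close>. M(\<xi>) has no weight
  vectors, so the ladder is built from identities between \<open>am\<close>, \<open>ev\<close> and
  \<open>coev\<close> that hold on every module. Weights enter only for finite dimensional modules
  and inside category O. A submodule is not an object, and morphisms are total functions on one
  vector type. Decompositions are therefore expressed by equations between morphisms, and a summand
  becomes an object by transporting its action to a basis numbered by natural numbers.\<close>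

section \<open>Linear maps on finitely supported functions\<close>

abbreviation lookup :: "vec \<Rightarrow> nat \<Rightarrow> complex" where
  "lookup \<equiv> Poly_Mapping.lookup"

abbreviation keys :: "vec \<Rightarrow> nat set" where
  "keys \<equiv> Poly_Mapping.keys"

abbreviation lin :: "(vec \<Rightarrow> vec) \<Rightarrow> bool" where
  "lin T \<equiv> Vector_Spaces.linear vscale vscale T"

global_interpretation vecp: vector_space_pair vscale vscale
  by unfold_locales

lemma lin_iff: "lin T \<longleftrightarrow> (\<forall>x y. T (x + y) = T x + T y) \<and> (\<forall>c x. T (vscale c x) = vscale c (T x))"
  by (auto simp: Vector_Spaces.linear_iff vec.vector_space_axioms)

lemma linI: "(\<And>x y. T (x + y) = T x + T y) \<Longrightarrow> (\<And>c x. T (vscale c x) = vscale c (T x)) \<Longrightarrow> lin T"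
  by (simp add: lin_iff)

lemma lin_simps:
  assumes "lin T"
  shows lin_add: "T (x + y) = T x + T y"
    and lin_scale: "T (vscale c x) = vscale c (T x)"
    and lin_zero: "T 0 = 0"
    and lin_diff: "T (x - y) = T x - T y"
    and lin_uminus: "T (- x) = - T x"
    and lin_sum: "T (sum g A) = (\<Sum>a\<in>A. T (g a))"
  using assms by (auto simp: lin_iff vecp.linear_0 vecp.linear_diff vecp.linear_neg vecp.linear_sum)

lemma vscale_simps [simp]:
  "vscale 0 v = 0" "vscale 1 v = v" "vscale c 0 = 0" "vscale c (vscale d v) = vscale (c * d) v"
  by (auto simp: poly_mapping_eq_iff fun_eq_iff)

lemma vec_eqI: "(\<And>i. lookup v i = lookup w i) \<Longrightarrow> v = (w :: vec)"
  by (rule poly_mapping_eqI)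

lemma lin_comp [intro!, simp]: "lin f \<Longrightarrow> lin g \<Longrightarrow> lin (f \<circ> g)"
  by (auto simp: lin_iff)

lemma lin_plus [intro!, simp]: "lin f \<Longrightarrow> lin g \<Longrightarrow> lin (f + g)"
  by (auto simp: lin_iff algebra_simps vec.scale_right_distrib)

lemma lin_minus [intro!, simp]: "lin f \<Longrightarrow> lin g \<Longrightarrow> lin (f - g)"
  by (auto simp: lin_iff algebra_simps vec.scale_right_diff_distrib)

lemma lin_neg [intro!, simp]: "lin f \<Longrightarrow> lin (- f)"
  by (auto simp: lin_iff algebra_simps)

lemma lin_zero_map [intro!, simp]: "lin 0"
  by (auto simp: lin_iff)

lemma map_scale_simps [simp]: "map_scale c f v = vscale c (f v)"
  by (simp add: map_scale_def)

lemma lin_map_scale [intro!, simp]: "lin f \<Longrightarrow> lin (map_scale c f)"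
  by (auto simp: lin_iff vec.scale_right_distrib mult.commute)

lemma lin_id [intro!, simp]: "lin id" "lin (\<lambda>x. x)"
  by (auto simp: lin_iff)

lemma sum_map_apply: "sum f A v = (\<Sum>k\<in>A. f k v)" for f :: "'a \<Rightarrow> vec \<Rightarrow> vec"
  by (induction A rule: infinite_finite_induct) auto

lemma vec_expand: "v = (\<Sum>i\<in>keys v. vscale (lookup v i) (basis_vec i))"
proof (rule vec_eqI)
  fix k
  have "lookup (\<Sum>i\<in>keys v. vscale (lookup v i) (basis_vec i)) k
      = (\<Sum>i\<in>keys v. if k = i then lookup v i else 0)"
    unfolding lookup_sum
    by (rule sum.cong) (auto simp: basis_vec_def lookup_single when_def)
  also have "\<dots> = lookup v k"
    by (simp add: in_keys_iff)
  finally show "lookup v k = lookup (\<Sum>i\<in>keys v. vscale (lookup v i) (basis_vec i)) k" by simp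
qed

lemma lin_ext:
  assumes "lin f" "lin g" "\<And>i. f (basis_vec i) = g (basis_vec i)"
  shows "f = g"
proof
  fix v
  have "f v = (\<Sum>i\<in>keys v. vscale (lookup v i) (f (basis_vec i)))"
    by (subst vec_expand) (simp add: lin_sum[OF assms(1)] lin_scale[OF assms(1)])
  also have "\<dots> = g v"
    by (subst (3) vec_expand) (simp add: lin_sum[OF assms(2)] lin_scale[OF assms(2)] assms(3))
  finally show "f v = g v" .
qed

lemma linear_extension_superset:
  assumes "finite A" "keys v \<subseteq> A"
  shows "linear_extension \<phi> v = (\<Sum>i\<in>A. vscale (lookup v i) (\<phi> i))"
  unfolding linear_extension_def
  by (rule sum.mono_neutral_left) (use assms in \<open>auto simp: in_keys_iff\<close>)

lemma lin_linear_extension [intro!, simp]: "lin (linear_extension \<phi>)"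
proof (rule linI)
  fix x y :: vec
  let ?A = "keys x \<union> keys y"
  have "linear_extension \<phi> (x + y) = (\<Sum>i\<in>?A. vscale (lookup (x + y) i) (\<phi> i))"
    by (rule linear_extension_superset) (use Poly_Mapping.keys_add[of x y] in auto)
  then show "linear_extension \<phi> (x + y) = linear_extension \<phi> x + linear_extension \<phi> y"
    by (simp add: linear_extension_superset[of ?A] lookup_add vec.scale_left_distrib sum.distrib)
next
  fix c x
  have "linear_extension \<phi> (vscale c x) = (\<Sum>i\<in>keys x. vscale (lookup (vscale c x) i) (\<phi> i))"
    by (rule linear_extension_superset) (auto simp: in_keys_iff)
  then show "linear_extension \<phi> (vscale c x) = vscale c (linear_extension \<phi> x)"
    by (simp add: linear_extension_def vec.scale_sum_right)
qed

lemma linear_extension_basis_vec [simp]: "linear_extension \<phi> (basis_vec i) = \<phi> i"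
  by (simp add: linear_extension_def basis_vec_def)

lemma lin_id_map [intro!, simp]: "lin (id_map B)"
  by (simp add: id_map_def)

lemma lookup_basis_vec: "lookup (basis_vec i) j = (if i = j then 1 else 0)"
  by (simp add: basis_vec_def lookup_single when_def)

lemma id_map_basis_vec: "id_map B (basis_vec i) = (if i \<in> B then basis_vec i else 0)"
  by (simp add: id_map_def)

lemma lookup_id_map [simp]: "lookup (id_map B v) i = (if i \<in> B then lookup v i else 0)"
proof -
  have "lookup (id_map B v) i =
      (\<Sum>k\<in>keys v. lookup v k * (if k \<in> B then lookup (basis_vec k) i else 0))"
    unfolding id_map_def linear_extension_def by (auto simp: lookup_sum intro!: sum.cong)
  also have "\<dots> = (\<Sum>k\<in>keys v. if k = i then (if i \<in> B then lookup v i else 0) else 0)"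
    by (rule sum.cong) (auto simp: lookup_basis_vec)
  also have "\<dots> = (if i \<in> B then lookup v i else 0)"
    by (auto simp: in_keys_iff)
  finally show ?thesis .
qed

lemma id_map_in [simp]: "id_map B v \<in> vec_space B"
  by (auto simp: vec_space_def in_keys_iff split: if_splits)

lemma in_vec_space_iff: "v \<in> vec_space B \<longleftrightarrow> (\<forall>i. i \<notin> B \<longrightarrow> lookup v i = 0)"
  by (auto simp: vec_space_def in_keys_iff)

lemma id_map_eq_iff: "id_map B v = v \<longleftrightarrow> v \<in> vec_space B"
  by (auto simp: in_vec_space_iff poly_mapping_eq_iff fun_eq_iff)

lemma id_map_eq [simp]: "v \<in> vec_space B \<Longrightarrow> id_map B v = v"
  by (simp add: id_map_eq_iff)

lemma id_map_idem [simp]: "id_map B (id_map B v) = id_map B v"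
  by simp

lemma basis_vec_in [simp]: "basis_vec i \<in> vec_space B \<longleftrightarrow> i \<in> B"
  by (auto simp: in_vec_space_iff lookup_basis_vec split: if_splits)

lemma basis_vec_nonzero [simp]: "basis_vec i \<noteq> 0"
  using lookup_basis_vec[of i i] by (metis lookup_zero zero_neq_one)

lemma subspace_vec_space [simp]: "vec.subspace (vec_space B)"
  by (auto simp: vec.subspace_def in_vec_space_iff lookup_add)

lemmas vec_space_closed [simp] =
  vec.subspace_0[OF subspace_vec_space] vec.subspace_add[OF subspace_vec_space]
  vec.subspace_scale[OF subspace_vec_space] vec.subspace_diff[OF subspace_vec_space]
  vec.subspace_neg[OF subspace_vec_space]

text \<open>Killing the basis vectors outside \<open>B\<close> is absorbing the idempotent
  \<open>id_map B\<close> on the right, and having values in \<open>vec_space B'\<close> is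
  absorbing \<open>id_map B'\<close> on the left. In this equational form membership survives
  composition, sums and tensor products by rewriting.\<close>

lemma linear_maps_iff:
  "T \<in> linear_maps B B' \<longleftrightarrow> lin T \<and> (\<forall>v. T (id_map B v) = T v) \<and> (\<forall>v. id_map B' (T v) = T v)"
proof -
  have "(\<forall>i. i \<notin> B \<longrightarrow> T (basis_vec i) = 0) \<longleftrightarrow> (\<forall>v. T (id_map B v) = T v)" if "lin T"
  proof
    assume "\<forall>i. i \<notin> B \<longrightarrow> T (basis_vec i) = 0"
    then have "T \<circ> id_map B = T"
      by (intro lin_ext) (auto simp: that id_map_basis_vec lin_zero[OF that])
    then show "\<forall>v. T (id_map B v) = T v" by (metis comp_apply)
  next
    assume "\<forall>v. T (id_map B v) = T v"
    then show "\<forall>i. i \<notin> B \<longrightarrow> T (basis_vec i) = 0"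
      using that by (metis id_map_basis_vec lin_zero)
  qed
  then show ?thesis
    by (auto simp: linear_maps_def id_map_eq_iff)
qed

lemma linear_mapsI:
  "lin T \<Longrightarrow> (\<And>v. T (id_map B v) = T v) \<Longrightarrow> (\<And>v. T v \<in> vec_space B') \<Longrightarrow> T \<in> linear_maps B B'"
  by (simp add: linear_maps_iff)

lemma id_map_in_linear_maps [simp]: "id_map B \<in> linear_maps B B"
  by (simp add: linear_maps_iff)


section \<open>Tensor products of vectors and of linear maps\<close>

lemma lookup_tensor_vec:
  "lookup (tensor_vec v w) n = lookup v (fst (prod_decode n)) * lookup w (snd (prod_decode n))"
proof -
  obtain a b where n: "n = prod_encode (a, b)"
    by (metis prod.exhaust prod_decode_inverse)
  have "lookup (tensor_vec v w) n =
      (\<Sum>i\<in>keys v. \<Sum>j\<in>keys w. if i = a \<and> j = b then lookup v i * lookup w j else 0)"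
    unfolding tensor_vec_def n
    by (auto simp: lookup_sum lookup_single when_def prod_encode_eq intro!: sum.cong)
  also have "\<dots> = (\<Sum>i\<in>keys v. if i = a then (\<Sum>j\<in>keys w. if j = b then lookup v i * lookup w j else 0) else 0)"
    by (rule sum.cong) auto
  also have "\<dots> = lookup v a * lookup w b"
    by (auto simp: in_keys_iff)
  finally show ?thesis by (simp add: n)
qed

lemma tensor_vec_bilinear:
  "tensor_vec (v + v') w = tensor_vec v w + tensor_vec v' w"
  "tensor_vec v (w + w') = tensor_vec v w + tensor_vec v w'"
  "tensor_vec (v - v') w = tensor_vec v w - tensor_vec v' w"
  "tensor_vec v (w - w') = tensor_vec v w - tensor_vec v w'"
  "tensor_vec (vscale c v) w = vscale c (tensor_vec v w)"
  "tensor_vec v (vscale c w) = vscale c (tensor_vec v w)"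
  "tensor_vec 0 w = 0"
  "tensor_vec v 0 = 0"
  "tensor_vec (- v) w = - tensor_vec v w"
  "tensor_vec v (- w) = - tensor_vec v w"
  by (auto intro!: vec_eqI simp: lookup_tensor_vec lookup_add lookup_minus algebra_simps)

lemma lin_tensor_vec [intro!, simp]: "lin (tensor_vec v)" "lin (\<lambda>v. tensor_vec v w)"
  by (auto simp: lin_iff tensor_vec_bilinear)

lemma tensor_vec_basis_vec: "tensor_vec (basis_vec i) (basis_vec j) = basis_vec (prod_encode (i, j))"
proof (rule vec_eqI)
  fix n
  show "lookup (tensor_vec (basis_vec i) (basis_vec j)) n = lookup (basis_vec (prod_encode (i, j))) n"
    by (cases "prod_decode n") (auto simp: lookup_tensor_vec lookup_basis_vec dest: arg_cong[of _ _ prod_encode])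
qed

lemma basis_vec_tensor: "basis_vec n =
    tensor_vec (basis_vec (fst (prod_decode n))) (basis_vec (snd (prod_decode n)))"
  by (simp add: tensor_vec_basis_vec)

lemma lin_tensor_map [intro!, simp]: "lin (tensor_map S T)"
  by (simp add: tensor_map_def)

lemma tensor_map_tensor_vec [simp]:
  assumes "lin S" "lin T"
  shows "tensor_map S T (tensor_vec v w) = tensor_vec (S v) (T w)"
proof -
  have 1: "(\<lambda>w. tensor_map S T (tensor_vec (basis_vec i) w)) = (\<lambda>w. tensor_vec (S (basis_vec i)) (T w))" for i
    using lin_comp[OF lin_tensor_map lin_tensor_vec(1), of S T] lin_comp[OF lin_tensor_vec(1) assms(2)]
    by (intro lin_ext) (auto simp: tensor_vec_basis_vec o_def tensor_map_def)
  have "(\<lambda>v. tensor_map S T (tensor_vec v w)) = (\<lambda>v. tensor_vec (S v) (T w))"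
    using lin_comp[OF lin_tensor_map lin_tensor_vec(2), of S T w]
      lin_comp[OF lin_tensor_vec(2) assms(1), of "T w"] fun_cong[OF 1, of _ w]
    by (intro lin_ext) (auto simp: o_def)
  then show ?thesis by meson
qed

text \<open>Every basis vector is a tensor product of two basis vectors, so equations between linear
  maps on a tensor product can be tested on pure tensors. The versions below for three and four
  factors serve the naturality and pentagon axioms.\<close>

lemma tensor_ext:
  assumes "lin f" "lin g" "\<And>v w. f (tensor_vec v w) = g (tensor_vec v w)"
  shows "f = g"
  by (rule lin_ext[OF assms(1,2)]) (metis basis_vec_tensor assms(3))

lemma tensor_map_comp:
  "lin S \<Longrightarrow> lin S' \<Longrightarrow> lin T \<Longrightarrow> lin T' \<Longrightarrow>
    tensor_map S T \<circ> tensor_map S' T' = tensor_map (S \<circ> S') (T \<circ> T')"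
  by (rule tensor_ext) auto

lemma tensor_map_id_map:
  "tensor_map (id_map B) (id_map C) = id_map (prod_encode ` (B \<times> C))"
proof (rule lin_ext)
  fix n
  show "tensor_map (id_map B) (id_map C) (basis_vec n) = id_map (prod_encode ` (B \<times> C)) (basis_vec n)"
  proof (cases "prod_decode n")
    case (Pair i j)
    then have n: "n = prod_encode (i, j)"
      by (metis prod_decode_inverse)
    then show ?thesis
      by (auto simp: n id_map_basis_vec tensor_vec_bilinear simp flip: tensor_vec_basis_vec)
        (auto simp: tensor_vec_basis_vec id_map_basis_vec prod_encode_eq image_iff)
  qed
qed auto

lemma tensor_map_linear:
  shows "lin f \<Longrightarrow> lin f' \<Longrightarrow> lin g \<Longrightarrow> tensor_map (f + f') g = tensor_map f g + tensor_map f' g"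
    "lin f \<Longrightarrow> lin g \<Longrightarrow> lin g' \<Longrightarrow> tensor_map f (g + g') = tensor_map f g + tensor_map f g'"
    "lin f \<Longrightarrow> lin g \<Longrightarrow> tensor_map (map_scale c f) g = map_scale c (tensor_map f g)"
    "lin f \<Longrightarrow> lin g \<Longrightarrow> tensor_map f (map_scale c g) = map_scale c (tensor_map f g)"
  by (rule tensor_ext; simp add: tensor_vec_bilinear)+

lemma tensor_map_zero [simp]: "tensor_map 0 g = 0" "tensor_map f 0 = 0"
  by (rule lin_ext; auto simp: tensor_map_def tensor_vec_bilinear split: prod.splits)+

lemma tensor_map_linear_maps:
  assumes "S \<in> linear_maps B B'" "T \<in> linear_maps C C'"
  shows "tensor_map S T \<in> linear_maps (prod_encode ` (B \<times> C)) (prod_encode ` (B' \<times> C'))"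
proof -
  have l: "lin S" "lin T" and eq: "S \<circ> id_map B = S" "T \<circ> id_map C = T" "id_map B' \<circ> S = S" "id_map C' \<circ> T = T"
    using assms by (auto simp: linear_maps_iff fun_eq_iff)
  have "tensor_map S T \<circ> id_map (prod_encode ` (B \<times> C)) = tensor_map S T"
    "id_map (prod_encode ` (B' \<times> C')) \<circ> tensor_map S T = tensor_map S T"
    by (simp_all add: tensor_map_comp l eq flip: tensor_map_id_map)
  then show ?thesis
    by (simp add: linear_maps_iff fun_eq_iff)
qed

lemma tensor_vec_in: "v \<in> vec_space B \<Longrightarrow> w \<in> vec_space C \<Longrightarrow> tensor_vec v w \<in> vec_space (prod_encode ` (B \<times> C))"
  by (auto simp: in_vec_space_iff lookup_tensor_vec image_iff)
   (metis prod.collapse prod_decode_inverse)+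

section \<open>Modules over \<open>sl\<^sub>2\<close> and their homomorphisms\<close>

lemma lin_sl2:
  assumes "V \<in> sl2_modules"
  shows lin_act_e: "lin (act_e V)" and lin_act_f: "lin (act_f V)" and lin_act_h: "lin (act_h V)"
  using assms by (auto simp: sl2_modules_def linear_maps_iff)

lemma sl2_rels:
  assumes "V \<in> sl2_modules"
  shows sl2_ef: "act_e V (act_f V v) = act_f V (act_e V v) + act_h V v"
    and sl2_he: "act_h V (act_e V v) = act_e V (act_h V v) + vscale 2 (act_e V v)"
    and sl2_hf: "act_h V (act_f V v) = act_f V (act_h V v) - vscale 2 (act_f V v)"
proof -
  show "act_e V (act_f V v) = act_f V (act_e V v) + act_h V v"
    "act_h V (act_e V v) = act_e V (act_h V v) + vscale 2 (act_e V v)"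
    using assms unfolding sl2_modules_def by (simp_all add: diff_eq_eq add.commute)
  have "act_h V (act_f V v) - act_f V (act_h V v) = vscale (-2) (act_f V v)"
    using assms unfolding sl2_modules_def by blast
  then show "act_h V (act_f V v) = act_f V (act_h V v) - vscale 2 (act_f V v)"
    by (simp add: diff_eq_eq add.commute)
qed

lemma sl2_absorb:
  assumes "V \<in> sl2_modules"
  shows "act_e V (id_map (basis V) v) = act_e V v" "act_f V (id_map (basis V) v) = act_f V v"
    "act_h V (id_map (basis V) v) = act_h V v"
    "id_map (basis V) (act_e V v) = act_e V v" "id_map (basis V) (act_f V v) = act_f V v"
    "id_map (basis V) (act_h V v) = act_h V v"
  using assms by (auto simp: sl2_modules_def linear_maps_iff)

lemma sl2_in_space [simp]:
  assumes "V \<in> sl2_modules"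
  shows "act_e V v \<in> space V" "act_f V v \<in> space V" "act_h V v \<in> space V"
  using sl2_absorb[OF assms] by (simp_all add: id_map_eq_iff)

text \<open>The three operators see only the component of a vector in \<open>space V\<close>. Hence
  the relations, which the definition demands on the whole vector type, can be checked on
  \<open>space V\<close>.\<close>

lemma sl2_modulesI:
  assumes "act_e V \<in> linear_maps (basis V) (basis V)" "act_f V \<in> linear_maps (basis V) (basis V)"
    "act_h V \<in> linear_maps (basis V) (basis V)"
    "\<And>v. v \<in> space V \<Longrightarrow> act_e V (act_f V v) = act_f V (act_e V v) + act_h V v"
    "\<And>v. v \<in> space V \<Longrightarrow> act_h V (act_e V v) = act_e V (act_h V v) + vscale 2 (act_e V v)"
    "\<And>v. v \<in> space V \<Longrightarrow> act_h V (act_f V v) = act_f V (act_h V v) - vscale 2 (act_f V v)"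
  shows "V \<in> sl2_modules"
proof -
  have "act_e V (id_map (basis V) v) = act_e V v" "act_f V (id_map (basis V) v) = act_f V v"
    "act_h V (id_map (basis V) v) = act_h V v" for v
    using assms(1-3) by (auto simp: linear_maps_iff)
  then have "act_e V (act_f V v) = act_f V (act_e V v) + act_h V v"
    "act_h V (act_e V v) = act_e V (act_h V v) + vscale 2 (act_e V v)"
    "act_h V (act_f V v) = act_f V (act_h V v) - vscale 2 (act_f V v)" for v
    using assms(4-6)[OF id_map_in, of v] by metis+
  then show ?thesis
    using assms(1-3) by (auto simp: sl2_modules_def)
qed

lemma sl2_homI:
  assumes "T \<in> linear_maps (basis V) (basis W)" "V \<in> sl2_modules"
    "\<And>v. v \<in> space V \<Longrightarrow> T (act_e V v) = act_e W (T v)"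
    "\<And>v. v \<in> space V \<Longrightarrow> T (act_f V v) = act_f W (T v)"
    "\<And>v. v \<in> space V \<Longrightarrow> T (act_h V v) = act_h W (T v)"
  shows "T \<in> sl2_hom V W"
proof -
  have T: "T (id_map (basis V) v) = T v" for v
    using assms(1) by (auto simp: linear_maps_iff)
  show ?thesis
    unfolding sl2_hom_def
    using assms(1) assms(3-5)[OF id_map_in] by (auto simp: T sl2_absorb[OF assms(2)])
qed

lemma sl2_homD:
  assumes "T \<in> sl2_hom V W"
  shows hom_lin: "lin T" and hom_dom: "T (id_map (basis V) v) = T v"
    and hom_cod: "id_map (basis W) (T v) = T v" and hom_in: "T v \<in> space W"
    and hom_e: "T (act_e V v) = act_e W (T v)" and hom_f: "T (act_f V v) = act_f W (T v)"
    and hom_h: "T (act_h V v) = act_h W (T v)"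
  using assms by (auto simp: sl2_hom_def linear_maps_iff id_map_eq_iff)

lemma hom_id [simp]: "V \<in> sl2_modules \<Longrightarrow> id_map (basis V) \<in> sl2_hom V V"
  by (auto simp: sl2_hom_def sl2_absorb)

lemma hom_comp: "f \<in> sl2_hom U V \<Longrightarrow> g \<in> sl2_hom V W \<Longrightarrow> g \<circ> f \<in> sl2_hom U W"
  by (auto simp: sl2_hom_def linear_maps_iff)

lemma hom_id_left: "f \<in> sl2_hom V W \<Longrightarrow> id_map (basis W) \<circ> f = f"
  and hom_id_right: "f \<in> sl2_hom V W \<Longrightarrow> f \<circ> id_map (basis V) = f"
  by (auto simp: sl2_hom_def linear_maps_iff)

lemma hom_plus: "W \<in> sl2_modules \<Longrightarrow> f \<in> sl2_hom V W \<Longrightarrow> g \<in> sl2_hom V W \<Longrightarrow> f + g \<in> sl2_hom V W"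
  and hom_minus: "W \<in> sl2_modules \<Longrightarrow> f \<in> sl2_hom V W \<Longrightarrow> g \<in> sl2_hom V W \<Longrightarrow> f - g \<in> sl2_hom V W"
  and hom_zero [simp]: "W \<in> sl2_modules \<Longrightarrow> 0 \<in> sl2_hom V W"
  and hom_scale: "W \<in> sl2_modules \<Longrightarrow> f \<in> sl2_hom V W \<Longrightarrow> map_scale c f \<in> sl2_hom V W"
  and hom_neg: "W \<in> sl2_modules \<Longrightarrow> f \<in> sl2_hom V W \<Longrightarrow> - f \<in> sl2_hom V W"
  by (auto simp: sl2_hom_def linear_maps_iff lin_add lin_scale lin_diff lin_uminus lin_zero lin_act_e lin_act_f lin_act_h)

lemma comp_plus_right: "lin f \<Longrightarrow> f \<circ> (g + h) = (f \<circ> g) + (f \<circ> h)"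
  and comp_minus_right: "lin f \<Longrightarrow> f \<circ> (g - h) = (f \<circ> g) - (f \<circ> h)"
  and comp_zero_right: "lin f \<Longrightarrow> f \<circ> 0 = 0"
  and comp_scale_right: "lin f \<Longrightarrow> f \<circ> map_scale c g = map_scale c (f \<circ> g)"
  by (auto simp: fun_eq_iff lin_simps)

lemma comp_plus_left: "(g + h) \<circ> f = (g \<circ> f) + (h \<circ> f)"
  and comp_minus_left: "(g - h) \<circ> f = (g \<circ> f) - (h \<circ> f)"
  and comp_zero_left: "0 \<circ> f = 0"
  and comp_scale_left: "map_scale c g \<circ> f = map_scale c (g \<circ> f)"
  for f g h :: "vec \<Rightarrow> vec"
  by (auto simp: fun_eq_iff)

lemma comp_sum_left: "sum g A \<circ> f = (\<Sum>k\<in>A. g k \<circ> f)" for f :: "vec \<Rightarrow> vec" and g :: "'a \<Rightarrow> vec \<Rightarrow> vec"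
  by (simp add: fun_eq_iff sum_map_apply)

lemma comp_sum_right: "lin f \<Longrightarrow> f \<circ> sum g A = (\<Sum>k\<in>A. f \<circ> g k)" for g :: "'a \<Rightarrow> vec \<Rightarrow> vec"
  by (simp add: fun_eq_iff sum_map_apply[where f = "\<lambda>k. f \<circ> g k"] sum_map_apply[where f = g] lin_simps)

lemma map_scale_vector_space: "vector_space map_scale"
  by unfold_locales (auto simp: fun_eq_iff vec.scale_right_distrib vec.scale_left_distrib)

section \<open>The tensor category of finite dimensional modules\<close>

abbreviation Mod :: "sl2_module set \<Rightarrow> (sl2_module, vec \<Rightarrow> vec, sl2_module, vec \<Rightarrow> vec) module_cat" where
  "Mod S \<equiv> sl2_module_cat\<lparr>Ob := S\<rparr>"

abbreviation FD :: "(sl2_module, vec \<Rightarrow> vec) monoidal_cat" where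
  "FD \<equiv> finite_dimensional_sl2_modules"

abbreviation idm :: "sl2_module \<Rightarrow> vec \<Rightarrow> vec" where
  "idm V \<equiv> id_map (basis V)"

lemma Mod_sl2_modules: "sl2_module_cat = Mod sl2_modules"
  by (simp add: sl2_module_cat_def)

lemma Mod_simps [simp]:
  "Ob (Mod S) = S" "Hom (Mod S) = sl2_hom" "Id (Mod S) = idm" "Comp (Mod S) = (\<circ>)"
  "Scale (Mod S) = map_scale" "Act (Mod S) = tensor_module" "ActM (Mod S) = tensor_map"
  "ActAssoc (Mod S) = associator" "ActUnit (Mod S) = left_unitor"
  by (simp_all add: sl2_module_cat_def)

lemma FD_simps [simp]:
  "Ob FD = {V \<in> sl2_modules. finite (basis V)}" "Hom FD = sl2_hom" "Id FD = idm" "Comp FD = (\<circ>)"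
  "Scale FD = map_scale" "Tensor FD = tensor_module" "TensorM FD = tensor_map"
  "Unit FD = trivial_module" "Assoc FD = associator" "LUnit FD = left_unitor" "RUnit FD = right_unitor"
  by (simp_all add: finite_dimensional_sl2_modules_def)

lemma basis_tensor_module: "basis (tensor_module V W) = prod_encode ` (basis V \<times> basis W)"
  by (simp add: tensor_module_def)

lemma act_tensor_module:
  "act_e (tensor_module V W) = tensor_map (act_e V) (idm W) + tensor_map (idm V) (act_e W)"
  "act_f (tensor_module V W) = tensor_map (act_f V) (idm W) + tensor_map (idm V) (act_f W)"
  "act_h (tensor_module V W) = tensor_map (act_h V) (idm W) + tensor_map (idm V) (act_h W)"
  by (simp_all add: tensor_module_def)

lemma act_tensor_vec:
  assumes "V \<in> sl2_modules" "W \<in> sl2_modules"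
  shows "act_e (tensor_module V W) (tensor_vec v w) = tensor_vec (act_e V v) (idm W w) + tensor_vec (idm V v) (act_e W w)"
    "act_f (tensor_module V W) (tensor_vec v w) = tensor_vec (act_f V v) (idm W w) + tensor_vec (idm V v) (act_f W w)"
    "act_h (tensor_module V W) (tensor_vec v w) = tensor_vec (act_h V v) (idm W w) + tensor_vec (idm V v) (act_h W w)"
  using assms by (simp_all add: act_tensor_module lin_act_e lin_act_f lin_act_h)

lemma idm_tensor_vec: "idm (tensor_module V W) (tensor_vec v w) = tensor_vec (idm V v) (idm W w)"
  by (simp add: basis_tensor_module flip: tensor_map_id_map)

lemma lin_act_tensor:
  "V \<in> sl2_modules \<Longrightarrow> W \<in> sl2_modules \<Longrightarrow> lin (act_e (tensor_module V W))"
  "V \<in> sl2_modules \<Longrightarrow> W \<in> sl2_modules \<Longrightarrow> lin (act_f (tensor_module V W))"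
  "V \<in> sl2_modules \<Longrightarrow> W \<in> sl2_modules \<Longrightarrow> lin (act_h (tensor_module V W))"
  by (auto simp: act_tensor_module)

lemma act_linear_maps:
  assumes "V \<in> sl2_modules"
  shows "act_e V \<in> linear_maps (basis V) (basis V)" "act_f V \<in> linear_maps (basis V) (basis V)"
    "act_h V \<in> linear_maps (basis V) (basis V)"
  using assms by (auto simp: sl2_modules_def)

lemma linear_maps_plus: "S \<in> linear_maps B C \<Longrightarrow> T \<in> linear_maps B C \<Longrightarrow> S + T \<in> linear_maps B C"
  by (auto simp: linear_maps_iff lin_add)

lemma tensor_module_closed [intro, simp]:
  assumes V: "V \<in> sl2_modules" and W: "W \<in> sl2_modules"
  shows "tensor_module V W \<in> sl2_modules"
proof -
  let ?T = "tensor_module V W"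
  have lm: "act_e ?T \<in> linear_maps (basis ?T) (basis ?T)" "act_f ?T \<in> linear_maps (basis ?T) (basis ?T)"
    "act_h ?T \<in> linear_maps (basis ?T) (basis ?T)"
    unfolding act_tensor_module basis_tensor_module
    by (intro linear_maps_plus tensor_map_linear_maps act_linear_maps id_map_in_linear_maps V W)+
  note l = lin_act_tensor[OF V W]
  have "act_e ?T \<circ> act_f ?T = (act_f ?T \<circ> act_e ?T) + act_h ?T"
    by (rule tensor_ext)
      (auto simp: l act_tensor_vec V W lin_add sl2_absorb sl2_rels tensor_vec_bilinear algebra_simps)
  moreover have "act_h ?T \<circ> act_e ?T = (act_e ?T \<circ> act_h ?T) + map_scale 2 (act_e ?T)"
    by (rule tensor_ext)
      (auto simp: l act_tensor_vec V W lin_add sl2_absorb sl2_rels tensor_vec_bilinear algebra_simps)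
  moreover have "act_h ?T \<circ> act_f ?T = (act_f ?T \<circ> act_h ?T) - map_scale 2 (act_f ?T)"
    by (rule tensor_ext)
      (auto simp: l act_tensor_vec V W lin_add sl2_absorb sl2_rels tensor_vec_bilinear algebra_simps)
  ultimately show ?thesis
    by (intro sl2_modulesI lm) (simp_all add: fun_eq_iff)
qed

lemma tensor_map_hom:
  assumes f: "f \<in> sl2_hom V V'" and g: "g \<in> sl2_hom W W'"
    and V: "V \<in> sl2_modules" "V' \<in> sl2_modules" and W: "W \<in> sl2_modules" "W' \<in> sl2_modules"
  shows "tensor_map f g \<in> sl2_hom (tensor_module V W) (tensor_module V' W')"
proof -
  let ?T = "tensor_module V W" and ?T' = "tensor_module V' W'"
  have "tensor_map f g \<in> linear_maps (basis ?T) (basis ?T')"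
    using f g unfolding basis_tensor_module by (intro tensor_map_linear_maps) (auto simp: sl2_hom_def)
  moreover note l = lin_act_tensor[OF V(1) W(1)] lin_act_tensor[OF V(2) W(2)] hom_lin[OF f] hom_lin[OF g]
  have "tensor_map f g \<circ> act_e ?T = act_e ?T' \<circ> tensor_map f g"
    "tensor_map f g \<circ> act_f ?T = act_f ?T' \<circ> tensor_map f g"
    "tensor_map f g \<circ> act_h ?T = act_h ?T' \<circ> tensor_map f g"
    by (rule tensor_ext; auto simp: l act_tensor_vec V W lin_add[OF lin_tensor_map] sl2_homD[OF f] sl2_homD[OF g])+
  ultimately show ?thesis
    by (simp add: sl2_hom_def fun_eq_iff)
qed

section \<open>Unit object, associators and coherence\<close>

lemma trivial_act [simp]: "act_e trivial_module v = 0" "act_f trivial_module v = 0" "act_h trivial_module v = 0"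
  by (simp_all add: trivial_module_def)

lemma trivial_module_closed [intro, simp]:
  shows "trivial_module \<in> sl2_modules" and "finite (basis trivial_module)"
proof -
  have "lin (act_e trivial_module)" "lin (act_f trivial_module)" "lin (act_h trivial_module)"
    by (auto intro!: linI)
  then show "trivial_module \<in> sl2_modules"
    by (intro sl2_modulesI) (simp_all add: linear_maps_iff lin_zero)
  show "finite (basis trivial_module)"
    by (simp add: trivial_module_def)
qed

lemma idm_trivial: "idm trivial_module v = vscale (lookup v 0) (basis_vec 0)"
  by (rule vec_eqI) (simp add: trivial_module_def lookup_basis_vec)

lemma lin_lookup_scale: "lin (\<lambda>v. vscale (lookup v i) w)"
  by (auto simp: lin_iff lookup_add vec.scale_left_distrib)

lemma tensor_ext3:
  assumes "lin f" "lin g" "\<And>u v w. f (tensor_vec (tensor_vec u v) w) = g (tensor_vec (tensor_vec u v) w)"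
  shows "f = g"
  by (rule lin_ext[OF assms(1,2)]) (metis basis_vec_tensor assms(3))

lemma tensor_ext4:
  assumes "lin f" "lin g" "\<And>t u v w. f (tensor_vec (tensor_vec (tensor_vec t u) v) w) = g (tensor_vec (tensor_vec (tensor_vec t u) v) w)"
  shows "f = g"
  by (rule lin_ext[OF assms(1,2)]) (metis basis_vec_tensor assms(3))

lemma lin_associator [simp]: "lin (associator U V W)"
  by (simp add: associator_def)

lemma lin_unitor [simp]: "lin (left_unitor V)" "lin (right_unitor V)"
  by (simp_all add: left_unitor_def right_unitor_def)

lemma associator_tensor_vec:
  "associator U V W (tensor_vec (tensor_vec u v) w) =
     tensor_vec (idm U u) (tensor_vec (idm V v) (idm W w))"
proof -
  have 1: "associator U V W (tensor_vec (tensor_vec (basis_vec i) (basis_vec j)) (basis_vec k)) =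
     tensor_vec (idm U (basis_vec i)) (tensor_vec (idm V (basis_vec j)) (idm W (basis_vec k)))" for i j k
    by (auto simp: tensor_vec_basis_vec id_map_basis_vec associator_def basis_tensor_module tensor_vec_bilinear prod_encode_eq)
  have 2: "associator U V W (tensor_vec (tensor_vec u (basis_vec j)) (basis_vec k)) =
     tensor_vec (idm U u) (tensor_vec (idm V (basis_vec j)) (idm W (basis_vec k)))" for u j k
    by (rule fun_cong[of _ _ u], rule lin_ext)
      (auto simp: 1 lin_iff tensor_vec_bilinear lin_simps[OF lin_id_map] lin_simps[OF lin_associator])
  have 3: "associator U V W (tensor_vec (tensor_vec u v) (basis_vec k)) =
     tensor_vec (idm U u) (tensor_vec (idm V v) (idm W (basis_vec k)))" for u v k
    by (rule fun_cong[of _ _ v], rule lin_ext)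
      (auto simp: 2 lin_iff tensor_vec_bilinear lin_simps[OF lin_id_map] lin_simps[OF lin_associator])
  show ?thesis
    by (rule fun_cong[of _ _ w], rule lin_ext)
      (auto simp: 3 lin_iff tensor_vec_bilinear lin_simps[OF lin_id_map] lin_simps[OF lin_associator])
qed

text \<open>The inverse of the associator. The factor \<open>idm\<close> kills the basis vectors
  outside the triple product, so that the composites are the identities of the objects and not of
  the vector type.\<close>

definition coassociator :: "sl2_module \<Rightarrow> sl2_module \<Rightarrow> sl2_module \<Rightarrow> vec \<Rightarrow> vec" where
  "coassociator U V W = linear_extension (\<lambda>n. case prod_decode n of (i, m) \<Rightarrow> case prod_decode m of (j, k) \<Rightarrow>
      idm (tensor_module (tensor_module U V) W) (basis_vec (prod_encode (prod_encode (i, j), k))))"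

lemma lin_coassociator [simp]: "lin (coassociator U V W)"
  by (simp add: coassociator_def)

lemma coassociator_tensor_vec:
  "coassociator U V W (tensor_vec u (tensor_vec v w)) =
     tensor_vec (tensor_vec (idm U u) (idm V v)) (idm W w)"
proof -
  have 1: "coassociator U V W (tensor_vec (basis_vec i) (tensor_vec (basis_vec j) (basis_vec k))) =
     tensor_vec (tensor_vec (idm U (basis_vec i)) (idm V (basis_vec j))) (idm W (basis_vec k))" for i j k
  proof -
    have "coassociator U V W (tensor_vec (basis_vec i) (tensor_vec (basis_vec j) (basis_vec k))) =
        idm (tensor_module (tensor_module U V) W) (tensor_vec (tensor_vec (basis_vec i) (basis_vec j)) (basis_vec k))"
      by (simp add: tensor_vec_basis_vec coassociator_def)
    then show ?thesis
      by (simp add: idm_tensor_vec)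
  qed
  have 2: "coassociator U V W (tensor_vec u (tensor_vec (basis_vec j) (basis_vec k))) =
     tensor_vec (tensor_vec (idm U u) (idm V (basis_vec j))) (idm W (basis_vec k))" for u j k
    by (rule fun_cong[of _ _ u], rule lin_ext)
      (auto simp: 1 lin_iff tensor_vec_bilinear lin_simps[OF lin_id_map] lin_simps[OF lin_coassociator])
  have 3: "coassociator U V W (tensor_vec u (tensor_vec v (basis_vec k))) =
     tensor_vec (tensor_vec (idm U u) (idm V v)) (idm W (basis_vec k))" for u v k
    by (rule fun_cong[of _ _ v], rule lin_ext)
      (auto simp: 2 lin_iff tensor_vec_bilinear lin_simps[OF lin_id_map] lin_simps[OF lin_coassociator])
  show ?thesis
    by (rule fun_cong[of _ _ w], rule lin_ext)
      (auto simp: 3 lin_iff tensor_vec_bilinear lin_simps[OF lin_id_map] lin_simps[OF lin_coassociator])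
qed

lemma left_unitor_tensor_vec: "left_unitor V (tensor_vec u v) = vscale (lookup u 0) (idm V v)"
proof -
  have 1: "left_unitor V (tensor_vec (basis_vec i) (basis_vec j)) = vscale (lookup (basis_vec i) 0) (idm V (basis_vec j))" for i j
    by (auto simp: tensor_vec_basis_vec id_map_basis_vec left_unitor_def basis_tensor_module trivial_module_def prod_encode_eq lookup_basis_vec)
  have 2: "left_unitor V (tensor_vec u (basis_vec j)) = vscale (lookup u 0) (idm V (basis_vec j))" for u j
    by (rule fun_cong[of _ _ u], rule lin_ext)
      (auto simp: 1 lin_iff tensor_vec_bilinear lookup_add vec.scale_left_distrib lin_simps[OF lin_unitor(1)])
  show ?thesis
    by (rule fun_cong[of _ _ v], rule lin_ext)
      (auto simp: 2 lin_iff tensor_vec_bilinear lin_simps[OF lin_id_map] vec.scale_right_distrib mult.commute lin_simps[OF lin_unitor(1)])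
qed

lemma right_unitor_tensor_vec: "right_unitor V (tensor_vec v u) = vscale (lookup u 0) (idm V v)"
proof -
  have 1: "right_unitor V (tensor_vec (basis_vec j) (basis_vec i)) = vscale (lookup (basis_vec i) 0) (idm V (basis_vec j))" for i j
    by (auto simp: tensor_vec_basis_vec id_map_basis_vec right_unitor_def basis_tensor_module trivial_module_def prod_encode_eq lookup_basis_vec)
  have 2: "right_unitor V (tensor_vec (basis_vec j) u) = vscale (lookup u 0) (idm V (basis_vec j))" for u j
    by (rule fun_cong[of _ _ u], rule lin_ext)
      (auto simp: 1 lin_iff tensor_vec_bilinear lookup_add vec.scale_left_distrib lin_simps[OF lin_unitor(2)])
  show ?thesis
    by (rule fun_cong[of _ _ v], rule lin_ext)
      (auto simp: 2 lin_iff tensor_vec_bilinear lin_simps[OF lin_id_map] vec.scale_right_distrib mult.commute lin_simps[OF lin_unitor(2)])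
qed

definition mod_iso :: "sl2_module \<Rightarrow> sl2_module \<Rightarrow> bool" where
  "mod_iso V W \<longleftrightarrow> (\<exists>f\<in>sl2_hom V W. \<exists>g\<in>sl2_hom W V. g \<circ> f = idm V \<and> f \<circ> g = idm W)"

lemma sl2_homI':
  assumes "lin T" "T \<circ> idm V = T" "idm W \<circ> T = T"
    "T \<circ> act_e V = act_e W \<circ> T" "T \<circ> act_f V = act_f W \<circ> T" "T \<circ> act_h V = act_h W \<circ> T"
  shows "T \<in> sl2_hom V W"
  using assms by (simp add: sl2_hom_def linear_maps_iff fun_eq_iff)

lemma associator_iso:
  assumes "U \<in> sl2_modules" "V \<in> sl2_modules" "W \<in> sl2_modules"
  shows "associator U V W \<in> sl2_hom (tensor_module (tensor_module U V) W) (tensor_module U (tensor_module V W))"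
    "coassociator U V W \<in> sl2_hom (tensor_module U (tensor_module V W)) (tensor_module (tensor_module U V) W)"
    "coassociator U V W \<circ> associator U V W = idm (tensor_module (tensor_module U V) W)"
    "associator U V W \<circ> coassociator U V W = idm (tensor_module U (tensor_module V W))"
proof -
  have ext: "f = g" if "lin f" "lin g" "\<And>u v w. f (tensor_vec u (tensor_vec v w)) = g (tensor_vec u (tensor_vec v w))" for f g
    by (rule lin_ext[OF that(1,2)]) (metis basis_vec_tensor that(3))
  note l = lin_act_tensor tensor_module_closed lin_add[OF lin_associator] lin_add[OF lin_coassociator]
  note s = assms act_tensor_vec idm_tensor_vec associator_tensor_vec coassociator_tensor_vec sl2_absorb tensor_vec_bilinear
  show "associator U V W \<in> sl2_hom (tensor_module (tensor_module U V) W) (tensor_module U (tensor_module V W))"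
    by (rule sl2_homI'; (rule tensor_ext3)?; simp add: s l)
  show "coassociator U V W \<in> sl2_hom (tensor_module U (tensor_module V W)) (tensor_module (tensor_module U V) W)"
    by (rule sl2_homI'; (rule ext)?; simp add: s l)
  show "coassociator U V W \<circ> associator U V W = idm (tensor_module (tensor_module U V) W)"
    by (rule tensor_ext3; simp add: s l)
  show "associator U V W \<circ> coassociator U V W = idm (tensor_module U (tensor_module V W))"
    by (rule ext; simp add: s l)
qed

lemma left_unitor_iso:
  assumes V: "V \<in> sl2_modules"
  shows "left_unitor V \<in> sl2_hom (tensor_module trivial_module V) V"
    "tensor_vec (basis_vec 0) \<circ> idm V \<in> sl2_hom V (tensor_module trivial_module V)"
    "(tensor_vec (basis_vec 0) \<circ> idm V) \<circ> left_unitor V = idm (tensor_module trivial_module V)"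
    "left_unitor V \<circ> (tensor_vec (basis_vec 0) \<circ> idm V) = idm V"
proof -
  note l = lin_act_tensor tensor_module_closed lin_add[OF lin_unitor(1)] lin_sl2[OF V]
  note s = V act_tensor_vec idm_tensor_vec idm_trivial left_unitor_tensor_vec sl2_absorb tensor_vec_bilinear lin_scale[OF lin_id_map] lin_scale[OF lin_unitor(1)] lin_scale[OF lin_unitor(2)] lin_scale[OF lin_tensor_map]
    lin_scale[OF lin_act_e[OF V]] lin_scale[OF lin_act_f[OF V]] lin_scale[OF lin_act_h[OF V]] lookup_basis_vec
  show "left_unitor V \<in> sl2_hom (tensor_module trivial_module V) V"
    by (rule sl2_homI'; (rule tensor_ext)?; simp add: s l)
  show "tensor_vec (basis_vec 0) \<circ> idm V \<in> sl2_hom V (tensor_module trivial_module V)"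
    by (rule sl2_homI'; simp add: s l fun_eq_iff)
  show "(tensor_vec (basis_vec 0) \<circ> idm V) \<circ> left_unitor V = idm (tensor_module trivial_module V)"
    by (rule tensor_ext; simp add: s l)
  show "left_unitor V \<circ> (tensor_vec (basis_vec 0) \<circ> idm V) = idm V"
    by (simp add: s l fun_eq_iff)
qed

lemma right_unitor_iso:
  assumes V: "V \<in> sl2_modules"
  shows "right_unitor V \<in> sl2_hom (tensor_module V trivial_module) V"
    "(\<lambda>v. tensor_vec (idm V v) (basis_vec 0)) \<in> sl2_hom V (tensor_module V trivial_module)"
    "(\<lambda>v. tensor_vec (idm V v) (basis_vec 0)) \<circ> right_unitor V = idm (tensor_module V trivial_module)"
    "right_unitor V \<circ> (\<lambda>v. tensor_vec (idm V v) (basis_vec 0)) = idm V"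
proof -
  have l0: "lin (\<lambda>v. tensor_vec (idm V v) (basis_vec 0))"
    by (auto simp: lin_iff lin_simps[OF lin_id_map] tensor_vec_bilinear)
  note l = l0 lin_act_tensor tensor_module_closed lin_add[OF lin_unitor(2)] lin_sl2[OF V]
  note s = V act_tensor_vec idm_tensor_vec idm_trivial right_unitor_tensor_vec sl2_absorb tensor_vec_bilinear lin_scale[OF lin_id_map] lin_scale[OF lin_unitor(1)] lin_scale[OF lin_unitor(2)] lin_scale[OF lin_tensor_map]
    lin_scale[OF lin_act_e[OF V]] lin_scale[OF lin_act_f[OF V]] lin_scale[OF lin_act_h[OF V]] lookup_basis_vec
  show "right_unitor V \<in> sl2_hom (tensor_module V trivial_module) V"
    by (rule sl2_homI'; (rule tensor_ext)?; simp add: s l)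
  show "(\<lambda>v. tensor_vec (idm V v) (basis_vec 0)) \<in> sl2_hom V (tensor_module V trivial_module)"
    by (rule sl2_homI'; simp add: s l fun_eq_iff)
  show "(\<lambda>v. tensor_vec (idm V v) (basis_vec 0)) \<circ> right_unitor V = idm (tensor_module V trivial_module)"
    by (rule tensor_ext; simp add: s l)
  show "right_unitor V \<circ> (\<lambda>v. tensor_vec (idm V v) (basis_vec 0)) = idm V"
    by (simp add: s l fun_eq_iff)
qed

lemma map_scale_module: "module map_scale"
  using map_scale_vector_space by (simp only: module_iff_vector_space)

lemma subspace_sl2_hom:
  assumes "W \<in> sl2_modules"
  shows "module.subspace map_scale (sl2_hom V W)"
  unfolding module.subspace_def[OF map_scale_module]
proof (intro conjI ballI allI)
  show "0 \<in> sl2_hom V W" by (rule hom_zero[OF assms])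
  show "x + y \<in> sl2_hom V W" if "x \<in> sl2_hom V W" "y \<in> sl2_hom V W" for x y
    by (rule hom_plus[OF assms that])
  show "map_scale c x \<in> sl2_hom V W" if "x \<in> sl2_hom V W" for x c
    by (rule hom_scale[OF assms that])
qed

lemma linear_category_sl2:
  fixes K :: "(sl2_module, vec \<Rightarrow> vec, 'z) linear_cat_scheme"
  assumes "Ob K \<subseteq> sl2_modules" "Hom K = sl2_hom" "Id K = idm" "Comp K = (\<circ>)" "Scale K = map_scale"
  shows "linear_category K"
  by (rule linear_category.intro; insert assms;
      simp add: subset_iff map_scale_vector_space subspace_sl2_hom hom_comp hom_id_left hom_id_right o_assoc
        comp_plus_left comp_plus_right comp_scale_left comp_scale_right hom_lin)

text \<open>On pure tensors a structural map only rebrackets or multiplies by a coordinate, so every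
  naturality and coherence axiom becomes a direct rewriting there.\<close>

lemma monoidal_linear_category_FD: "monoidal_linear_category FD"
proof -
  interpret linear_category FD
    by (rule linear_category_sl2) auto
  have fin: "finite (basis (tensor_module V W))" if "finite (basis V)" "finite (basis W)" for V W
    using that by (simp add: basis_tensor_module)
  note s = associator_tensor_vec left_unitor_tensor_vec right_unitor_tensor_vec hom_lin hom_dom hom_cod
    idm_tensor_vec tensor_vec_bilinear idm_trivial lin_scale[OF lin_unitor(1)] lin_scale[OF lin_unitor(2)] lin_scale[OF lin_tensor_map]
  show ?thesis
  proof (unfold_locales, goal_cases)
    case 4 then show ?case by (simp add: tensor_map_id_map basis_tensor_module)
  next
    case 5 then show ?case by (simp add: tensor_map_comp hom_lin)
  next
    case 6 then show ?case by (simp add: tensor_map_linear hom_lin)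
  next
    case 7 then show ?case by (simp add: tensor_map_linear hom_lin)
  next
    case (8 X Y Z)
    then show ?case using associator_iso[of X Y Z] by (auto simp: isomorphism_def)
  next
    case (9 X X' Y Y' Z Z' f g h)
    show ?case unfolding FD_simps
      by (rule tensor_ext3) (use 9 in \<open>auto simp: s\<close>)
  next
    case (10 X)
    then show ?case using left_unitor_iso[of X] by (auto simp: isomorphism_def)
  next
    case (11 X X' f)
    show ?case unfolding FD_simps
      by (rule tensor_ext) (use 11 in \<open>auto simp: s lookup_basis_vec lin_scale[OF hom_lin]\<close>)
  next
    case (12 X)
    then show ?case using right_unitor_iso[of X] by (auto simp: isomorphism_def)
  next
    case (13 X X' f)
    show ?case unfolding FD_simps
      by (rule tensor_ext) (use 13 in \<open>auto simp: s lookup_basis_vec lin_scale[OF hom_lin]\<close>)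
  next
    case (14 W X Y Z)
    show ?case unfolding FD_simps
      by (rule tensor_ext4) (use 14 in \<open>auto simp: s\<close>)
  next
    case (15 X Y)
    show ?case unfolding FD_simps
      by (rule tensor_ext3) (use 15 in \<open>auto simp: s lookup_basis_vec\<close>)
  qed (auto simp: fin tensor_map_hom)
qed

text \<open>The action is the tensor product itself, so the coherence computations for finite
  dimensional modules carry over to arbitrary ones. For a concrete category only stability under
  tensoring remains to be shown.\<close>

lemma module_category_Mod:
  assumes S: "S \<subseteq> sl2_modules"
    and act: "\<And>X A. X \<in> sl2_modules \<Longrightarrow> finite (basis X) \<Longrightarrow> A \<in> S \<Longrightarrow> tensor_module X A \<in> S"
  shows "module_category FD (Mod S)"
proof -
  interpret C: monoidal_linear_category FD
    by (rule monoidal_linear_category_FD)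
  interpret M: linear_category "Mod S"
    by (rule linear_category_sl2) (use S in auto)
  have S': "A \<in> S \<Longrightarrow> A \<in> sl2_modules" for A
    using S by auto
  note s = associator_tensor_vec left_unitor_tensor_vec right_unitor_tensor_vec hom_lin hom_dom hom_cod
    idm_tensor_vec tensor_vec_bilinear idm_trivial lin_scale[OF lin_unitor(1)] lin_scale[OF lin_unitor(2)] lin_scale[OF lin_tensor_map]
  show ?thesis
  proof (unfold_locales, goal_cases)
    case 1 then show ?case by (simp add: act)
  next
    case 2 then show ?case by (simp add: tensor_map_hom S')
  next
    case 3 then show ?case by (simp add: tensor_map_id_map basis_tensor_module)
  next
    case 4 then show ?case by (simp add: tensor_map_comp hom_lin)
  next
    case 5 then show ?case by (simp add: tensor_map_linear hom_lin)
  next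
    case 6 then show ?case by (simp add: tensor_map_linear hom_lin)
  next
    case (7 X Y A)
    then show ?case using associator_iso[of X Y A] S' by (auto simp: isomorphism_def)
  next
    case (8 X X' Y Y' Z Z' f g h)
    show ?case unfolding FD_simps Mod_simps
      by (rule tensor_ext3) (use 8 in \<open>auto simp: s\<close>)
  next
    case (9 X)
    then show ?case using left_unitor_iso[of X] S' by (auto simp: isomorphism_def)
  next
    case (10 X X' f)
    show ?case unfolding FD_simps Mod_simps
      by (rule tensor_ext) (use 10 in \<open>auto simp: s lookup_basis_vec lin_scale[OF hom_lin]\<close>)
  next
    case (11 W X Y Z)
    show ?case unfolding FD_simps Mod_simps
      by (rule tensor_ext4) (use 11 in \<open>auto simp: s\<close>)
  next
    case (12 X Y)
    show ?case unfolding FD_simps Mod_simps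
      by (rule tensor_ext3) (use 12 in \<open>auto simp: s lookup_basis_vec\<close>)
  qed
qed

section \<open>Submodules as objects\<close>

text \<open>Every vector has finite support, and at most n independent vectors have support below n.
  Countability allows a basis of a submodule to be numbered, which is how submodules become
  objects.\<close>

lemma independent_countable:
  assumes "vec.independent B"
  shows "countable B"
proof -
  have fin: "finite {b \<in> B. b \<in> vec_space {..<n}}" for n
  proof -
    have "vec_space {..<n} \<subseteq> vec.span (basis_vec ` {..<n})"
    proof
      fix v :: vec assume v: "v \<in> vec_space {..<n}"
      then have "(\<Sum>i\<in>keys v. vscale (lookup v i) (basis_vec i)) \<in> vec.span (basis_vec ` {..<n})"
        by (intro vec.span_sum vec.span_scale vec.span_base) (auto simp: vec_space_def)
      then show "v \<in> vec.span (basis_vec ` {..<n})"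
        using vec_expand by metis
    qed
    then have "{b \<in> B. b \<in> vec_space {..<n}} \<subseteq> vec.span (basis_vec ` {..<n})"
      by auto
    moreover have "vec.independent {b \<in> B. b \<in> vec_space {..<n}}"
      using assms by (rule vec.independent_mono) auto
    ultimately show ?thesis
      using vec.independent_span_bound[of "basis_vec ` {..<n}"] by blast
  qed
  have "B = (\<Union>n. {b \<in> B. b \<in> vec_space {..<n}})"
  proof -
    have "\<exists>n. b \<in> vec_space {..<n}" for b :: vec
      by (rule exI[of _ "Suc (Max (keys b))"]) (auto simp: vec_space_def less_Suc_eq_le)
    then show ?thesis by auto
  qed
  moreover have "countable (\<Union>n. {b \<in> B. b \<in> vec_space {..<n}})"
    using fin by (intro countable_UN) (auto intro: countable_finite)
  ultimately show ?thesis by metis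
qed

lemma vec_space_finite_span:
  assumes "finite C"
  shows "vec_space C \<subseteq> vec.span (basis_vec ` C)"
proof
  fix v :: vec assume v: "v \<in> vec_space C"
  then have "(\<Sum>i\<in>keys v. vscale (lookup v i) (basis_vec i)) \<in> vec.span (basis_vec ` C)"
    by (intro vec.span_sum vec.span_scale vec.span_base) (auto simp: vec_space_def)
  then show "v \<in> vec.span (basis_vec ` C)"
    using vec_expand by metis
qed

text \<open>A basis of the submodule is numbered by natural numbers and the action is transported
  along it. \<open>\<iota>\<close> is the inclusion; \<open>\<kappa>\<close> takes coordinates, is
  linear on the whole vector type, and inverts the inclusion on \<open>N\<close>.\<close>

lemma submodule_copy:
  assumes V: "V \<in> sl2_modules" and N: "submodule N V"
  obtains W \<iota> \<kappa> where "W \<in> sl2_modules" "\<iota> \<in> sl2_hom W V" "lin \<kappa>"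
    "\<And>w. w \<in> space W \<Longrightarrow> \<iota> w \<in> N \<and> \<kappa> (\<iota> w) = w" "\<And>x. x \<in> N \<Longrightarrow> \<kappa> x \<in> space W \<and> \<iota> (\<kappa> x) = x"
    "finite (basis V) \<Longrightarrow> finite (basis W)"
proof -
  have sub: "vec.subspace N" and NV: "N \<subseteq> space V"
    and Nact: "\<And>v. v \<in> N \<Longrightarrow> act_e V v \<in> N \<and> act_f V v \<in> N \<and> act_h V v \<in> N"
    using N by (auto simp: submodule_def)
  obtain B where B: "B \<subseteq> N" "vec.independent B" "N \<subseteq> vec.span B"
    using vec.basis_exists[of N] by metis
  have cB: "countable B"
    by (rule independent_countable[OF B(2)])
  define I where "I = to_nat_on B ` B"
  define \<iota> where "\<iota> = linear_extension (\<lambda>n. if n \<in> I then from_nat_into B n else 0)"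
  have lin_i: "lin \<iota>" by (simp add: \<iota>_def)
  obtain \<kappa> where k: "lin \<kappa>" "\<And>b. b \<in> B \<Longrightarrow> \<kappa> b = basis_vec (to_nat_on B b)"
    using vecp.linear_independent_extend[OF B(2), of "\<lambda>b. basis_vec (to_nat_on B b)"] by blast
  have i_b: "\<iota> (basis_vec n) = (if n \<in> I then from_nat_into B n else 0)" for n
    by (simp add: \<iota>_def)
  have i_N: "\<iota> v \<in> N" for v
    unfolding \<iota>_def linear_extension_def
    using B(1) cB sub by (intro vec.subspace_sum vec.subspace_scale) (auto simp: I_def vec.subspace_0)
  have "\<kappa> \<circ> \<iota> = id_map I"
    using k cB by (intro lin_ext) (auto simp: i_b id_map_basis_vec I_def lin_i lin_zero)
  then have ki: "\<kappa> (\<iota> v) = id_map I v" for v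
    by (metis comp_apply)
  have "(\<iota> \<circ> \<kappa>) x = id x" if "x \<in> vec.span B" for x
    by (rule vecp.linear_eq_on_span[OF lin_comp[OF lin_i k(1)] lin_id(1) _ that]) (auto simp: k i_b I_def cB)
  then have ik: "\<iota> (\<kappa> x) = x" if "x \<in> N" for x
    using that B(3) by auto
  have kN: "\<kappa> x \<in> vec_space I" if "x \<in> N" for x
    by (metis that id_map_in ik ki)
  have i_id: "\<iota> (id_map I v) = \<iota> v" for v
    by (metis ik ki i_N)
  define W where "W = \<lparr>basis = I, act_e = \<kappa> \<circ> act_e V \<circ> \<iota>, act_f = \<kappa> \<circ> act_f V \<circ> \<iota>, act_h = \<kappa> \<circ> act_h V \<circ> \<iota>\<rparr>"
  have W: "basis W = I" "act_e W v = \<kappa> (act_e V (\<iota> v))" "act_f W v = \<kappa> (act_f V (\<iota> v))"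
    "act_h W v = \<kappa> (act_h V (\<iota> v))" for v
    by (simp_all add: W_def)
  have lW: "lin (act_e W)" "lin (act_f W)" "lin (act_h W)"
    unfolding W_def by (simp_all add: k(1) lin_i lin_sl2[OF V])
  have Wm: "W \<in> sl2_modules"
    by (rule sl2_modulesI)
      (auto simp: linear_maps_iff lW W i_id kN i_N Nact ik sl2_rels[OF V] lin_simps[OF k(1)])
  moreover have "\<iota> \<in> sl2_hom W V"
    using NV i_N by (intro sl2_homI linear_mapsI Wm) (auto simp: W i_id ik Nact lin_i)
  moreover have "finite (basis W)" if "finite (basis V)"
    using vec.independent_span_bound[of "basis_vec ` basis V" B] that B NV vec_space_finite_span[OF that]
    by (auto simp: W I_def)
  ultimately show ?thesis
    using that[of W \<iota> \<kappa>] k ki kN ik i_N by (auto simp: W)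
qed

text \<open>The image of \<open>e\<close> is copied to an object; \<open>\<kappa> \<circ> e\<close>
  and the inclusion split the idempotent.\<close>

lemma idempotent_splits:
  assumes V: "V \<in> sl2_modules" and e: "e \<in> sl2_hom V V" "e \<circ> e = e"
  obtains W r s where "W \<in> sl2_modules" "r \<in> sl2_hom V W" "s \<in> sl2_hom W V" "r \<circ> s = idm W" "s \<circ> r = e"
    "finite (basis V) \<Longrightarrow> finite (basis W)"
proof -
  note l = hom_lin[OF e(1)]
  have ee: "e (e v) = e v" for v using e(2) by (metis comp_apply)
  have "submodule (range e) V"
    unfolding submodule_def
  proof (intro conjI ballI)
    show "range e \<subseteq> space V" using hom_in[OF e(1)] by auto
    show "vec.subspace (range e)"
      using vecp.linear_subspace_image[OF l vec.subspace_UNIV] by simp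
  qed (auto simp flip: sl2_homD(5,6,7)[OF e(1)])
  from submodule_copy[OF V this] obtain W \<iota> \<kappa> where W: "W \<in> sl2_modules" "\<iota> \<in> sl2_hom W V" "lin \<kappa>"
    "\<And>w. w \<in> space W \<Longrightarrow> \<iota> w \<in> range e \<and> \<kappa> (\<iota> w) = w" "\<And>x. x \<in> range e \<Longrightarrow> \<kappa> x \<in> space W \<and> \<iota> (\<kappa> x) = x"
    "finite (basis V) \<Longrightarrow> finite (basis W)" by metis
  have ek: "\<iota> (\<kappa> (e v)) = e v" "\<kappa> (e v) \<in> space W" for v using W(5)[of "e v"] by auto
  have incl: "x = y" if "x \<in> space W" "y \<in> space W" "\<iota> x = \<iota> y" for x y
    using W(4) that by metis
  have "\<kappa> \<circ> e \<in> sl2_hom V W"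
  proof (intro sl2_homI linear_mapsI V)
    show "lin (\<kappa> \<circ> e)" using W(3) l by simp
    show "(\<kappa> \<circ> e) (idm V v) = (\<kappa> \<circ> e) v" for v by (simp add: hom_dom[OF e(1)])
    show "(\<kappa> \<circ> e) v \<in> space W" for v by (simp add: ek)
    show "(\<kappa> \<circ> e) (act_e V v) = act_e W ((\<kappa> \<circ> e) v)" for v
      by (rule incl) (simp_all add: ek W(1) sl2_homD(5-7)[OF W(2)], simp add: sl2_homD(5-7)[OF e(1)])
    show "(\<kappa> \<circ> e) (act_f V v) = act_f W ((\<kappa> \<circ> e) v)" for v
      by (rule incl) (simp_all add: ek W(1) sl2_homD(5-7)[OF W(2)], simp add: sl2_homD(5-7)[OF e(1)])
    show "(\<kappa> \<circ> e) (act_h V v) = act_h W ((\<kappa> \<circ> e) v)" for v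
      by (rule incl) (simp_all add: ek W(1) sl2_homD(5-7)[OF W(2)], simp add: sl2_homD(5-7)[OF e(1)])
  qed
  moreover have "(\<kappa> \<circ> e) \<circ> \<iota> = idm W"
  proof
    fix w
    have "\<iota> (idm W w) = e (\<iota> (idm W w))" using W(4)[OF id_map_in, of w] ee by auto
    then have "\<kappa> (e (\<iota> (idm W w))) = idm W w" using W(4)[OF id_map_in, of w] by simp
    then show "((\<kappa> \<circ> e) \<circ> \<iota>) w = idm W w" by (simp add: hom_dom[OF W(2)])
  qed
  moreover have "\<iota> \<circ> (\<kappa> \<circ> e) = e" by (auto simp: ek)
  ultimately show ?thesis using that W by metis
qed


section \<open>Direct sums and the Krull--Schmidt argument\<close>

text \<open>\<open>thr As V W f\<close> says that \<open>f\<close> is a sum of composites V -> A ->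
  W, one for each entry A of \<open>As\<close>. When \<open>f\<close> is the identity of
  \<open>V\<close>, this makes \<open>V\<close> a summand of the sum of \<open>As\<close> without
  choosing an object for that sum and without orthogonality relations, so it composes and tensors
  easily.\<close>

inductive thr :: "sl2_module list \<Rightarrow> sl2_module \<Rightarrow> sl2_module \<Rightarrow> (vec \<Rightarrow> vec) \<Rightarrow> bool" where
  thr_Nil: "thr [] V W 0"
| thr_Cons: "thr As V W f \<Longrightarrow> A \<in> sl2_modules \<Longrightarrow> v \<in> sl2_hom V A \<Longrightarrow> u \<in> sl2_hom A W \<Longrightarrow> thr (A # As) V W ((u \<circ> v) + f)"

abbreviation splits_through :: "sl2_module list \<Rightarrow> sl2_module \<Rightarrow> bool" where
  "splits_through As V \<equiv> thr As V V (idm V)"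

lemma thr_Cons': "thr As V W f \<Longrightarrow> A \<in> sl2_modules \<Longrightarrow> v \<in> sl2_hom V A \<Longrightarrow> u \<in> sl2_hom A W \<Longrightarrow> g = (u \<circ> v) + f \<Longrightarrow> thr (A # As) V W g"
  by (simp add: thr_Cons)

lemma thr_Nil': "(\<And>x. f x = 0) \<Longrightarrow> thr [] V W f"
  using thr_Nil by (metis ext zero_fun_apply)

lemma thr_hom: "thr As V W f \<Longrightarrow> W \<in> sl2_modules \<Longrightarrow> f \<in> sl2_hom V W"
  by (induction rule: thr.induct) (auto intro: hom_plus hom_comp)

lemma thr_append: "thr As V W f \<Longrightarrow> thr Bs V W g \<Longrightarrow> thr (As @ Bs) V W (f + g)"
  by (induction rule: thr.induct) (auto simp: add.assoc intro: thr_Cons)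

lemma thr_comp: "thr As V W f \<Longrightarrow> h \<in> sl2_hom V' V \<Longrightarrow> g \<in> sl2_hom W W' \<Longrightarrow> thr As V' W' (g \<circ> f \<circ> h)"
proof (induction rule: thr.induct)
  case (thr_Nil V W)
  then show ?case by (intro thr_Nil') (simp add: lin_zero[OF hom_lin])
next
  case (thr_Cons As V W f A v u)
  show ?case
    by (rule thr_Cons'[OF thr_Cons.IH[OF thr_Cons.prems] thr_Cons.hyps(2), of "v \<circ> h" "g \<circ> u"])
      (use thr_Cons in \<open>auto intro: hom_comp simp: fun_eq_iff lin_add[OF hom_lin]\<close>)
qed

lemma thr_single: "A \<in> sl2_modules \<Longrightarrow> v \<in> sl2_hom V A \<Longrightarrow> u \<in> sl2_hom A W \<Longrightarrow> thr [A] V W (u \<circ> v)"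
  using thr_Cons[OF thr_Nil] by fastforce

text \<open>The identity of each entry may be replaced by a factorisation of its own: decompositions
  can be refined.\<close>

lemma thr_trans:
  assumes "thr As V W f" "\<And>A. A \<in> set As \<Longrightarrow> \<exists>Bs. set Bs \<subseteq> S \<and> splits_through Bs A"
  shows "\<exists>Bs. set Bs \<subseteq> S \<and> thr Bs V W f"
  using assms
proof (induction rule: thr.induct)
  case (thr_Nil V W)
  then show ?case by (intro exI[of _ "[]"]) (auto intro: thr_Nil')
next
  case (thr_Cons As V W f A v u)
  then obtain Bs Cs where "set Bs \<subseteq> S" "thr Bs V W f" "set Cs \<subseteq> S" "splits_through Cs A"
    by (metis list.set_intros)
  then have "thr (Cs @ Bs) V W ((u \<circ> idm A \<circ> v) + f)" "set (Cs @ Bs) \<subseteq> S"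
    using thr_Cons by (auto intro!: thr_append thr_comp)
  then show ?case using hom_id_right[OF thr_Cons.hyps(4)] by (metis)
qed

lemma thr_tensor_left:
  assumes X: "X \<in> sl2_modules" and "thr As V W f" "V \<in> sl2_modules" "W \<in> sl2_modules"
  shows "thr (map (tensor_module X) As) (tensor_module X V) (tensor_module X W) (tensor_map (idm X) f)"
  using assms(2-)
proof (induction rule: thr.induct)
  case (thr_Nil V W)
  then show ?case using tensor_map_zero(2)[of "idm X"] thr.thr_Nil by (metis list.map(1) zero_fun_def)
next
  case (thr_Cons As V W f A v u)
  have "tensor_map (idm X) ((u \<circ> v) + f) = (tensor_map (idm X) u \<circ> tensor_map (idm X) v) + tensor_map (idm X) f"
    using thr_Cons X hom_lin[OF thr_hom[OF thr_Cons.hyps(1)]]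
    by (simp add: tensor_map_comp hom_lin tensor_map_linear hom_id_left[OF hom_id])
  moreover have "(u \<circ> v) + f = (\<lambda>a. u (v a) + f a)" by (simp add: fun_eq_iff)
  ultimately show ?case
    using thr_Cons X unfolding list.map
    by (intro thr_Cons'[where u = "tensor_map (idm X) u" and v = "tensor_map (idm X) v"]) (auto intro: tensor_map_hom)
qed

lemma thr_tensor_right:
  assumes X: "X \<in> sl2_modules" and "thr As V W f" "V \<in> sl2_modules" "W \<in> sl2_modules"
  shows "thr (map (\<lambda>A. tensor_module A X) As) (tensor_module V X) (tensor_module W X) (tensor_map f (idm X))"
  using assms(2-)
proof (induction rule: thr.induct)
  case (thr_Nil V W)
  then show ?case using tensor_map_zero(1)[of "idm X"] thr.thr_Nil by (metis list.map(1) zero_fun_def)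
next
  case (thr_Cons As V W f A v u)
  have "tensor_map ((u \<circ> v) + f) (idm X) = (tensor_map u (idm X) \<circ> tensor_map v (idm X)) + tensor_map f (idm X)"
    using thr_Cons X hom_lin[OF thr_hom[OF thr_Cons.hyps(1)]]
    by (simp add: tensor_map_comp hom_lin tensor_map_linear hom_id_left[OF hom_id])
  moreover have "(u \<circ> v) + f = (\<lambda>a. u (v a) + f a)" by (simp add: fun_eq_iff)
  ultimately show ?case
    using thr_Cons X unfolding list.map
    by (intro thr_Cons'[where u = "tensor_map u (idm X)" and v = "tensor_map v (idm X)"]) (auto intro: tensor_map_hom)
qed

lemma idm_tensor: "idm (tensor_module X V) = tensor_map (idm X) (idm V)"
  by (simp only: basis_tensor_module tensor_map_id_map)

lemma thr_from_sum:
  assumes "\<And>k. k < length As \<Longrightarrow> As ! k \<in> sl2_modules \<and> u k \<in> sl2_hom (As ! k) W \<and> v k \<in> sl2_hom V (As ! k)"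
  shows "thr As V W (\<Sum>k<length As. u k \<circ> v k)"
  using assms
proof (induction As arbitrary: u v)
  case Nil
  then show ?case by (auto intro: thr_Nil')
next
  case (Cons A As)
  have "thr As V W (\<Sum>k<length As. u (Suc k) \<circ> v (Suc k))"
    by (rule Cons.IH) (use Cons.prems[of "Suc _"] in auto)
  then show ?case
    using Cons.prems[of 0]
    by (intro thr_Cons'[where u = "u 0" and v = "v 0"])
      (auto simp add: sum.lessThan_Suc_shift fun_eq_iff sum_map_apply simp del: sum.lessThan_Suc)
qed

text \<open>The direct sum condition with the set of ambient objects stripped off, so that one
  decomposition serves all full subcategories at once.\<close>

definition biprod :: "sl2_module list \<Rightarrow> sl2_module \<Rightarrow> bool" where
  "biprod As D \<longleftrightarrow> (\<exists>\<iota> \<pi>. (\<forall>k<length As. \<iota> k \<in> sl2_hom (As ! k) D \<and> \<pi> k \<in> sl2_hom D (As ! k)) \<and>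
            (\<forall>k<length As. \<forall>l<length As. \<pi> k \<circ> \<iota> l = (if k = l then idm (As ! k) else 0)) \<and>
            (\<Sum>k<length As. \<iota> k \<circ> \<pi> k) = idm D)"

lemma biprodI:
  assumes "\<And>k. k < length As \<Longrightarrow> \<iota> k \<in> sl2_hom (As ! k) D \<and> \<pi> k \<in> sl2_hom D (As ! k)"
    "\<And>k l. k < length As \<Longrightarrow> l < length As \<Longrightarrow> \<pi> k \<circ> \<iota> l = (if k = l then idm (As ! k) else 0)"
    "(\<Sum>k<length As. \<iota> k \<circ> \<pi> k) = idm D"
  shows "biprod As D"
  unfolding biprod_def by (intro exI[of _ \<iota>] exI[of _ \<pi>] conjI allI impI assms) (use assms(1) in auto)

lemma direct_sum_Mod: "direct_sum (Mod S) As D \<longleftrightarrow> set As \<subseteq> S \<and> D \<in> S \<and> biprod As D"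
  by (simp add: direct_sum_def biprod_def)

lemma biprod_thr: "biprod As D \<Longrightarrow> set As \<subseteq> sl2_modules \<Longrightarrow> splits_through As D"
proof -
  assume "biprod As D" and As: "set As \<subseteq> sl2_modules"
  then obtain \<iota> \<pi> where d: "\<And>k. k < length As \<Longrightarrow> \<iota> k \<in> sl2_hom (As ! k) D \<and> \<pi> k \<in> sl2_hom D (As ! k)"
    "(\<Sum>k<length As. \<iota> k \<circ> \<pi> k) = idm D" unfolding biprod_def by blast
  show "splits_through As D"
    using thr_from_sum[of As \<iota> D \<pi> D] d(1) As unfolding d(2) by (meson nth_mem subsetD)
qed

lemma biprod_Cons:
  assumes "biprod Bs V'" "i \<in> sl2_hom A V" "p \<in> sl2_hom V A" "s \<in> sl2_hom V' V" "r \<in> sl2_hom V V'"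
    "p \<circ> i = idm A" "r \<circ> s = idm V'" "p \<circ> s = 0" "r \<circ> i = 0" "(i \<circ> p) + (s \<circ> r) = idm V"
  shows "biprod (A # Bs) V"
proof -
  from assms(1) obtain \<iota> \<pi> where d: "\<And>k. k < length Bs \<Longrightarrow> \<iota> k \<in> sl2_hom (Bs ! k) V' \<and> \<pi> k \<in> sl2_hom V' (Bs ! k)"
    "\<And>k l. k < length Bs \<Longrightarrow> l < length Bs \<Longrightarrow> \<pi> k \<circ> \<iota> l = (if k = l then idm (Bs ! k) else 0)"
    "(\<Sum>k<length Bs. \<iota> k \<circ> \<pi> k) = idm V'" unfolding biprod_def by blast
  define \<iota>' where "\<iota>' k = (case k of 0 \<Rightarrow> i | Suc k \<Rightarrow> s \<circ> \<iota> k)" for k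
  define \<pi>' where "\<pi>' k = (case k of 0 \<Rightarrow> p | Suc k \<Rightarrow> \<pi> k \<circ> r)" for k
  have lp: "lin (\<pi> k)" if "k < length Bs" for k using d(1)[OF that] hom_lin by blast
  have "\<iota>' k \<in> sl2_hom ((A # Bs) ! k) V \<and> \<pi>' k \<in> sl2_hom V ((A # Bs) ! k)" if "k < length (A # Bs)" for k
    using that assms d(1) by (cases k) (auto simp: \<iota>'_def \<pi>'_def intro: hom_comp)
  moreover have "\<pi>' k \<circ> \<iota>' l = (if k = l then idm ((A # Bs) ! k) else 0)" if "k < length (A # Bs)" "l < length (A # Bs)" for k l
  proof (cases k; cases l)
    fix k' l' assume k: "k = Suc k'" "l = Suc l'"
    have "\<pi>' k \<circ> \<iota>' l = \<pi> k' \<circ> (r \<circ> s) \<circ> \<iota> l'" by (simp add: k \<iota>'_def \<pi>'_def comp_assoc)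
    also have "\<dots> = \<pi> k' \<circ> \<iota> l'" using d(1)[of k'] that(1) k(1) hom_id_right[of "\<pi> k'" V' "Bs ! k'"] assms(7) by simp
    finally show ?thesis using d(2) that k by simp
  next
    fix l' assume k: "k = 0" "l = Suc l'"
    have "\<pi>' k \<circ> \<iota>' l = (p \<circ> s) \<circ> \<iota> l'" by (simp add: k \<iota>'_def \<pi>'_def comp_assoc)
    then show ?thesis using k assms by (simp add: comp_zero_left)
  next
    fix k' assume k: "k = Suc k'" "l = 0"
    have "\<pi>' k \<circ> \<iota>' l = \<pi> k' \<circ> (r \<circ> i)" by (simp add: k \<iota>'_def \<pi>'_def comp_assoc)
    then show ?thesis using k assms lp[of k'] that by (simp add: comp_zero_right)
  qed (use assms in \<open>auto simp: \<iota>'_def \<pi>'_def\<close>)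
  moreover have "(\<Sum>k<length (A # Bs). \<iota>' k \<circ> \<pi>' k) = idm V"
  proof -
    have "(\<Sum>k<length (A # Bs). \<iota>' k \<circ> \<pi>' k) = (i \<circ> p) + (\<Sum>k<length Bs. s \<circ> (\<iota> k \<circ> \<pi> k) \<circ> r)"
      by (simp add: sum.lessThan_Suc_shift \<iota>'_def \<pi>'_def comp_assoc del: sum.lessThan_Suc)
    also have "(\<Sum>k<length Bs. s \<circ> (\<iota> k \<circ> \<pi> k) \<circ> r) = s \<circ> (\<Sum>k<length Bs. \<iota> k \<circ> \<pi> k) \<circ> r"
      by (simp add: comp_sum_right[OF hom_lin[OF assms(4)]] comp_sum_left)
    also have "\<dots> = s \<circ> r" using d(3) hom_id_right[OF assms(4)] by simp
    finally show ?thesis by (simp only: assms(10))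
  qed
  ultimately show ?thesis by (rule biprodI)
qed

lemma biprod_Nil: "biprod [] V \<longleftrightarrow> idm V = 0"
  by (auto simp: biprod_def)

lemma thr_ConsE:
  assumes "thr (A # As) V W g"
  obtains f u v where "thr As V W f" "A \<in> sl2_modules" "v \<in> sl2_hom V A" "u \<in> sl2_hom A W" "g = (u \<circ> v) + f"
  using assms by (cases rule: thr.cases) auto

lemma isomorphism_Mod: "isomorphism (Mod S) a b f \<longleftrightarrow>
   f \<in> sl2_hom a b \<and> (\<exists>g\<in>sl2_hom b a. g \<circ> f = idm a \<and> f \<circ> g = idm b)"
  by (simp add: isomorphism_def)

lemma isomorphic_Mod: "isomorphic (Mod S) a b \<longleftrightarrow> mod_iso a b"
  by (auto simp: isomorphic_def isomorphism_Mod mod_iso_def)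

text \<open>With id = u v + f, locality of End A makes v u or 1 - v u invertible. In the first case
  A is a summand of V, and the complement is still covered by the rest of the list. In the second
  case f = 1 - u v is invertible too, so the rest of the list already covers V.\<close>

lemma split_off_local:
  assumes V: "V \<in> sl2_modules" and t: "splits_through (A # As) V" and loc: "local_endomorphisms (Mod S) A"
  shows "splits_through As V \<or> (\<exists>V' i p s r. V' \<in> sl2_modules \<and> splits_through As V' \<and> i \<in> sl2_hom A V \<and> p \<in> sl2_hom V A \<and> s \<in> sl2_hom V' V \<and> r \<in> sl2_hom V V' \<and>
    p \<circ> i = idm A \<and> r \<circ> s = idm V' \<and> p \<circ> s = 0 \<and> r \<circ> i = 0 \<and> (i \<circ> p) + (s \<circ> r) = idm V)"
proof -
  obtain f u v where f: "thr As V V f" "A \<in> sl2_modules" "v \<in> sl2_hom V A" "u \<in> sl2_hom A V" "idm V = (u \<circ> v) + f"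
    using t by (rule thr_ConsE)
  note lu = lin_simps[OF hom_lin[OF f(4)]] and lv = lin_simps[OF hom_lin[OF f(3)]]
  note d = hom_dom[OF f(3)] hom_cod[OF f(3)] hom_dom[OF f(4)] hom_cod[OF f(4)]
  have vu: "v \<circ> u \<in> sl2_hom A A" using f by (auto intro: hom_comp)
  have 1: "idm A - (v \<circ> u) \<in> sl2_hom A A" using vu f by (auto intro: hom_minus)
  have iA: "isomorphism (Mod S) A A (idm A)"
    using f(2) by (auto simp: isomorphism_Mod intro!: bexI[of _ "idm A"])
  have "isomorphism (Mod S) A A (v \<circ> u) \<or> isomorphism (Mod S) A A (idm A - (v \<circ> u))"
    using loc vu 1 iA unfolding local_endomorphisms_def by auto
  then show ?thesis
  proof
    assume "isomorphism (Mod S) A A (v \<circ> u)"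
    then obtain q where q: "q \<in> sl2_hom A A" "q \<circ> (v \<circ> u) = idm A" "(v \<circ> u) \<circ> q = idm A"
      by (auto simp: isomorphism_Mod)
    have q2: "q (v (u x)) = idm A x" "v (u (q x)) = idm A x" for x using q(2,3) by (metis comp_apply)+
    note lq = lin_simps[OF hom_lin[OF q(1)]]
    note dq = hom_dom[OF q(1)] hom_cod[OF q(1)]
    \<comment> \<open>u q v is idempotent because q inverts v u; \<open>?e\<close> projects onto the
      complement of this copy of A.\<close>
    let ?e = "idm V - (u \<circ> (q \<circ> v))"
    have e: "?e \<in> sl2_hom V V" using V f q by (intro hom_minus hom_id hom_comp[of v V A] hom_comp[of _ V A]) auto
    have "?e \<circ> ?e = ?e"
      by (auto simp: fun_eq_iff lu lv lq d dq q2 lin_simps[OF lin_id_map])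
    from idempotent_splits[OF V e this] obtain V' r s where V': "V' \<in> sl2_modules" "r \<in> sl2_hom V V'" "s \<in> sl2_hom V' V" "r \<circ> s = idm V'" "s \<circ> r = ?e"
      by metis
    have sr: "s (r x) = idm V x - u (q (v x))" for x using V'(5) by (simp add: fun_eq_iff)
    have rs: "r (s x) = idm V' x" for x using V'(4) by (simp add: fun_eq_iff)
    have vs: "v (s x) = 0" for x
    proof -
      have "v (s x) = v (s (r (s x)))" by (simp add: rs hom_dom[OF V'(3)])
      also have "\<dots> = 0" by (subst sr) (simp add: lv d q2)
      finally show ?thesis .
    qed
    have ru: "r (u x) = 0" for x
    proof -
      have "r (u x) = r (s (r (u x)))" by (simp add: rs hom_cod[OF V'(2)])
      also have "\<dots> = 0" by (subst sr) (simp add: lu lv d dq q2 hom_lin[OF V'(2)] lin_zero)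
      finally show ?thesis .
    qed
    have "thr As V' V' (r \<circ> f \<circ> s)" using f V' by (auto intro: thr_comp)
    moreover have "r \<circ> f \<circ> s = idm V'"
    proof
      fix x
      have "f (s x) = s x" using fun_cong[OF f(5), of "s x"] by (simp add: vs lu hom_cod[OF V'(3)])
      then show "(r \<circ> f \<circ> s) x = idm V' x" by (simp add: rs)
    qed
    moreover have "q \<circ> v \<in> sl2_hom V A" using f q by (auto intro: hom_comp)
    moreover have "(q \<circ> v) \<circ> u = idm A" using q(2) by (simp add: comp_assoc)
    moreover have "(q \<circ> v) \<circ> s = 0" "r \<circ> u = 0" by (auto simp: vs lq ru)
    moreover have "(u \<circ> (q \<circ> v)) + (s \<circ> r) = idm V" by (simp add: V'(5))
    ultimately show ?thesis using V' f by metis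
  next
    assume "isomorphism (Mod S) A A (idm A - (v \<circ> u))"
    then obtain q where q: "q \<in> sl2_hom A A" "q \<circ> (idm A - (v \<circ> u)) = idm A" "(idm A - (v \<circ> u)) \<circ> q = idm A"
      by (auto simp: isomorphism_Mod)
    note lq = lin_simps[OF hom_lin[OF q(1)]]
    note dq = hom_dom[OF q(1)] hom_cod[OF q(1)]
    have q2: "q (v (u x)) = q x - idm A x" for x
      using fun_cong[OF q(2), of x] by (simp add: lq dq algebra_simps)
    \<comment> \<open>The inverse of 1 - u v suggested by the geometric series: 1 + u (1 - v u)^(-1)
      v.\<close>
    let ?w = "idm V + (u \<circ> (q \<circ> v))"
    have w: "?w \<in> sl2_hom V V" using V f q by (intro hom_plus hom_id hom_comp[of v V A] hom_comp[of _ V A]) auto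
    have "?w \<circ> f \<circ> idm V = idm V"
    proof
      fix x
      have "f (idm V x) = idm V x - u (v x)" using fun_cong[OF f(5), of "idm V x"] by (simp add: d algebra_simps)
      then show "(?w \<circ> f \<circ> idm V) x = idm V x"
        by (simp add: lin_simps[OF lin_id_map] lu lv lq d dq q2)
    qed
    then have "splits_through As V" using thr_comp[OF f(1) hom_id[OF V] w] by simp
    then show ?thesis ..
  qed
qed

lemma krull_schmidt_biprod:
  assumes "V \<in> sl2_modules" "splits_through As V" "\<And>A. A \<in> set As \<Longrightarrow> local_endomorphisms (Mod S) A"
  shows "\<exists>Bs. set Bs \<subseteq> set As \<and> biprod Bs V"
  using assms
proof (induction As arbitrary: V)
  case Nil
  then have "idm V = 0" by (auto elim: thr.cases)
  then show ?case by (auto simp: biprod_Nil)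
next
  case (Cons A As)
  from split_off_local[OF Cons.prems(1,2) Cons.prems(3)[OF list.set_intros(1)]] show ?case
  proof (elim disjE exE conjE, goal_cases)
    case 1
    then show ?case using Cons by (metis list.set_intros subset_trans set_subset_Cons)
  next
    case (2 V' i p s r)
    obtain Bs where "set Bs \<subseteq> set As" "biprod Bs V'"
      using Cons.IH[OF 2(1,2)] Cons.prems(3) by (metis list.set_intros(2))
    then show ?case using biprod_Cons[OF _ 2(3-)] by (intro exI[of _ "A # Bs"]) auto
  qed
qed

lemma mod_iso_refl: "V \<in> sl2_modules \<Longrightarrow> mod_iso V V"
  unfolding mod_iso_def by (auto intro!: bexI[of _ "idm V"])

lemma mod_iso_sym: "mod_iso V W \<Longrightarrow> mod_iso W V"
  unfolding mod_iso_def by auto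

lemma biprod_iso:
  assumes "biprod As D" "length Bs = length As" "\<And>k. k < length As \<Longrightarrow> mod_iso (As ! k) (Bs ! k)" "mod_iso D E"
  shows "biprod Bs E"
proof -
  from assms(1) obtain \<iota> \<pi> where d: "\<And>k. k < length As \<Longrightarrow> \<iota> k \<in> sl2_hom (As ! k) D" "\<And>k. k < length As \<Longrightarrow> \<pi> k \<in> sl2_hom D (As ! k)"
    "\<And>k l. k < length As \<Longrightarrow> l < length As \<Longrightarrow> \<pi> k \<circ> \<iota> l = (if k = l then idm (As ! k) else 0)"
    "(\<Sum>k<length As. \<iota> k \<circ> \<pi> k) = idm D" unfolding biprod_def by blast
  from assms(4) obtain f g where fg: "f \<in> sl2_hom D E" "g \<in> sl2_hom E D" "g \<circ> f = idm D" "f \<circ> g = idm E"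
    by (auto simp: mod_iso_def)
  from assms(3) obtain a b where ab: "\<And>k. k < length As \<Longrightarrow> a k \<in> sl2_hom (As ! k) (Bs ! k)" "\<And>k. k < length As \<Longrightarrow> b k \<in> sl2_hom (Bs ! k) (As ! k)"
    "\<And>k. k < length As \<Longrightarrow> b k \<circ> a k = idm (As ! k)" "\<And>k. k < length As \<Longrightarrow> a k \<circ> b k = idm (Bs ! k)"
    unfolding mod_iso_def by metis
  define \<iota>' where "\<iota>' k = f \<circ> (\<iota> k \<circ> b k)" for k
  define \<pi>' where "\<pi>' k = a k \<circ> (\<pi> k \<circ> g)" for k
  have "\<iota>' k \<in> sl2_hom (Bs ! k) E \<and> \<pi>' k \<in> sl2_hom E (Bs ! k)" if "k < length Bs" for k
    unfolding \<iota>'_def \<pi>'_def using that assms(2)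
    by (auto intro!: hom_comp[OF _ fg(1)] hom_comp[OF ab(2) d(1)] hom_comp[OF _ ab(1)] hom_comp[OF fg(2) d(2)])
  moreover have "\<pi>' k \<circ> \<iota>' l = (if k = l then idm (Bs ! k) else 0)" if "k < length Bs" "l < length Bs" for k l
  proof -
    have kl: "k < length As" "l < length As" using that assms(2) by auto
    have "\<pi>' k \<circ> \<iota>' l = a k \<circ> (\<pi> k \<circ> (g \<circ> f) \<circ> \<iota> l) \<circ> b l"
      by (simp add: \<iota>'_def \<pi>'_def comp_assoc)
    also have "\<dots> = a k \<circ> (\<pi> k \<circ> \<iota> l) \<circ> b l"
      by (simp only: fg(3) hom_id_right[OF d(2)[OF kl(1)]])
    also have "\<dots> = (if k = l then idm (Bs ! k) else 0)"
    proof (cases "k = l")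
      case True
      then show ?thesis
        using d(3)[OF kl] ab(4)[OF kl(1)] hom_id_right[OF ab(1)[OF kl(1)]] by (simp only: True if_True refl)
    next
      case False
      then show ?thesis
        using d(3)[OF kl] by (simp only: comp_zero_right[OF hom_lin[OF ab(1)[OF kl(1)]]] comp_zero_left if_False)
    qed
    finally show ?thesis .
  qed
  moreover have "(\<Sum>k<length Bs. \<iota>' k \<circ> \<pi>' k) = idm E"
  proof -
    have "(\<Sum>k<length Bs. \<iota>' k \<circ> \<pi>' k) = (\<Sum>k<length As. f \<circ> (\<iota> k \<circ> \<pi> k) \<circ> g)"
    proof (rule sum.cong)
      fix k assume "k \<in> {..<length As}"
      then have k: "k < length As" by simp
      have "\<iota>' k \<circ> \<pi>' k = f \<circ> (\<iota> k \<circ> (b k \<circ> a k) \<circ> \<pi> k) \<circ> g"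
        by (simp add: \<iota>'_def \<pi>'_def comp_assoc)
      then show "\<iota>' k \<circ> \<pi>' k = f \<circ> (\<iota> k \<circ> \<pi> k) \<circ> g"
        by (simp only: ab(3)[OF k] hom_id_right[OF d(1)[OF k]])
    qed (simp add: assms(2))
    also have "\<dots> = f \<circ> (\<Sum>k<length As. \<iota> k \<circ> \<pi> k) \<circ> g"
      by (simp add: comp_sum_right[OF hom_lin[OF fg(1)]] comp_sum_left)
    finally show ?thesis by (simp only: d(4) fg(4) hom_id_right[OF fg(1)])
  qed
  ultimately show ?thesis by (rule biprodI)
qed

section \<open>Tensoring with the two-dimensional module\<close>

declare One_nat_def [simp del]

text \<open>Binary forms of degree m, the concrete model of L(m): the basis vector k is x^(m-k) y^k,
  with e = x d/dy, f = y d/dx and h = x d/dx - y d/dy. The index k - 1 has coefficient 0 at k = 0,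
  and the index k + 1 has coefficient 0 at k = m.\<close>

definition E :: "nat \<Rightarrow> sl2_module" where
  "E m = \<lparr>basis = {..m},
     act_e = linear_extension (\<lambda>k. if k \<le> m then vscale (of_nat k) (basis_vec (k - 1)) else 0),
     act_f = linear_extension (\<lambda>k. if k \<le> m then vscale (of_nat m - of_nat k) (basis_vec (Suc k)) else 0),
     act_h = linear_extension (\<lambda>k. if k \<le> m then vscale (of_nat m - 2 * of_nat k) (basis_vec k) else 0)\<rparr>"

lemmas lk = lookup_add lookup_minus lookup_uminus lookup_vscale lookup_zero

(* The simplifier collects equal summands in the ring structure of finitely supported functions. *)
lemma numeral_times_vec [simp]: "numeral w * v = vscale (numeral w) (v :: vec)"
  by (induction w) (simp_all only: numeral.simps distrib_right vec.scale_left_distrib vscale_simps mult_1)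

lemma basis_E [simp]: "basis (E m) = {..m}"
  by (simp add: E_def)

lemma act_E_basis_vec:
  "act_e (E m) (basis_vec k) = (if k \<le> m then vscale (of_nat k) (basis_vec (k - 1)) else 0)"
  "act_f (E m) (basis_vec k) = (if k \<le> m then vscale (of_nat m - of_nat k) (basis_vec (Suc k)) else 0)"
  "act_h (E m) (basis_vec k) = (if k \<le> m then vscale (of_nat m - 2 * of_nat k) (basis_vec k) else 0)"
  by (simp_all add: E_def)

lemma lin_act_E [simp]: "lin (act_e (E m))" "lin (act_f (E m))" "lin (act_h (E m))"
  by (simp_all add: E_def)

lemma E_closed [intro, simp]: "E m \<in> sl2_modules"
proof (rule sl2_modulesI)
  note s = act_E_basis_vec lin_simps[OF lin_act_E(1)] lin_simps[OF lin_act_E(2)] lin_simps[OF lin_act_E(3)]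
  have c: "act_e (E m) v \<in> vec_space {..m}" "act_f (E m) v \<in> vec_space {..m}" "act_h (E m) v \<in> vec_space {..m}" for v
  proof -
    have f: "vscale c (if k \<le> m then vscale (of_nat m - of_nat k) (basis_vec (Suc k)) else 0) \<in> vec_space {..m}" for c k
    proof (cases "Suc k \<le> m")
      case False
      then show ?thesis by (cases "k = m") auto
    qed auto
    show "act_e (E m) v \<in> vec_space {..m}" "act_f (E m) v \<in> vec_space {..m}" "act_h (E m) v \<in> vec_space {..m}"
      unfolding E_def linear_extension_def sl2_module.simps
      by (rule vec.subspace_sum[OF subspace_vec_space]; use f in auto)+
  qed
  have "act_e (E m) \<circ> id_map {..m} = act_e (E m)" "act_f (E m) \<circ> id_map {..m} = act_f (E m)"
    "act_h (E m) \<circ> id_map {..m} = act_h (E m)"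
    by (rule lin_ext; simp add: id_map_basis_vec s)+
  then have i: "act_e (E m) (id_map {..m} v) = act_e (E m) v" "act_f (E m) (id_map {..m} v) = act_f (E m) v" "act_h (E m) (id_map {..m} v) = act_h (E m) v" for v
    by (simp_all add: fun_eq_iff)
  show "act_e (E m) \<in> linear_maps (basis (E m)) (basis (E m))" "act_f (E m) \<in> linear_maps (basis (E m)) (basis (E m))"
    "act_h (E m) \<in> linear_maps (basis (E m)) (basis (E m))"
    by (auto intro!: linear_mapsI simp: c i)
  fix v
  have "act_e (E m) \<circ> act_f (E m) = (act_f (E m) \<circ> act_e (E m)) + act_h (E m)"
  proof (rule lin_ext)
    fix k
    show "(act_e (E m) \<circ> act_f (E m)) (basis_vec k) = ((act_f (E m) \<circ> act_e (E m)) + act_h (E m)) (basis_vec k)"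
    proof (cases "k < m")
      case True
      then show ?thesis
        by (cases k) (simp_all add: s, ((intro impI)?, rule vec_eqI, simp only: lk, auto simp: lookup_basis_vec algebra_simps)?)
    next
      case False
      then show ?thesis
        by (cases "k = m"; cases k) (simp_all add: s, ((intro impI)?, rule vec_eqI, simp only: lk, auto simp: lookup_basis_vec algebra_simps)?)
    qed
  qed auto
  then show "act_e (E m) (act_f (E m) v) = act_f (E m) (act_e (E m) v) + act_h (E m) v"
    by (simp add: fun_eq_iff)
  have "act_h (E m) \<circ> act_e (E m) = (act_e (E m) \<circ> act_h (E m)) + map_scale 2 (act_e (E m))"
  proof (rule lin_ext)
    fix k
    show "(act_h (E m) \<circ> act_e (E m)) (basis_vec k) = ((act_e (E m) \<circ> act_h (E m)) + map_scale 2 (act_e (E m))) (basis_vec k)"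
      by (cases k) (simp_all add: s, ((intro impI)?, rule vec_eqI, simp only: lk, auto simp: lookup_basis_vec algebra_simps)?)
  qed auto
  then show "act_h (E m) (act_e (E m) v) = act_e (E m) (act_h (E m) v) + vscale 2 (act_e (E m) v)"
    by (simp add: fun_eq_iff)
  have "act_h (E m) \<circ> act_f (E m) = (act_f (E m) \<circ> act_h (E m)) - map_scale 2 (act_f (E m))"
  proof (rule lin_ext)
    fix k
    show "(act_h (E m) \<circ> act_f (E m)) (basis_vec k) = ((act_f (E m) \<circ> act_h (E m)) - map_scale 2 (act_f (E m))) (basis_vec k)"
      by (cases "k < m"; cases "k = m") (simp_all add: s, ((intro impI)?, rule vec_eqI, simp only: lk, auto simp: lookup_basis_vec algebra_simps)?)
  qed auto
  then show "act_h (E m) (act_f (E m) v) = act_f (E m) (act_h (E m) v) - vscale 2 (act_f (E m) v)"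
    by (simp add: fun_eq_iff)
qed

abbreviation incl :: "nat \<Rightarrow> vec \<Rightarrow> vec" where
  "incl i v \<equiv> tensor_vec (basis_vec i) v"

text \<open>Coordinate with respect to the first tensor factor. Through \<open>incl 0\<close>,
  \<open>incl 1\<close>, \<open>prj 0\<close> and \<open>prj 1\<close> the space of
  \<open>F V\<close> is two copies of that of \<open>V\<close>, and operators on it are 2 by 2
  matrices of operators on \<open>V\<close>.\<close>

definition prj :: "nat \<Rightarrow> vec \<Rightarrow> vec" where
  "prj i = linear_extension (\<lambda>n. if fst (prod_decode n) = i then basis_vec (snd (prod_decode n)) else 0)"

lemma lin_prj [simp]: "lin (prj i)"
  by (simp add: prj_def)

lemma prj_tensor_vec: "prj i (tensor_vec u v) = vscale (lookup u i) v"
proof -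
  note L = lin_simps(1-3)[OF lin_prj] tensor_vec_bilinear lookup_add vec.scale_right_distrib vec.scale_left_distrib algebra_simps
  have 1: "prj i (tensor_vec (basis_vec k) (basis_vec j)) = vscale (lookup (basis_vec k) i) (basis_vec j)" for k j
    by (simp add: tensor_vec_basis_vec prj_def lookup_basis_vec)
  have "(\<lambda>u. prj i (tensor_vec u (basis_vec j))) = (\<lambda>u. vscale (lookup u i) (basis_vec j))" for j
    by (rule lin_ext) (simp_all add: 1 lin_iff L)
  then have 2: "prj i (tensor_vec u (basis_vec j)) = vscale (lookup u i) (basis_vec j)" for j
    by meson
  have "(\<lambda>v. prj i (tensor_vec u v)) = (\<lambda>v. vscale (lookup u i) v)"
    by (rule lin_ext) (simp_all add: 2 lin_iff L)
  then show ?thesis by meson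
qed

lemma prj_incl [simp]: "prj i (incl j v) = (if i = j then v else 0)"
  by (simp add: prj_tensor_vec lookup_basis_vec)

lemmas prj_simps [simp] = lin_simps(1-5)[OF lin_prj]

definition F :: "sl2_module \<Rightarrow> sl2_module" where
  "F V = tensor_module (E 1) V"

definition Fm :: "(vec \<Rightarrow> vec) \<Rightarrow> vec \<Rightarrow> vec" where
  "Fm f = tensor_map (idm (E 1)) f"

lemma F_closed [intro, simp]: "V \<in> sl2_modules \<Longrightarrow> F V \<in> sl2_modules"
  by (simp add: F_def)

lemma lin_Fm [simp]: "lin (Fm f)"
  by (simp add: Fm_def)

lemma le_1_iff: "(k::nat) \<le> 1 \<longleftrightarrow> k = 0 \<or> k = 1"
  by auto

lemma E1_expand: "idm (E 1) u = vscale (lookup u 0) (basis_vec 0) + vscale (lookup u 1) (basis_vec 1)"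
  by (rule vec_eqI) (auto simp: lookup_add lookup_basis_vec le_1_iff)

lemma E1_act:
  "act_e (E 1) u = vscale (lookup u 1) (basis_vec 0)"
  "act_f (E 1) u = vscale (lookup u 0) (basis_vec 1)"
  "act_h (E 1) u = vscale (lookup u 0) (basis_vec 0) - vscale (lookup u 1) (basis_vec 1)"
proof -
  have "act_e (E 1) = (\<lambda>u. vscale (lookup u 1) (basis_vec 0))"
    by (rule lin_ext) (auto simp: lin_lookup_scale act_E_basis_vec lookup_basis_vec le_1_iff)
  moreover have "act_f (E 1) = (\<lambda>u. vscale (lookup u 0) (basis_vec 1))"
    by (rule lin_ext) (auto simp: lin_lookup_scale act_E_basis_vec lookup_basis_vec le_1_iff One_nat_def)
  moreover have "act_h (E 1) = (\<lambda>u. vscale (lookup u 0) (basis_vec 0) - vscale (lookup u 1) (basis_vec 1))"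
    using lin_minus[OF lin_lookup_scale[of 0 "basis_vec 0"] lin_lookup_scale[of 1 "basis_vec 1"]]
    by (intro lin_ext) (auto simp: fun_diff_def act_E_basis_vec lookup_basis_vec le_1_iff)
  ultimately show "act_e (E 1) u = vscale (lookup u 1) (basis_vec 0)"
    "act_f (E 1) u = vscale (lookup u 0) (basis_vec 1)"
    "act_h (E 1) u = vscale (lookup u 0) (basis_vec 0) - vscale (lookup u 1) (basis_vec 1)"
    by simp_all
qed

lemma Fm_apply:
  assumes "lin f"
  shows "Fm f v = incl 0 (f (prj 0 v)) + incl 1 (f (prj 1 v))"
proof -
  have "Fm f = (\<lambda>v. incl 0 (f (prj 0 v)) + incl 1 (f (prj 1 v)))"
  proof (rule tensor_ext)
    show "lin (Fm f)" by simp
    show "lin (\<lambda>v. incl 0 (f (prj 0 v)) + incl 1 (f (prj 1 v)))"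
      by (simp add: lin_iff lin_simps(1,2)[OF assms] tensor_vec_bilinear vec.scale_right_distrib add_ac)
    show "Fm f (tensor_vec v w) = incl 0 (f (prj 0 (tensor_vec v w))) + incl 1 (f (prj 1 (tensor_vec v w)))" for v w
      by (simp add: assms Fm_def E1_expand prj_tensor_vec tensor_vec_bilinear lin_scale[OF assms] del: basis_E)
  qed
  then show ?thesis by simp
qed

lemma idmF_apply: "idm (F V) v = incl 0 (idm V (prj 0 v)) + incl 1 (idm V (prj 1 v))"
  using Fm_apply[of "idm V" v] by (simp add: Fm_def F_def idm_tensor)

lemma actF:
  assumes V: "V \<in> sl2_modules"
  shows "act_e (F V) v = incl 0 (act_e V (prj 0 v)) + incl 0 (idm V (prj 1 v)) + incl 1 (act_e V (prj 1 v))"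
    "act_f (F V) v = incl 0 (act_f V (prj 0 v)) + incl 1 (idm V (prj 0 v)) + incl 1 (act_f V (prj 1 v))"
    "act_h (F V) v = incl 0 (act_h V (prj 0 v)) + incl 0 (idm V (prj 0 v)) + incl 1 (act_h V (prj 1 v)) - incl 1 (idm V (prj 1 v))"
proof -
  note l = lin_sl2[OF V]
  have L: "lin (\<lambda>v. incl 0 (act_e V (prj 0 v)) + incl 0 (idm V (prj 1 v)) + incl 1 (act_e V (prj 1 v)))"
    "lin (\<lambda>v. incl 0 (act_f V (prj 0 v)) + incl 1 (idm V (prj 0 v)) + incl 1 (act_f V (prj 1 v)))"
    "lin (\<lambda>v. incl 0 (act_h V (prj 0 v)) + incl 0 (idm V (prj 0 v)) + incl 1 (act_h V (prj 1 v)) - incl 1 (idm V (prj 1 v)))"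
    by (simp add: lin_iff lin_simps(1,2)[OF l(1)] lin_simps(1,2)[OF l(2)] lin_simps(1,2)[OF l(3)] lin_simps(1,2)[OF lin_id_map]
      tensor_vec_bilinear vec.scale_right_distrib vec.scale_right_diff_distrib; intro conjI allI; rule vec_eqI; simp only: lk; simp add: algebra_simps)+
  note l = l lin_scale[OF l(1)] lin_scale[OF l(2)] lin_scale[OF l(3)] lin_scale[OF lin_id_map]
  have "act_e (F V) = (\<lambda>v. incl 0 (act_e V (prj 0 v)) + incl 0 (idm V (prj 1 v)) + incl 1 (act_e V (prj 1 v)))"
    by (rule tensor_ext; (rule L)?; simp add: l lin_act_tensor F_def act_tensor_vec V E1_expand E1_act prj_tensor_vec tensor_vec_bilinear
      vec.scale_right_distrib vec.scale_right_diff_distrib add_ac diff_add_eq add_diff_eq del: basis_E)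
  moreover have "act_f (F V) = (\<lambda>v. incl 0 (act_f V (prj 0 v)) + incl 1 (idm V (prj 0 v)) + incl 1 (act_f V (prj 1 v)))"
    by (rule tensor_ext; (rule L)?; simp add: l lin_act_tensor F_def act_tensor_vec V E1_expand E1_act prj_tensor_vec tensor_vec_bilinear
      vec.scale_right_distrib vec.scale_right_diff_distrib add_ac diff_add_eq add_diff_eq del: basis_E)
  moreover have "act_h (F V) = (\<lambda>v. incl 0 (act_h V (prj 0 v)) + incl 0 (idm V (prj 0 v)) + incl 1 (act_h V (prj 1 v)) - incl 1 (idm V (prj 1 v)))"
    by (rule tensor_ext; (rule L)?; simp add: l lin_act_tensor F_def act_tensor_vec V E1_expand E1_act prj_tensor_vec tensor_vec_bilinear
      vec.scale_right_distrib vec.scale_right_diff_distrib add_ac diff_add_eq add_diff_eq del: basis_E)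
  ultimately show "act_e (F V) v = incl 0 (act_e V (prj 0 v)) + incl 0 (idm V (prj 1 v)) + incl 1 (act_e V (prj 1 v))"
    "act_f (F V) v = incl 0 (act_f V (prj 0 v)) + incl 1 (idm V (prj 0 v)) + incl 1 (act_f V (prj 1 v))"
    "act_h (F V) v = incl 0 (act_h V (prj 0 v)) + incl 0 (idm V (prj 0 v)) + incl 1 (act_h V (prj 1 v)) - incl 1 (idm V (prj 1 v))"
    by simp_all
qed

lemma Fm_hom: "f \<in> sl2_hom V W \<Longrightarrow> V \<in> sl2_modules \<Longrightarrow> W \<in> sl2_modules \<Longrightarrow> Fm f \<in> sl2_hom (F V) (F W)"
  unfolding Fm_def F_def by (intro tensor_map_hom hom_id) auto

lemma Fm_simps:
  "lin f \<Longrightarrow> lin g \<Longrightarrow> Fm (f \<circ> g) = Fm f \<circ> Fm g"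
  "lin f \<Longrightarrow> lin g \<Longrightarrow> Fm (f + g) = Fm f + Fm g"
  "lin f \<Longrightarrow> Fm (map_scale c f) = map_scale c (Fm f)"
  "Fm (idm V) = idm (F V)"
  "Fm 0 = 0"
  by (auto simp: fun_eq_iff Fm_apply tensor_vec_bilinear idmF_apply vec.scale_right_distrib)

section \<open>The Casimir operator, its mixed part on \<open>F V\<close> and the self-adjunction of
  \<open>F\<close>\<close>

definition cas :: "sl2_module \<Rightarrow> vec \<Rightarrow> vec" where
  "cas V v = act_h V (act_h V v) + vscale 2 (act_h V v) + idm V v + vscale 4 (act_f V (act_e V v))"

text \<open>With \<open>idm V v\<close> in place of \<open>v\<close>, \<open>cas\<close> factors
  through the projection onto \<open>space V\<close>, as a morphism must.\<close>

lemma cas_casimir: "v \<in> space V \<Longrightarrow> cas V v = casimir V v"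
  by (simp add: cas_def casimir_def)

text \<open>The matrix with rows (h + 1, 2 f) and (2 e, 1 - h), that is 1 + h \<otimes> h + 2 e
  \<otimes> f + 2 f \<otimes> e. Up to normalisation it is the mixed part of the Casimir element
  under the coproduct; the summand 1 makes its square the Casimir operator of
  \<open>V\<close>.\<close>

definition am :: "sl2_module \<Rightarrow> vec \<Rightarrow> vec" where
  "am V v = incl 0 (act_h V (prj 0 v)) + incl 0 (idm V (prj 0 v)) + vscale 2 (incl 0 (act_f V (prj 1 v)))
    + vscale 2 (incl 1 (act_e V (prj 0 v))) + incl 1 (idm V (prj 1 v)) - incl 1 (act_h V (prj 1 v))"

text \<open>Insertion of the antisymmetric invariant of L(1) \<otimes> L(1); \<open>ev\<close> is
  contraction with the antisymmetric form. They are unit and counit of the self-adjunction of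
  \<open>F\<close>, up to the sign in \<open>zigzag\<close>.\<close>

definition coev :: "sl2_module \<Rightarrow> vec \<Rightarrow> vec" where
  "coev V v = incl 0 (incl 1 (idm V v)) - incl 1 (incl 0 (idm V v))"

definition ev :: "sl2_module \<Rightarrow> vec \<Rightarrow> vec" where
  "ev V v = idm V (prj 1 (prj 0 v)) - idm V (prj 0 (prj 1 v))"

lemma lin_Fstuff:
  "V \<in> sl2_modules \<Longrightarrow> lin (cas V)" "V \<in> sl2_modules \<Longrightarrow> lin (am V)" "lin (coev V)" "lin (ev V)"
  by (simp add: lin_iff cas_def am_def coev_def ev_def lin_simps(1,2)[OF lin_act_e] lin_simps(1,2)[OF lin_act_f]
    lin_simps(1,2)[OF lin_act_h] lin_simps(1,2)[OF lin_id_map]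
    tensor_vec_bilinear vec.scale_right_distrib vec.scale_right_diff_distrib; intro conjI allI; rule vec_eqI; simp only: lk; simp add: algebra_simps)+

lemma cas_hom [simp]:
  assumes V: "V \<in> sl2_modules"
  shows "cas V \<in> sl2_hom V V"
proof -
  note l = lin_simps(1-5)[OF lin_act_e[OF V]] lin_simps(1-5)[OF lin_act_f[OF V]] lin_simps(1-5)[OF lin_act_h[OF V]] lin_simps(1-5)[OF lin_id_map]
  show ?thesis
    by (intro sl2_homI linear_mapsI V lin_Fstuff; (simp add: cas_def l sl2_absorb[OF V] V)?;
      (simp add: sl2_rels[OF V] l vec.scale_right_distrib vec.scale_right_diff_distrib)?; (rule vec_eqI, simp only: lk, simp add: algebra_simps)?)
qed

lemma hom_cas:
  assumes g: "g \<in> sl2_hom V W"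
  shows "g (cas V v) = cas W (g v)"
  unfolding cas_def by (simp add: lin_simps(1-5)[OF hom_lin[OF g]] sl2_homD(2,3)[OF g] flip: sl2_homD(5-7)[OF g])

context
  fixes V assumes V: "V \<in> sl2_modules"
begin

private lemmas lin_V = lin_simps(1-5)[OF lin_act_e[OF V]] lin_simps(1-5)[OF lin_act_f[OF V]] lin_simps(1-5)[OF lin_act_h[OF V]]
  lin_simps(1-5)[OF lin_id_map] tensor_vec_bilinear vec.scale_right_distrib vec.scale_right_diff_distrib

private lemmas rel_V = sl2_rels[OF V] sl2_absorb[OF V]

lemma am_hom: "am V \<in> sl2_hom (F V) (F V)"
  by (intro sl2_homI' lin_Fstuff V; simp add: fun_eq_iff; intro allI; simp add: actF V am_def idmF_apply lin_V rel_V;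
     (rule vec_eqI, simp only: lk, simp add: algebra_simps)?)

lemma coev_hom: "coev V \<in> sl2_hom V (F (F V))"
  by (intro sl2_homI' lin_Fstuff V; simp add: fun_eq_iff; intro allI; simp add: actF V coev_def idmF_apply lin_V rel_V;
     (rule vec_eqI, simp only: lk, simp add: algebra_simps)?)

lemma ev_hom: "ev V \<in> sl2_hom (F (F V)) V"
  by (intro sl2_homI' lin_Fstuff V; simp add: fun_eq_iff; intro allI; simp add: actF V ev_def idmF_apply lin_V rel_V;
     (rule vec_eqI, simp only: lk, simp add: algebra_simps)?)

text \<open>The entries of the squared matrix collapse by the commutation relations. This is to be
  expected: for a generic Casimir eigenvalue r^2 on \<open>V\<close>, the eigenvalues on
  \<open>F V\<close> are (r + 1)^2 and (r - 1)^2, and \<open>cas_F\<close> says that they are r^2 +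
  1 + 2 \<open>am\<close>.\<close>

lemma am_am: "am V (am V v) = Fm (cas V) v"
  by (simp add: am_def Fm_apply lin_Fstuff V cas_def lin_V rel_V; (rule vec_eqI, simp only: lk, simp add: algebra_simps)?)

lemma cas_F: "cas (F V) v = Fm (cas V) v + idm (F V) v + vscale 2 (am V v)"
  by (simp add: am_def Fm_apply lin_Fstuff V cas_def actF idmF_apply lin_V rel_V; (rule vec_eqI, simp only: lk, simp add: algebra_simps)?)

lemma ev_coev: "ev V (coev V v) = vscale 2 (idm V v)"
  by (simp add: ev_def coev_def lin_V; (rule vec_eqI, simp)?)

text \<open>Between \<open>coev\<close> and \<open>ev\<close> an operator on \<open>F V\<close>
  yields the sum of its diagonal entries. Here this is (h + 1) + (1 - h) = 2, the same as for the
  identity.\<close>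

lemma ev_am_coev: "ev V (Fm (am V) (coev V v)) = vscale 2 (idm V v)"
  by (simp add: ev_def coev_def lin_V Fm_apply lin_Fstuff V am_def rel_V; (rule vec_eqI, simp only: lk, simp add: algebra_simps)?)

lemma zigzag: "ev (F V) (Fm (coev V) v) = - idm (F V) v" "Fm (ev V) (coev (F V) v) = - idm (F V) v"
  by (simp_all add: ev_def coev_def lin_V Fm_apply lin_Fstuff V idmF_apply)

text \<open>Let P = \<open>coev\<close> \<open>ev\<close> and A = \<open>Fm (am V)\<close>. The swap
  of the two copies of L(1) is 1 - P. The mixed Casimir part for three factors is a sum over pairs:
  the pair of the two copies gives 2 (1 - P) - 1, and the outer copy with V gives the swap conjugate
  of A - 1. Expanding with P A P = 2 P leaves 1 + A - P A - A P.\<close>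

lemma am_F: "am (F V) v = Fm (am V) v + idm (F (F V)) v - coev V (ev V (Fm (am V) v)) - Fm (am V) (coev V (ev V v))"
  by (simp add: am_def coev_def ev_def Fm_apply lin_Fstuff V actF idmF_apply lin_V rel_V; (rule vec_eqI, simp only: lk, simp add: algebra_simps)?)

end

lemma nat_F:
  assumes V: "V \<in> sl2_modules" "W \<in> sl2_modules" and g: "g \<in> sl2_hom V W"
  shows am_nat: "am W (Fm g v) = Fm g (am V v)"
    and coev_nat: "coev W (g w) = Fm (Fm g) (coev V w)"
    and ev_nat: "ev W (Fm (Fm g) v) = g (ev V v)"
proof -
  note gg = lin_simps(1-5)[OF hom_lin[OF g]] hom_lin[OF g] sl2_homD(2,3,5,6,7)[OF g]
  note lin_V = lin_simps(1-5)[OF lin_id_map] tensor_vec_bilinear vec.scale_right_distrib vec.scale_right_diff_distrib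
  show "am W (Fm g v) = Fm g (am V v)"
    by (simp add: am_def Fm_apply gg lin_V)
  show "coev W (g w) = Fm (Fm g) (coev V w)"
    by (simp add: coev_def Fm_apply gg lin_V)
  show "ev W (Fm (Fm g) v) = g (ev V v)"
    by (simp add: ev_def Fm_apply gg lin_V)
qed

section \<open>The ladder of modules generated by a module with Casimir zero\<close>

text \<open>
  \<open>stage i X d\<close> says that the Casimir operator acts on \<open>X\<close> as \<open>(i + d)\<^sup>2\<close> with \<open>d\<^sup>2 = 0\<close>. On \<open>F X\<close> the
  operator \<open>am X\<close> is then a square root of \<open>(i + Fm d)\<^sup>2\<close>, and \<open>pp i X d\<close> projects onto the part
  where it equals \<open>i + Fm d\<close>, that is, \<open>pp = (1 + am / (i + Fm d)) / 2\<close>.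
\<close>

definition stage :: "nat \<Rightarrow> sl2_module \<Rightarrow> (vec \<Rightarrow> vec) \<Rightarrow> bool" where
  "stage i X d \<longleftrightarrow> X \<in> sl2_modules \<and> d \<in> sl2_hom X X \<and> (\<forall>v. d (d v) = 0) \<and>
     (\<forall>v. cas X v = vscale (of_nat i * of_nat i) (idm X v) + vscale (2 * of_nat i) (d v))"

definition pp :: "nat \<Rightarrow> sl2_module \<Rightarrow> (vec \<Rightarrow> vec) \<Rightarrow> vec \<Rightarrow> vec" where
  "pp i X d v = vscale (1 / 2) (idm (F X) v) + vscale (1 / (2 * of_nat i)) (am X v)
     - vscale (1 / (2 * of_nat i * of_nat i)) (am X (Fm d v))"

text \<open>One rung of the ladder: \<open>W\<close> is an object for the image of
  \<open>pp i X d\<close>, with \<open>s\<close> and \<open>r\<close> as inclusion and projection,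
  and \<open>d'\<close> is the restriction of \<open>Fm d\<close> to it.\<close>

definition link :: "nat \<Rightarrow> sl2_module \<Rightarrow> (vec \<Rightarrow> vec) \<Rightarrow> sl2_module \<Rightarrow> (vec \<Rightarrow> vec) \<Rightarrow> (vec \<Rightarrow> vec) \<Rightarrow> (vec \<Rightarrow> vec) \<Rightarrow> bool" where
  "link i X d W d' r s \<longleftrightarrow> W \<in> sl2_modules \<and> r \<in> sl2_hom (F X) W \<and> s \<in> sl2_hom W (F X) \<and>
     (\<forall>w. r (s w) = idm W w) \<and> (\<forall>v. s (r v) = pp i X d v) \<and> d' = (\<lambda>w. r (Fm d (s w)))"

definition scalar_end :: "sl2_module \<Rightarrow> (vec \<Rightarrow> vec) \<Rightarrow> bool" where
  "scalar_end X d \<longleftrightarrow> (\<forall>g\<in>sl2_hom X X. \<exists>\<alpha> \<beta>. \<forall>v. g v = vscale \<alpha> (idm X v) + vscale \<beta> (d v))"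

lemma Fm_comp_apply: "lin f \<Longrightarrow> lin g \<Longrightarrow> Fm f (Fm g v) = Fm (\<lambda>v. f (g v)) v"
  using Fm_simps(1)[of f g] by (simp add: fun_eq_iff o_def)

lemma Fm_zero_apply: "Fm (\<lambda>v. 0) v = 0"
  by (simp add: Fm_apply[OF lin_zero_map[unfolded zero_fun_def]] tensor_vec_bilinear)

text \<open>\<open>Fm g \<circ> coev X\<close> is the transpose of \<open>g\<close> under the
  self-adjunction, and \<open>zigzag\<close> recovers \<open>g\<close> from it up to sign.\<close>

lemma zigzag_transpose:
  assumes X: "X \<in> sl2_modules" "Y \<in> sl2_modules" and g: "g \<in> sl2_hom (F X) Y" and z: "\<And>v. Fm g (coev X v) = 0"
  shows "g v = 0"
proof -
  have "g (idm (F X) v) = - g (ev (F X) (Fm (coev X) v))"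
    by (simp add: zigzag[OF X(1)] lin_uminus[OF hom_lin[OF g]])
  also have "g (ev (F X) (Fm (coev X) v)) = ev Y (Fm (Fm g) (Fm (coev X) v))"
    using ev_nat[OF _ X(2) g] X by simp
  also have "\<dots> = ev Y (Fm (\<lambda>v. Fm g (coev X v)) v)"
    by (simp add: Fm_comp_apply lin_Fstuff)
  also have "\<dots> = 0"
    by (simp add: z Fm_zero_apply lin_zero[OF lin_Fstuff(4)])
  finally show ?thesis by (simp add: hom_dom[OF g])
qed

lemma biprod_single: "W \<in> sl2_modules \<Longrightarrow> biprod [W] W"
  by (rule biprodI[where \<iota> = "\<lambda>_. idm W" and \<pi> = "\<lambda>_. idm W"]) (auto simp: fun_eq_iff)

text \<open>The Casimir operator commutes with \<open>g\<close> and has the single generalised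
  eigenvalue i^2 on the source and j^2 on the target.\<close>

lemma stage_hom_zero:
  assumes X: "stage i X d" and Y: "stage j Y d'" and ij: "i \<noteq> j" and g: "g \<in> sl2_hom X Y"
  shows "g v = 0"
proof -
  have d: "d (d v) = 0" "d' (d' v) = 0" for v
    using X Y by (auto simp: stage_def)
  have dh: "d \<in> sl2_hom X X" "d' \<in> sl2_hom Y Y"
    using X Y by (auto simp: stage_def)
  note l = lin_simps(1-5)[OF hom_lin[OF g]] lin_simps(1-5)[OF hom_lin[OF dh(1)]] lin_simps(1-5)[OF hom_lin[OF dh(2)]]
    sl2_homD(2,3)[OF g] sl2_homD(2,3)[OF dh(1)] sl2_homD(2,3)[OF dh(2)]
  let ?i = "of_nat i :: complex" and ?j = "of_nat j :: complex"
  have neq: "?j * ?j \<noteq> ?i * ?i"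
    using ij by (metis of_nat_eq_iff of_nat_mult mult_eq_self_implies_10 power2_eq_iff_nonneg power2_eq_square zero_le)
  have cancel: "w = 0" if "vscale (?j * ?j) w = vscale (?i * ?i) w" for w
    using that neq vec.scale_left_diff_distrib[of "?j * ?j" "?i * ?i" w] vec.scale_eq_0_iff by fastforce
  have main: "vscale (?j * ?j) (g v) + vscale (2 * ?j) (d' (g v)) = vscale (?i * ?i) (g v) + vscale (2 * ?i) (g (d v))" for v
  proof -
    have "cas Y (g v) = g (cas X v)" by (simp add: hom_cas[OF g])
    then show ?thesis using X Y by (simp add: stage_def l)
  qed
  \<comment> \<open>Composing \<open>main\<close> with the nilpotents on both sides, then on one
    side only, removes the error terms one after the other.\<close>
  have C: "d' (g (d v)) = 0" for v
  proof (rule cancel)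
    show "vscale (?j * ?j) (d' (g (d v))) = vscale (?i * ?i) (d' (g (d v)))"
      using arg_cong[OF main[of "d v"], of d'] by (simp add: l d)
  qed
  have A: "g (d v) = 0" for v
    by (rule cancel) (use main[of "d v"] in \<open>simp add: l d C\<close>)
  have B: "d' (g v) = 0" for v
    by (rule cancel) (use arg_cong[OF main[of v], of d'] in \<open>simp add: l d A C\<close>)
  show ?thesis
    by (rule cancel) (use main[of v] in \<open>simp add: A B\<close>)
qed

context
  fixes i X d
  assumes st: "stage i X d" and i: "i \<ge> 1"
begin

private lemma X: "X \<in> sl2_modules" and dh: "d \<in> sl2_hom X X" and dd: "d (d v) = 0"
  and casX: "cas X v = vscale (of_nat i * of_nat i) (idm X v) + vscale (2 * of_nat i) (d v)"
  using st by (auto simp: stage_def)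

private lemmas Dh = Fm_hom[OF dh X X]

private lemma i0: "of_nat i \<noteq> (0 :: complex)"
  using i by simp

private lemma aa: "am X (am X v) = vscale (of_nat i * of_nat i) (idm (F X) v) + vscale (2 * of_nat i) (Fm d v)"
proof -
  have "cas X = map_scale (of_nat i * of_nat i) (idm X) + map_scale (2 * of_nat i) d"
    by (simp add: fun_eq_iff casX)
  then show ?thesis
    by (simp add: am_am[OF X] Fm_simps hom_lin[OF dh])
qed

private lemma Fcas: "Fm (cas X) v = vscale (of_nat i * of_nat i) (idm (F X) v) + vscale (2 * of_nat i) (Fm d v)"
  using aa[of v] by (simp add: am_am[OF X])

private lemma DD: "Fm d (Fm d v) = 0"
  by (simp add: Fm_comp_apply hom_lin[OF dh] dd Fm_zero_apply)

private lemmas Da = am_nat[OF X X dh, symmetric]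

private lemmas ab = sl2_homD(2,3)[OF am_hom[OF X]] sl2_homD(2,3)[OF Dh] sl2_homD(2,3)[OF dh] id_map_idem
private lemmas l = lin_simps(1-5)[OF hom_lin[OF am_hom[OF X]]] lin_simps(1-5)[OF hom_lin[OF Dh]] lin_simps(1-5)[OF hom_lin[OF dh]]
  lin_simps(1-5)[OF lin_id_map] vec.scale_right_distrib vec.scale_right_diff_distrib

lemma pp_hom: "pp i X d \<in> sl2_hom (F X) (F X)"
proof -
  have "map_scale (1 / 2) (idm (F X)) + map_scale (1 / (2 * of_nat i)) (am X)
      - map_scale (1 / (2 * of_nat i * of_nat i)) (am X \<circ> Fm d) \<in> sl2_hom (F X) (F X)"
    by (intro hom_minus hom_plus hom_scale hom_id hom_comp[OF Dh] am_hom X F_closed)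
  also have "\<dots> = {pp i X d}" if "sl2_hom (F X) (F X) = {pp i X d}"
    using that .
  moreover have "map_scale (1 / 2) (idm (F X)) + map_scale (1 / (2 * of_nat i)) (am X)
      - map_scale (1 / (2 * of_nat i * of_nat i)) (am X \<circ> Fm d) = pp i X d"
    by (simp add: fun_eq_iff pp_def)
  ultimately show ?thesis by metis
qed

private lemma ipos: "0 < i" "i \<noteq> 0"
  using i by auto

lemma pp_idem: "pp i X d (pp i X d v) = pp i X d v"
  by (simp add: pp_def l ab aa DD Da ipos; (rule vec_eqI; simp only: lk; use i0 in \<open>simp add: field_simps\<close>)?)

lemma am_pp: "am X (pp i X d v) = vscale (of_nat i) (pp i X d v) + Fm d (pp i X d v)"
  by (simp add: pp_def l ab aa DD Da ipos; (rule vec_eqI; simp only: lk; use i0 in \<open>simp add: field_simps\<close>)?)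

lemma D_pp: "Fm d (pp i X d v) = pp i X d (Fm d v)"
  by (simp add: pp_def l ab aa DD Da)

lemma link_exists: "\<exists>W d' r s. link i X d W d' r s"
proof -
  have "pp i X d \<circ> pp i X d = pp i X d" by (simp add: fun_eq_iff pp_idem)
  from idempotent_splits[OF F_closed[OF X] pp_hom this] obtain W r s where
    "W \<in> sl2_modules" "r \<in> sl2_hom (F X) W" "s \<in> sl2_hom W (F X)" "r \<circ> s = idm W" "s \<circ> r = pp i X d" by metis
  then have "link i X d W (\<lambda>w. r (Fm d (s w))) r s"
    by (simp add: link_def fun_eq_iff)
  then show ?thesis by blast
qed

context
  fixes W d' r s
  assumes lk1: "link i X d W d' r s"
begin

private lemma W: "W \<in> sl2_modules" and rh: "r \<in> sl2_hom (F X) W" and sh: "s \<in> sl2_hom W (F X)"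
  and rs: "r (s w) = idm W w" and sr: "s (r v) = pp i X d v" and d': "d' w = r (Fm d (s w))"
  using lk1 by (auto simp: link_def)

private lemma d'_eq: "d' = r \<circ> (Fm d \<circ> s)"
  by (simp add: fun_eq_iff d')

private lemma d'h: "d' \<in> sl2_hom W W"
  unfolding d'_eq by (intro hom_comp[OF _ rh] hom_comp[OF sh Dh])

private lemma pps: "pp i X d (s w) = s w"
  by (simp add: sr[symmetric] rs hom_dom[OF sh])

private lemma rpp: "r (pp i X d v) = r v"
  by (simp add: sr[symmetric] rs hom_cod[OF rh])

private lemma sd: "s (d' w) = Fm d (s w)"
  by (simp add: d' sr flip: D_pp) (simp add: pps)

private lemma rD: "r (Fm d v) = d' (r v)"
  by (simp add: d' sr D_pp rpp)

private lemma as: "am X (s w) = vscale (of_nat i) (s w) + s (d' w)"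
  using am_pp[of "s w"] by (simp add: pps sd)

private lemma ra: "r (am X v) = vscale (of_nat i) (r v) + d' (r v)"
proof -
  have "pp i X d (am X v) = am X (pp i X d v)"
    by (simp add: pp_def l ab aa DD Da; rule vec_eqI; simp only: lk; use i0 in \<open>simp add: field_simps\<close>)
  then have "r (am X v) = r (am X (pp i X d v))" by (metis rpp)
  then show ?thesis
    by (simp add: am_pp lin_simps[OF hom_lin[OF rh]] rpp rD)
qed

private lemma dd': "d' (d' w) = 0"
  by (simp add: d' sr D_pp[symmetric] pps DD lin_zero[OF hom_lin[OF rh]])

text \<open>On the image of \<open>pp\<close> the operator \<open>am\<close> is i + d, so the
  formula for the Casimir operator of \<open>F X\<close> gives (i + d)^2 + 1 + 2 (i + d) = (i + 1 +
  d)^2.\<close>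

lemma link_stage: "stage (Suc i) W d'"
proof -
  note ls = lin_simps(1-5)[OF hom_lin[OF sh]] lin_simps(1-5)[OF hom_lin[OF rh]]
  have "cas W w = vscale (of_nat (Suc i) * of_nat (Suc i)) (idm W w) + vscale (2 * of_nat (Suc i)) (d' w)" for w
  proof -
    have "cas W w = r (s (cas W w))" by (simp add: rs hom_cod[OF cas_hom[OF W]])
    also have "s (cas W w) = cas (F X) (s w)" by (rule hom_cas[OF sh])
    also have "\<dots> = vscale (of_nat i * of_nat i) (s w) + vscale (2 * of_nat i) (s (d' w)) + s w
        + vscale 2 (vscale (of_nat i) (s w) + s (d' w))"
      by (simp add: cas_F[OF X] Fcas hom_cod[OF sh] as sd)
    also have "r \<dots> = vscale (of_nat (Suc i) * of_nat (Suc i)) (idm W w) + vscale (2 * of_nat (Suc i)) (d' w)"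
      by (simp add: ls rs hom_cod[OF d'h] vec.scale_right_distrib; rule vec_eqI; simp only: lk; simp add: algebra_simps)
    finally show ?thesis .
  qed
  then show ?thesis by (simp add: stage_def W d'h dd')
qed

text \<open>The transpose of the projection \<open>r\<close>; it will embed \<open>X\<close> into
  \<open>F W\<close>.\<close>

definition uu :: "vec \<Rightarrow> vec" where "uu x = Fm r (coev X x)"

text \<open>The transpose of the inclusion \<open>s\<close>, corrected by (i + d) / (i + 1 + d) = i
  / (i + 1) + d / (i + 1)^2, where d^2 = 0. The correction inverts the partial trace 1 + 1 / (i + d)
  of \<open>pp i X d\<close>, so that \<open>vv \<circ> uu\<close> becomes the identity.\<close>

definition vv :: "vec \<Rightarrow> vec" where
  "vv w = vscale (of_nat i / (of_nat i + 1)) (ev X (Fm s w)) +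
     vscale (1 / ((of_nat i + 1) * (of_nat i + 1))) (ev X (Fm s (Fm d' w)))"

private lemmas Frh = Fm_hom[OF rh F_closed[OF X] W]
private lemmas Fsh = Fm_hom[OF sh W F_closed[OF X]]
private lemmas Fd'h = Fm_hom[OF d'h W W]
private lemmas FDh = Fm_hom[OF Dh F_closed[OF X] F_closed[OF X]]
private lemmas Fah = Fm_hom[OF am_hom[OF X] F_closed[OF X] F_closed[OF X]]

private lemmas L = lin_simps(1-5)[OF hom_lin[OF Frh]] lin_simps(1-5)[OF hom_lin[OF Fsh]]
  lin_simps(1-5)[OF hom_lin[OF Fd'h]] lin_simps(1-5)[OF hom_lin[OF FDh]] lin_simps(1-5)[OF lin_Fstuff(3)] lin_simps(1-5)[OF lin_Fstuff(4)]
  lin_simps(1-5)[OF hom_lin[OF Fah]]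
  lin_simps(1-5)[OF hom_lin[OF rh]] lin_simps(1-5)[OF hom_lin[OF sh]] lin_simps(1-5)[OF hom_lin[OF d'h]]

private lemmas AB = sl2_homD(2,3)[OF Frh] sl2_homD(2,3)[OF Fsh] sl2_homD(2,3)[OF Fd'h] sl2_homD(2,3)[OF FDh]
  sl2_homD(2,3)[OF Fah] sl2_homD(2,3)[OF coev_hom[OF X]] sl2_homD(2,3)[OF ev_hom[OF X]]

lemma uu_hom: "uu \<in> sl2_hom X (F W)"
proof -
  have "uu = Fm r \<circ> coev X" by (simp add: fun_eq_iff uu_def)
  then show ?thesis using hom_comp[OF coev_hom[OF X] Frh] by simp
qed

lemma vv_hom: "vv \<in> sl2_hom (F W) X"
proof -
  have "vv = map_scale (of_nat i / (of_nat i + 1)) (ev X \<circ> Fm s) +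
     map_scale (1 / ((of_nat i + 1) * (of_nat i + 1))) (ev X \<circ> (Fm s \<circ> Fm d'))"
    by (simp add: fun_eq_iff vv_def)
  then show ?thesis
    using hom_plus[OF X hom_scale[OF X hom_comp[OF Fsh ev_hom[OF X]]] hom_scale[OF X hom_comp[OF hom_comp[OF Fd'h Fsh] ev_hom[OF X]]]]
    by simp
qed

private lemma Fsr: "Fm s (Fm r v) = Fm (pp i X d) v"
  by (simp add: Fm_comp_apply hom_lin[OF sh] hom_lin[OF rh] sr)

private lemma Frs: "Fm r (Fm s v) = idm (F W) v"
  by (simp add: Fm_comp_apply hom_lin[OF sh] hom_lin[OF rh] rs Fm_simps(4)[symmetric])

private lemma Fsd: "Fm s (Fm d' v) = Fm (Fm d) (Fm s v)"
  by (simp add: Fm_comp_apply hom_lin[OF sh] hom_lin[OF d'h] sd)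

private lemma FrD: "Fm r (Fm (Fm d) v) = Fm d' (Fm r v)"
  by (simp add: Fm_comp_apply hom_lin[OF rh] hom_lin[OF d'h] rD)

private lemma FaFs: "Fm (am X) (Fm s v) = vscale (of_nat i) (Fm s v) + Fm s (Fm d' v)"
proof -
  have "am X \<circ> s = map_scale (of_nat i) s + (s \<circ> d')"
    by (simp add: fun_eq_iff as)
  then have "Fm (am X \<circ> s) v = Fm (map_scale (of_nat i) s + (s \<circ> d')) v" by simp
  then show ?thesis
    by (simp add: Fm_simps lin_Fstuff X hom_lin[OF sh] hom_lin[OF d'h])
qed

private lemma FrFa: "Fm r (Fm (am X) v) = vscale (of_nat i) (Fm r v) + Fm d' (Fm r v)"
proof -
  have "r \<circ> am X = map_scale (of_nat i) r + (d' \<circ> r)"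
    by (simp add: fun_eq_iff ra)
  then have "Fm (r \<circ> am X) v = Fm (map_scale (of_nat i) r + (d' \<circ> r)) v" by simp
  then show ?thesis
    by (simp add: Fm_simps lin_Fstuff X hom_lin[OF rh] hom_lin[OF d'h])
qed

private lemma Fpp: "Fm (pp i X d) v = vscale (1 / 2) (idm (F (F X)) v) + vscale (1 / (2 * of_nat i)) (Fm (am X) v)
     - vscale (1 / (2 * of_nat i * of_nat i)) (Fm (am X) (Fm (Fm d) v))"
proof -
  have "pp i X d = map_scale (1 / 2) (idm (F X)) + map_scale (1 / (2 * of_nat i)) (am X)
      + map_scale (- 1 / (2 * of_nat i * of_nat i)) (am X \<circ> Fm d)"
    by (simp add: fun_eq_iff pp_def)
  then show ?thesis
    by (simp add: Fm_simps lin_Fstuff X)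
qed

private lemma FDD: "Fm (Fm d) (Fm (Fm d) v) = 0"
  by (simp add: Fm_comp_apply DD Fm_zero_apply)

private lemma FDa: "Fm (Fm d) (Fm (am X) v) = Fm (am X) (Fm (Fm d) v)"
  by (simp add: Fm_comp_apply lin_Fstuff X Da)

private lemmas coD = coev_nat[OF X X dh, symmetric]
private lemmas evD = ev_nat[OF X X dh]

lemma vv_uu: "vv (uu x) = idm X x"
proof -
  let ?q = "of_nat i :: complex"
  have q: "?q + 1 \<noteq> 0" using of_nat_neq_0[of i, where 'a = complex] by (simp add: add.commute)
  have 1: "?q / (?q + 1) + 1 / (?q + 1) = 1" using q by (simp add: field_simps)
  have 2: "1 / ((?q + 1) * (?q + 1)) + 1 / ((?q + 1) * (?q + 1) * ?q) - 1 / ((?q + 1) * ?q) = 0"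
    using q i0 by (simp add: divide_simps)
  have "vv (uu x) = vscale (?q / (?q + 1) + 1 / (?q + 1)) (idm X x)
      + vscale (1 / ((?q + 1) * (?q + 1)) + 1 / ((?q + 1) * (?q + 1) * ?q) - 1 / ((?q + 1) * ?q)) (d x)"
    by (simp add: vv_def uu_def Fsd Fsr Fpp L AB FDD FDa coD evD ev_coev[OF X] ev_am_coev[OF X] l ab dd ipos;
       rule vec_eqI; simp only: lk; simp add: algebra_simps)
  then show ?thesis by (simp only: 1 2 vscale_simps add_0_right)
qed

text \<open>With \<tau> the composite of the two uncorrected transposes, \<open>am_F\<close> cut
  down to \<open>W\<close> reads am = (i + 1 + d') - 2 (i + d') \<tau>. Inserted into (1 + am / (i +
  1 + d')) / 2 this gives 1 - (i + d') / (i + 1 + d') \<tau>, which is 1 -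
  \<open>uu \<circ> vv\<close>.\<close>

lemma uu_vv: "uu (vv w) = idm (F W) w - pp (Suc i) W d' w"
proof -
  define \<tau> where "\<tau> w = Fm r (coev X (ev X (Fm s w)))" for w
  have \<tau>: "Fm r (coev X (ev X (Fm s w))) = \<tau> w" for w by (simp add: \<tau>_def)
  have \<tau>D: "\<tau> (Fm d' w) = Fm d' (\<tau> w)" for w
    by (simp add: \<tau>_def Fsd evD FrD[symmetric] coD)
  have am: "am W w = vscale (of_nat i + 1) w + Fm d' w - vscale (2 * of_nat i) (\<tau> w) - vscale 2 (Fm d' (\<tau> w))" if "idm (F W) w = w" for w
  proof -
    have "am W w = Fm r (Fm s (am W w))" by (simp add: Frs hom_cod[OF am_hom[OF W]])
    also have "Fm s (am W w) = am (F X) (Fm s w)" by (rule am_nat[OF W F_closed[OF X] sh, symmetric])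
    also have "Fm r \<dots> = vscale (of_nat i + 1) w + Fm d' w - vscale (2 * of_nat i) (\<tau> w) - vscale 2 (Fm d' (\<tau> w))"
      by (simp add: am_F[OF X] FaFs L Frs FrFa AB that \<tau> \<tau>D; rule vec_eqI; simp only: lk; simp add: algebra_simps)
    finally show ?thesis .
  qed
  have dd2: "Fm d' (Fm d' w) = 0" for w
    by (simp add: Fm_comp_apply hom_lin[OF d'h] dd' Fm_zero_apply)
  have u: "uu (vv w) = vscale (of_nat i / (of_nat i + 1)) (\<tau> w) + vscale (1 / ((of_nat i + 1) * (of_nat i + 1))) (Fm d' (\<tau> w))" for w
    by (simp add: uu_def vv_def L \<tau> \<tau>D)
  have p: "pp (Suc i) W d' w = vscale (1 / 2) w + vscale (1 / (2 * (of_nat i + 1))) (am W w)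
     - vscale (1 / (2 * (of_nat i + 1) * (of_nat i + 1))) (am W (Fm d' w))" if "idm (F W) w = w" for w
    by (simp add: pp_def that add.commute)
  have main: "uu (vv w) = idm (F W) w - pp (Suc i) W d' w" if w: "idm (F W) w = w" for w
  proof -
    \<comment> \<open>k is i + 1, so that the denominators are powers of a single nonzero
      symbol.\<close>
    obtain k :: complex where k: "of_nat i = k - 1" "k \<noteq> 0"
      using of_nat_neq_0[of i, where 'a = complex] that[of "of_nat i + 1"] by (simp add: add.commute)
    show ?thesis
      by (simp add: u p[OF w] am[OF w] am[OF hom_cod[OF Fd'h]] dd2 w \<tau>D L k;
         rule vec_eqI; simp only: lk; use k(2) in \<open>simp add: field_simps\<close>)
  qed
  have "uu (vv w) = uu (vv (idm (F W) w))" by (simp add: hom_dom[OF vv_hom])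
  also have "\<dots> = idm (F W) w - pp (Suc i) W d' w"
    by (subst main) (simp_all add: pp_def hom_dom[OF am_hom[OF W]] hom_dom[OF Fd'h])
  finally show ?thesis .
qed

text \<open>By \<open>uu_vv\<close> the idempotents \<open>uu \<circ> vv\<close> and
  \<open>s' \<circ> r'\<close> add up to the identity of \<open>F W\<close>.\<close>

lemma link_biprod:
  assumes lk2: "link (Suc i) W d' W' d'' r' s'"
  shows "biprod [X, W'] (F W)"
proof -
  have W': "W' \<in> sl2_modules" and r': "r' \<in> sl2_hom (F W) W'" and s': "s' \<in> sl2_hom W' (F W)"
    and rs': "r' (s' w) = idm W' w" and sr': "s' (r' v) = pp (Suc i) W d' v" for w v
    using lk2 by (auto simp: link_def)
  have pu: "pp (Suc i) W d' (uu x) = 0" for x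
    using uu_vv[of "uu x"] by (simp add: vv_uu hom_dom[OF uu_hom] hom_cod[OF uu_hom])
  have vp: "vv (pp (Suc i) W d' w) = 0" for w
  proof -
    have "pp (Suc i) W d' w = idm (F W) w - uu (vv w)" by (simp add: uu_vv)
    then show ?thesis by (simp add: lin_diff[OF hom_lin[OF vv_hom]] vv_uu hom_dom[OF vv_hom] hom_cod[OF vv_hom])
  qed
  show ?thesis
  proof (rule biprod_Cons[OF biprod_single[OF W'] uu_hom vv_hom s' r'])
    show "vv \<circ> uu = idm X" "r' \<circ> s' = idm W'" by (auto simp: vv_uu rs')
    show "(uu \<circ> vv) + (s' \<circ> r') = idm (F W)" by (auto simp: uu_vv sr')
    show "vv \<circ> s' = 0"
    proof
      fix w
      have "s' w = pp (Suc i) W d' (s' w)" by (simp add: sr'[symmetric] rs' hom_dom[OF s'])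
      then show "(vv \<circ> s') w = 0 w" using vp[of "s' w"] by simp
    qed
    show "r' \<circ> uu = 0"
    proof
      fix x
      have "r' (uu x) = r' (s' (r' (uu x)))" by (simp add: rs' hom_cod[OF r'])
      then show "(r' \<circ> uu) x = 0 x" by (simp add: sr' pu lin_zero[OF hom_lin[OF r']])
    qed
  qed
qed

text \<open>By adjunction g is determined by \<open>Fm g \<circ> uu\<close>. As \<open>Fm g\<close>
  commutes with the projector \<open>pp\<close>, which kills \<open>uu\<close>, this map lands in
  the copy of \<open>X\<close> and is \<open>uu\<close> after an endomorphism \<alpha> + \<beta> d
  of \<open>X\<close>. Since \<open>uu\<close> intertwines d with \<open>Fm d'\<close>, it is also
  the transpose of \<alpha> + \<beta> d'.\<close>

lemma link_scalar_end:
  assumes sc: "scalar_end X d"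
  shows "scalar_end W d'"
  unfolding scalar_end_def
proof
  fix g assume g: "g \<in> sl2_hom W W"
  note Fgh = Fm_hom[OF g W W]
  have "vv \<circ> (Fm g \<circ> uu) \<in> sl2_hom X X"
    by (intro hom_comp[OF _ vv_hom] hom_comp[OF uu_hom Fgh])
  then obtain \<alpha> \<beta> where ab: "vv (Fm g (uu x)) = vscale \<alpha> (idm X x) + vscale \<beta> (d x)" for x
    using sc by (force simp: scalar_end_def)
  have "pp (Suc i) W d' (Fm g v) = Fm g (pp (Suc i) W d' v)" for v
  proof -
    have gd: "g (d' w) = d' (g w)" for w
    proof -
      have c: "cas W (g w) = g (cas W w)" by (simp add: hom_cas[OF g])
      have "vscale (2 * of_nat (Suc i)) (d' (g w)) = vscale (2 * of_nat (Suc i)) (g (d' w))"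
        using c link_stage by (simp add: stage_def lin_simps(1,2)[OF hom_lin[OF g]] hom_dom[OF g] hom_cod[OF g] del: of_nat_Suc)
      then show ?thesis by (metis mult_eq_0_iff nat.distinct(1) of_nat_eq_0_iff vec.scale_left_imp_eq zero_neq_numeral)
    qed
    then have Fgd: "Fm g (Fm d' v) = Fm d' (Fm g v)" for v
      by (simp add: Fm_comp_apply hom_lin[OF g] hom_lin[OF d'h])
    show ?thesis
      by (simp add: pp_def lin_simps(1-5)[OF lin_Fm] hom_dom[OF Fgh] hom_cod[OF Fgh] Fgd am_nat[OF W W g, symmetric])
  qed
  moreover have "pp (Suc i) W d' (uu x) = 0" for x
    using uu_vv[of "uu x"] by (simp add: vv_uu hom_dom[OF uu_hom] hom_cod[OF uu_hom])
  ultimately have "uu (vv (Fm g (uu x))) = Fm g (uu x)" for x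
    by (simp add: uu_vv hom_cod[OF Fgh] lin_zero[OF lin_Fm])
  then have gu: "Fm g (uu x) = vscale \<alpha> (uu x) + vscale \<beta> (uu (d x))" for x
    by (simp add: ab lin_simps(1,2)[OF hom_lin[OF uu_hom]] hom_dom[OF uu_hom])
  have ud: "uu (d x) = Fm d' (uu x)" for x
    by (simp add: uu_def FrD[symmetric] coD)
  define k where "k = g - map_scale \<alpha> (idm W) - map_scale \<beta> d'"
  have k: "k \<in> sl2_hom W W"
    unfolding k_def by (intro hom_minus hom_scale hom_id W g d'h)
  have "Fm (k \<circ> r) (coev X x) = 0" for x
  proof -
    have "k = g + map_scale (- \<alpha>) (idm W) + map_scale (- \<beta>) d'" by (simp add: k_def fun_eq_iff)
    then have "Fm k v = Fm g v - vscale \<alpha> (idm (F W) v) - vscale \<beta> (Fm d' v)" for v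
      by (simp add: Fm_simps hom_lin[OF g] hom_lin[OF d'h])
    then have "Fm k (uu x) = 0" by (simp add: gu ud hom_cod[OF uu_hom])
    then show ?thesis by (simp add: Fm_simps hom_lin[OF k] hom_lin[OF rh] uu_def)
  qed
  then have kr: "(k \<circ> r) v = 0" for v
    by (rule zigzag_transpose[OF X W hom_comp[OF rh k]])
  have "k w = 0" for w
    using kr[of "s w"] by (simp add: rs hom_dom[OF k])
  then have "g w = vscale \<alpha> (idm W w) + vscale \<beta> (d' w)" for w
    by (simp add: k_def algebra_simps)
  then show "\<exists>\<alpha> \<beta>. \<forall>v. g v = vscale \<alpha> (idm W v) + vscale \<beta> (d' v)" by blast
qed

lemma link_nonzero: "idm X x \<noteq> 0 \<Longrightarrow> \<exists>w. idm W w \<noteq> 0"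
proof (rule ccontr)
  assume x: "idm X x \<noteq> 0" and "\<nexists>w. idm W w \<noteq> 0"
  then have "idm (F W) w = 0" for w by (simp add: idmF_apply tensor_vec_bilinear)
  then have "uu x = 0" by (metis hom_cod uu_hom)
  then show False using vv_uu[of x] x by (simp add: lin_zero[OF hom_lin[OF vv_hom]])
qed

end

end


section \<open>The bottom of the ladder: \<open>N\<close>, \<open>F N\<close> and
  \<open>F (F N)\<close>\<close>

context
  fixes N
  assumes N: "N \<in> sl2_modules" and cas0: "\<And>v. cas N v = 0"
begin

private lemma aaN: "am N (am N v) = 0"
  using cas0 by (simp add: am_am[OF N] Fm_apply[OF lin_Fstuff(1)[OF N]] tensor_vec_bilinear)

lemma start_stage0: "stage 0 N 0"
  by (simp add: stage_def N cas0)

lemma start_stage1: "stage 1 (F N) (am N)"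
  using cas0 by (simp add: stage_def N am_hom aaN cas_F[OF N] Fm_apply[OF lin_Fstuff(1)[OF N]] tensor_vec_bilinear)

private lemmas FahN = Fm_hom[OF am_hom[OF N] F_closed[OF N] F_closed[OF N]]

private lemma AA: "Fm (am N) (Fm (am N) v) = 0"
  by (simp add: Fm_comp_apply lin_Fstuff N aaN Fm_zero_apply)

private lemmas LN = lin_simps(1-5)[OF hom_lin[OF FahN]] lin_simps(1-5)[OF lin_Fstuff(3)] lin_simps(1-5)[OF lin_Fstuff(4)]
private lemmas ABN = sl2_homD(2,3)[OF FahN] sl2_homD(2,3)[OF coev_hom[OF N]] sl2_homD(2,3)[OF ev_hom[OF N]]

text \<open>The stage below \<open>F N\<close> is 0, where the general construction would divide by
  0, so the complement of the projector is computed directly from \<open>am_F\<close>. It is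
  expressed by \<open>coev\<close> and \<open>Fm (am N) \<circ> coev\<close>: two copies of
  \<open>N\<close>.\<close>

private lemma pp1: "idm (F (F N)) v - pp 1 (F N) (am N) v =
   vscale (1 / 2) (coev N (ev N (Fm (am N) v)) + Fm (am N) (coev N (ev N v)) - Fm (am N) (coev N (ev N (Fm (am N) v))))"
  by (simp add: pp_def am_F[OF N] ABN AA LN ev_am_coev[OF N];
      rule vec_eqI; simp only: lk; simp add: algebra_simps)

text \<open>The transpose of g is a map N -> F (F N) that lands in the two copies of N, since
  \<open>Fm g\<close> commutes with the projector and the projector kills \<open>coev\<close>.
  Endomorphisms of N are scalars, so two numbers determine g.\<close>

lemma start_scalar_end:
  assumes sc: "\<And>g. g \<in> sl2_hom N N \<Longrightarrow> \<exists>\<alpha>. \<forall>v. g v = vscale \<alpha> (idm N v)"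
  shows "scalar_end (F N) (am N)"
  unfolding scalar_end_def
proof
  fix g assume g: "g \<in> sl2_hom (F N) (F N)"
  note Fgh = Fm_hom[OF g F_closed[OF N] F_closed[OF N]]
  have h: "Fm g \<circ> coev N \<in> sl2_hom N (F (F N))"
    by (intro hom_comp[OF coev_hom[OF N] Fgh])
  have ga: "g (am N w) = am N (g w)" for w
  proof -
    have "vscale 2 (am N (g w)) + g w = vscale 2 (g (am N w)) + g w"
      using hom_cas[OF g, of w] start_stage1
      by (simp add: stage_def lin_simps(1,2)[OF hom_lin[OF g]] hom_dom[OF g] hom_cod[OF g] add.commute)
    then have "vscale 2 (am N (g w)) = vscale 2 (g (am N w))" by simp
    then show ?thesis by (metis vec.scale_left_imp_eq zero_neq_numeral)
  qed
  have Fga: "Fm g (Fm (am N) v) = Fm (am N) (Fm g v)" for v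
    by (simp add: Fm_comp_apply hom_lin[OF g] lin_Fstuff N ga)
  have aFg: "am (F N) (Fm g v) = Fm g (am (F N) v)" for v
    by (rule am_nat[OF F_closed[OF N] F_closed[OF N] g])
  have pg: "pp 1 (F N) (am N) (Fm g v) = Fm g (pp 1 (F N) (am N) v)" for v
    by (simp add: pp_def lin_simps(1-5)[OF lin_Fm] hom_dom[OF Fgh] hom_cod[OF Fgh] aFg Fga[symmetric])
  have pc: "pp 1 (F N) (am N) (coev N x) = 0" for x
    using pp1[of "coev N x"]
    by (simp add: ABN ev_coev[OF N] ev_am_coev[OF N] LN vec.scale_right_distrib vec.scale_right_diff_distrib)
  obtain \<alpha> where a: "ev N (Fm g (coev N x)) = vscale \<alpha> (idm N x)" for x
    using sc[OF hom_comp[OF h ev_hom[OF N]]] by force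
  obtain \<beta> where b: "ev N (Fm (am N) (Fm g (coev N x))) = vscale \<beta> (idm N x)" for x
    using sc[OF hom_comp[OF hom_comp[OF h FahN] ev_hom[OF N]]] by force
  have gc: "Fm g (coev N x) = vscale (\<beta> / 2) (coev N x) + vscale ((\<alpha> - \<beta>) / 2) (Fm (am N) (coev N x))" for x
  proof -
    have "Fm g (coev N x) = idm (F (F N)) (Fm g (coev N x)) - pp 1 (F N) (am N) (Fm g (coev N x))"
      by (simp add: pg pc lin_zero[OF lin_Fm] hom_cod[OF Fgh])
    also have "\<dots> = vscale (\<beta> / 2) (coev N x) + vscale ((\<alpha> - \<beta>) / 2) (Fm (am N) (coev N x))"
      by (simp add: pp1 a b LN ABN; rule vec_eqI; simp only: lk; simp add: algebra_simps diff_divide_distrib)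
    finally show ?thesis .
  qed
  define k where "k = g + map_scale (- (\<beta> / 2)) (idm (F N)) + map_scale (- ((\<alpha> - \<beta>) / 2)) (am N)"
  have k: "k \<in> sl2_hom (F N) (F N)"
    unfolding k_def by (intro hom_plus hom_scale hom_id F_closed N g am_hom)
  have "Fm k (coev N x) = 0" for x
    by (simp add: k_def Fm_simps hom_lin[OF g] lin_Fstuff N gc ABN)
  then have "k v = 0" for v
    by (rule zigzag_transpose[OF N F_closed[OF N] k])
  then have "g v = vscale (\<beta> / 2) (idm (F N) v) + vscale ((\<alpha> - \<beta>) / 2) (am N v)" for v
    by (simp add: k_def algebra_simps)
  then show "\<exists>\<alpha> \<beta>. \<forall>v. g v = vscale \<alpha> (idm (F N) v) + vscale \<beta> (am N v)" by blast
qed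

lemma start_biprod:
  assumes lk1: "link 1 (F N) (am N) W d r s"
  shows "biprod [N, N, W] (F (F N))"
proof -
  have W: "W \<in> sl2_modules" and r: "r \<in> sl2_hom (F (F N)) W" and s: "s \<in> sl2_hom W (F (F N))"
    and rs: "r (s w) = idm W w" and sr: "s (r v) = pp 1 (F N) (am N) v" for w v
    using lk1 by (auto simp: link_def)
  \<comment> \<open>With A = \<open>Fm (am N)\<close> one has ev coev = ev A coev = 2 and A^2 = 0.
    So ev A / 2 and (ev - ev A) / 2 are the projections dual to the embeddings coev and A
    coev.\<close>
  define i1 p1 i2 p2 where "i1 = coev N" and "p1 = map_scale (1 / 2) (ev N \<circ> Fm (am N))"
    and "i2 = Fm (am N) \<circ> coev N" and "p2 = map_scale (1 / 2) (ev N - (ev N \<circ> Fm (am N)))"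
  have h: "i1 \<in> sl2_hom N (F (F N))" "i2 \<in> sl2_hom N (F (F N))" "p1 \<in> sl2_hom (F (F N)) N" "p2 \<in> sl2_hom (F (F N)) N"
    unfolding i1_def p1_def i2_def p2_def
    using coev_hom[OF N] ev_hom[OF N] FahN N by (auto intro!: hom_scale hom_minus intro: hom_comp)
  have e: "p1 (i1 x) = idm N x" "p1 (i2 x) = 0" "p2 (i1 x) = 0" "p2 (i2 x) = idm N x" for x
    by (simp_all add: i1_def p1_def i2_def p2_def ev_coev[OF N] ev_am_coev[OF N] AA LN vec.scale_right_diff_distrib)
  have q: "idm (F (F N)) v - pp 1 (F N) (am N) v = i1 (p1 v) + i2 (p2 v)" for v
    unfolding pp1 i1_def p1_def i2_def p2_def
    by (simp add: LN; rule vec_eqI; simp only: lk; simp add: field_simps)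
  have pi: "pp 1 (F N) (am N) (i1 x) = 0" "pp 1 (F N) (am N) (i2 x) = 0" for x
    using q[of "i1 x"] q[of "i2 x"]
    by (simp_all add: e lin_zero[OF hom_lin[OF h(1)]] lin_zero[OF hom_lin[OF h(2)]] hom_dom[OF h(1)] hom_dom[OF h(2)] hom_cod[OF h(1)] hom_cod[OF h(2)])
  have ri: "r (i1 x) = 0" "r (i2 x) = 0" for x
    using rs[of "r (i1 x)"] rs[of "r (i2 x)"] by (simp_all add: sr pi lin_zero[OF hom_lin[OF r]] hom_cod[OF r])
  have sp: "pp 1 (F N) (am N) (s w) = s w" for w
    by (simp add: sr[symmetric] rs hom_dom[OF s])
  have ps: "p1 (s w) = 0" "p2 (s w) = 0" for w
  proof -
    have *: "i1 (p1 (s w)) + i2 (p2 (s w)) = 0" using q[of "s w"] by (simp add: sp hom_cod[OF s])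
    show "p1 (s w) = 0" using arg_cong[OF *, of p1]
      by (simp add: e lin_simps[OF hom_lin[OF h(3)]] hom_cod[OF h(3)])
    show "p2 (s w) = 0" using arg_cong[OF *, of p2]
      by (simp add: e lin_simps[OF hom_lin[OF h(4)]] hom_cod[OF h(4)])
  qed
  show ?thesis
  proof (rule biprodI[where \<iota> = "\<lambda>k. [i1, i2, s] ! k" and \<pi> = "\<lambda>k. [p1, p2, r] ! k"])
    have n3: "k = 0 \<or> k = 1 \<or> k = 2" if "k < length [N, N, W]" for k using that by auto
    show "[i1, i2, s] ! k \<in> sl2_hom ([N, N, W] ! k) (F (F N)) \<and> [p1, p2, r] ! k \<in> sl2_hom (F (F N)) ([N, N, W] ! k)"
      if "k < length [N, N, W]" for k
      using n3[OF that] h r s by (auto simp: One_nat_def numeral_2_eq_2)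
    show "[p1, p2, r] ! k \<circ> [i1, i2, s] ! l = (if k = l then idm ([N, N, W] ! k) else 0)"
      if "k < length [N, N, W]" "l < length [N, N, W]" for k l
      using n3[OF that(1)] n3[OF that(2)] by (auto simp: One_nat_def numeral_2_eq_2 fun_eq_iff e ri ps rs)
    have "i1 (p1 v) + (i2 (p2 v) + s (r v)) = idm (F (F N)) v" for v
      by (simp add: sr add.assoc[symmetric] flip: q)
    then show "(\<Sum>k<length [N, N, W]. [i1, i2, s] ! k \<circ> [p1, p2, r] ! k) = idm (F (F N))"
      by (simp add: fun_eq_iff lessThan_Suc add_ac)
  qed
qed

lemma F_nonzero: "idm N x \<noteq> 0 \<Longrightarrow> \<exists>w. idm (F N) w \<noteq> 0"
  by (rule exI[of _ "incl 0 x"], rule notI, drule arg_cong[of _ _ "prj 0"]) (simp add: idmF_apply lin_zero[OF lin_prj])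

end

text \<open>\<open>X i\<close> is the module with index \<open>-1 - i\<close>.\<close>

definition ladder :: "sl2_module \<Rightarrow> (nat \<Rightarrow> sl2_module) \<Rightarrow> (nat \<Rightarrow> vec \<Rightarrow> vec) \<Rightarrow> bool" where
  "ladder N X d \<longleftrightarrow> X 0 = N \<and> X 1 = F N \<and> d 0 = (\<lambda>v. 0) \<and> (\<forall>i. stage i (X i) (d i)) \<and> (\<forall>i. scalar_end (X i) (d i)) \<and>
     (\<forall>i. \<exists>v. idm (X i) v \<noteq> 0) \<and> biprod [X 0, X 0, X 2] (F (X 1)) \<and> (\<forall>i\<ge>1. biprod [X i, X (i + 2)] (F (X (i + 1))))"

text \<open>Each rung is only known to exist, so the sequence needs dependent choice. The choice
  begins with \<open>F N\<close>, at stage \<open>Suc 0\<close>, because passing to the next rung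
  divides by the stage.\<close>

theorem ladder_exists:
  assumes N: "N \<in> sl2_modules" and cas0: "\<And>v. cas N v = 0"
    and sc: "\<And>g. g \<in> sl2_hom N N \<Longrightarrow> \<exists>\<alpha>. \<forall>v. g v = vscale \<alpha> (idm N v)" and nz: "idm N x \<noteq> 0"
  obtains X d where "ladder N X d"
proof -
  define P where "P n Xd \<longleftrightarrow> stage (Suc n) (fst Xd) (snd Xd) \<and> scalar_end (fst Xd) (snd Xd) \<and> (\<exists>v. idm (fst Xd) v \<noteq> 0) \<and>
      (n = 0 \<longrightarrow> Xd = (F N, am N))" for n and Xd :: "sl2_module \<times> (vec \<Rightarrow> vec)"
  define Q where "Q n Xd Wd \<longleftrightarrow> (\<exists>r s. link (Suc n) (fst Xd) (snd Xd) (fst Wd) (snd Wd) r s)"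
    for n and Xd Wd :: "sl2_module \<times> (vec \<Rightarrow> vec)"
  have "\<exists>f. \<forall>n. P n (f n) \<and> Q n (f n) (f (Suc n))"
  proof (rule dependent_nat_choice)
    have "P 0 (F N, am N)"
      using start_stage1[OF N cas0] start_scalar_end[OF N cas0 sc] F_nonzero[OF N cas0 nz] by (simp add: P_def One_nat_def)
    then show "\<exists>x. P 0 x" by blast
  next
    fix Xd n assume P: "P n Xd"
    then have st: "stage (Suc n) (fst Xd) (snd Xd)" "scalar_end (fst Xd) (snd Xd)" "\<exists>v. idm (fst Xd) v \<noteq> 0" by (auto simp: P_def)
    obtain W d' r s where lk: "link (Suc n) (fst Xd) (snd Xd) W d' r s"
      using link_exists[OF st(1)] by auto
    have "P (Suc n) (W, d')"
      using link_stage[OF st(1) _ lk] link_scalar_end[OF st(1) _ lk st(2)] link_nonzero[OF st(1) _ lk] st(3) by (auto simp: P_def)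
    moreover have "Q n Xd (W, d')" using lk by (auto simp: Q_def)
    ultimately show "\<exists>y. P (Suc n) y \<and> Q n Xd y" by blast
  qed
  then obtain f where f: "\<And>n. P n (f n)" "\<And>n. Q n (f n) (f (Suc n))" by blast
  define X d where "X n = (case n of 0 \<Rightarrow> N | Suc k \<Rightarrow> fst (f k))" and "d n = (case n of 0 \<Rightarrow> 0 | Suc k \<Rightarrow> snd (f k))" for n
  have X: "X 0 = N" "X (Suc n) = fst (f n)" "d 0 = 0" "d (Suc n) = snd (f n)" for n
    by (simp_all add: X_def d_def)
  have f0: "f 0 = (F N, am N)" using f(1)[of 0] by (simp add: P_def)
  have sc0: "scalar_end N 0"
    using sc by (force simp: scalar_end_def)
  have "ladder N X d"
    unfolding ladder_def
  proof (intro conjI allI impI)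
    show "X 0 = N" "X 1 = F N" "d 0 = (\<lambda>v. 0)" by (simp_all add: X One_nat_def f0 fun_eq_iff)
    fix i
    show "stage i (X i) (d i)" using f(1) start_stage0[OF N cas0] by (cases i) (auto simp: X P_def)
    show "scalar_end (X i) (d i)" using f(1) sc0 by (cases i) (auto simp: X P_def)
    show "\<exists>v. idm (X i) v \<noteq> 0" using f(1) nz by (cases i) (auto simp: X P_def)
  next
    show "biprod [X 0, X 0, X 2] (F (X 1))"
      using f(2)[of 0] start_biprod[OF N cas0] by (auto simp: Q_def f0 X One_nat_def numeral_2_eq_2)
  next
    fix i :: nat assume "1 \<le> i"
    then obtain k where i: "i = Suc k" by (cases i) auto
    have "stage (Suc k) (fst (f k)) (snd (f k))" using f(1)[of k] by (simp add: P_def)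
    then show "biprod [X i, X (i + 2)] (F (X (i + 1)))"
      using f(2)[of k] f(2)[of "Suc k"] link_biprod[of "Suc k"] by (auto simp: Q_def i X simp flip: Suc_eq_plus1)
  qed
  then show ?thesis using that by blast
qed

declare One_nat_def [simp]

section \<open>Nilpotency and the Casimir operator on finite dimensional representations\<close>

text \<open>The scalar multiplication is abstract because the arguments are applied to two spaces:
  all vectors, and the linear maps between two modules.\<close>

locale cvector_space = vector_space scale
  for scale :: "complex \<Rightarrow> 'a::ab_group_add \<Rightarrow> 'a" (infixr "*c" 75)
begin

definition endo :: "('a \<Rightarrow> 'a) \<Rightarrow> bool" where
  "endo T \<longleftrightarrow> (\<forall>x y. T (x + y) = T x + T y) \<and> (\<forall>c x. T (c *c x) = c *c T x)"

lemma endo_simps: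
  assumes "endo T"
  shows "T (x + y) = T x + T y" "T (c *c x) = c *c T x" "T 0 = 0" "T (- x) = - T x" "T (x - y) = T x - T y"
proof -
  show 1: "T (x + y) = T x + T y" "T (c *c x) = c *c T x" for x y c
    using assms by (auto simp: endo_def)
  show 2: "T 0 = 0" using 1(2)[of 0 0] by simp
  show 3: "T (- x) = - T x" for x using 1(2)[of "-1" x] by simp
  show "T (x - y) = T x - T y" using 1(1)[of x "- y"] 3 by simp
qed

text \<open>The product of the operators T - l over the list. Monic polynomials are kept as lists of
  roots, so that products are concatenations and coprimality is disjointness.\<close>

primrec lprod :: "('a \<Rightarrow> 'a) \<Rightarrow> complex list \<Rightarrow> 'a \<Rightarrow> 'a" where
  "lprod T [] v = v"
| "lprod T (l # ls) v = T (lprod T ls v) - l *c lprod T ls v"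

lemma lprod_append: "lprod T (ls @ ms) v = lprod T ls (lprod T ms v)"
  by (induction ls) auto

context
  fixes T assumes T: "endo T"
begin

lemma endo_lprod: "endo (lprod T ls)"
  by (induction ls) (auto simp: endo_def endo_simps[OF T] algebra_simps)

lemma lprod_commute_T: "lprod T ls (T v) = T (lprod T ls v)"
  by (induction ls) (auto simp: endo_simps[OF T])

lemma lprod_commute: "lprod T ls (lprod T ms v) = lprod T ms (lprod T ls v)"
  by (induction ls) (auto simp: endo_simps[OF endo_lprod] lprod_commute_T)

lemma lprod_eigen: "T w = l *c w \<Longrightarrow> lprod T ms w = prod_list (map (\<lambda>m. l - m) ms) *c w"
  by (induction ms) (auto simp: endo_simps[OF T] algebra_simps)

text \<open>Applying all factors of the first list but one leaves an eigenvector of T; the second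
  product acts on it by a nonzero scalar, so it was zero already.\<close>

lemma lprod_disjoint:
  assumes "lprod T ls v = 0" "lprod T ms v = 0" "set ls \<inter> set ms = {}"
  shows "v = 0"
  using assms
proof (induction ls arbitrary: v)
  case (Cons l ls)
  let ?w = "lprod T ls v"
  have "T ?w = l *c ?w" using Cons.prems(1) by simp
  then have "lprod T ms ?w = prod_list (map (\<lambda>m. l - m) ms) *c ?w" by (rule lprod_eigen)
  moreover have "lprod T ms ?w = 0"
    using Cons.prems(2) by (simp add: lprod_commute[of ms] endo_simps[OF endo_lprod])
  moreover have "prod_list (map (\<lambda>m. l - m) ms) \<noteq> 0"
    using Cons.prems(3) by (auto simp: prod_list_zero_iff)
  ultimately have "?w = 0" by simp
  then show ?case using Cons by auto
qed simp

lemma lprod_shift: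
  assumes "endo g" "\<And>x. T (g x) = g (T x) + c *c g x"
  shows "lprod T (map (\<lambda>l. l + c) ls) (g v) = g (lprod T ls v)"
  by (induction ls) (auto simp: assms endo_simps[OF assms(1)] algebra_simps)

lemma lprod_eigenvector:
  assumes "lprod T ls v = 0" "v \<noteq> 0"
  shows "\<exists>l\<in>set ls. \<exists>ms. lprod T ms v \<noteq> 0 \<and> T (lprod T ms v) = l *c lprod T ms v"
  using assms
proof (induction ls)
  case (Cons l ls)
  then show ?case
    by (cases "lprod T ls v = 0") (auto simp: algebra_simps intro: exI[of _ ls])
qed simp

lemma lprod_separate:
  "lprod T ms v = lprod T (replicate (count_list ms l) l) (lprod T (filter (\<lambda>m. m \<noteq> l) ms) v)"
proof (induction ms)
  case (Cons m ms)
  show ?case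
  proof (cases "m = l")
    case False
    have "lprod T (m # ms) v = lprod T [m] (lprod T ms v)" by simp
    also have "\<dots> = lprod T (replicate (count_list ms l) l) (lprod T [m] (lprod T (filter (\<lambda>m. m \<noteq> l) ms) v))"
      by (simp only: Cons lprod_commute[of "[m]"])
    finally show ?thesis using False by simp
  qed (use Cons in auto)
qed simp

text \<open>A polynomial in \<open>T\<close> annihilating \<open>v\<close> exists by a dimension count and splits into linear factors.\<close>

lemma annihilating_list:
  assumes B: "finite B" and S: "\<And>k. (T ^^ k) v \<in> span B"
  shows "\<exists>ls. lprod T ls v = 0"
proof -
  define P where "P p = fold_coeffs (\<lambda>a w. a *c v + T w) p 0" for p
  have P0: "P 0 = 0" by (simp add: P_def)
  have Pc: "P (pCons a p) = a *c v + T (P p)" for a p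
    by (cases "p = 0"; cases "a = 0") (auto simp: P_def endo_simps[OF T])
  have Padd: "P (p + q) = P p + P q" for p q
  proof (induction p arbitrary: q)
    case (pCons a p)
    then show ?case by (cases q) (simp add: Pc endo_simps[OF T] algebra_simps)
  qed (simp add: P0)
  have Psm: "P (smult c p) = c *c P p" for c p
    by (induction p) (auto simp: P0 Pc endo_simps[OF T] algebra_simps)
  have Pmon: "P (monom c k) = c *c (T ^^ k) v" for c k
    by (induction k) (auto simp: monom_0 monom_Suc P0 Pc endo_simps[OF T])
  have Psum: "P (sum g A) = (\<Sum>a\<in>A. P (g a))" for g :: "nat \<Rightarrow> complex poly" and A
    by (induction A rule: infinite_finite_induct) (auto simp: P0 Padd)
  have "\<exists>p. p \<noteq> 0 \<and> P p = 0"
  proof (cases "inj_on (\<lambda>k. (T ^^ k) v) {..card B}")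
    case False
    then obtain i j where ij: "i \<noteq> j" "(T ^^ i) v = (T ^^ j) v" by (auto simp: inj_on_def)
    have "coeff (monom 1 i + monom (- 1) j) i = (1::complex)" using ij by simp
    then have "monom 1 i + monom (- 1) j \<noteq> (0 :: complex poly)" by (metis coeff_0 zero_neq_one)
    then show ?thesis using ij by (intro exI[of _ "monom 1 i + monom (- 1) j"]) (auto simp: Padd Pmon)
  next
    case True
    let ?A = "(\<lambda>k. (T ^^ k) v) ` {..card B}"
    have "card ?A = Suc (card B)" using card_image[OF True] by simp
    moreover have "?A \<subseteq> span B" using S by auto
    ultimately have "dependent ?A" using independent_span_bound[OF B, of ?A] by linarith
    then obtain u where u: "\<exists>x\<in>?A. u x \<noteq> 0" "(\<Sum>x\<in>?A. u x *c x) = 0"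
      by (auto simp: dependent_finite)
    then obtain k where k: "k \<le> card B" "u ((T ^^ k) v) \<noteq> 0" by auto
    define p where "p = (\<Sum>k\<le>card B. monom (u ((T ^^ k) v)) k)"
    have "coeff p k = u ((T ^^ k) v)"
      using k by (simp add: p_def coeff_sum)
    then have "p \<noteq> 0" using k by auto
    moreover have "P p = (\<Sum>k\<le>card B. u ((T ^^ k) v) *c (T ^^ k) v)"
      by (simp add: p_def Psum Pmon)
    then have "P p = 0" using u(2) by (simp add: sum.reindex[OF True])
    ultimately show ?thesis by blast
  qed
  then obtain p where p: "p \<noteq> 0" "P p = 0" by blast
  obtain A where A: "p = smult (lead_coeff p) (\<Prod>x\<in>#A. [:-x, 1:])"
    using alg_closed_imp_factorization[OF p(1)] by blast
  obtain ls where ls: "mset ls = A" by (metis ex_mset)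
  have fac: "P ([:-x, 1:] * q) = T (P q) - x *c P q" for x q
  proof -
    have "[:-x, 1:] * q = smult (- x) q + pCons 0 q" by simp
    then show ?thesis by (simp only: Padd Psm Pc) simp
  qed
  have "P (\<Prod>x\<in>#mset ls. [:-x, 1:]) = lprod T ls v"
  proof (induction ls)
    case Nil
    then show ?case using Pc[of 1 0] by (simp add: P0 endo_simps[OF T] flip: one_pCons)
  next
    case (Cons a ls)
    have "(\<Prod>x\<in>#mset (a # ls). [:-x, 1:]) = [:-a, 1:] * (\<Prod>x\<in>#mset ls. [:-x, 1:])" by simp
    then show ?case by (simp only: fac Cons lprod.simps)
  qed
  moreover have "P p = lead_coeff p *c P (\<Prod>x\<in>#A. [:-x, 1:])"
    by (subst A) (simp only: Psm)
  ultimately show ?thesis using p ls by auto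
qed

text \<open>Concatenate the annihilating lists of the members of a finite basis; the factors
  commute.\<close>

lemma annihilating_list_subspace:
  assumes S: "subspace S" "\<And>x. x \<in> S \<Longrightarrow> T x \<in> S" and B: "finite B" "S \<subseteq> span B"
  shows "\<exists>ls. \<forall>x\<in>S. lprod T ls x = 0"
proof -
  obtain B0 where B0: "B0 \<subseteq> S" "independent B0" "S \<subseteq> span B0"
    using basis_exists[of S] by metis
  have fin: "finite B0" using independent_span_bound[OF B(1) B0(2)] B0(1) B(2) by auto
  have each: "\<exists>ls. lprod T ls x = 0" if "x \<in> S" for x
  proof (rule annihilating_list[OF B(1)])
    have "(T ^^ k) x \<in> S" for k by (induction k) (use that S in auto)
    then show "(T ^^ k) x \<in> span B" for k using B(2) by auto
  qed
  have "\<exists>ls. \<forall>x\<in>C. lprod T ls x = 0" if "finite C" "C \<subseteq> S" for C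
    using that
  proof (induction C)
    case (insert b C)
    then obtain ls where ls: "\<forall>x\<in>C. lprod T ls x = 0" by auto
    obtain ms where ms: "lprod T ms b = 0" using each insert.prems by auto
    have "lprod T (ms @ ls) x = 0" if "x \<in> C" for x
      using ls that by (simp add: lprod_append endo_simps[OF endo_lprod])
    moreover have "lprod T (ms @ ls) b = 0"
      unfolding lprod_append by (subst lprod_commute) (simp add: ms endo_simps[OF endo_lprod])
    ultimately have "\<forall>x\<in>insert b C. lprod T (ms @ ls) x = 0" by auto
    then show ?case by blast
  qed auto
  from this[OF fin B0(1)] obtain ls where ls: "\<forall>x\<in>B0. lprod T ls x = 0" by blast
  have "subspace {x. lprod T ls x = 0}"
    by (rule subspaceI) (auto simp: endo_simps[OF endo_lprod])
  then have "span B0 \<subseteq> {x. lprod T ls x = 0}"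
    using ls by (intro span_minimal) auto
  then show ?thesis using B0(3) by blast
qed

end

text \<open>\<open>g\<close> moves generalised eigenvalues of T by c. Only finitely many occur on S,
  so after enough applications the shifted roots avoid the original ones.\<close>

lemma shift_nilpotent:
  assumes T: "endo T" and g: "endo g" and Tg: "\<And>x. T (g x) = g (T x) + c *c g x" and c: "c \<noteq> 0"
    and S: "subspace S" "\<And>x. x \<in> S \<Longrightarrow> T x \<in> S" "\<And>x. x \<in> S \<Longrightarrow> g x \<in> S" and B: "finite B" "S \<subseteq> span B" and v: "v \<in> S"
  shows "\<exists>k. (g ^^ k) v = 0"
proof -
  obtain ls where ls: "\<forall>x\<in>S. lprod T ls x = 0"
    using annihilating_list_subspace[OF T S(1,2) B] by blast
  have Tgk: "T ((g ^^ k) x) = (g ^^ k) (T x) + (of_nat k * c) *c (g ^^ k) x" for k x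
    by (induction k arbitrary: x) (auto simp: Tg endo_simps[OF g] algebra_simps)
  have gk: "endo (g ^^ k)" for k
    by (induction k) (auto simp: endo_def endo_simps[OF g])
  define M where "M = (\<Sum>l\<leftarrow>ls. norm l)"
  have M: "norm l \<le> M" if "l \<in> set ls" for l
    unfolding M_def using that
  proof (induction ls)
    case (Cons a ls)
    have "0 \<le> sum_list (map norm ls)" by (rule sum_list_nonneg) auto
    then show ?case using Cons by (auto intro: add_increasing)
  qed simp
  \<comment> \<open>All roots have norm at most M, so two of them differ by at most 2 M.\<close>
  obtain k :: nat where k: "2 * M / norm c < of_nat k" using reals_Archimedean2 by blast
  have "set (map (\<lambda>l. l + of_nat k * c) ls) \<inter> set ls = {}"
  proof (rule ccontr)
    assume "set (map (\<lambda>l. l + of_nat k * c) ls) \<inter> set ls \<noteq> {}"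
    then obtain a b where ab: "a \<in> set ls" "b \<in> set ls" "b = a + of_nat k * c" by auto
    then have "of_nat k * norm c = norm (b - a)" by (simp add: norm_mult)
    also have "\<dots> \<le> 2 * M" using norm_triangle_ineq4[of b a] M[OF ab(1)] M[OF ab(2)] by simp
    finally show False using k c by (simp add: field_simps)
  qed
  moreover have "lprod T (map (\<lambda>l. l + of_nat k * c) ls) ((g ^^ k) v) = 0"
    using lprod_shift[OF T gk Tgk, of k ls v] ls v by (simp add: endo_simps[OF gk])
  moreover have "(g ^^ k) v \<in> S" using v by (induction k) (auto simp: S)
  then have "lprod T ls ((g ^^ k) v) = 0" using ls by simp
  ultimately show ?thesis using lprod_disjoint[OF T] by blast
qed

end

section \<open>Representations of \<open>sl\<^sub>2\<close> on an abstract vector space\<close>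

locale sl2_rep = cvector_space scale
  for scale :: "complex \<Rightarrow> 'a::ab_group_add \<Rightarrow> 'a" (infixr "*c" 75) +
  fixes e f h :: "'a \<Rightarrow> 'a"
  assumes e: "endo e" and f: "endo f" and h: "endo h"
    and ef: "e (f x) = f (e x) + h x"
    and he: "h (e x) = e (h x) + 2 *c e x"
    and hf: "h (f x) = f (h x) - 2 *c f x"
begin

text \<open>Exchanging e and f and negating h is an automorphism of the Lie algebra; it turns
  statements about e into statements about f.\<close>

lemma sl2_rep_swap: "sl2_rep (*c) f e (\<lambda>x. - h x)"
  by unfold_locales (auto simp: endo_def endo_simps[OF e] endo_simps[OF f] endo_simps[OF h] ef he hf algebra_simps)

lemmas lin = endo_simps[OF e] endo_simps[OF f] endo_simps[OF h]

definition cc :: "'a \<Rightarrow> 'a" where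
  "cc v = h (h v) + 2 *c h v + v + 4 *c f (e v)"

lemma endo_cc: "endo cc"
  by (auto simp: endo_def cc_def lin algebra_simps)

lemma scale_num: "2 *c x + 2 *c x = 4 *c x"
  by (simp flip: scale_left_distrib)

lemma cc_e: "cc (e v) = e (cc v)"
  by (simp add: cc_def lin ef he algebra_simps scale_num[symmetric])

lemma cc_f: "cc (f v) = f (cc v)"
  by (simp add: cc_def lin ef hf algebra_simps scale_num[symmetric])

lemma cc_h: "cc (h v) = h (cc v)"
  by (simp add: cc_def lin he hf algebra_simps)

lemma cc_ef: "cc v = h (h v) - 2 *c h v + v + 4 *c e (f v)"
  by (simp add: cc_def ef algebra_simps scale_num[symmetric])

lemma h_fk: "h ((f ^^ k) v) = (f ^^ k) (h v) - (2 * of_nat k) *c (f ^^ k) v"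
  by (induction k arbitrary: v) (auto simp: hf lin distrib_left scale_left_distrib diff_diff_eq add.commute)

lemma scale_two: "2 *c x = x + x"
  using scale_left_distrib[of 1 1 x] by simp

lemma endo_pow: "endo g \<Longrightarrow> endo (g ^^ k)"
  by (induction k) (auto simp: endo_def)

lemma e_fk: "e ((f ^^ Suc k) v) = (f ^^ Suc k) (e v) + of_nat (Suc k) *c (f ^^ k) (h v - of_nat k *c v)"
proof (induction k)
  case (Suc k)
  have "e ((f ^^ Suc (Suc k)) v) = f (e ((f ^^ Suc k) v)) + h ((f ^^ Suc k) v)"
    by (simp add: ef)
  also have "\<dots> = (f ^^ Suc (Suc k)) (e v) + of_nat (Suc k) *c (f ^^ Suc k) (h v - of_nat k *c v)
      + ((f ^^ Suc k) (h v) - (2 * of_nat (Suc k)) *c (f ^^ Suc k) v)"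
    by (simp only: Suc h_fk) (simp add: lin)
  also have "\<dots> = (f ^^ Suc (Suc k)) (e v) + of_nat (Suc (Suc k)) *c (f ^^ Suc k) (h v - of_nat (Suc k) *c v)"
    by (simp only: endo_simps[OF endo_pow[OF f]]) (simp add: algebra_simps scale_two)
  finally show ?case .
qed (simp add: ef)

lemma e_h_kernel: "e v = 0 \<Longrightarrow> e (h v) = 0"
  using he[of v] by (simp add: lin)

lemma e_lprod_kernel: "e v = 0 \<Longrightarrow> e (lprod h ls v) = 0"
  by (induction ls) (auto simp: lin e_h_kernel)

text \<open>On the kernel of e, e^k f^k is k! h (h - 1) ... (h - k + 1). The vector is not assumed
  to have a weight: f^k v = 0 turns the formula into a polynomial equation for h with the simple
  roots 0, ..., k - 1.\<close>

lemma ek_fk: "e v = 0 \<Longrightarrow> (e ^^ k) ((f ^^ k) v) = fact k *c lprod h (map of_nat [0..<k]) v"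
proof (induction k arbitrary: v)
  case (Suc k)
  let ?w = "h v - of_nat k *c v"
  have w: "e ?w = 0" using Suc.prems by (simp add: lin e_h_kernel)
  have "(e ^^ Suc k) ((f ^^ Suc k) v) = (e ^^ k) (e ((f ^^ Suc k) v))"
    by (simp only: funpow_Suc_right o_apply)
  also have "e ((f ^^ Suc k) v) = of_nat (Suc k) *c (f ^^ k) ?w"
    by (simp only: e_fk Suc.prems endo_simps[OF endo_pow[OF f]]) simp
  also have "(e ^^ k) \<dots> = of_nat (Suc k) *c (fact k *c lprod h (map of_nat [0..<k]) ?w)"
    by (simp only: endo_simps[OF endo_pow[OF e]] Suc.IH[OF w])
  also have "lprod h (map of_nat [0..<k]) ?w = lprod h (map of_nat [0..<Suc k]) v"
    by (simp add: lprod_append)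
  finally show ?case by (simp add: mult.commute)
qed simp

lemma kernel_e_weights: "e v = 0 \<Longrightarrow> (f ^^ k) v = 0 \<Longrightarrow> lprod h (map of_nat [0..<k]) v = 0"
  using ek_fk[of v k] by (simp add: endo_simps[OF endo_pow[OF e]])

lemma cc_kernel: "e v = 0 \<Longrightarrow> cc v = h (h v) + 2 *c h v + v"
  by (simp add: cc_def lin)

text \<open>On the kernel of e the Casimir operator is (h + 1)^2, and (h + 1)^2 - (l + 1)^2 = (h -
  l) (h + l + 2).\<close>

lemma cc_lprod_kernel:
  "e v = 0 \<Longrightarrow> lprod cc (map (\<lambda>l. (l + 1) * (l + 1)) ls) v = lprod h (concat (map (\<lambda>l. [l, - l - 2]) ls)) v"
proof (induction ls)
  case (Cons l ls)
  let ?w = "lprod h (concat (map (\<lambda>l. [l, - l - 2]) ls)) v"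
  have "e ?w = 0" using Cons by (simp add: e_lprod_kernel)
  then show ?case using Cons by (simp add: cc_kernel lin algebra_simps scale_num[symmetric])
qed simp

lemma lprod_concat_zero: "lprod h ls v = 0 \<Longrightarrow> lprod h (concat (map (\<lambda>l. [l, - l - 2]) ls)) v = 0"
proof -
  have "lprod h (concat (map (\<lambda>l. [l, - l - 2]) ls)) v = lprod h (map (\<lambda>l. - l - 2) ls) (lprod h ls v)"
  proof (induction ls)
    case (Cons l ls)
    have "lprod h (concat (map (\<lambda>l. [l, - l - 2]) (l # ls))) v
      = lprod h [l] (lprod h [- l - 2] (lprod h (map (\<lambda>l. - l - 2) ls) (lprod h ls v)))"
      by (simp add: Cons)
    also have "\<dots> = lprod h [- l - 2] (lprod h (map (\<lambda>l. - l - 2) ls) (lprod h [l] (lprod h ls v)))"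
      by (simp only: lprod_commute[OF h, of "[l]"])
    finally show ?case by simp
  qed simp
  then show "lprod h ls v = 0 \<Longrightarrow> ?thesis" by (simp add: endo_simps[OF endo_lprod[OF h]])
qed

lemma kernel_e_casimir: "e v = 0 \<Longrightarrow> (f ^^ k) v = 0 \<Longrightarrow> lprod cc (map (\<lambda>j. of_nat (Suc j) * of_nat (Suc j)) [0..<k]) v = 0"
  using cc_lprod_kernel[of v "map of_nat [0..<k]"] lprod_concat_zero[OF kernel_e_weights, of v k]
  by (simp add: o_def add.commute)

lemma e_lprod_cc: "e (lprod cc ls v) = lprod cc ls (e v)"
  and f_lprod_cc: "f (lprod cc ls v) = lprod cc ls (f v)"
  and h_lprod_cc: "h (lprod cc ls v) = lprod cc ls (h v)"
  by (induction ls) (auto simp: cc_e[symmetric] cc_f[symmetric] cc_h[symmetric] lin)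

end

text \<open>A finite dimensional invariant subspace, seen through the nilpotency of \<open>e\<close> and \<open>f\<close>.\<close>

locale sl2_nil = sl2_rep +
  fixes S :: "'a set"
  assumes S: "subspace S" and S_act: "v \<in> S \<Longrightarrow> e v \<in> S" "v \<in> S \<Longrightarrow> f v \<in> S" "v \<in> S \<Longrightarrow> h v \<in> S"
    and e_nil: "v \<in> S \<Longrightarrow> \<exists>k. (e ^^ k) v = 0" and f_nil: "v \<in> S \<Longrightarrow> \<exists>k. (f ^^ k) v = 0"
begin

lemma cc_S: "v \<in> S \<Longrightarrow> cc v \<in> S"
  by (auto simp: cc_def intro!: subspace_add[OF S] subspace_scale[OF S] S_act)

lemma lprod_S: "v \<in> S \<Longrightarrow> lprod h ls v \<in> S" "v \<in> S \<Longrightarrow> lprod cc ls v \<in> S"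
  by (induction ls; auto intro!: subspace_diff[OF S] subspace_scale[OF S] S_act cc_S)+

text \<open>Otherwise f^(m+1) w would again be killed by e and have weight - m - 2, whereas
  nilpotency of f leaves only natural numbers as weights on the kernel of e.\<close>

lemma highest_weight_power:
  assumes w: "w \<in> S" "e w = 0" and l: "h w = of_nat m *c w"
  shows "(f ^^ Suc m) w = 0"
proof (rule ccontr)
  let ?z = "(f ^^ Suc m) w"
  assume z: "?z \<noteq> 0"
  have fS: "(f ^^ j) w \<in> S" for j using w(1) by (induction j) (auto intro: S_act)
  have "e ?z = 0"
    unfolding e_fk by (simp add: w(2) l endo_simps[OF endo_pow[OF f]] lin)
  moreover obtain j where "(f ^^ j) ?z = 0" using f_nil[OF fS] by blast
  ultimately have "lprod h (map of_nat [0..<j]) ?z = 0" by (rule kernel_e_weights)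
  moreover have hz: "h ?z = (- of_nat m - 2) *c ?z"
    unfolding h_fk by (simp add: l endo_simps[OF endo_pow[OF f]] lin algebra_simps flip: scale_left_distrib)
  ultimately have "prod_list (map (\<lambda>x. - of_nat m - 2 - x) (map of_nat [0..<j])) *c ?z = 0"
    by (simp only: lprod_eigen[OF h hz])
  then obtain x where "- of_nat m - 2 - of_nat x = (0::complex)" using z by (auto simp: prod_list_zero_iff)
  then have "of_nat (m + 2 + x) = (0::complex)" by (simp add: algebra_simps) (metis add.commute add_diff_cancel_left' diff_0 minus_add_cancel)
  then show False by (simp only: of_nat_eq_0_iff)
qed

lemma highest_weight_vector:
  assumes v: "v \<in> S" "v \<noteq> 0"
  shows "\<exists>w\<in>S. \<exists>m::nat. w \<noteq> 0 \<and> e w = 0 \<and> h w = of_nat m *c w \<and> (f ^^ Suc m) w = 0"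
proof -
  define k where "k = (LEAST k. (e ^^ k) v = 0)"
  have k: "(e ^^ k) v = 0" unfolding k_def using LeastI_ex[OF e_nil[OF v(1)]] .
  then obtain k' where k': "k = Suc k'" using v(2) by (cases k) auto
  define u where "u = (e ^^ k') v"
  have u: "u \<noteq> 0" "e u = 0" using k not_less_Least[of k' "\<lambda>k. (e ^^ k) v = 0"] by (auto simp: u_def k' k_def[symmetric])
  have uS: "u \<in> S" unfolding u_def using v(1) by (induction k') (auto intro: S_act)
  obtain n where n: "(f ^^ n) u = 0" using f_nil[OF uS] by blast
  obtain l ms where l: "l \<in> set (map of_nat [0..<n])" "lprod h ms u \<noteq> 0" "h (lprod h ms u) = l *c lprod h ms u"
    using lprod_eigenvector[OF h kernel_e_weights[OF u(2) n] u(1)] by blast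
  then obtain m where m: "l = of_nat m" by auto
  let ?w = "lprod h ms u"
  have w: "?w \<in> S" "e ?w = 0" using uS u by (auto intro: lprod_S e_lprod_kernel)
  have "(f ^^ Suc m) ?w = 0"
    by (rule highest_weight_power[OF w]) (simp add: l(3) m)
  then show ?thesis using w l m by blast
qed

text \<open>Induction on the order of nilpotency of e at v: the product that kills e v moves v into
  the kernel of e, where \<open>kernel_e_casimir\<close> applies. The roots are the Casimir
  eigenvalues (m + 1)^2 of the modules L(m).\<close>

lemma casimir_annihilator:
  assumes v: "v \<in> S"
  shows "\<exists>ms. set ms \<subseteq> range (\<lambda>j. of_nat (Suc j) * of_nat (Suc j)) \<and> lprod cc ms v = 0"
proof -
  have "(e ^^ l) v = 0 \<Longrightarrow> v \<in> S \<Longrightarrow> ?thesis" for l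
  proof (induction l arbitrary: v)
    case 0
    then show ?case by (intro exI[of _ "[]"]) auto
  next
    case (Suc l)
    have "(e ^^ l) (e v) = 0" "e v \<in> S" using Suc.prems by (auto simp: funpow_swap1 intro: S_act)
    then obtain ms where ms: "set ms \<subseteq> range (\<lambda>j. of_nat (Suc j) * of_nat (Suc j))" "lprod cc ms (e v) = 0"
      using Suc.IH by blast
    have w: "lprod cc ms v \<in> S" "e (lprod cc ms v) = 0" using Suc.prems ms by (auto intro: lprod_S simp: e_lprod_cc)
    obtain k where "(f ^^ k) (lprod cc ms v) = 0" using f_nil[OF w(1)] by blast
    from kernel_e_casimir[OF w(2) this]
    have "lprod cc (map (\<lambda>j. of_nat (Suc j) * of_nat (Suc j)) [0..<k] @ ms) v = 0" by (simp only: lprod_append)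
    then show ?case using ms(1) by (intro exI[of _ "map (\<lambda>j. of_nat (Suc j) * of_nat (Suc j)) [0..<k] @ ms"]) auto
  qed
  then show ?thesis using e_nil[OF v] v by blast
qed

text \<open>On the kernel of e the roots of h are simple and natural numbers, while Casimir
  eigenvalue 1 permits only 0 and -2. The simple root 0 is the only common one.\<close>

lemma kernel_e_casimir_one:
  assumes u: "u \<in> S" "lprod cc (replicate K 1) u = 0" "e u = 0"
  shows "h u = 0"
proof -
  obtain k where k: "(f ^^ k) u = 0" using f_nil[OF u(1)] by blast
  have 1: "lprod h (map of_nat [0..<k]) u = 0" by (rule kernel_e_weights[OF u(3) k])
  have "lprod h (concat (map (\<lambda>l. [l, - l - 2]) (replicate K 0))) u = 0"
  proof -
    have "map (\<lambda>l. (l + 1) * (l + 1)) (replicate K 0) = replicate K (1::complex)" by simp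
    then show ?thesis using cc_lprod_kernel[OF u(3), of "replicate K 0"] u(2) by (simp only:)
  qed
  then have 2: "lprod h (concat (map (\<lambda>l. [l, - l - 2]) (replicate K 0))) (h u) = 0"
    by (simp add: lprod_commute_T[OF h] lin)
  show ?thesis
  proof (cases k)
    case (Suc k')
    have "map of_nat [0..<k] = (0::complex) # map of_nat [1..<k]" using Suc by (simp add: upt_conv_Cons)
    then have "lprod h (map of_nat [1..<k]) (h u) = 0" using 1 by (simp add: lprod_commute_T[OF h])
    then show ?thesis
      by (rule lprod_disjoint[OF h 2]) (auto simp: complex_eq_iff)
  qed (use k in \<open>simp add: lin\<close>)
qed

lemma cc_lowest: "f z = 0 \<Longrightarrow> h z = l *c z \<Longrightarrow> cc z = (l * l - 2 * l + 1) *c z"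
  by (simp add: cc_ef lin scale_left_distrib scale_left_diff_distrib)

text \<open>The last nonzero f^k u would be a lowest weight vector of weight - 2 - 2 k, with Casimir
  eigenvalue (2 k + 3)^2, which is never 1.\<close>

lemma no_weight_minus_two:
  assumes u: "u \<in> S" "lprod cc (replicate K 1) u = 0" "h u = - 2 *c u"
  shows "u = 0"
proof (rule ccontr)
  assume "u \<noteq> 0"
  define k where "k = (LEAST k. (f ^^ k) u = 0)"
  have k: "(f ^^ k) u = 0" unfolding k_def using LeastI_ex[OF f_nil[OF u(1)]] .
  then obtain k' where k': "k = Suc k'" using \<open>u \<noteq> 0\<close> by (cases k) auto
  let ?z = "(f ^^ k') u"
  have z: "?z \<noteq> 0" "f ?z = 0" using k not_less_Least[of k' "\<lambda>k. (f ^^ k) u = 0"] by (auto simp: k' k_def[symmetric])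
  have hz: "h ?z = (- 2 - 2 * of_nat k') *c ?z"
    unfolding h_fk by (simp add: u(3) endo_simps[OF endo_pow[OF f]] scale_left_diff_distrib)
  have "cc ?z = ((- 2 - 2 * of_nat k') * (- 2 - 2 * of_nat k') - 2 * (- 2 - 2 * of_nat k') + 1) *c ?z"
    by (rule cc_lowest[OF z(2) hz])
  also have "(- 2 - 2 * of_nat k') * (- 2 - 2 * of_nat k') - 2 * (- 2 - 2 * of_nat k') + 1 = (of_nat ((2 * k' + 3) * (2 * k' + 3)) :: complex)"
    by (simp add: algebra_simps)
  finally have c: "lprod cc (replicate K 1) ?z = prod_list (map (\<lambda>m. of_nat ((2 * k' + 3) * (2 * k' + 3)) - m) (replicate K 1)) *c ?z"
    by (rule lprod_eigen[OF endo_cc])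
  have "lprod cc (replicate K 1) ((f ^^ j) u) = 0" for j
    by (induction j) (auto simp: u f_lprod_cc[symmetric] lin)
  then have "prod_list (map (\<lambda>m. of_nat ((2 * k' + 3) * (2 * k' + 3)) - m) (replicate K 1)) = (0::complex)"
    using c z by simp
  then have "of_nat ((2 * k' + 3) * (2 * k' + 3)) = (1::complex)" by (auto simp: prod_list_zero_iff split: if_splits)
  then have "(2 * k' + 3) * (2 * k' + 3) = 1" by (metis of_nat_1 of_nat_eq_iff)
  then show False by simp
qed

text \<open>It suffices that e^2 x = 0 implies e x = 0. In that case e x has weight 0, so u = h x +
  2 x is killed by e and therefore by h. Then x - u / 2 has weight -2 and vanishes, and e x is a
  multiple of e u = 0.\<close>

lemma casimir_one_e:
  assumes v: "v \<in> S" "lprod cc (replicate K 1) v = 0"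
  shows "e v = 0"
proof -
  have step: "e x = 0" if x: "x \<in> S" "lprod cc (replicate K 1) x = 0" "e (e x) = 0" for x
  proof -
    have w: "e x \<in> S" "lprod cc (replicate K 1) (e x) = 0" using x by (auto intro: S_act simp: e_lprod_cc[symmetric] lin)
    have hw: "h (e x) = 0" by (rule kernel_e_casimir_one[OF w x(3)])
    let ?u = "h x + 2 *c x"
    have u: "?u \<in> S" "lprod cc (replicate K 1) ?u = 0"
      using x by (auto intro!: subspace_add[OF S] subspace_scale[OF S] S_act
          simp: h_lprod_cc[symmetric] endo_simps[OF endo_lprod[OF endo_cc]] lin)
    have eu: "e ?u = 0" using hw he[of x] by (simp add: lin)
    have hu: "h ?u = 0" by (rule kernel_e_casimir_one[OF u eu])
    let ?y = "x - (1 / 2) *c ?u"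
    have "h ?y = h x" by (simp only: endo_simps(2,5)[OF h] hu) simp
    moreover have "- 2 *c ?y = h x" by (simp add: scale_right_diff_distrib scale_right_distrib)
    ultimately have "h ?y = - 2 *c ?y" by simp
    moreover have "?y \<in> S" "lprod cc (replicate K 1) ?y = 0"
      using x u by (auto intro!: subspace_diff[OF S] subspace_scale[OF S] simp: endo_simps[OF endo_lprod[OF endo_cc]])
    ultimately have "?y = 0" using no_weight_minus_two by blast
    then have "x = (1 / 2) *c ?u" by simp
    then have "e x = (1 / 2) *c e ?u" using endo_simps(2)[OF e] by metis
    then show ?thesis by (simp add: eu)
  qed
  have "(e ^^ Suc l) v = 0 \<Longrightarrow> e v = 0" for l
  proof (induction l)
    case (Suc l)
    have "(e ^^ l) v \<in> S" "lprod cc (replicate K 1) ((e ^^ l) v) = 0"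
      using v by (induction l) (auto intro: S_act simp: e_lprod_cc[symmetric] lin)
    then have "e ((e ^^ l) v) = 0" using step Suc.prems by auto
    then show ?case using Suc.IH by simp
  qed auto
  then show ?thesis using e_nil[OF v(1)] by (metis funpow.simps(2) comp_apply lin(3))
qed

end

context sl2_nil
begin

lemma sl2_nil_swap: "sl2_nil (*c) f e (\<lambda>x. - h x) S"
proof -
  interpret s: sl2_rep "(*c)" f e "\<lambda>x. - h x" by (rule sl2_rep_swap)
  show ?thesis
    by unfold_locales (auto intro: S S_act e_nil f_nil subspace_neg[OF S])
qed

lemma casimir_one_trivial:
  assumes v: "v \<in> S" "lprod cc (replicate K 1) v = 0"
  shows "e v = 0" "f v = 0" "h v = 0"
proof -
  show ev: "e v = 0" by (rule casimir_one_e[OF v])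
  interpret s: sl2_nil "(*c)" f e "\<lambda>x. - h x" S by (rule sl2_nil_swap)
  have "s.cc x = cc x" for x
    by (simp add: s.cc_def cc_ef lin)
  then have "s.cc = cc" by (rule ext)
  then show fv: "f v = 0" using s.casimir_one_e[of v K] v by simp
  show "h v = 0" using ef[of v] by (simp add: ev fv lin)
qed

end

section \<open>Complete reducibility\<close>

lemma cvector_space_vec: "cvector_space vscale"
  by unfold_locales

lemma endo_vec: "cvector_space.endo vscale T \<longleftrightarrow> lin T"
  by (simp add: cvector_space.endo_def[OF cvector_space_vec] lin_iff)

lemma rep_vec:
  assumes V: "V \<in> sl2_modules"
  shows "sl2_rep vscale (act_e V) (act_f V) (act_h V)"
  by (intro sl2_rep.intro sl2_rep_axioms.intro cvector_space_vec)
    (simp_all only: endo_vec lin_sl2[OF V] sl2_rels[OF V])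

lemma nil_vec:
  assumes V: "V \<in> sl2_modules" and fin: "finite (basis V)"
  shows "sl2_nil vscale (act_e V) (act_f V) (act_h V) (space V)"
proof -
  note nil = cvector_space.shift_nilpotent[OF cvector_space_vec, unfolded endo_vec, OF lin_act_h[OF V] _ _ _
      subspace_vec_space _ _ finite_imageI[OF fin] vec_space_finite_span[OF fin]]
  have hf: "act_h V (act_f V x) = act_f V (act_h V x) + vscale (- 2) (act_f V x)" for x
    by (simp add: sl2_rels[OF V])
  show ?thesis
  proof (intro sl2_nil.intro sl2_nil_axioms.intro rep_vec V)
    fix v assume v: "v \<in> space V"
    show "\<exists>k. (act_e V ^^ k) v = 0"
      by (rule nil[OF lin_act_e[OF V] sl2_he[OF V] _ _ _ v]) (simp_all add: V)
    show "\<exists>k. (act_f V ^^ k) v = 0"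
      by (rule nil[OF lin_act_f[OF V] hf _ _ _ v]) (simp_all add: V)
  qed (simp_all add: V)
qed

text \<open>
  Linear maps are represented by their values on the basis vectors, so that the relations of
  \<open>sl\<^sub>2\<close> hold on the whole type \<open>nat \<Rightarrow> vec\<close>.
\<close>

definition fscale :: "complex \<Rightarrow> (nat \<Rightarrow> vec) \<Rightarrow> nat \<Rightarrow> vec" where
  "fscale c \<phi> = (\<lambda>i. vscale c (\<phi> i))"

lemma fscale_apply [simp]: "fscale c \<phi> i = vscale c (\<phi> i)"
  by (simp add: fscale_def)

lemma cvector_space_fscale: "cvector_space fscale"
proof -
  have "vector_space fscale"
    by unfold_locales (auto simp: fun_eq_iff vec.scale_right_distrib vec.scale_left_distrib)
  then show ?thesis by (simp only: cvector_space_def)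
qed

text \<open>The Lie algebra action on linear maps, \<phi> \<mapsto> a \<phi> - \<phi> b; its
  invariants are the homomorphisms.\<close>

definition hact :: "(vec \<Rightarrow> vec) \<Rightarrow> (vec \<Rightarrow> vec) \<Rightarrow> (nat \<Rightarrow> vec) \<Rightarrow> nat \<Rightarrow> vec" where
  "hact a b \<phi> i = a (\<phi> i) - linear_extension \<phi> (b (basis_vec i))"

lemma linear_extension_linear:
  "linear_extension (\<phi> + \<psi>) v = linear_extension \<phi> v + linear_extension \<psi> v"
  "linear_extension (fscale c \<phi>) v = vscale c (linear_extension \<phi> v)"
  "linear_extension (\<phi> - \<psi>) v = linear_extension \<phi> v - linear_extension \<psi> v"
  "linear_extension 0 v = 0"
  by (simp_all add: linear_extension_def vec.scale_right_distrib sum.distrib vec.scale_sum_right mult.commute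
      vec.scale_right_diff_distrib sum_subtractf)

lemma linear_extension_eqI: "lin T \<Longrightarrow> (\<And>i. T (basis_vec i) = \<phi> i) \<Longrightarrow> linear_extension \<phi> v = T v"
  using fun_cong[OF lin_ext[OF lin_linear_extension, of T \<phi>]] by simp

lemma linear_extension_hact:
  assumes "lin a" "lin b"
  shows "linear_extension (hact a b \<phi>) v = a (linear_extension \<phi> v) - linear_extension \<phi> (b v)"
proof (rule linear_extension_eqI)
  show "lin (\<lambda>v. a (linear_extension \<phi> v) - linear_extension \<phi> (b v))"
    using lin_minus[OF lin_comp[OF assms(1) lin_linear_extension] lin_comp[OF lin_linear_extension assms(2)], of \<phi> \<phi>]
    by (simp add: fun_diff_def)
qed (simp add: hact_def)

lemma endo_hact:
  assumes "lin a"
  shows "cvector_space.endo fscale (hact a b)"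
  by (simp add: cvector_space.endo_def[OF cvector_space_fscale] fun_eq_iff hact_def lin_simps(1,2)[OF assms]
      linear_extension_linear vec.scale_right_diff_distrib)

definition maps_of :: "nat set \<Rightarrow> nat set \<Rightarrow> (nat \<Rightarrow> vec) set" where
  "maps_of B C = {\<phi>. (\<forall>i. i \<notin> B \<longrightarrow> \<phi> i = 0) \<and> (\<forall>i. \<phi> i \<in> vec_space C)}"

lemma subspace_maps_of: "module.subspace fscale (maps_of B C)"
proof -
  interpret cvector_space fscale by (rule cvector_space_fscale)
  show ?thesis by (rule subspaceI) (auto simp: maps_of_def)
qed

lemma maps_of_span:
  assumes "finite B" "finite C"
  shows "maps_of B C \<subseteq> module.span fscale ((\<lambda>(j, k) i. if i = j then basis_vec k else 0) ` (B \<times> C))"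
proof
  interpret cvector_space fscale by (rule cvector_space_fscale)
  let ?b = "\<lambda>(j, k) i. if i = j then basis_vec k else 0"
  fix \<phi> assume phi: "\<phi> \<in> maps_of B C"
  have app: "(\<Sum>x\<in>A. f x) i = (\<Sum>x\<in>A. f x i)" for f :: "nat \<times> nat \<Rightarrow> nat \<Rightarrow> vec" and A i
    by (induction A rule: infinite_finite_induct) auto
  have "(\<Sum>(j, k)\<in>B \<times> C. fscale (lookup (\<phi> j) k) (?b (j, k))) \<in> span (?b ` (B \<times> C))"
    by (rule span_sum) (auto intro!: span_scale intro: span_base)
  moreover have "(\<Sum>(j, k)\<in>B \<times> C. fscale (lookup (\<phi> j) k) (?b (j, k))) = \<phi>"
  proof (rule ext, rule vec_eqI)
    fix i n
    have "lookup ((\<Sum>(j, k)\<in>B \<times> C. fscale (lookup (\<phi> j) k) (?b (j, k))) i) n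
       = (\<Sum>(j, k)\<in>B \<times> C. if i = j then (if k = n then lookup (\<phi> j) k else 0) else 0)"
      unfolding app lookup_sum by (rule sum.cong) (auto simp: lookup_basis_vec)
    also have "\<dots> = (\<Sum>j\<in>B. \<Sum>k\<in>C. if i = j then (if k = n then lookup (\<phi> j) k else 0) else 0)"
      by (simp add: sum.cartesian_product)
    also have "\<dots> = (\<Sum>j\<in>B. if i = j then (if n \<in> C then lookup (\<phi> j) n else 0) else 0)"
      by (rule sum.cong) (auto simp: assms)
    also have "\<dots> = lookup (\<phi> i) n"
      using phi assms by (auto simp: maps_of_def in_vec_space_iff)
    finally show "lookup ((\<Sum>(j, k)\<in>B \<times> C. fscale (lookup (\<phi> j) k) (?b (j, k))) i) n = lookup (\<phi> i) n" .
  qed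
  ultimately show "\<phi> \<in> span (?b ` (B \<times> C))" by simp
qed

lemma nil_hom:
  assumes V: "V \<in> sl2_modules" "finite (basis V)" and W: "W \<in> sl2_modules" "finite (basis W)"
  shows "sl2_nil fscale (hact (act_e W) (act_e V)) (hact (act_f W) (act_f V)) (hact (act_h W) (act_h V))
    (maps_of (basis V) (basis W))"
proof -
  note lV = lin_sl2[OF V(1)] and lW = lin_sl2[OF W(1)]
  note l = lin_simps(1-5)[OF lW(1)] lin_simps(1-5)[OF lW(2)] lin_simps(1-5)[OF lW(3)]
    lin_simps(1-5)[OF lin_linear_extension]
  note rels = sl2_rels[OF V(1)] sl2_rels[OF W(1)]
  note en = endo_hact[OF lW(1), of "act_e V"] endo_hact[OF lW(2), of "act_f V"] endo_hact[OF lW(3), of "act_h V"]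
  have he: "hact (act_h W) (act_h V) (hact (act_e W) (act_e V) \<phi>) =
      hact (act_e W) (act_e V) (hact (act_h W) (act_h V) \<phi>) + fscale 2 (hact (act_e W) (act_e V) \<phi>)" for \<phi>
    by (rule ext) (simp add: hact_def[of _ _ "hact _ _ \<phi>"] linear_extension_hact lV lW, simp add: hact_def l rels vec.scale_right_diff_distrib)
  have hf: "hact (act_h W) (act_h V) (hact (act_f W) (act_f V) \<phi>) =
      hact (act_f W) (act_f V) (hact (act_h W) (act_h V) \<phi>) - fscale 2 (hact (act_f W) (act_f V) \<phi>)" for \<phi>
    by (rule ext) (simp add: hact_def[of _ _ "hact _ _ \<phi>"] linear_extension_hact lV lW, simp add: hact_def l rels vec.scale_right_diff_distrib)
  have ef: "hact (act_e W) (act_e V) (hact (act_f W) (act_f V) \<phi>) =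
      hact (act_f W) (act_f V) (hact (act_e W) (act_e V) \<phi>) + hact (act_h W) (act_h V) \<phi>" for \<phi>
    by (rule ext) (simp add: hact_def[of _ _ "hact _ _ \<phi>"] linear_extension_hact lV lW, simp add: hact_def l rels)
  have rep: "sl2_rep fscale (hact (act_e W) (act_e V)) (hact (act_f W) (act_f V)) (hact (act_h W) (act_h V))"
    by (intro sl2_rep.intro sl2_rep_axioms.intro cvector_space_fscale en ef he hf)
  have cl: "hact a b \<phi> \<in> maps_of (basis V) (basis W)"
    if "\<phi> \<in> maps_of (basis V) (basis W)" "a \<in> linear_maps (basis W) (basis W)" "b \<in> linear_maps (basis V) (basis V)" for a b \<phi>
  proof -
    have "linear_extension \<phi> v \<in> space W" for v
      unfolding linear_extension_def using that(1)
      by (intro vec.subspace_sum[OF subspace_vec_space] vec.subspace_scale[OF subspace_vec_space]) (auto simp: maps_of_def)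
    then show ?thesis
      using that by (auto simp: maps_of_def hact_def linear_maps_def lin_zero)
  qed
  note cl = cl[OF _ act_linear_maps(1)[OF W(1)] act_linear_maps(1)[OF V(1)]]
    cl[OF _ act_linear_maps(2)[OF W(1)] act_linear_maps(2)[OF V(1)]]
    cl[OF _ act_linear_maps(3)[OF W(1)] act_linear_maps(3)[OF V(1)]]
  note nil = cvector_space.shift_nilpotent[OF cvector_space_fscale en(3) _ _ _ subspace_maps_of _ _
     finite_imageI[OF finite_cartesian_product[OF V(2) W(2)]] maps_of_span[OF V(2) W(2)]]
  have hf': "hact (act_h W) (act_h V) (hact (act_f W) (act_f V) \<phi>) =
      hact (act_f W) (act_f V) (hact (act_h W) (act_h V) \<phi>) + fscale (- 2) (hact (act_f W) (act_f V) \<phi>)" for \<phi>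
    by (simp add: hf fun_eq_iff)
  show ?thesis
  proof (intro sl2_nil.intro sl2_nil_axioms.intro rep subspace_maps_of cl)
    fix \<phi> assume phi: "\<phi> \<in> maps_of (basis V) (basis W)"
    show "\<exists>k. (hact (act_e W) (act_e V) ^^ k) \<phi> = 0"
      by (rule nil[OF en(1) he _ _ _ phi]) (simp_all add: cl)
    show "\<exists>k. (hact (act_f W) (act_f V) ^^ k) \<phi> = 0"
      by (rule nil[OF en(2) hf' _ _ _ phi]) (simp_all add: cl)
  qed
qed

text \<open>A linear retraction is projected to the generalised Casimir eigenvalue 1 in the module
  of linear maps. There the action is trivial, so the result is a homomorphism, and it still
  restricts to a nonzero multiple of the identity of \<open>W\<close>.\<close>

lemma splitting_exists:
  assumes V: "V \<in> sl2_modules" "finite (basis V)" and W: "W \<in> sl2_modules" "finite (basis W)"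
    and a: "a \<in> sl2_hom W V" "inj_on a (space W)"
  obtains b where "b \<in> sl2_hom V W" "b \<circ> a = idm W"
proof -
  interpret H: sl2_nil fscale "hact (act_e W) (act_e V)" "hact (act_f W) (act_f V)" "hact (act_h W) (act_h V)"
    "maps_of (basis V) (basis W)"
    by (rule nil_hom[OF V W])
  note lV = lin_sl2[OF V(1)] and lW = lin_sl2[OF W(1)]
  obtain k where k: "lin k" "\<And>w. w \<in> space W \<Longrightarrow> k (a w) = w"
    using vecp.linear_exists_left_inverse_on[OF hom_lin[OF a(1)] subspace_vec_space a(2)] by blast
  define \<phi>0 where "\<phi>0 i = idm W (k (idm V (basis_vec i)))" for i
  have e0: "linear_extension \<phi>0 v = idm W (k (idm V v))" for v
    by (rule linear_extension_eqI) (use lin_comp[OF lin_id_map lin_comp[OF k(1) lin_id_map]] in \<open>simp_all add: \<phi>0_def o_def\<close>)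
  \<comment> \<open>\<open>R c \<phi>\<close>: on the copy of \<open>W\<close> the map is c times
    the identity. The Lie algebra takes such maps to \<open>R 0\<close>, so the Casimir operator
    preserves c, and a factor with root m multiplies c by 1 - m.\<close>
  define R where "R c \<phi> \<longleftrightarrow> (\<forall>w. linear_extension \<phi> (a w) = vscale c (idm W w))" for c \<phi>
  have R0: "R 1 \<phi>0"
    unfolding R_def
  proof
    fix w
    have "linear_extension \<phi>0 (a w) = idm W (k (a (idm W w)))" by (simp add: e0 hom_cod[OF a(1)] hom_dom[OF a(1)])
    then show "linear_extension \<phi>0 (a w) = vscale 1 (idm W w)" using k(2)[OF id_map_in, of w] by simp
  qed
  have Ract: "R 0 (hact (act_e W) (act_e V) \<phi>)" "R 0 (hact (act_f W) (act_f V) \<phi>)" "R 0 (hact (act_h W) (act_h V) \<phi>)" if "R c \<phi>" for c \<phi>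
    using that by (simp_all add: R_def linear_extension_hact lV lW sl2_absorb[OF W(1)] lin_scale[OF lW(1)] lin_scale[OF lW(2)] lin_scale[OF lW(3)]
        flip: sl2_homD(5-7)[OF a(1)])
  have Radd: "R (c + d) (\<phi> + \<psi>)" "R (x * c) (fscale x \<phi>)" "R (c - d) (\<phi> - \<psi>)" if "R c \<phi>" "R d \<psi>" for c d x \<phi> \<psi>
    using that by (simp_all add: R_def linear_extension_linear vec.scale_left_distrib vec.scale_left_diff_distrib)
  have Rcc: "R c (H.cc \<phi>)" if "R c \<phi>" for c \<phi>
  proof -
    note h = Ract(3)[OF that] and fe = Ract(2)[OF Ract(1)[OF that]]
    have "R (0 + 2 * 0 + c + 4 * 0) (H.cc \<phi>)"
      unfolding H.cc_def
      by (intro Radd(1)[OF Radd(1)[OF Radd(1)[OF Ract(3)[OF h] Radd(2)[OF h h]] that] Radd(2)[OF fe fe]])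
    then show ?thesis by simp
  qed
  have Rprod: "R (c * prod_list (map (\<lambda>m. 1 - m) ms)) (H.lprod H.cc ms \<phi>)" if "R c \<phi>" for c ms \<phi>
  proof (induction ms)
    case (Cons m ms)
    have "R (c * prod_list (map (\<lambda>m. 1 - m) ms) - m * (c * prod_list (map (\<lambda>m. 1 - m) ms))) (H.lprod H.cc (m # ms) \<phi>)"
      unfolding H.lprod.simps by (rule Radd(3)[OF Rcc[OF Cons] Radd(2)[OF Cons Cons]])
    moreover have "c * prod_list (map (\<lambda>m. 1 - m) ms) - m * (c * prod_list (map (\<lambda>m. 1 - m) ms))
        = c * prod_list (map (\<lambda>m. 1 - m) (m # ms))"
      by (simp add: algebra_simps)
    ultimately show ?case by (simp only:)
  next
    case Nil
    show ?case using that by (simp only: H.lprod.simps list.map prod_list.Nil mult_1_right)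
  qed
  have S0: "\<phi>0 \<in> maps_of (basis V) (basis W)"
    by (auto simp: maps_of_def \<phi>0_def id_map_basis_vec lin_zero[OF k(1)] lin_zero[OF lin_id_map])
  obtain ms where ms: "H.lprod H.cc ms \<phi>0 = 0" using H.casimir_annihilator[OF S0] by blast
  define \<phi> where "\<phi> = H.lprod H.cc (filter (\<lambda>m. m \<noteq> 1) ms) \<phi>0"
  have "H.lprod H.cc (replicate (count_list ms 1) 1) \<phi> = 0"
    using ms H.lprod_separate[OF H.endo_cc, of ms \<phi>0 1] by (simp add: \<phi>_def)
  moreover have S1: "\<phi> \<in> maps_of (basis V) (basis W)" unfolding \<phi>_def by (rule H.lprod_S(2)[OF S0])
  ultimately have tr: "hact (act_e W) (act_e V) \<phi> = 0" "hact (act_f W) (act_f V) \<phi> = 0" "hact (act_h W) (act_h V) \<phi> = 0"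
    using H.casimir_one_trivial by blast+
  define c where "c = prod_list (map (\<lambda>m. 1 - m) (filter (\<lambda>m. m \<noteq> 1) ms))"
  have c: "c \<noteq> 0" by (auto simp: c_def prod_list_zero_iff)
  have R1: "R c \<phi>" using Rprod[OF R0, of "filter (\<lambda>m. m \<noteq> 1) ms"] by (simp add: \<phi>_def c_def)
  let ?g = "linear_extension \<phi>"
  have g: "?g \<in> sl2_hom V W"
  proof (intro sl2_homI V(1))
    show "?g \<in> linear_maps (basis V) (basis W)"
      unfolding linear_maps_def using S1
      by (auto simp: maps_of_def linear_extension_def intro!: vec.subspace_sum[OF subspace_vec_space] vec.subspace_scale[OF subspace_vec_space])
       (simp_all flip: linear_extension_def)
    show "?g (act_e V v) = act_e W (?g v)" "?g (act_f V v) = act_f W (?g v)" "?g (act_h V v) = act_h W (?g v)" for v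
      using linear_extension_hact[OF lW(1) lV(1), of \<phi> v] linear_extension_hact[OF lW(2) lV(2), of \<phi> v]
        linear_extension_hact[OF lW(3) lV(3), of \<phi> v] by (simp_all add: tr linear_extension_linear)
  qed
  have "map_scale (1 / c) ?g \<circ> a = idm W"
    using R1 c by (simp add: R_def fun_eq_iff)
  then show ?thesis using that[OF hom_scale[OF W(1) g]] by blast
qed

section \<open>The simple modules \<open>E m\<close> and complete reducibility\<close>

lemma lookup_act_e_E: "lookup (act_e (E m) y) j = (if j < m then of_nat (Suc j) * lookup y (Suc j) else 0)"
proof -
  \<comment> \<open>A coordinate is a functional; multiplied by a fixed vector it becomes a linear
    map of vectors, to which \<open>lin_ext\<close> applies.\<close>
  have "(\<lambda>y. vscale (lookup (act_e (E m) y) j) (basis_vec 0)) = (\<lambda>y. vscale (if j < m then of_nat (Suc j) * lookup y (Suc j) else 0) (basis_vec 0))"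
  proof (rule lin_ext)
    fix k
    show "vscale (lookup (act_e (E m) (basis_vec k)) j) (basis_vec 0) = vscale (if j < m then of_nat (Suc j) * lookup (basis_vec k) (Suc j) else 0) (basis_vec 0)"
      by (cases k) (auto simp: act_E_basis_vec lookup_basis_vec)
  qed (auto simp: lin_iff lin_simps(1,2)[OF lin_act_E(1)] lookup_add vec.scale_left_distrib algebra_simps)
  then have "lookup (vscale (lookup (act_e (E m) y) j) (basis_vec 0)) 0 = lookup (vscale (if j < m then of_nat (Suc j) * lookup y (Suc j) else 0) (basis_vec 0)) 0"
    by (simp add: fun_eq_iff)
  then show ?thesis by (simp add: lookup_basis_vec)
qed

lemma E_kernel_e:
  assumes "y \<in> space (E m)" "act_e (E m) y = 0"
  shows "y = vscale (lookup y 0) (basis_vec 0)"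
proof (rule vec_eqI)
  fix j
  show "lookup y j = lookup (vscale (lookup y 0) (basis_vec 0)) j"
  proof (cases j)
    case (Suc i)
    have "lookup (act_e (E m) y) i = 0" using assms(2) by simp
    then show ?thesis using assms(1) Suc of_nat_neq_0[of i, where 'a = complex]
      by (cases "i < m") (auto simp: lookup_act_e_E lookup_basis_vec in_vec_space_iff)
  qed (simp add: lookup_basis_vec)
qed

lemma E_nilpotent: "x \<in> space (E m) \<Longrightarrow> \<exists>k. (act_e (E m) ^^ k) x = 0"
  using sl2_nil.e_nil[OF nil_vec[OF E_closed]] by simp

lemma E_top:
  assumes x: "x \<in> space (E m)" "x \<noteq> 0"
  shows "\<exists>k c. c \<noteq> 0 \<and> (act_e (E m) ^^ k) x = vscale c (basis_vec 0)"
proof -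
  define k where "k = (LEAST k. (act_e (E m) ^^ k) x = 0)"
  have k: "(act_e (E m) ^^ k) x = 0" unfolding k_def using LeastI_ex[OF E_nilpotent[OF x(1)]] .
  then obtain k' where k': "k = Suc k'" using x(2) by (cases k) auto
  let ?y = "(act_e (E m) ^^ k') x"
  have y: "?y \<noteq> 0" "act_e (E m) ?y = 0"
    using k not_less_Least[of k' "\<lambda>k. (act_e (E m) ^^ k) x = 0"] by (auto simp: k' k_def[symmetric])
  have "?y \<in> space (E m)" by (cases k') (use x sl2_in_space[OF E_closed, of m] in auto)
  from E_kernel_e[OF this y(2)] have *: "?y = vscale (lookup ?y 0) (basis_vec 0)" .
  then have "lookup ?y 0 \<noteq> 0" using y(1) by (metis vscale_simps(1))
  then show ?thesis using * by blast
qed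

lemma submodule_pow:
  "submodule N V \<Longrightarrow> x \<in> N \<Longrightarrow> (act_e V ^^ k) x \<in> N"
  "submodule N V \<Longrightarrow> x \<in> N \<Longrightarrow> (act_f V ^^ k) x \<in> N"
  by (induction k) (auto simp: submodule_def)

text \<open>Powers of e take any nonzero vector to a nonzero multiple of the highest weight vector,
  from which powers of f recover the whole basis.\<close>

lemma simple_E: "simple_module (E m)"
  unfolding simple_module_def
proof (intro conjI allI impI E_closed)
  have "basis_vec 0 \<in> space (E m)" by simp
  then show "space (E m) \<noteq> {0}" using basis_vec_nonzero[of 0] by blast
  fix N assume N: "submodule N (E m)"
  show "N = {0} \<or> N = space (E m)"
  proof (cases "N = {0}")
    case False
    have sub: "vec.subspace N" "N \<subseteq> space (E m)" using N by (auto simp: submodule_def)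
    then obtain x where x: "x \<in> N" "x \<noteq> 0" using False vec.subspace_0 by blast
    then obtain k c where c: "c \<noteq> 0" "(act_e (E m) ^^ k) x = vscale c (basis_vec 0)" using E_top sub by blast
    then have "vscale (1 / c) (vscale c (basis_vec 0)) \<in> N"
      using submodule_pow(1)[OF N x(1), of k] vec.subspace_scale[OF sub(1)] by metis
    then have b0: "basis_vec 0 \<in> N" using c by simp
    have "k \<le> m \<Longrightarrow> basis_vec k \<in> N" for k
    proof (induction k)
      case (Suc k)
      have "act_f (E m) (basis_vec k) \<in> N" using Suc N by (auto simp: submodule_def)
      then have "vscale (1 / (of_nat m - of_nat k)) (vscale (of_nat m - of_nat k) (basis_vec (Suc k))) \<in> N"
        using Suc.prems by (intro vec.subspace_scale[OF sub(1), of "vscale (of_nat m - of_nat k) (basis_vec (Suc k))"]) (simp add: act_E_basis_vec)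
      moreover have "of_nat m - of_nat k \<noteq> (0 :: complex)"
        using Suc.prems by (metis Suc_n_not_le_n eq_iff_diff_eq_0 of_nat_eq_iff)
      ultimately show ?case by simp
    qed (use b0 in simp)
    then have "vec.span (basis_vec ` {..m}) \<subseteq> N" using sub(1) by (intro vec.span_minimal) auto
    then have "space (E m) \<subseteq> N" using vec_space_finite_span[of "{..m}"] by simp
    then show ?thesis using sub by blast
  qed simp
qed

lemma submodule_kernel: "f \<in> sl2_hom V W \<Longrightarrow> V \<in> sl2_modules \<Longrightarrow> W \<in> sl2_modules \<Longrightarrow> submodule {v \<in> space V. f v = 0} V"
  by (auto simp: submodule_def vec.subspace_def lin_simps[OF hom_lin] sl2_homD(5-7) lin_zero[OF lin_act_e] lin_zero[OF lin_act_f] lin_zero[OF lin_act_h])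

lemma submodule_image:
  assumes f: "f \<in> sl2_hom V W" and V: "V \<in> sl2_modules" and N: "submodule N V"
  shows "submodule (f ` N) W"
  unfolding submodule_def
proof (intro conjI ballI)
  show "f ` N \<subseteq> space W" using hom_in[OF f] by auto
  show "vec.subspace (f ` N)"
    using N vecp.linear_subspace_image[OF hom_lin[OF f]] by (simp add: submodule_def)
qed (use N in \<open>auto simp: submodule_def simp flip: sl2_homD(5-7)[OF f]\<close>)

lemma submodule_whole: "V \<in> sl2_modules \<Longrightarrow> submodule (space V) V"
  by (simp add: submodule_def)

lemma hom_injective_iff:
  assumes f: "f \<in> sl2_hom V W" and k: "\<And>v. v \<in> space V \<Longrightarrow> f v = 0 \<Longrightarrow> v = 0"
  shows "inj_on f (space V)"
proof (rule inj_onI)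
  fix x y assume "x \<in> space V" "y \<in> space V" "f x = f y"
  then have "x - y = 0" by - (rule k, simp_all add: lin_diff[OF hom_lin[OF f]])
  then show "x = y" by simp
qed

lemma simple_hom:
  assumes f: "f \<in> sl2_hom V W" and V: "V \<in> sl2_modules" and W: "W \<in> sl2_modules" and x: "f x \<noteq> 0"
  shows "simple_module V \<Longrightarrow> inj_on f (space V)" "simple_module W \<Longrightarrow> f ` space V = space W"
proof -
  have x': "idm V x \<in> space V" "f (idm V x) \<noteq> 0" using x by (simp_all add: hom_dom[OF f])
  show "inj_on f (space V)" if "simple_module V"
  proof (rule hom_injective_iff[OF f])
    have "{v \<in> space V. f v = 0} = {0} \<or> {v \<in> space V. f v = 0} = space V"
      using that submodule_kernel[OF f V W] by (simp add: simple_module_def)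
    then show "v \<in> space V \<Longrightarrow> f v = 0 \<Longrightarrow> v = 0" for v using x' by blast
  qed
  show "f ` space V = space W" if "simple_module W"
    using that submodule_image[OF f V submodule_whole[OF V]] x' by (force simp: simple_module_def)
qed

lemma bijective_hom_iso:
  assumes f: "f \<in> sl2_hom V W" and V: "V \<in> sl2_modules" and W: "W \<in> sl2_modules"
    and incl: "inj_on f (space V)" and sur: "f ` space V = space W"
  shows "mod_iso V W"
proof -
  obtain g where g: "lin g" "\<And>v. v \<in> space V \<Longrightarrow> g (f v) = v" "\<And>w. g w \<in> space V"
    using vecp.linear_exists_left_inverse_on[OF hom_lin[OF f] subspace_vec_space incl] by blast
  have fg: "f (g w) = w" if "w \<in> space W" for w
    using that g(2) sur by force
  have incl': "x = y" if "x \<in> space V" "y \<in> space V" "f x = f y" for x y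
    using that incl by (auto simp: inj_on_def)
  have gg: "g \<circ> idm W \<in> sl2_hom W V"
    by (intro sl2_homI linear_mapsI W; (rule incl')?; simp add: g fg V W sl2_homD(5-7)[OF f])
  moreover have "(g \<circ> idm W) \<circ> f = idm V"
  proof
    fix v show "((g \<circ> idm W) \<circ> f) v = idm V v"
      using g(2)[OF id_map_in, of v] by (simp add: hom_cod[OF f] hom_dom[OF f])
  qed
  moreover have "f \<circ> (g \<circ> idm W) = idm W" by (simp add: fun_eq_iff fg)
  ultimately show ?thesis using f unfolding mod_iso_def by blast
qed

lemma independent_basis_vecs: "vec.independent (basis_vec ` B)"
  unfolding vec.independent_explicit_finite_subsets
proof (intro allI impI ballI)
  fix S u v assume S: "S \<subseteq> basis_vec ` B" "finite S" "(\<Sum>v\<in>S. vscale (u v) v) = 0" "v \<in> S"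
  then obtain i where i: "v = basis_vec i" by auto
  have "0 = lookup (\<Sum>v\<in>S. vscale (u v) v) i" using S by simp
  also have "\<dots> = (\<Sum>w\<in>S. if w = v then u w else 0)"
    unfolding lookup_sum
  proof (rule sum.cong)
    fix w assume "w \<in> S"
    then obtain j where j: "w = basis_vec j" using S by auto
    have "basis_vec j = basis_vec i \<longleftrightarrow> j = i" by (metis lookup_basis_vec zero_neq_one)
    then show "lookup (vscale (u w) w) i = (if w = v then u w else 0)" by (simp add: i j lookup_basis_vec)
  qed simp
  also have "\<dots> = u v" using S by simp
  finally show "u v = 0" by simp
qed

lemma inj_basis_vec: "inj_on basis_vec B"
  by (rule inj_onI) (metis lookup_basis_vec zero_neq_one)

lemma vec_space_span: "vec.span (basis_vec ` B) = vec_space B"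
proof
  show "vec.span (basis_vec ` B) \<subseteq> vec_space B" by (rule vec.span_minimal) auto
  show "vec_space B \<subseteq> vec.span (basis_vec ` B)"
  proof
    fix v assume v: "v \<in> vec_space B"
    then have "(\<Sum>i\<in>keys v. vscale (lookup v i) (basis_vec i)) \<in> vec.span (basis_vec ` B)"
      by (intro vec.span_sum vec.span_scale vec.span_base) (auto simp: vec_space_def)
    then show "v \<in> vec.span (basis_vec ` B)" using vec_expand by metis
  qed
qed

lemma card_basis_le:
  assumes f: "f \<in> sl2_hom V W" and incl: "inj_on f (space V)" and fin: "finite (basis W)"
  shows "card (basis V) \<le> card (basis W)" "y \<in> space W \<Longrightarrow> y \<notin> f ` space V \<Longrightarrow> card (basis V) < card (basis W)"
proof -
  let ?A = "f ` basis_vec ` basis V"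
  have incl': "inj_on f (vec.span (basis_vec ` basis V))" using incl by (simp add: vec_space_span)
  have ind: "vec.independent ?A"
    by (rule vecp.linear_independent_injective_image[OF hom_lin[OF f] independent_basis_vecs incl'])
  have "basis_vec ` basis V \<subseteq> space V" by auto
  then have card: "card ?A = card (basis V)"
    by (simp add: card_image inj_on_subset[OF incl] inj_basis_vec)
  have sp: "?A \<subseteq> vec.span (basis_vec ` basis W)" using hom_in[OF f] by (auto simp: vec_space_span)
  note b = vec.independent_span_bound[OF finite_imageI[OF fin]]
  show "card (basis V) \<le> card (basis W)"
    using b[OF ind sp] by (simp add: card card_image inj_basis_vec)
  show "card (basis V) < card (basis W)" if y: "y \<in> space W" "y \<notin> f ` space V"
  proof -
    have "vec.span ?A = f ` space V"
      by (simp add: vecp.linear_span_image[OF hom_lin[OF f]] vec_space_span)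
    then have nin: "y \<notin> vec.span ?A" using y by simp
    then have nA: "y \<notin> ?A" by (rule contrapos_nn) (rule vec.span_base)
    then have "vec.independent (insert y ?A)" using ind nin by (simp add: vec.independent_insert)
    moreover have "insert y ?A \<subseteq> vec.span (basis_vec ` basis W)" using sp y by (simp add: vec_space_span)
    ultimately have "card (insert y ?A) \<le> card (basis_vec ` basis W)" using b[of "insert y ?A"] by simp
    moreover have "finite ?A" using b[OF ind sp] by simp
    ultimately show ?thesis using nA card by (simp add: card_image inj_basis_vec)
  qed
qed

lemma E_hom_exists:
  assumes V: "V \<in> sl2_modules" and v: "v \<in> space V" "act_e V v = 0" "act_h V v = vscale (of_nat m) v" "(act_f V ^^ Suc m) v = 0"
  obtains a where "a \<in> sl2_hom (E m) V" "a (basis_vec 0) = v"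
proof -
  interpret R: sl2_rep vscale "act_e V" "act_f V" "act_h V" by (rule rep_vec[OF V])
  note lV = lin_simps(1-5)[OF lin_act_e[OF V]] lin_simps(1-5)[OF lin_act_f[OF V]] lin_simps(1-5)[OF lin_act_h[OF V]]
  let ?F = "\<lambda>k. (act_f V ^^ k) v"
  \<comment> \<open>In \<open>E m\<close> the vector f^k b_0 is m! / (m - k)! times b_k, so b_k has
    to go to the inverse multiple of f^k v.\<close>
  define co where "co k = (fact (m - k) / fact m :: complex)" for k
  define a where "a = linear_extension (\<lambda>k. if k \<le> m then vscale (co k) (?F k) else 0)"
  have la: "lin a" by (simp add: a_def)
  have ab: "a (basis_vec k) = (if k \<le> m then vscale (co k) (?F k) else 0)" for k by (simp add: a_def)
  have Fs: "lin ((act_f V) ^^ k)" for k by (induction k) (auto simp: lin_iff lV)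
  have hF: "act_h V (?F k) = vscale (of_nat m - 2 * of_nat k) (?F k)" for k
    unfolding R.h_fk by (simp add: v(3) lin_scale[OF Fs] vec.scale_left_diff_distrib)
  have eF: "act_e V (?F (Suc k)) = vscale (of_nat (Suc k) * (of_nat m - of_nat k)) (?F k)" for k
    unfolding R.e_fk by (simp only: v(2,3) lin_zero[OF Fs] add_0_left) (simp add: lin_scale[OF Fs] lin_diff[OF Fs] vec.scale_left_diff_distrib vec.scale_right_diff_distrib algebra_simps)
  have co: "co k = (of_nat m - of_nat k) * co (Suc k)" if "k < m" for k
  proof -
    have "m - k = Suc (m - Suc k)" using that by simp
    then have "fact (m - k) = (of_nat (m - k) :: complex) * fact (m - Suc k)" by (metis fact_Suc of_nat_Suc)
    then show ?thesis using that by (simp add: co_def of_nat_diff)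
  qed
  have Fsp: "?F k \<in> space V" for k by (cases k) (auto simp: v V)
  have "a \<in> sl2_hom (E m) V"
  proof (rule sl2_homI')
    note s = la act_E_basis_vec lin_simps(1-5)[OF la] lin_sl2[OF V] lV ab
    show "lin a" by (rule la)
    show "a \<circ> idm (E m) = a" by (rule lin_ext) (simp_all add: la ab id_map_basis_vec lin_zero[OF la])
    show "idm V \<circ> a = a" by (rule lin_ext) (simp_all add: la ab Fsp)
    show "a \<circ> act_h (E m) = act_h V \<circ> a" by (rule lin_ext) (simp_all add: s hF mult.commute)
    show "a \<circ> act_e (E m) = act_e V \<circ> a"
    proof (rule lin_ext)
      fix k show "(a \<circ> act_e (E m)) (basis_vec k) = (act_e V \<circ> a) (basis_vec k)"
      proof (cases k)
        case (Suc j)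
        show ?thesis
        proof (cases "k \<le> m")
          case True
          then show ?thesis
            using Suc co[of j] by (simp add: s eF mult_ac del: funpow.simps of_nat_Suc)
        next
          case False
          then show ?thesis using Suc by (simp add: s)
        qed
      qed (simp add: s v)
    qed (simp_all add: s)
    show "a \<circ> act_f (E m) = act_f V \<circ> a"
    proof (rule lin_ext)
      fix k show "(a \<circ> act_f (E m)) (basis_vec k) = (act_f V \<circ> a) (basis_vec k)"
      proof (cases "k < m")
        case True
        then show ?thesis by (simp add: s co[of k])
      next
        case False
        then show ?thesis using v(4) by (cases "k = m") (simp_all add: s)
      qed
    qed (simp_all add: s)
  qed
  moreover have "a (basis_vec 0) = v" by (simp add: ab co_def)
  ultimately show ?thesis using that by blast
qed

lemma E_hom_injective:
  assumes V: "V \<in> sl2_modules" and a: "a \<in> sl2_hom (E m) V" and n: "a (basis_vec 0) \<noteq> 0"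
  shows "inj_on a (space (E m))"
  by (rule simple_hom(1)[OF a E_closed V n simple_E])

lemma thr_nonzero:
  assumes "thr As V W f" "f x \<noteq> 0"
  shows "\<exists>A\<in>set As. \<exists>v\<in>sl2_hom V A. \<exists>u\<in>sl2_hom A W. A \<in> sl2_modules \<and> u (v x) \<noteq> 0"
  using assms
proof (induction rule: thr.induct)
  case (thr_Cons As V W f A v u)
  then show ?case by (cases "u (v x) = 0") auto
qed auto

text \<open>A highest weight vector generates a copy of some \<open>E m\<close>,
  \<open>splitting_exists\<close> splits it off, and the complement has smaller dimension.\<close>

theorem complete_reducibility:
  assumes "V \<in> sl2_modules" "finite (basis V)"
  shows "\<exists>As. set As \<subseteq> range E \<and> splits_through As V"
  using assms
proof (induction "card (basis V)" arbitrary: V rule: less_induct)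
  case less
  note V = less.prems
  show ?case
  proof (cases "\<exists>x. x \<in> space V \<and> x \<noteq> 0")
    case False
    then have "idm V x = 0" for x using id_map_in by blast
    then show ?thesis by (intro exI[of _ "[]"]) (auto intro: thr_Nil')
  next
    case True
    interpret N: sl2_nil vscale "act_e V" "act_f V" "act_h V" "space V" by (rule nil_vec[OF V])
    obtain v m where v: "v \<in> space V" "v \<noteq> 0" "act_e V v = 0" "act_h V v = vscale (of_nat m) v" "(act_f V ^^ Suc m) v = 0"
      using True N.highest_weight_vector by metis
    obtain a where a: "a \<in> sl2_hom (E m) V" "a (basis_vec 0) = v" using E_hom_exists[OF V(1) v(1,3-5)] .
    obtain b where b: "b \<in> sl2_hom V (E m)" "b \<circ> a = idm (E m)"
      using splitting_exists[OF V E_closed _ a(1) E_hom_injective[OF V(1) a(1)]] a(2) v(2) by auto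
    have ba: "b (a x) = idm (E m) x" for x using b(2) by (metis comp_apply)
    let ?e = "idm V - (a \<circ> b)"
    have e: "?e \<in> sl2_hom V V" by (intro hom_minus V hom_id hom_comp[OF b(1) a(1)])
    note la = lin_simps(1-5)[OF hom_lin[OF a(1)]] lin_simps(1-5)[OF hom_lin[OF b(1)]] lin_simps(1-5)[OF lin_id_map]
      sl2_homD(2,3)[OF a(1), simplified] sl2_homD(2,3)[OF b(1), simplified]
    have "?e \<circ> ?e = ?e" by (simp add: fun_eq_iff la ba)
    from idempotent_splits[OF V(1) e this] obtain W r s where W: "W \<in> sl2_modules" "r \<in> sl2_hom V W" "s \<in> sl2_hom W V"
      "r \<circ> s = idm W" "s \<circ> r = ?e" "finite (basis W)" using V(2) by metis
    have rs: "r (s w) = idm W w" for w using W(4) by (metis comp_apply)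
    have sr: "s (r x) = idm V x - a (b x)" for x using W(5) by (simp add: fun_eq_iff)
    have incl: "inj_on s (space W)"
      by (rule inj_onI) (metis rs id_map_eq)
    have "v \<notin> s ` space W"
    proof
      assume "v \<in> s ` space W"
      then obtain w where w: "w \<in> space W" "v = s w" by auto
      have "s w = s (r (s w))" by (simp add: rs hom_dom[OF W(3)])
      also have "\<dots> = v - a (b v)" using v(1) by (simp add: sr w(2))
      also have "a (b v) = v" using a(2) ba[of "basis_vec 0"] hom_dom[OF a(1), of "basis_vec 0"] by metis
      finally show False using w v(2) by simp
    qed
    then have "card (basis W) < card (basis V)" using card_basis_le(2)[OF W(3) incl V(2) v(1)] by blast
    then obtain As where As: "set As \<subseteq> range E" "splits_through As W" using less.hyps W by blast
    have "thr As V V (s \<circ> idm W \<circ> r)" by (rule thr_comp[OF As(2) W(2,3)])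
    then have "splits_through (E m # As) V"
    proof (rule thr_Cons'[OF _ E_closed b(1) a(1)])
      show "idm V = (a \<circ> b) + (s \<circ> idm W \<circ> r)" by (simp add: fun_eq_iff hom_cod[OF W(2)] sr)
    qed
    then show ?thesis using As(1) by (intro exI[of _ "E m # As"]) auto
  qed
qed

text \<open>\<open>L_fd\<close> is a choice of which only simplicity and dimension are known.
  Complete reducibility provides a nonzero, hence bijective, map from some \<open>E k\<close>, and
  the dimension fixes k.\<close>

lemma L_fd_iso: "mod_iso (E m) (L_fd m)" and L_fd_closed: "L_fd m \<in> sl2_modules" "finite (basis (L_fd m))"
proof -
  define V where "V = L_fd m"
  have "simple_module V \<and> finite (basis V) \<and> card (basis V) = m + 1"
    unfolding V_def L_fd_def by (rule someI[of _ "E m"]) (simp add: simple_E)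
  then have V: "simple_module V" "V \<in> sl2_modules" "finite (basis V)" "card (basis V) = m + 1"
    by (auto simp: simple_module_def)
  show "L_fd m \<in> sl2_modules" "finite (basis (L_fd m))" using V by (auto simp: V_def)
  obtain As where As: "set As \<subseteq> range E" "splits_through As V" using complete_reducibility[OF V(2,3)] by blast
  obtain x where x: "x \<in> space V" "x \<noteq> 0"
    using V(1) vec.subspace_0[OF subspace_vec_space] by (force simp: simple_module_def)
  then have "idm V x \<noteq> 0" by simp
  from thr_nonzero[OF As(2) this] obtain A u where A: "A \<in> set As" "u \<in> sl2_hom A V" "\<exists>y. u y \<noteq> 0" by blast
  then obtain k y where k: "A = E k" "u y \<noteq> 0" using As(1) by auto
  note u = A(2)[unfolded k(1)]
  note si = simple_hom[OF u E_closed V(2) k(2)]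
  have iso: "mod_iso (E k) V" by (rule bijective_hom_iso[OF u E_closed V(2) si(1)[OF simple_E] si(2)[OF V(1)]])
  have "k + 1 \<le> m + 1" using card_basis_le(1)[OF u si(1)[OF simple_E] V(3)] V(4) by simp
  moreover obtain g f where g: "g \<in> sl2_hom V (E k)" "f \<circ> g = idm V"
    using iso unfolding mod_iso_def by blast
  have "inj_on g (space V)"
  proof (rule inj_onI)
    fix x y assume "x \<in> space V" "y \<in> space V" "g x = g y"
    then show "x = y" using fun_cong[OF g(2), of x] fun_cong[OF g(2), of y] by simp
  qed
  from card_basis_le(1)[OF g(1) this] have "m + 1 \<le> k + 1" using V(4) by simp
  ultimately have "k = m" by simp
  then show "mod_iso (E m) (L_fd m)" using iso by (simp add: V_def)
qed

section \<open>The module category generated by a ladder\<close>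

interpretation fv: vector_space map_scale
  by (rule map_scale_vector_space)

definition zero_module :: sl2_module where
  "zero_module = \<lparr>basis = {}, act_e = 0, act_f = 0, act_h = 0\<rparr>"

lemma zero_module_closed: "zero_module \<in> sl2_modules" and idm_zero_module: "idm zero_module v = 0"
proof -
  have act: "act_e zero_module v = 0" "act_f zero_module v = 0" "act_h zero_module v = 0" for v
    by (simp_all add: zero_module_def)
  have "lin (act_e zero_module)" "lin (act_f zero_module)" "lin (act_h zero_module)"
    by (simp_all add: zero_module_def)
  then show "zero_module \<in> sl2_modules"
    by (intro sl2_modulesI) (simp_all add: linear_maps_iff act lin_zero[OF lin_id_map])
  show "idm zero_module v = 0"
    by (rule vec_eqI) (simp add: zero_module_def)
qed

text \<open>The basis is tagged with 0 and 1 through the pairing already used for tensor products,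
  so \<open>incl\<close> and \<open>prj\<close> serve as injections and projections.\<close>

definition osum :: "sl2_module \<Rightarrow> sl2_module \<Rightarrow> sl2_module" where
  "osum A B = \<lparr>basis = prod_encode ` ({0} \<times> basis A \<union> {1} \<times> basis B),
     act_e = (\<lambda>v. incl 0 (act_e A (prj 0 v)) + incl 1 (act_e B (prj 1 v))),
     act_f = (\<lambda>v. incl 0 (act_f A (prj 0 v)) + incl 1 (act_f B (prj 1 v))),
     act_h = (\<lambda>v. incl 0 (act_h A (prj 0 v)) + incl 1 (act_h B (prj 1 v)))\<rparr>"

lemma lookup_prj: "lookup (prj i v) j = lookup v (prod_encode (i, j))"
proof -
  have "(\<lambda>v. vscale (lookup (prj i v) j) (basis_vec 0)) = (\<lambda>v. vscale (lookup v (prod_encode (i, j))) (basis_vec 0))"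
  proof (rule lin_ext)
    fix n
    obtain a b where n: "n = prod_encode (a, b)" by (metis prod.exhaust prod_decode_inverse)
    show "vscale (lookup (prj i (basis_vec n)) j) (basis_vec 0) = vscale (lookup (basis_vec n) (prod_encode (i, j))) (basis_vec 0)"
      by (simp add: n prj_def lookup_basis_vec prod_encode_eq)
  qed (auto simp: lin_iff lookup_add vec.scale_left_distrib)
  then have "lookup (vscale (lookup (prj i v) j) (basis_vec 0)) 0 = lookup (vscale (lookup v (prod_encode (i, j))) (basis_vec 0)) 0"
    by (simp add: fun_eq_iff)
  then show ?thesis by (simp add: lookup_basis_vec)
qed

lemma lookup_incl: "lookup (incl i v) (prod_encode (a, b)) = (if a = i then lookup v b else 0)"
  by (simp add: lookup_tensor_vec lookup_basis_vec)

lemma idm_osum: "idm (osum A B) v = incl 0 (idm A (prj 0 v)) + incl 1 (idm B (prj 1 v))"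
proof (rule vec_eqI)
  fix n
  obtain a b where n: "n = prod_encode (a, b)" by (metis prod.exhaust prod_decode_inverse)
  show "lookup (idm (osum A B) v) n = lookup (incl 0 (idm A (prj 0 v)) + incl 1 (idm B (prj 1 v))) n"
    by (auto simp: n osum_def lookup_add lookup_incl lookup_prj image_iff prod_encode_eq)
qed

lemma osum:
  assumes A: "A \<in> sl2_modules" and B: "B \<in> sl2_modules"
  shows "osum A B \<in> sl2_modules"
    "incl 0 \<circ> idm A \<in> sl2_hom A (osum A B)" "incl 1 \<circ> idm B \<in> sl2_hom B (osum A B)"
    "idm A \<circ> prj 0 \<in> sl2_hom (osum A B) A" "idm B \<circ> prj 1 \<in> sl2_hom (osum A B) B"
proof -
  note l = lin_simps(1-5)[OF lin_act_e[OF A]] lin_simps(1-5)[OF lin_act_f[OF A]] lin_simps(1-5)[OF lin_act_h[OF A]]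
    lin_simps(1-5)[OF lin_act_e[OF B]] lin_simps(1-5)[OF lin_act_f[OF B]] lin_simps(1-5)[OF lin_act_h[OF B]]
    lin_simps(1-5)[OF lin_id_map]
  have act: "act_e (osum A B) v = incl 0 (act_e A (prj 0 v)) + incl 1 (act_e B (prj 1 v))"
    "act_f (osum A B) v = incl 0 (act_f A (prj 0 v)) + incl 1 (act_f B (prj 1 v))"
    "act_h (osum A B) v = incl 0 (act_h A (prj 0 v)) + incl 1 (act_h B (prj 1 v))" for v
    by (simp_all add: osum_def)
  note s = act idm_osum sl2_absorb[OF A] sl2_absorb[OF B] sl2_rels[OF A] sl2_rels[OF B] l tensor_vec_bilinear vec.scale_right_distrib
  have lact: "lin (act_e (osum A B))" "lin (act_f (osum A B))" "lin (act_h (osum A B))"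
    by (simp_all add: lin_iff s; simp add: add_ac)+
  show closed: "osum A B \<in> sl2_modules"
    by (intro sl2_modulesI; (simp add: linear_maps_iff lact)?; simp add: s; (rule vec_eqI, simp only: lk, simp)?)
  show "incl 0 \<circ> idm A \<in> sl2_hom A (osum A B)" "incl 1 \<circ> idm B \<in> sl2_hom B (osum A B)"
    "idm A \<circ> prj 0 \<in> sl2_hom (osum A B) A" "idm B \<circ> prj 1 \<in> sl2_hom (osum A B) B"
    by (intro sl2_homI'; simp add: fun_eq_iff s)+
qed

lemma biprod_osum:
  assumes A: "A \<in> sl2_modules" and B: "B \<in> sl2_modules"
  shows "biprod As B \<Longrightarrow> biprod (A # As) (osum A B)"
  by (rule biprod_Cons[OF _ osum(2,4)[OF A B] osum(3,5)[OF A B]])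
    (auto simp: fun_eq_iff idm_osum lin_zero[OF lin_id_map])

lemma biprod_pair: "A \<in> sl2_modules \<Longrightarrow> B \<in> sl2_modules \<Longrightarrow> biprod [A, B] (osum A B)"
  by (rule biprod_osum[OF _ _ biprod_single])

lemma biprod_with_zero:
  assumes V: "V \<in> sl2_modules"
  shows "biprod [V, zero_module] V"
proof (rule biprod_Cons[OF biprod_single[OF zero_module_closed], of "idm V" _ _ "idm V" 0 0])
  show "0 \<in> sl2_hom zero_module V" "0 \<in> sl2_hom V zero_module"
    by (rule hom_zero[OF V], rule hom_zero[OF zero_module_closed])
qed (use V in \<open>auto simp: fun_eq_iff idm_zero_module lin_zero[OF lin_id_map]\<close>)

lemma E0_trivial: "E 0 = trivial_module"
proof -
  have "act_e (E 0) = 0" "act_f (E 0) = 0" "act_h (E 0) = 0"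
    by (rule lin_ext; simp add: act_E_basis_vec)+
  then show ?thesis by (auto simp: E_def trivial_module_def)
qed

text \<open>The vector b_0 \<otimes> b_0 in L(1) \<otimes> L(m) is a highest weight vector of weight
  m + 1. Iterated, this makes every L(m) a summand of a tensor power of L(1), which reduces the
  action of all finite dimensional modules to \<open>F\<close>.\<close>

lemma E_Suc_retract:
  obtains a b where "a \<in> sl2_hom (E (Suc m)) (F (E m))" "b \<in> sl2_hom (F (E m)) (E (Suc m))" "b \<circ> a = idm (E (Suc m))"
    "a (basis_vec 0) = incl 0 (basis_vec 0)"
proof -
  let ?v = "incl 0 (basis_vec 0)"
  have fin: "finite (basis (F (E m)))" by (simp add: F_def basis_tensor_module)
  have sp: "?v \<in> space (F (E m))" by (simp add: F_def basis_tensor_module tensor_vec_in)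
  have e: "act_e (F (E m)) ?v = 0"
    by (simp add: actF act_E_basis_vec tensor_vec_bilinear lin_zero[OF lin_act_E(1)] lin_zero[OF lin_id_map])
  have h: "act_h (F (E m)) ?v = vscale (of_nat (Suc m)) ?v"
    by (simp add: actF act_E_basis_vec tensor_vec_bilinear lin_zero[OF lin_act_E(3)] lin_zero[OF lin_id_map] id_map_basis_vec
        vec.scale_left_distrib add.commute)
  interpret R: sl2_nil vscale "act_e (F (E m))" "act_f (F (E m))" "act_h (F (E m))" "space (F (E m))"
    by (rule nil_vec[OF F_closed[OF E_closed] fin])
  obtain a where a: "a \<in> sl2_hom (E (Suc m)) (F (E m))" "a (basis_vec 0) = ?v"
    using E_hom_exists[OF F_closed[OF E_closed] sp e h R.highest_weight_power[OF sp e h]] .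
  have nz: "a (basis_vec 0) \<noteq> 0"
    using a(2) by (simp add: tensor_vec_basis_vec)
  obtain b where "b \<in> sl2_hom (F (E m)) (E (Suc m))" "b \<circ> a = idm (E (Suc m))"
    using splitting_exists[OF F_closed[OF E_closed] fin E_closed _ a(1) E_hom_injective[OF F_closed[OF E_closed] a(1) nz]] by auto
  then show ?thesis using that a by blast
qed

lemma mod_iso_tensor:
  assumes "mod_iso A B" "A \<in> sl2_modules" "B \<in> sl2_modules" "V \<in> sl2_modules"
  shows "mod_iso (tensor_module A V) (tensor_module B V)"
proof -
  obtain f g where fg: "f \<in> sl2_hom A B" "g \<in> sl2_hom B A" "g \<circ> f = idm A" "f \<circ> g = idm B"
    using assms(1) by (auto simp: mod_iso_def)
  have "tensor_map g (idm V) \<circ> tensor_map f (idm V) = idm (tensor_module A V)"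
    "tensor_map f (idm V) \<circ> tensor_map g (idm V) = idm (tensor_module B V)"
    using assms fg by (simp_all add: tensor_map_comp hom_lin idm_tensor hom_id_left[OF hom_id])
  then show ?thesis
    unfolding mod_iso_def using fg assms
    by (intro bexI[of _ "tensor_map f (idm V)"] bexI[of _ "tensor_map g (idm V)"]) (auto intro: tensor_map_hom)
qed

lemma thr_nonzero_comp:
  assumes "thr As V W g" "lin f" "f (g x) \<noteq> 0"
  shows "\<exists>A\<in>set As. \<exists>v\<in>sl2_hom V A. \<exists>u\<in>sl2_hom A W. f (u (v x)) \<noteq> 0"
  using assms
proof (induction rule: thr.induct)
  case (thr_Cons As V W g A v u)
  then show ?case by (cases "f (u (v x)) = 0") (auto simp: lin_add[OF thr_Cons.prems(1)])
qed (auto simp: lin_zero)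

lemma biprod_pairE:
  assumes "biprod [A, B] V"
  obtains i p j q where "i \<in> sl2_hom A V" "j \<in> sl2_hom B V" "p \<in> sl2_hom V A" "q \<in> sl2_hom V B"
    "p \<circ> i = idm A" "q \<circ> j = idm B" "p \<circ> j = 0" "q \<circ> i = 0" "(i \<circ> p) + (j \<circ> q) = idm V"
proof -
  from assms obtain \<iota> \<pi> where d: "\<forall>k<length [A, B]. \<iota> k \<in> sl2_hom ([A, B] ! k) V \<and> \<pi> k \<in> sl2_hom V ([A, B] ! k)"
    "\<forall>k<length [A, B]. \<forall>l<length [A, B]. \<pi> k \<circ> \<iota> l = (if k = l then idm ([A, B] ! k) else 0)"
    "(\<Sum>k<length [A, B]. \<iota> k \<circ> \<pi> k) = idm V"
    unfolding biprod_def by blast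
  have s: "(\<iota> 0 \<circ> \<pi> 0) + (\<iota> (Suc 0) \<circ> \<pi> (Suc 0)) = idm V" using d(3) by simp
  show ?thesis
    using that[OF _ _ _ _ _ _ _ _ s] d(1)[rule_format, of 0] d(1)[rule_format, of "Suc 0"]
      d(2)[rule_format, of 0 0] d(2)[rule_format, of 0 "Suc 0"] d(2)[rule_format, of "Suc 0" 0] d(2)[rule_format, of "Suc 0" "Suc 0"]
    by simp
qed

lemma biprod_component:
  assumes "biprod As V" "k < length As"
  obtains i p where "i \<in> sl2_hom (As ! k) V" "p \<in> sl2_hom V (As ! k)" "p \<circ> i = idm (As ! k)"
proof -
  from assms(1) obtain \<iota> \<pi> where d: "\<forall>k<length As. \<iota> k \<in> sl2_hom (As ! k) V \<and> \<pi> k \<in> sl2_hom V (As ! k)"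
    "\<forall>k<length As. \<forall>l<length As. \<pi> k \<circ> \<iota> l = (if k = l then idm (As ! k) else 0)"
    unfolding biprod_def by blast
  show ?thesis
    using that[of "\<iota> k" "\<pi> k"] d(1)[rule_format, OF assms(2)] d(2)[rule_format, OF assms(2) assms(2)] by simp
qed

section \<open>The full subcategory of summands of sums of ladder modules\<close>

locale ladder_modules =
  fixes N X d
  assumes lad: "ladder N X d"
begin

lemma X0: "X 0 = N" and X1: "X 1 = F N" and d0: "d 0 = (\<lambda>v. 0)" and st: "stage i (X i) (d i)" and sc: "scalar_end (X i) (d i)"
  and nz: "\<exists>v. idm (X i) v \<noteq> 0" and bp1: "biprod [X 0, X 0, X 2] (F (X 1))"
  and bp: "i \<ge> 1 \<Longrightarrow> biprod [X i, X (i + 2)] (F (X (i + 1)))"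
  using lad by (auto simp: ladder_def)

lemma Xm [simp]: "X i \<in> sl2_modules" and dh: "d i \<in> sl2_hom (X i) (X i)" and dd: "d i (d i v) = 0"
  using st[of i] by (auto simp: stage_def)

text \<open>This description does not depend on an ambient category;
  \<open>additive_closure_K\<close> identifies it with the additive closures taken in category O and
  in the category of all modules.\<close>

definition K :: "sl2_module set" where
  "K = {V \<in> sl2_modules. \<exists>As. set As \<subseteq> range X \<and> splits_through As V}"

lemma K_sub: "K \<subseteq> sl2_modules"
  by (auto simp: K_def)

lemma splits_self: "V \<in> sl2_modules \<Longrightarrow> splits_through [V] V"
  using thr_single[OF _ hom_id hom_id, of V] by (simp add: hom_id_left[OF hom_id])

lemma X_in_K [simp]: "X i \<in> K"
  unfolding K_def using splits_self[OF Xm[of i]] by (auto intro!: exI[of _ "[X i]"])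

lemma K_splits: "V \<in> sl2_modules \<Longrightarrow> splits_through As V \<Longrightarrow> set As \<subseteq> K \<Longrightarrow> V \<in> K"
  using thr_trans[of As V V "idm V" "range X"] by (auto simp: K_def subset_iff)

lemma K_retract: "V \<in> sl2_modules \<Longrightarrow> W \<in> K \<Longrightarrow> s \<in> sl2_hom V W \<Longrightarrow> r \<in> sl2_hom W V \<Longrightarrow> r \<circ> s = idm V \<Longrightarrow> V \<in> K"
  using K_splits[of V "[W]"] thr_single[of W s V r V] K_sub by auto

lemma K_iso: "V \<in> sl2_modules \<Longrightarrow> mod_iso V W \<Longrightarrow> W \<in> K \<Longrightarrow> V \<in> K"
  unfolding mod_iso_def using K_retract by blast

lemma F_X_K: "F (X i) \<in> K"
proof -
  consider "i = 0" | "i = 1" | j where "i = j + 1" "j \<ge> 1"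
    by (metis One_nat_def Suc_eq_plus1 Suc_le_eq not0_implies_Suc neq0_conv)
  then show ?thesis
  proof cases
    case 1
    then show ?thesis using X_in_K[of 1] by (simp only: X0 X1)
  next
    case 2
    then show ?thesis using biprod_thr[OF bp1] by (intro K_splits[of _ "[X 0, X 0, X 2]"]) auto
  next
    case 3
    then show ?thesis using biprod_thr[OF bp[of j]] by (intro K_splits[of _ "[X j, X (j + 2)]"]) auto
  qed
qed

lemma F_K: "V \<in> K \<Longrightarrow> F V \<in> K"
proof -
  assume V: "V \<in> K"
  then obtain As where As: "set As \<subseteq> range X" "splits_through As V" by (auto simp: K_def)
  have "splits_through (map F As) (F V)"
    using thr_tensor_left[OF E_closed[of 1] As(2)] V K_sub by (auto simp: F_def[abs_def] idm_tensor)
  then show ?thesis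
    using As(1) V K_sub F_X_K by (intro K_splits[of _ "map F As"]) auto
qed

lemma E_tensor_K: "V \<in> K \<Longrightarrow> tensor_module (E m) V \<in> K"
proof (induction m)
  case 0
  have V: "V \<in> sl2_modules" using 0 K_sub by auto
  have "mod_iso (tensor_module (E 0) V) V"
    unfolding mod_iso_def E0_trivial using left_unitor_iso[OF V] by blast
  then show ?case by (rule K_iso[OF tensor_module_closed[OF E_closed V] _ 0])
next
  case (Suc m)
  have V: "V \<in> sl2_modules" using Suc.prems K_sub by auto
  obtain a b where ab: "a \<in> sl2_hom (E (Suc m)) (F (E m))" "b \<in> sl2_hom (F (E m)) (E (Suc m))" "b \<circ> a = idm (E (Suc m))"
    using E_Suc_retract[of m] by metis
  have 1: "F (tensor_module (E m) V) \<in> K" by (intro F_K Suc)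
  have "mod_iso (tensor_module (F (E m)) V) (F (tensor_module (E m) V))"
    unfolding mod_iso_def F_def using associator_iso[OF E_closed E_closed V] by blast
  then have "tensor_module (F (E m)) V \<in> K"
    by (rule K_iso[OF tensor_module_closed[OF F_closed[OF E_closed] V] _ 1])
  moreover have "tensor_map b (idm V) \<circ> tensor_map a (idm V) = idm (tensor_module (E (Suc m)) V)"
    using ab V by (simp add: tensor_map_comp hom_lin idm_tensor hom_id_left[OF hom_id] del: basis_E)
  ultimately show ?case
    using V by (intro K_retract[OF _ _ tensor_map_hom[OF ab(1) hom_id] tensor_map_hom[OF ab(2) hom_id]]) auto
qed

lemma act_K:
  assumes Y: "Y \<in> sl2_modules" "finite (basis Y)" and V: "V \<in> K"
  shows "tensor_module Y V \<in> K"
proof -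
  have Vm: "V \<in> sl2_modules" using V K_sub by auto
  obtain As where As: "set As \<subseteq> range E" "splits_through As Y" using complete_reducibility[OF Y] by blast
  have "splits_through (map (\<lambda>A. tensor_module A V) As) (tensor_module Y V)"
    using thr_tensor_right[OF Vm As(2) Y(1) Y(1)] by (simp add: idm_tensor)
  moreover have "tensor_module A V \<in> K" if A: "A \<in> set As" for A
  proof -
    obtain m where "A = E m" using A As(1) by auto
    then show ?thesis using E_tensor_K[OF V] by simp
  qed
  ultimately show ?thesis
    using Y Vm by (intro K_splits) auto
qed

lemma module_category_K: "module_category FD (Mod K)"
  by (rule module_category_Mod[OF K_sub act_K])

lemma scE:
  assumes "g \<in> sl2_hom (X i) (X i)"
  obtains a b where "\<forall>v. g v = vscale a (idm (X i) v) + vscale b (d i v)"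
  using sc[of i] assms unfolding scalar_end_def by blast

lemma hom_X_zero: "i \<noteq> j \<Longrightarrow> g \<in> sl2_hom (X i) (X j) \<Longrightarrow> g v = 0"
  by (rule stage_hom_zero[OF st st])

text \<open>An endomorphism \<alpha> + \<beta> d is invertible exactly when \<alpha> is nonzero, and
  \<alpha> is additive.\<close>

lemma local_X: "local_endomorphisms (Mod S) (X i)"
  unfolding local_endomorphisms_def Mod_simps
proof (intro conjI ballI impI)
  show "idm (X i) \<noteq> 0" using nz[of i] by auto
  fix f g assume f: "f \<in> sl2_hom (X i) (X i)" and g: "g \<in> sl2_hom (X i) (X i)" and iso: "isomorphism (Mod S) (X i) (X i) (f + g)"
  note ld = lin_simps(1-5)[OF hom_lin[OF dh[of i]]] sl2_homD(2,3)[OF dh[of i]]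
  have unit: "isomorphism (Mod S) (X i) (X i) k" if k: "k \<in> sl2_hom (X i) (X i)" "\<And>v. k v = vscale a (idm (X i) v) + vscale b (d i v)" "a \<noteq> 0" for k a b
  proof -
    \<comment> \<open>The inverse of a + b d, since d^2 = 0.\<close>
    let ?q = "map_scale (1 / a) (idm (X i)) - map_scale (b / (a * a)) (d i)"
    have "?q \<in> sl2_hom (X i) (X i)" by (intro hom_minus hom_scale hom_id dh Xm)
    moreover have "?q \<circ> k = idm (X i)" "k \<circ> ?q = idm (X i)"
      using that(3) by (simp_all add: fun_eq_iff k(2) ld dd lin_simps(1-5)[OF lin_id_map] vec.scale_right_distrib vec.scale_right_diff_distrib)
    ultimately show ?thesis using k(1) by (auto simp: isomorphism_Mod)
  qed
  obtain a b where f': "\<forall>v. f v = vscale a (idm (X i) v) + vscale b (d i v)" using f by (rule scE)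
  obtain a' b' where g': "\<forall>v. g v = vscale a' (idm (X i) v) + vscale b' (d i v)" using g by (rule scE)
  have "a \<noteq> 0 \<or> a' \<noteq> 0"
  proof (rule ccontr)
    assume "\<not> (a \<noteq> 0 \<or> a' \<noteq> 0)"
    then have fg: "(f + g) v = vscale (b + b') (d i v)" for v by (simp add: f' g' vec.scale_left_distrib)
    obtain q where q: "q \<in> sl2_hom (X i) (X i)" "q \<circ> (f + g) = idm (X i)" using iso by (auto simp: isomorphism_Mod)
    have q': "q (vscale (b + b') (d i v)) = idm (X i) v" for v using fun_cong[OF q(2), of v] by (simp only: comp_apply fg)
    have "d i v = 0" for v
    proof -
      have "idm (X i) (d i v) = 0" using q'[of "d i v"] by (simp add: dd lin_zero[OF hom_lin[OF q(1)]])
      then show ?thesis by (simp add: ld)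
    qed
    then have "idm (X i) v = 0" for v using q'[of v] by (simp add: lin_zero[OF hom_lin[OF q(1)]])
    then show False using nz[of i] by simp
  qed
  then show "isomorphism (Mod S) (X i) (X i) f \<or> isomorphism (Mod S) (X i) (X i) g"
    using unit[OF f f'[rule_format]] unit[OF g g'[rule_format]] by blast
qed

lemma K_biprod: "V \<in> K \<Longrightarrow> \<exists>Bs. set Bs \<subseteq> range X \<and> biprod Bs V"
proof -
  assume V: "V \<in> K"
  then obtain As where As: "set As \<subseteq> range X" "splits_through As V" by (auto simp: K_def)
  have "local_endomorphisms (Mod K) A" if "A \<in> set As" for A using that As(1) local_X by auto
  then obtain Bs where "set Bs \<subseteq> set As" "biprod Bs V"
    using krull_schmidt_biprod[OF _ As(2)] V K_sub by blast
  then show ?thesis using As(1) by blast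
qed

lemma zero_in_K: "zero_module \<in> K"
  by (rule K_splits[OF zero_module_closed, of "[]"]) (auto intro: thr_Nil' simp: idm_zero_module)

lemma additive_K: "additive (Mod K)"
  unfolding additive_def
proof (intro allI impI)
  fix As assume "set As \<subseteq> Ob (Mod K)"
  then show "\<exists>D. direct_sum (Mod K) As D"
  proof (induction As)
    case Nil
    then show ?case using zero_in_K by (auto simp: direct_sum_Mod biprod_Nil fun_eq_iff idm_zero_module)
  next
    case (Cons A As)
    then obtain D where D: "D \<in> K" "biprod As D" "A \<in> K" "set As \<subseteq> K" by (auto simp: direct_sum_Mod)
    have m: "A \<in> sl2_modules" "D \<in> sl2_modules" using D K_sub by auto
    have "osum A D \<in> K"
      using biprod_thr[OF biprod_pair[OF m]] m D osum(1)[OF m] by (intro K_splits[of _ "[A, D]"]) auto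
    then show ?case
      using biprod_osum[OF m D(2)] D by (auto simp: direct_sum_Mod)
  qed
qed

lemma idempotent_split_K: "idempotent_split (Mod K)"
  unfolding idempotent_split_def Mod_simps
proof (intro ballI impI)
  fix V e assume V: "V \<in> K" and e: "e \<in> sl2_hom V V" "e \<circ> e = e"
  have Vm: "V \<in> sl2_modules" using V K_sub by auto
  from idempotent_splits[OF Vm e] obtain W r s where W: "W \<in> sl2_modules" "r \<in> sl2_hom V W" "s \<in> sl2_hom W V" "r \<circ> s = idm W" "s \<circ> r = e"
    by metis
  have "W \<in> K" by (rule K_retract[OF W(1) V W(3,2,4)])
  then show "\<exists>b\<in>K. \<exists>r\<in>sl2_hom V b. \<exists>s\<in>sl2_hom b V. r \<circ> s = idm b \<and> s \<circ> r = e"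
    using W by blast
qed

lemma krull_schmidt_K: "krull_schmidt (Mod K)"
  unfolding krull_schmidt_def
proof
  fix V assume "V \<in> Ob (Mod K)"
  then have V: "V \<in> K" by simp
  obtain Bs where "set Bs \<subseteq> range X" "biprod Bs V" using K_biprod[OF V] by blast
  with V show "\<exists>As. direct_sum (Mod K) As V \<and> (\<forall>b\<in>set As. local_endomorphisms (Mod K) b)"
    using local_X by (intro exI[of _ Bs]) (auto simp: direct_sum_Mod)
qed

lemma indecomposable_iso: 
  assumes a: "indecomposable (Mod K) a"
  shows "\<exists>i. mod_iso a (X i)"
proof -
  have aK: "a \<in> K" and nza: "idm a \<noteq> 0" and dec: "\<And>b c. b \<in> K \<Longrightarrow> c \<in> K \<Longrightarrow> biprod [b, c] a \<Longrightarrow> idm b = 0 \<or> idm c = 0"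
    using a by (auto simp: indecomposable_def direct_sum_Mod biprod_Nil)
  have am: "a \<in> sl2_modules" using aK K_sub by auto
  obtain As where As: "set As \<subseteq> range X" "splits_through As a" using aK by (auto simp: K_def)
  then show ?thesis
  proof (induction As)
    case Nil
    then have "idm a v = 0" for v by (auto elim: thr.cases)
    then show ?case using nza by auto
  next
    case (Cons A As)
    obtain i where A: "A = X i" using Cons.prems by auto
    from split_off_local[OF am Cons.prems(2), of K] local_X A
    consider "splits_through As a"
      | V' j p s r where "V' \<in> sl2_modules" "splits_through As V'" "j \<in> sl2_hom A a" "p \<in> sl2_hom a A" "s \<in> sl2_hom V' a" "r \<in> sl2_hom a V'"
        "p \<circ> j = idm A" "r \<circ> s = idm V'" "p \<circ> s = 0" "r \<circ> j = 0" "(j \<circ> p) + (s \<circ> r) = idm a"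
      by blast
    then show ?case
    proof cases
      case 1
      then show ?thesis using Cons by auto
    next
      case 2
      have "V' \<in> K" using 2(1,2) Cons.prems(1) by (auto simp: K_def)
      moreover have "biprod [A, V'] a" by (rule biprod_Cons[OF biprod_single[OF 2(1)] 2(3-)])
      ultimately have "idm A = 0 \<or> idm V' = 0" using dec A by auto
      moreover have "idm A \<noteq> 0" using nz[of i] A by auto
      ultimately have V0: "idm V' v = 0" for v by (auto simp: fun_eq_iff)
      have "r v = 0" for v using hom_cod[OF 2(6), of v] V0 by simp
      then have "(j \<circ> p) v = idm a v" for v
        using fun_cong[OF 2(11), of v] by (simp add: lin_zero[OF hom_lin[OF 2(5)]])
      then have "j \<circ> p = idm a" by (rule ext)
      then show ?thesis using 2 A unfolding mod_iso_def by blast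
    qed
  qed
qed

text \<open>The two idempotents of a decomposition add up to the identity. By locality one of them
  is invertible, which forces the other summand to be zero.\<close>

lemma indecomposable_X: "indecomposable (Mod K) (X i)"
  unfolding indecomposable_def
proof (intro conjI allI impI)
  show "X i \<in> Ob (Mod K)" by simp
  show "\<not> zero_object (Mod K) (X i)" using nz[of i] by (auto simp: direct_sum_Mod biprod_Nil)
  fix b c assume "direct_sum (Mod K) [b, c] (X i)"
  then have bc: "b \<in> K" "c \<in> K" and bb: "biprod [b, c] (X i)" by (auto simp: direct_sum_Mod)
  from bb obtain i0 p0 i1 p1 where h: "i0 \<in> sl2_hom b (X i)" "i1 \<in> sl2_hom c (X i)" "p0 \<in> sl2_hom (X i) b" "p1 \<in> sl2_hom (X i) c"
    and o: "p0 \<circ> i0 = idm b" "p1 \<circ> i1 = idm c" "p0 \<circ> i1 = 0" "p1 \<circ> i0 = 0" and sum: "(i0 \<circ> p0) + (i1 \<circ> p1) = idm (X i)"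
    by (rule biprod_pairE)
  have "isomorphism (Mod K) (X i) (X i) ((i0 \<circ> p0) + (i1 \<circ> p1))"
    unfolding sum isomorphism_Mod by (intro conjI bexI[of _ "idm (X i)"]) (auto simp: fun_eq_iff)
  then have "isomorphism (Mod K) (X i) (X i) (i0 \<circ> p0) \<or> isomorphism (Mod K) (X i) (X i) (i1 \<circ> p1)"
    using local_X[of K i] hom_comp[OF h(3,1)] hom_comp[OF h(4,2)] by (auto simp: local_endomorphisms_def)
  moreover have "idm c = 0" if "isomorphism (Mod K) (X i) (X i) (i0 \<circ> p0)"
  proof -
    obtain q where q: "q \<in> sl2_hom (X i) (X i)" "q \<circ> (i0 \<circ> p0) = idm (X i)" using \<open>isomorphism _ _ _ (i0 \<circ> p0)\<close> by (auto simp: isomorphism_Mod)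
    have "i1 v = 0" for v
      using fun_cong[OF q(2), of "i1 v"] fun_cong[OF o(3), of v]
      by (simp add: hom_cod[OF h(2)] lin_zero[OF hom_lin[OF q(1)]] lin_zero[OF hom_lin[OF h(1)]])
    then show ?thesis using o(2) by (simp add: fun_eq_iff lin_zero[OF hom_lin[OF h(4)]])
  qed
  moreover have "idm b = 0" if "isomorphism (Mod K) (X i) (X i) (i1 \<circ> p1)"
  proof -
    obtain q where q: "q \<in> sl2_hom (X i) (X i)" "q \<circ> (i1 \<circ> p1) = idm (X i)" using \<open>isomorphism _ _ _ (i1 \<circ> p1)\<close> by (auto simp: isomorphism_Mod)
    have "i0 v = 0" for v
      using fun_cong[OF q(2), of "i0 v"] fun_cong[OF o(4), of v]
      by (simp add: hom_cod[OF h(1)] lin_zero[OF hom_lin[OF q(1)]] lin_zero[OF hom_lin[OF h(2)]])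
    then show ?thesis using o(1) by (simp add: fun_eq_iff lin_zero[OF hom_lin[OF h(3)]])
  qed
  ultimately show "zero_object (Mod K) b \<or> zero_object (Mod K) c"
    using bc by (auto simp: direct_sum_Mod biprod_Nil)
qed

lemma countably_many_K: "countably_many_indecomposables (Mod K)"
  unfolding countably_many_indecomposables_def
  using indecomposable_iso by (intro exI[of _ "range X"]) (auto simp: isomorphic_Mod)

definition hom_bound :: "sl2_module \<Rightarrow> sl2_module \<Rightarrow> bool" where
  "hom_bound V W \<longleftrightarrow> (\<exists>B. finite B \<and> sl2_hom V W \<subseteq> fv.span B)"

lemma span_comp_right: "f \<in> fv.span B \<Longrightarrow> f \<circ> v \<in> fv.span ((\<lambda>b. b \<circ> v) ` B)"
proof (induction rule: fv.span_induct_alt)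
  case base
  show ?case unfolding comp_zero_left by (rule fv.span_zero)
next
  case (step c x y)
  show ?case
    unfolding comp_plus_left comp_scale_left
    by (intro fv.span_add fv.span_scale step(2)) (rule fv.span_base[OF imageI[OF step(1)]])
qed

lemma span_comp_left:
  assumes u: "lin u" and f: "f \<in> fv.span B"
  shows "u \<circ> f \<in> fv.span ((\<lambda>b. u \<circ> b) ` B)"
  using f
proof (induction rule: fv.span_induct_alt)
  case base
  show ?case unfolding comp_zero_right[OF u] by (rule fv.span_zero)
next
  case (step c x y)
  show ?case
    unfolding comp_plus_right[OF u] comp_scale_right[OF u]
    by (intro fv.span_add fv.span_scale step(2)) (rule fv.span_base[OF imageI[OF step(1)]])
qed

lemma hom_bound_X: "hom_bound (X i) (X j)"
proof (cases "i = j")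
  case True
  have "sl2_hom (X i) (X i) \<subseteq> fv.span {idm (X i), d i}"
  proof
    fix g assume "g \<in> sl2_hom (X i) (X i)"
    then obtain a b where "\<forall>v. g v = vscale a (idm (X i) v) + vscale b (d i v)" by (rule scE)
    then have g: "g = map_scale a (idm (X i)) + map_scale b (d i)" by (simp add: fun_eq_iff)
    show "g \<in> fv.span {idm (X i), d i}" unfolding g by (intro fv.span_add fv.span_scale fv.span_base) auto
  qed
  then show ?thesis unfolding hom_bound_def True by (intro exI[of _ "{idm (X j), d j}"]) (simp add: True)
next
  case False
  then have "sl2_hom (X i) (X j) \<subseteq> fv.span {}" using hom_X_zero by (auto simp: fun_eq_iff)
  then show ?thesis unfolding hom_bound_def by (intro exI[of _ "{}"]) auto
qed

text \<open>Finite dimension passes from the entries of the list to the maps that factor through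
  them; with the identity for \<open>g\<close> these are all maps out of \<open>V\<close>.\<close>

lemma hom_bound_source:
  assumes "thr As V V' g" "\<And>A. A \<in> set As \<Longrightarrow> hom_bound A W"
  shows "\<exists>B. finite B \<and> (\<forall>f\<in>sl2_hom V' W. f \<circ> g \<in> fv.span B)"
  using assms
proof (induction rule: thr.induct)
  case (thr_Nil V V')
  have "f \<circ> 0 \<in> fv.span {}" if f: "f \<in> sl2_hom V' W" for f
    unfolding comp_zero_right[OF hom_lin[OF f]] by (rule fv.span_zero)
  then show ?case by (intro exI[of _ "{}"] conjI ballI finite.emptyI)
next
  case (thr_Cons As V V' g A v u)
  have "\<exists>B. finite B \<and> (\<forall>f\<in>sl2_hom V' W. f \<circ> g \<in> fv.span B)"
    by (rule thr_Cons.IH[OF thr_Cons.prems[OF list.set_intros(2)]])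
  then obtain B where B: "finite B" "\<forall>f\<in>sl2_hom V' W. f \<circ> g \<in> fv.span B" by blast
  obtain C where C: "finite C" "sl2_hom A W \<subseteq> fv.span C" using thr_Cons.prems[of A] by (auto simp: hom_bound_def)
  have "f \<circ> ((u \<circ> v) + g) \<in> fv.span ((\<lambda>b. b \<circ> v) ` C \<union> B)" if f: "f \<in> sl2_hom V' W" for f
  proof -
    have "f \<circ> ((u \<circ> v) + g) = ((f \<circ> u) \<circ> v) + (f \<circ> g)" by (simp add: fun_eq_iff lin_add[OF hom_lin[OF f]])
    moreover have "(f \<circ> u) \<circ> v \<in> fv.span ((\<lambda>b. b \<circ> v) ` C)"
      using C(2) hom_comp[OF thr_Cons.hyps(4) f] by (intro span_comp_right) auto
    ultimately show ?thesis
      using B(2) f by (auto intro!: fv.span_add intro: subsetD[OF fv.span_mono])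
  qed
  then show ?case using B(1) C(1)
    by (intro exI[of _ "(\<lambda>b. b \<circ> v) ` C \<union> B"] conjI ballI finite_UnI finite_imageI)
qed

lemma hom_bound_target:
  assumes "thr As W' W g" "\<And>A. A \<in> set As \<Longrightarrow> hom_bound V A"
  shows "\<exists>B. finite B \<and> (\<forall>f\<in>sl2_hom V W'. g \<circ> f \<in> fv.span B)"
  using assms
proof (induction rule: thr.induct)
  case (thr_Nil W' W)
  have "0 \<circ> f \<in> fv.span {}" for f :: "vec \<Rightarrow> vec"
    unfolding comp_zero_left by (rule fv.span_zero)
  then show ?case by (intro exI[of _ "{}"] conjI ballI finite.emptyI)
next
  case (thr_Cons As W' W g A v u)
  have "\<exists>B. finite B \<and> (\<forall>f\<in>sl2_hom V W'. g \<circ> f \<in> fv.span B)"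
    by (rule thr_Cons.IH[OF thr_Cons.prems[OF list.set_intros(2)]])
  then obtain B where B: "finite B" "\<forall>f\<in>sl2_hom V W'. g \<circ> f \<in> fv.span B" by blast
  obtain C where C: "finite C" "sl2_hom V A \<subseteq> fv.span C" using thr_Cons.prems[of A] by (auto simp: hom_bound_def)
  have "((u \<circ> v) + g) \<circ> f \<in> fv.span ((\<lambda>b. u \<circ> b) ` C \<union> B)" if f: "f \<in> sl2_hom V W'" for f
  proof -
    have "((u \<circ> v) + g) \<circ> f = (u \<circ> (v \<circ> f)) + (g \<circ> f)" by (simp add: fun_eq_iff)
    moreover have "u \<circ> (v \<circ> f) \<in> fv.span ((\<lambda>b. u \<circ> b) ` C)"
      using C(2) hom_comp[OF f thr_Cons.hyps(3)] by (intro span_comp_left hom_lin[OF thr_Cons.hyps(4)]) auto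
    ultimately show ?thesis
      using B(2) f by (auto intro!: fv.span_add intro: subsetD[OF fv.span_mono])
  qed
  then show ?case using B(1) C(1)
    by (intro exI[of _ "(\<lambda>b. u \<circ> b) ` C \<union> B"] conjI ballI finite_UnI finite_imageI)
qed

lemma finite_dimensional_homs_K: "finite_dimensional_homs (Mod K)"
  unfolding finite_dimensional_homs_def Mod_simps
proof (intro ballI)
  fix V W assume V: "V \<in> K" and W: "W \<in> K"
  obtain As where As: "set As \<subseteq> range X" "splits_through As V" using V by (auto simp: K_def)
  obtain Bs where Bs: "set Bs \<subseteq> range X" "splits_through Bs W" using W by (auto simp: K_def)
  have "hom_bound (X i) W" for i
  proof -
    have "hom_bound (X i) A" if "A \<in> set Bs" for A using that Bs(1) hom_bound_X by auto
    from hom_bound_target[OF Bs(2) this] obtain B where B: "finite B" "\<forall>f\<in>sl2_hom (X i) W. idm W \<circ> f \<in> fv.span B" by auto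
    have "f \<in> fv.span B" if f: "f \<in> sl2_hom (X i) W" for f using B(2) f hom_id_left[OF f] by force
    then show ?thesis unfolding hom_bound_def using B(1) by auto
  qed
  then have "hom_bound A W" if "A \<in> set As" for A using that As(1) by auto
  from hom_bound_source[OF As(2) this] obtain B where B: "finite B" "\<forall>f\<in>sl2_hom V W. f \<circ> idm V \<in> fv.span B" by auto
  have "f \<in> fv.span B" if f: "f \<in> sl2_hom V W" for f using B(2) f hom_id_right[OF f] by force
  then show "\<exists>B. finite B \<and> sl2_hom V W \<subseteq> fv.span B" using B(1) by auto
qed

lemma locally_finitary_K: "locally_finitary FD (Mod K)"
  unfolding locally_finitary_def
  using module_category_K additive_K idempotent_split_K krull_schmidt_K countably_many_K finite_dimensional_homs_K by blast

lemma X_iso_eq: "mod_iso (X i) (X j) \<Longrightarrow> i = j"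
proof (rule ccontr)
  assume "mod_iso (X i) (X j)" and ij: "i \<noteq> j"
  then obtain f g where fg: "f \<in> sl2_hom (X i) (X j)" "g \<in> sl2_hom (X j) (X i)" "g \<circ> f = idm (X i)" by (auto simp: mod_iso_def)
  have "idm (X i) v = 0" for v
    using fun_cong[OF fg(3), of v] hom_X_zero[OF ij fg(1), of v] by (simp add: lin_zero[OF hom_lin[OF fg(2)]])
  then show False using nz[of i] by simp
qed

lemma L1_iso: "V \<in> sl2_modules \<Longrightarrow> mod_iso (F V) (tensor_module (L_fd 1) V)"
  unfolding F_def by (rule mod_iso_tensor[OF L_fd_iso E_closed L_fd_closed(1)])

theorem type_C_infinity_K: "type_C_infinity FD (L_fd 1) (Mod K)"
  unfolding type_C_infinity_def
\<comment> \<open>The list of indecomposables is numbered from 1, the ladder from 0.\<close>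
proof (intro conjI exI[of _ "\<lambda>i. X (i - 1)"] allI impI)
  show "locally_finitary FD (Mod K)" by (rule locally_finitary_K)
  show "indecomposable (Mod K) (X (i - 1))" for i by (rule indecomposable_X)
  show "i = j" if "1 \<le> i" "1 \<le> j" "isomorphic (Mod K) (X (i - 1)) (X (j - 1))" for i j
    using X_iso_eq[of "i - 1" "j - 1"] that by (simp add: isomorphic_Mod)
  show "\<exists>i\<ge>1. isomorphic (Mod K) a (X (i - 1))" if a: "indecomposable (Mod K) a" for a
  proof -
    obtain i where "mod_iso a (X i)" using indecomposable_iso[OF a] by blast
    then show ?thesis by (intro exI[of _ "Suc i"]) (simp add: isomorphic_Mod)
  qed
  have L1K: "tensor_module (L_fd 1) (X i) \<in> K" for i by (rule act_K[OF L_fd_closed X_in_K])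
  have iso_refl: "mod_iso ((As :: sl2_module list) ! k) (As ! k)" if "set As \<subseteq> sl2_modules" "k < length As" for As k
    using that by (intro mod_iso_refl) auto
  show "isomorphic (Mod K) (Act (Mod K) (L_fd 1) (X (1 - 1))) (X (2 - 1))"
    using mod_iso_sym[OF L1_iso[OF Xm[of 0]]] by (simp add: isomorphic_Mod X0 flip: X1)
  show "direct_sum (Mod K) [X (1 - 1), X (1 - 1), X (3 - 1)] (Act (Mod K) (L_fd 1) (X (2 - 1)))"
    using biprod_iso[OF bp1 refl iso_refl L1_iso[OF Xm[of 1]]] L1K by (simp add: direct_sum_Mod)
  show "direct_sum (Mod K) [X (i - 1 - 1), X (i + 1 - 1)] (Act (Mod K) (L_fd 1) (X (i - 1)))" if i: "3 \<le> i" for i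
  proof -
    obtain j where j: "i = j + 2" "j \<ge> 1" using i by (metis add.commute le_Suc_ex numeral_3_eq_3 plus_1_eq_Suc add_2_eq_Suc' le_add1 add.assoc one_add_one numeral_plus_one add_Suc_right)
    then show ?thesis
      using biprod_iso[OF bp[OF j(2)] refl iso_refl L1_iso[OF Xm[of "j + 1"]]] L1K by (simp add: direct_sum_Mod)
  qed
qed

lemma X_Suc_retract:
  obtains s r where "s \<in> sl2_hom (X (Suc i)) (F (X i))" "r \<in> sl2_hom (F (X i)) (X (Suc i))" "r \<circ> s = idm (X (Suc i))"
proof -
  consider "i = 0" | "i = 1" | j where "i = j + 1" "j \<ge> 1"
    by (metis One_nat_def Suc_eq_plus1 Suc_le_eq not0_implies_Suc neq0_conv)
  then show ?thesis
  proof cases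
    case 1
    have "X (Suc i) = F (X i)" using 1 X0 X1 by (simp add: One_nat_def)
    then show ?thesis using that[of "idm (F (X i))" "idm (F (X i))"] by (simp add: hom_id_left[OF hom_id])
  next
    case 2
    show ?thesis
      by (rule biprod_component[OF bp1, of 2]) (use that 2 in \<open>simp_all add: numeral_2_eq_2 One_nat_def\<close>)
  next
    case 3
    show ?thesis
      by (rule biprod_component[OF bp[OF 3(2)], of 1]) (use that 3 in \<open>simp_all add: One_nat_def\<close>)
  qed
qed

theorem simple_transitive_K: "simple_transitive FD (Mod K)"
  unfolding simple_transitive_def
proof (intro conjI allI impI locally_finitary_K)
  fix I assume I: "invariant_ideal FD (Mod K) I"
  have hom: "f \<in> sl2_hom a b" if "f \<in> I a b" "a \<in> K" "b \<in> K" for f a b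
    using I that by (auto simp: invariant_ideal_def ideal_def)
  have sub: "fv.subspace (I a b)" if "a \<in> K" "b \<in> K" for a b
    using I that by (auto simp: invariant_ideal_def ideal_def)
  have left: "g \<circ> f \<in> I a c" if "f \<in> I a b" "g \<in> sl2_hom b c" "a \<in> K" "b \<in> K" "c \<in> K" for f g a b c
    using I that by (auto simp: invariant_ideal_def ideal_def)
  have right: "g \<circ> f \<in> I a c" if "f \<in> sl2_hom a b" "g \<in> I b c" "a \<in> K" "b \<in> K" "c \<in> K" for f g a b c
    using I that by (auto simp: invariant_ideal_def ideal_def)
  have actI: "Fm f \<in> I (F a) (F b)" if "f \<in> I a b" "a \<in> K" "b \<in> K" for f a b
  proof -
    have "\<forall>X\<in>Ob FD. \<forall>a\<in>K. \<forall>b\<in>K. \<forall>f\<in>I a b. tensor_map (idm X) f \<in> I (tensor_module X a) (tensor_module X b)"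
      using I by (simp add: invariant_ideal_def)
    moreover have "E 1 \<in> Ob FD" by simp
    ultimately show ?thesis using that unfolding Fm_def F_def by blast
  qed
  \<comment> \<open>A nonzero map out of \<open>X i\<close> stays nonzero after projection to some
    summand \<open>X j\<close> of its target, and only j = i admits nonzero maps.\<close>
  have target: "\<exists>g\<in>I (X i) (X i). \<exists>x. g x \<noteq> 0" if f: "f \<in> I (X i) b" "f x \<noteq> 0" and b: "b \<in> K" for f i b x
  proof -
    obtain Bs where Bs: "set Bs \<subseteq> range X" "splits_through Bs b" using b by (auto simp: K_def)
    have fh: "f \<in> sl2_hom (X i) b" using hom f(1) b by simp
    have "idm b (f x) \<noteq> 0" using f(2) by (simp add: hom_cod[OF fh])
    from thr_nonzero[OF Bs(2) this] obtain j v u where j: "v \<in> sl2_hom b (X j)" "u \<in> sl2_hom (X j) b" "u (v (f x)) \<noteq> 0"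
      using Bs(1) by blast
    then have vx: "v (f x) \<noteq> 0" using lin_zero[OF hom_lin[OF j(2)]] by auto
    have vf: "v \<circ> f \<in> I (X i) (X j)" by (rule left[OF f(1) j(1) X_in_K b X_in_K])
    have "i = j" using hom_X_zero[of i j "v \<circ> f" x] hom[OF vf] vx by auto
    then show ?thesis using vf vx by (intro bexI[of _ "v \<circ> f"] exI[of _ x]) auto
  qed
  show "(\<forall>a\<in>Ob (Mod K). \<forall>b\<in>Ob (Mod K). I a b = {0}) \<or> (\<forall>a\<in>Ob (Mod K). \<forall>b\<in>Ob (Mod K). I a b = Hom (Mod K) a b)"
  proof (cases "\<exists>a\<in>K. \<exists>b\<in>K. \<exists>f\<in>I a b. \<exists>x. f x \<noteq> 0")
    case False
    have "I a b = {0}" if "a \<in> K" "b \<in> K" for a b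
      using False that fv.subspace_0[OF sub[OF that]] by (auto simp: fun_eq_iff)
    then show ?thesis by simp
  next
    case True
    then obtain a b f x where f: "a \<in> K" "b \<in> K" "f \<in> I a b" "f x \<noteq> 0" by blast
    have fh: "f \<in> sl2_hom a b" using hom f by simp
    obtain As where As: "set As \<subseteq> range X" "splits_through As a" using f(1) by (auto simp: K_def)
    have "f (idm a x) \<noteq> 0" using f(4) by (simp add: hom_dom[OF fh])
    from thr_nonzero_comp[OF As(2) hom_lin[OF fh] this] obtain i v u where u: "v \<in> sl2_hom a (X i)" "u \<in> sl2_hom (X i) a" "f (u (v x)) \<noteq> 0"
      using As(1) by blast
    have fu: "f \<circ> u \<in> I (X i) b" by (rule right[OF u(2) f(3) X_in_K f(1,2)])
    have start: "\<exists>g\<in>I (X i) (X i). \<exists>x. g x \<noteq> 0" using target[OF fu _ f(2), of "v x"] u(3) by simp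
    \<comment> \<open>An endomorphism of \<open>X (Suc i)\<close>, a summand of
      \<open>F (X i)\<close>, extends to \<open>F (X i)\<close>. The transpose X i -> F (F (X i)) of
      the extension is in the ideal, because ideals here are stable under \<open>F\<close>, and it
      is nonzero by adjunction.\<close>
    have descend: "\<exists>g\<in>I (X i) (X i). \<exists>x. g x \<noteq> 0 \<Longrightarrow> \<exists>g\<in>I (X 0) (X 0). \<exists>x. g x \<noteq> 0" for i
    proof (induction i)
      case (Suc i)
      then obtain g x where g: "g \<in> I (X (Suc i)) (X (Suc i))" "g x \<noteq> 0" by blast
      have gh: "g \<in> sl2_hom (X (Suc i)) (X (Suc i))" using hom g by simp
      obtain s r where sr: "s \<in> sl2_hom (X (Suc i)) (F (X i))" "r \<in> sl2_hom (F (X i)) (X (Suc i))" "r \<circ> s = idm (X (Suc i))"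
        by (rule X_Suc_retract)
      have rs: "r (s y) = idm (X (Suc i)) y" for y using sr(3) by (metis comp_apply)
      define g' where "g' = s \<circ> (g \<circ> r)"
      have g': "g' \<in> I (F (X i)) (F (X i))"
        unfolding g'_def using left[OF right[OF sr(2) g(1)] sr(1)] F_X_K by simp
      have g'h: "g' \<in> sl2_hom (F (X i)) (F (X i))" using hom[OF g'] F_X_K by simp
      have FF: "F (F (X i)) \<in> K" by (intro F_K X_in_K)
      have c: "Fm g' \<circ> coev (X i) \<in> I (X i) (F (F (X i)))"
        by (rule right[OF coev_hom[OF Xm] actI[OF g' F_X_K F_X_K] X_in_K FF FF])
      have "\<exists>y. Fm g' (coev (X i) y) \<noteq> 0"
      proof (rule ccontr)
        assume "\<nexists>y. Fm g' (coev (X i) y) \<noteq> 0"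
        then have "g' v = 0" for v using zigzag_transpose[OF Xm F_closed[OF Xm] g'h] by blast
        then have "r (g' (s x)) = 0" by (simp add: lin_zero[OF hom_lin[OF sr(2)]])
        then show False using g(2) by (simp add: g'_def rs hom_dom[OF gh] hom_cod[OF gh])
      qed
      then obtain y where "(Fm g' \<circ> coev (X i)) y \<noteq> 0" by auto
      then have "\<exists>g\<in>I (X i) (X i). \<exists>x. g x \<noteq> 0" using target[OF c _ FF] by blast
      then show ?case by (rule Suc.IH)
    qed
    obtain g y where g: "g \<in> I (X 0) (X 0)" "g y \<noteq> 0" using descend[OF start] by blast
    have gh: "g \<in> sl2_hom (X 0) (X 0)" using hom[OF g(1)] by simp
    obtain \<alpha> \<beta> where ab: "\<forall>v. g v = vscale \<alpha> (idm (X 0) v) + vscale \<beta> (d 0 v)"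
      using gh by (rule scE)
    have al: "\<alpha> \<noteq> 0" using g(2) ab by (auto simp: d0)
    have "map_scale (1 / \<alpha>) g \<in> I (X 0) (X 0)" by (rule fv.subspace_scale[OF sub g(1)]) simp_all
    moreover have "map_scale (1 / \<alpha>) g = idm (X 0)" using ab al by (simp add: fun_eq_iff d0)
    ultimately have id0: "idm (X 0) \<in> I (X 0) (X 0)" by simp
    \<comment> \<open>Back up the ladder: \<open>F\<close> takes identities to identities, and
      \<open>X (Suc i)\<close> is a summand of \<open>F (X i)\<close>.\<close>
    have idi: "idm (X i) \<in> I (X i) (X i)" for i
    proof (induction i)
      case (Suc i)
      obtain s r where sr: "s \<in> sl2_hom (X (Suc i)) (F (X i))" "r \<in> sl2_hom (F (X i)) (X (Suc i))" "r \<circ> s = idm (X (Suc i))"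
        by (rule X_Suc_retract)
      have "idm (F (X i)) \<in> I (F (X i)) (F (X i))" using actI[OF Suc] by (simp add: Fm_simps(4))
      from left[OF right[OF sr(1) this] sr(2)] have "r \<circ> (idm (F (X i)) \<circ> s) \<in> I (X (Suc i)) (X (Suc i))"
        using F_X_K by simp
      then show ?case by (simp only: hom_id_left[OF sr(1)] sr(3))
    qed (rule id0)
    have all: "f \<in> I a b" if f: "f \<in> sl2_hom a b" and a: "a \<in> K" and b: "b \<in> K" for f a b
    proof -
      obtain As where As: "set As \<subseteq> range X" "splits_through As a" using a by (auto simp: K_def)
      have "thr As a a g \<Longrightarrow> set As \<subseteq> range X \<Longrightarrow> g \<in> I a a" for g
      proof (induction As arbitrary: g)
        case Nil
        then have "g = 0" by (auto elim: thr.cases)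
        show ?case by (subst \<open>g = 0\<close>) (rule fv.subspace_0[OF sub[OF a a]])
      next
        case (Cons A As)
        obtain g' u v where t: "thr As a a g'" "v \<in> sl2_hom a A" "u \<in> sl2_hom A a" "g = (u \<circ> v) + g'"
          using Cons.prems(1) by (rule thr_ConsE)
        obtain i where A: "A = X i" using Cons.prems by auto
        have "u \<circ> (idm A \<circ> v) \<in> I a a" using left[OF right[OF t(2)] t(3)] idi a by (simp add: A)
        then have "u \<circ> v \<in> I a a" by (simp only: hom_id_left[OF t(2)])
        moreover have "g' \<in> I a a" using Cons t by simp
        ultimately show ?case unfolding t(4) by (rule fv.subspace_add[OF sub[OF a a]])
      qed
      then have "idm a \<in> I a a" using As by blast
      then have "f \<circ> idm a \<in> I a b" by (rule left[OF _ f a a b])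
      then show ?thesis by (simp only: hom_id_right[OF f])
    qed
    have "I a b = sl2_hom a b" if "a \<in> K" "b \<in> K" for a b using all hom that by blast
    then show ?thesis by simp
  qed
qed

text \<open>\<open>S\<close> is the ambient category in which the closure is formed: all modules for
  \<open>K2\<close>, category O for \<open>K1\<close>. The generators enter up to isomorphism, as
  they are given by choice.\<close>

theorem additive_closure_K:
  assumes S: "S \<subseteq> sl2_modules" "K \<subseteq> S" and Z: "Z \<subseteq> S"
    and ZX: "\<And>z. z \<in> Z \<Longrightarrow> \<exists>i. mod_iso z (X i)" and XZ: "\<And>i. \<exists>z\<in>Z. mod_iso (X i) z"
  shows "additive_closure (Mod S) Z = K"
proof
  show "additive_closure (Mod S) Z \<subseteq> K"
  proof
    fix V assume "V \<in> additive_closure (Mod S) Z"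
    then obtain As D W where As: "set As \<subseteq> Z" "set As \<subseteq> S" "D \<in> S" "biprod As D" "V \<in> S" "biprod [V, W] D"
      unfolding additive_closure_def by (auto simp: direct_sum_Mod)
    have m: "V \<in> sl2_modules" "D \<in> sl2_modules" "set As \<subseteq> sl2_modules" using As S by auto
    have "set As \<subseteq> K" using ZX As(1) m(3) by (force intro: K_iso)
    then have "D \<in> K" using biprod_thr[OF As(4) m(3)] m by (intro K_splits)
    moreover obtain i p where "i \<in> sl2_hom V D" "p \<in> sl2_hom D V" "p \<circ> i = idm V"
      using As(6) by (rule biprod_pairE)
    ultimately show "V \<in> K" using m by (intro K_retract[of V D i p])
  qed
  show "K \<subseteq> additive_closure (Mod S) Z"
  proof
    fix V assume V: "V \<in> K"
    then have Vm: "V \<in> sl2_modules" using K_sub by auto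
    obtain Bs where Bs: "set Bs \<subseteq> range X" "biprod Bs V" using K_biprod[OF V] by blast
    have "\<exists>z. z \<in> Z \<and> mod_iso B z" if "B \<in> set Bs" for B
      using that Bs(1) XZ by blast
    then obtain z where z: "\<And>B. B \<in> set Bs \<Longrightarrow> z B \<in> Z \<and> mod_iso B (z B)" by metis
    have "biprod (map z Bs) V"
      by (rule biprod_iso[OF Bs(2)]) (use z Vm in \<open>auto intro: mod_iso_refl\<close>)
    moreover have "set (map z Bs) \<subseteq> Z" using z by auto
    ultimately show "V \<in> additive_closure (Mod S) Z"
      unfolding additive_closure_def mem_Collect_eq direct_sum_Mod
      using biprod_with_zero[OF Vm] V S Z zero_in_K by (intro exI[of _ "map z Bs"] exI[of _ V] exI[of _ zero_module]) auto
  qed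
qed

end

declare One_nat_def [simp del]

section \<open>The summand of highest index in \<open>L(i) \<otimes> N\<close>\<close>

lemma lookup_act_h_E: "lookup (act_h (E m) y) n = (if n \<le> m then (of_nat m - 2 * of_nat n) * lookup y n else 0)"
proof -
  have "(\<lambda>y. vscale (lookup (act_h (E m) y) n) (basis_vec 0)) = (\<lambda>y. vscale (if n \<le> m then (of_nat m - 2 * of_nat n) * lookup y n else 0) (basis_vec 0))"
  proof (rule lin_ext)
    fix k
    show "vscale (lookup (act_h (E m) (basis_vec k)) n) (basis_vec 0) = vscale (if n \<le> m then (of_nat m - 2 * of_nat n) * lookup (basis_vec k) n else 0) (basis_vec 0)"
      by (auto simp: act_E_basis_vec lookup_basis_vec)
  qed (auto simp: lin_iff lin_simps(1,2)[OF lin_act_E(3)] lookup_add vec.scale_left_distrib algebra_simps)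
  then have "lookup (vscale (lookup (act_h (E m) y) n) (basis_vec 0)) 0 = lookup (vscale (if n \<le> m then (of_nat m - 2 * of_nat n) * lookup y n else 0) (basis_vec 0)) 0"
    by (simp add: fun_eq_iff)
  then show ?thesis by (simp add: lookup_basis_vec)
qed

text \<open>The weights of L(1) \<otimes> L(i) are at most i + 1, and the weight i + 1 is carried by
  b_0 \<otimes> b_0 alone. So once a copy of L(i + 1) is split off, only L(k) with k \<le> i can
  remain.\<close>

lemma F_E_weight:
  assumes y: "y \<in> space (F (E i))" "act_h (F (E i)) y = vscale (of_nat k) y" and k: "k \<ge> Suc i"
  shows "\<exists>c. y = vscale c (incl 0 (basis_vec 0))"
proof -
  let ?p = "prj 0 y" and ?q = "prj 1 y"
  have y': "y = incl 0 (idm (E i) ?p) + incl 1 (idm (E i) ?q)"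
    using y(1) idmF_apply[of "E i" y] by simp
  have p: "act_h (E i) ?p + idm (E i) ?p = vscale (of_nat k) ?p"
    using arg_cong[OF y(2), of "prj 0"] by (simp add: actF)
  have q: "act_h (E i) ?q - idm (E i) ?q = vscale (of_nat k) ?q"
    using arg_cong[OF y(2), of "prj 1"] by (simp add: actF)
  have q0: "lookup ?q n = 0" if n: "n \<le> i" for n
  proof -
    have "(of_nat i - 2 * of_nat n) * lookup ?q n - lookup ?q n = of_nat k * lookup ?q n"
      using arg_cong[OF q, of "\<lambda>v. lookup v n"] n by (simp add: lookup_minus lookup_act_h_E)
    then have "(of_nat i - 2 * of_nat n - 1 - of_nat k) * lookup ?q n = 0"
      by (simp add: algebra_simps)
    moreover have "of_nat i - 2 * of_nat n - 1 - of_nat k \<noteq> (0 :: complex)"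
    proof
      assume "of_nat i - 2 * of_nat n - 1 - of_nat k = (0 :: complex)"
      then have "of_nat i = (of_nat (2 * n + 1 + k) :: complex)" by (simp add: algebra_simps)
      then show False using k by (simp only: of_nat_eq_iff)
    qed
    ultimately show ?thesis by simp
  qed
  have p0: "lookup ?p n = 0" if n: "n \<le> i" "n \<noteq> 0" for n
  proof -
    have "(of_nat i - 2 * of_nat n) * lookup ?p n + lookup ?p n = of_nat k * lookup ?p n"
      using arg_cong[OF p, of "\<lambda>v. lookup v n"] n by (simp add: lookup_add lookup_act_h_E)
    then have "(of_nat i - 2 * of_nat n + 1 - of_nat k) * lookup ?p n = 0"
      by (simp add: algebra_simps)
    moreover have "of_nat i - 2 * of_nat n + 1 - of_nat k \<noteq> (0 :: complex)"
    proof
      assume "of_nat i - 2 * of_nat n + 1 - of_nat k = (0 :: complex)"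
      then have "of_nat (i + 1) = (of_nat (2 * n + k) :: complex)" by (simp add: algebra_simps)
      then show False using k n by (simp only: of_nat_eq_iff)
    qed
    ultimately show ?thesis by simp
  qed
  have "idm (E i) ?q = 0" by (rule vec_eqI) (simp add: q0)
  moreover have "idm (E i) ?p = vscale (lookup ?p 0) (basis_vec 0)"
    by (rule vec_eqI) (auto simp: p0 lookup_basis_vec)
  ultimately have "y = vscale (lookup ?p 0) (incl 0 (basis_vec 0))"
    using y' by (simp add: tensor_vec_bilinear)
  then show ?thesis by blast
qed

lemma thr_filter:
  assumes "thr As V W f" "\<And>A u x. A \<in> set As \<Longrightarrow> \<not> P A \<Longrightarrow> u \<in> sl2_hom A W \<Longrightarrow> u x = 0"
  shows "thr (filter P As) V W f"
  using assms
proof (induction rule: thr.induct)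
  case (thr_Nil V W)
  then show ?case by (auto intro: thr_Nil')
next
  case (thr_Cons As V W f A v u)
  have IH: "thr (filter P As) V W f" by (rule thr_Cons.IH) (use thr_Cons.prems in auto)
  show ?case
  proof (cases "P A")
    case True
    show ?thesis using thr.thr_Cons[OF IH thr_Cons.hyps(2-4)] True by (simp only: filter.simps if_True)
  next
    case False
    have "u x = 0" for x by (rule thr_Cons.prems[OF _ False thr_Cons.hyps(4)]) simp
    then have "(u \<circ> v) + f = f" by (simp add: fun_eq_iff)
    then show ?thesis using IH False by (simp only: filter.simps if_False)
  qed
qed

lemma F_E_decomposition:
  obtains a b Cs where "a \<in> sl2_hom (E (Suc i)) (F (E i))" "b \<in> sl2_hom (F (E i)) (E (Suc i))" "b \<circ> a = idm (E (Suc i))"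
    "set Cs \<subseteq> E ` {..i}" "thr Cs (F (E i)) (F (E i)) (idm (F (E i)) - (a \<circ> b))"
proof -
  let ?V = "F (E i)"
  have V: "?V \<in> sl2_modules" "finite (basis ?V)" by (auto simp: F_def basis_tensor_module)
  obtain a b where ab: "a \<in> sl2_hom (E (Suc i)) ?V" "b \<in> sl2_hom ?V (E (Suc i))" "b \<circ> a = idm (E (Suc i))"
    "a (basis_vec 0) = incl 0 (basis_vec 0)" by (rule E_Suc_retract)
  have ba: "b (a x) = idm (E (Suc i)) x" for x using ab(3) by (metis comp_apply)
  let ?e = "idm ?V - (a \<circ> b)"
  have e: "?e \<in> sl2_hom ?V ?V" by (intro hom_minus V hom_id hom_comp[OF ab(2,1)])
  note la = lin_simps(1-5)[OF hom_lin[OF ab(1)]] lin_simps(1-5)[OF hom_lin[OF ab(2)]] lin_simps(1-5)[OF lin_id_map]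
    sl2_homD(2,3)[OF ab(1), simplified] sl2_homD(2,3)[OF ab(2), simplified]
  have "?e \<circ> ?e = ?e" by (simp add: fun_eq_iff la ba)
  from idempotent_splits[OF V(1) e this] obtain W r s where W: "W \<in> sl2_modules" "r \<in> sl2_hom ?V W" "s \<in> sl2_hom W ?V"
    "r \<circ> s = idm W" "s \<circ> r = ?e" "finite (basis W)" using V(2) by metis
  have rs: "r (s w) = idm W w" for w using W(4) by (metis comp_apply)
  have sr: "s (r x) = idm ?V x - a (b x)" for x using W(5) by (simp add: fun_eq_iff)
  obtain As where As: "set As \<subseteq> range E" "splits_through As W" using complete_reducibility[OF W(1,6)] by blast
  have van: "u x = 0" if k: "k \<ge> Suc i" and u: "u \<in> sl2_hom (E k) W" for k u x
  proof (rule ccontr)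
    assume ux: "u x \<noteq> 0"
    let ?b = "basis_vec 0"
    have incl: "inj_on u (space (E k))" by (rule simple_hom(1)[OF u E_closed W(1) ux simple_E])
    have h: "act_h (E k) ?b = vscale (of_nat k) ?b" by (simp add: act_E_basis_vec)
    have "act_h ?V (s (u ?b)) = vscale (of_nat k) (s (u ?b))"
      by (simp add: hom_h[OF W(3), symmetric] hom_h[OF u, symmetric] h lin_scale[OF hom_lin[OF u]] lin_scale[OF hom_lin[OF W(3)]])
    from F_E_weight[OF hom_in[OF W(3)] this k] obtain c where c: "s (u ?b) = vscale c (incl 0 ?b)" by blast
    have "s (u ?b) = s (r (s (u ?b)))" by (simp add: rs hom_cod[OF u])
    also have "\<dots> = idm ?V (s (u ?b)) - a (b (s (u ?b)))" by (rule sr)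
    also have "a (b (s (u ?b))) = vscale c (a (b (a ?b)))"
      by (simp add: c ab(4) lin_scale[OF hom_lin[OF ab(1)]] lin_scale[OF hom_lin[OF ab(2)]])
    also have "\<dots> = s (u ?b)" using c ab(4) ba[of ?b] by simp
    finally have "s (u ?b) = 0" by (simp add: hom_cod[OF W(3)])
    then have "u ?b = 0" using rs[of "u ?b"] by (simp add: lin_zero[OF hom_lin[OF W(2)]] hom_cod[OF u])
    then have "u ?b = u 0" by (simp add: lin_zero[OF hom_lin[OF u]])
    then have "?b = (0 :: vec)" by (rule inj_onD[OF incl]) simp_all
    then show False by simp
  qed
  have "thr (filter (\<lambda>A. A \<in> E ` {..i}) As) W W (idm W)"
  proof (rule thr_filter[OF As(2)])
    fix A u x assume A: "A \<in> set As" "A \<notin> E ` {..i}" and u: "u \<in> sl2_hom A W"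
    then obtain k where k: "A = E k" using As(1) by blast
    then have "k \<notin> {..i}" using A(2) by blast
    then show "u x = 0" using van[of k u x] u k by simp
  qed
  from thr_comp[OF this W(2,3)] have "thr (filter (\<lambda>A. A \<in> E ` {..i}) As) ?V ?V (s \<circ> idm W \<circ> r)" .
  moreover have "s \<circ> idm W \<circ> r = ?e" by (simp add: fun_eq_iff hom_cod[OF W(2)] sr)
  ultimately have "thr (filter (\<lambda>A. A \<in> E ` {..i}) As) ?V ?V ?e" by (simp only:)
  then show ?thesis using that[OF ab(1-3), of "filter (\<lambda>A. A \<in> E ` {..i}) As"] by auto
qed

section \<open>The copy of \<open>X i\<close> in L(i) \<otimes> N\<close>

context ladder_modules
begin

lemma thr_zero:
  assumes "thr As (X n) W f" "set As \<subseteq> X ` {l. l \<noteq> n}"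
  shows "f x = 0"
proof (rule ccontr)
  assume "f x \<noteq> 0"
  from thr_nonzero[OF assms(1) this] obtain A v u where A: "A \<in> set As" "v \<in> sl2_hom (X n) A" "u \<in> sl2_hom A W" "u (v x) \<noteq> 0"
    by blast
  then obtain l where l: "A = X l" "l \<noteq> n" using assms(2) by auto
  have "v x = 0" using hom_X_zero[of n l v x] A(2) l by simp
  then show False using A(4) lin_zero[OF hom_lin[OF A(3)]] by simp
qed

text \<open>A common form of the three fusion rules: besides \<open>X (Suc i)\<close> there is
  nothing for i = 0, twice \<open>X 0\<close> for i = 1, and \<open>X (i - 1)\<close> otherwise.
  What matters later is that these indices do not exceed i.\<close>

lemma F_X_decomposition:
  obtains s r As where "s \<in> sl2_hom (X (Suc i)) (F (X i))" "r \<in> sl2_hom (F (X i)) (X (Suc i))" "r \<circ> s = idm (X (Suc i))"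
    "set As \<subseteq> X ` {..i}" "thr As (F (X i)) (F (X i)) (idm (F (X i)) - (s \<circ> r))"
proof -
  consider "i = 0" | "i = 1" | j where "i = j + 1" "j \<ge> 1"
    by (metis One_nat_def Suc_eq_plus1 Suc_le_eq not0_implies_Suc neq0_conv)
  then show ?thesis
  proof cases
    case 1
    have eq: "X (Suc i) = F (X i)" using 1 X0 X1 by (simp add: One_nat_def)
    show ?thesis
    proof (rule that[of "idm (F (X i))" "idm (F (X i))" "[]"])
      show "thr [] (F (X i)) (F (X i)) (idm (F (X i)) - (idm (F (X i)) \<circ> idm (F (X i))))"
        by (rule thr_Nil') simp
    qed (simp_all add: eq hom_id_left[OF hom_id])
  next
    case 2
    from bp1 obtain \<iota> \<pi> where d: "\<forall>k<length [X 0, X 0, X 2]. \<iota> k \<in> sl2_hom ([X 0, X 0, X 2] ! k) (F (X 1)) \<and> \<pi> k \<in> sl2_hom (F (X 1)) ([X 0, X 0, X 2] ! k)"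
      "\<forall>k<length [X 0, X 0, X 2]. \<forall>l<length [X 0, X 0, X 2]. \<pi> k \<circ> \<iota> l = (if k = l then idm ([X 0, X 0, X 2] ! k) else 0)"
      "(\<Sum>k<length [X 0, X 0, X 2]. \<iota> k \<circ> \<pi> k) = idm (F (X 1))"
      unfolding biprod_def by blast
    have sum: "\<iota> 0 (\<pi> 0 v) + \<iota> (Suc 0) (\<pi> (Suc 0) v) + \<iota> (Suc (Suc 0)) (\<pi> (Suc (Suc 0)) v) = idm (F (X 1)) v" for v
      using fun_cong[OF d(3), of v] by simp
    note d1 = d(1)[rule_format, of 0] d(1)[rule_format, of "Suc 0"] d(1)[rule_format, of "Suc (Suc 0)"]
    have t: "thr [X 0, X 0] (F (X 1)) (F (X 1)) (idm (F (X 1)) - (\<iota> (Suc (Suc 0)) \<circ> \<pi> (Suc (Suc 0))))"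
    proof (rule thr_Cons'[where u = "\<iota> 0" and v = "\<pi> 0"])
      show "thr [X 0] (F (X 1)) (F (X 1)) (\<iota> (Suc 0) \<circ> \<pi> (Suc 0))"
        by (rule thr_single) (use d1 in auto)
      show "idm (F (X 1)) - (\<iota> (Suc (Suc 0)) \<circ> \<pi> (Suc (Suc 0))) = (\<iota> 0 \<circ> \<pi> 0) + (\<iota> (Suc 0) \<circ> \<pi> (Suc 0))"
        by (rule ext) (simp flip: sum)
    qed (use d1 in auto)
    show ?thesis
      by (rule that[of "\<iota> (Suc (Suc 0))" "\<pi> (Suc (Suc 0))" "[X 0, X 0]"])
        (use d1 d(2)[rule_format, of "Suc (Suc 0)" "Suc (Suc 0)"] t 2 in \<open>simp_all add: One_nat_def numeral_2_eq_2\<close>)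
  next
    case 3
    from bp[OF 3(2)] obtain a p s r where b: "a \<in> sl2_hom (X j) (F (X (j + 1)))" "s \<in> sl2_hom (X (j + 2)) (F (X (j + 1)))"
      "p \<in> sl2_hom (F (X (j + 1))) (X j)" "r \<in> sl2_hom (F (X (j + 1))) (X (j + 2))" "r \<circ> s = idm (X (j + 2))"
      "(a \<circ> p) + (s \<circ> r) = idm (F (X (j + 1)))"
      by (rule biprod_pairE)
    have eq: "idm (F (X (j + 1))) - (s \<circ> r) = a \<circ> p"
      by (subst b(6)[symmetric]) (simp add: fun_eq_iff)
    have t: "thr [X j] (F (X (j + 1))) (F (X (j + 1))) (idm (F (X (j + 1))) - (s \<circ> r))"
      unfolding eq by (rule thr_single[OF Xm b(3,1)])
    show ?thesis
      by (rule that[of s r "[X j]"]) (use b t 3 in \<open>simp_all add: One_nat_def\<close>)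
  qed
qed

text \<open>L(1) \<otimes> L(i) \<otimes> N is decomposed in two ways: as L(i + 1) \<otimes> N plus
  terms of index at most i, and as \<open>X (Suc i)\<close> plus terms of index at most i. There are
  no maps between different ladder modules, so \<open>X (Suc i)\<close> has to sit in L(i + 1)
  \<otimes> N.\<close>

lemma tensor_structure:
  "\<exists>j q As. j \<in> sl2_hom (X i) (tensor_module (E i) N) \<and> q \<in> sl2_hom (tensor_module (E i) N) (X i) \<and>
     q \<circ> j = idm (X i) \<and> set As \<subseteq> X ` {..<i} \<and>
     thr As (tensor_module (E i) N) (tensor_module (E i) N) (idm (tensor_module (E i) N) - (j \<circ> q))"
proof (induction i rule: less_induct)
  case (less n)
  have N: "N \<in> sl2_modules" using Xm[of 0] X0 by simp
  show ?case
  proof (cases n)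
    case 0
    note u = left_unitor_iso[OF N]
    have "thr [] (tensor_module (E n) N) (tensor_module (E n) N)
       (idm (tensor_module (E n) N) - ((tensor_vec (basis_vec 0) \<circ> idm N) \<circ> left_unitor N))"
      unfolding 0 E0_trivial u(3) by (rule thr_Nil') simp
    then show ?thesis
      using u unfolding 0 E0_trivial X0
      by (rule_tac exI[of _ "tensor_vec (basis_vec 0) \<circ> idm N"], rule_tac exI[of _ "left_unitor N"], rule_tac exI[of _ "[]"])
        (simp only: set_simps empty_subsetI simp_thms)
  next
    case (Suc i)
    let ?Z = "tensor_module (E i) N" and ?Z' = "tensor_module (E (Suc i)) N" and ?Y = "tensor_module (F (E i)) N"
    have m: "?Z \<in> sl2_modules" "?Z' \<in> sl2_modules" "?Y \<in> sl2_modules" "F ?Z \<in> sl2_modules" using N by auto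
    have low: "\<exists>As. set As \<subseteq> X ` {..k} \<and> splits_through As (tensor_module (E k) N)" if k: "k \<le> i" for k
    proof -
      obtain j q As where s: "j \<in> sl2_hom (X k) (tensor_module (E k) N)" "q \<in> sl2_hom (tensor_module (E k) N) (X k)"
         "set As \<subseteq> X ` {..<k}" "thr As (tensor_module (E k) N) (tensor_module (E k) N) (idm (tensor_module (E k) N) - (j \<circ> q))"
        using less.IH[unfolded Suc less_Suc_eq_le, OF k] by (elim exE conjE) (rule that)
      have "splits_through (X k # As) (tensor_module (E k) N)"
        by (rule thr_Cons'[OF s(4) Xm s(2,1)]) (simp add: fun_eq_iff)
      then show ?thesis using s(3) by (intro exI[of _ "X k # As"]) auto
    qed
    obtain j q As where s: "j \<in> sl2_hom (X i) ?Z" "q \<in> sl2_hom ?Z (X i)" "q \<circ> j = idm (X i)"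
         "set As \<subseteq> X ` {..<i}" "thr As ?Z ?Z (idm ?Z - (j \<circ> q))"
      using less.IH[unfolded Suc less_Suc_eq_le, OF order_refl] by (elim exE conjE) (rule that)
    obtain a b Cs where ab: "a \<in> sl2_hom (E (Suc i)) (F (E i))" "b \<in> sl2_hom (F (E i)) (E (Suc i))" "b \<circ> a = idm (E (Suc i))"
       "set Cs \<subseteq> E ` {..i}" "thr Cs (F (E i)) (F (E i)) (idm (F (E i)) - (a \<circ> b))"
      by (rule F_E_decomposition)
    obtain \<sigma> \<rho> Bs where sr: "\<sigma> \<in> sl2_hom (X (Suc i)) (F (X i))" "\<rho> \<in> sl2_hom (F (X i)) (X (Suc i))" "\<rho> \<circ> \<sigma> = idm (X (Suc i))"
       "set Bs \<subseteq> X ` {..i}" "thr Bs (F (X i)) (F (X i)) (idm (F (X i)) - (\<sigma> \<circ> \<rho>))"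
      by (rule F_X_decomposition)
    define \<phi> where "\<phi> = coassociator (E 1) (E i) N"
    define \<psi> where "\<psi> = associator (E 1) (E i) N"
    have pp: "\<phi> \<in> sl2_hom (F ?Z) ?Y" "\<psi> \<in> sl2_hom ?Y (F ?Z)" "\<phi> \<circ> \<psi> = idm ?Y" "\<psi> \<circ> \<phi> = idm (F ?Z)"
      unfolding \<phi>_def \<psi>_def F_def using associator_iso[OF E_closed[of 1] E_closed[of i] N] by auto
    define A B where "A = tensor_map a (idm N)" and "B = tensor_map b (idm N)"
    have AB: "A \<in> sl2_hom ?Z' ?Y" "B \<in> sl2_hom ?Y ?Z'"
      unfolding A_def B_def by (intro tensor_map_hom ab hom_id N E_closed F_closed)+
    have BA: "B (A v) = idm ?Z' v" for v
      using fun_cong[OF tensor_map_comp[OF hom_lin[OF ab(2)] hom_lin[OF ab(1)] lin_id_map lin_id_map, of "basis N" "basis N"], of v]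
      by (simp add: A_def B_def idm_tensor ab(3) hom_id_left[OF hom_id[OF N]] del: basis_E)
    have AB1: "A (B v) = idm ?Y v - tensor_map (idm (F (E i)) - (a \<circ> b)) (idm N) v" for v
    proof -
      have ab': "a \<circ> b = idm (F (E i)) + map_scale (- 1) (idm (F (E i)) - (a \<circ> b))" by (simp add: fun_eq_iff)
      have l: "lin (idm (F (E i)) - (a \<circ> b))" using hom_lin[OF ab(1)] hom_lin[OF ab(2)] by simp
      have "A (B v) = tensor_map (a \<circ> b) (idm N) v"
        using fun_cong[OF tensor_map_comp[OF hom_lin[OF ab(1)] hom_lin[OF ab(2)] lin_id_map lin_id_map, of "basis N" "basis N"], of v]
        by (simp add: A_def B_def hom_id_left[OF hom_id[OF N]])
      also have "\<dots> = tensor_map (idm (F (E i)) + map_scale (- 1) (idm (F (E i)) - (a \<circ> b))) (idm N) v"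
        by (simp only: ab'[symmetric])
      also have "\<dots> = idm ?Y v - tensor_map (idm (F (E i)) - (a \<circ> b)) (idm N) v"
        using l by (simp only: tensor_map_linear(1)[OF lin_id_map lin_map_scale[OF l] lin_id_map] tensor_map_linear(3)[OF l lin_id_map]) (simp add: idm_tensor)
      finally show ?thesis .
    qed
    \<comment> \<open>The way from \<open>X (Suc i)\<close> through F (X i), L(1) \<otimes> (L(i)
      \<otimes> N) and (L(1) \<otimes> L(i)) \<otimes> N to L(i + 1) \<otimes> N, and the way
      back.\<close>
    let ?j = "B \<circ> (\<phi> \<circ> (Fm j \<circ> \<sigma>))" and ?q = "\<rho> \<circ> (Fm q \<circ> (\<psi> \<circ> A))"
    note Fj = Fm_hom[OF s(1) Xm m(1)] and Fq = Fm_hom[OF s(2) m(1) Xm]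
    have jh: "?j \<in> sl2_hom (X (Suc i)) ?Z'" and qh: "?q \<in> sl2_hom ?Z' (X (Suc i))"
      by (intro hom_comp[OF _ AB(2)] hom_comp[OF _ pp(1)] hom_comp[OF _ Fj] sr hom_comp[OF _ sr(2)] hom_comp[OF _ Fq] hom_comp[OF AB(1) pp(2)])+
    have Fqj: "Fm q (Fm j v) = idm (F (X i)) v" for v
      using s(3) by (simp add: Fm_comp_apply hom_lin[OF s(1)] hom_lin[OF s(2)] fun_eq_iff flip: Fm_simps(4))
    have low': "\<exists>As. set As \<subseteq> X ` {..i} \<and> splits_through As V" if VV: "V \<in> (\<lambda>E. tensor_module E N) ` E ` {..i}" for V
    proof -
      obtain k where k: "V = tensor_module (E k) N" "k \<le> i" using VV by auto
      obtain As where "set As \<subseteq> X ` {..k}" "splits_through As (tensor_module (E k) N)" using low[OF k(2)] by blast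
      then show ?thesis using k by (intro exI[of _ As]) auto
    qed
    \<comment> \<open>The difference between \<open>A \<circ> B\<close> and the identity factors
      through modules \<open>X l\<close> with l \<le> i, so it contributes nothing to an
      endomorphism of \<open>X (Suc i)\<close>.\<close>
    have qj: "?q \<circ> ?j = idm (X (Suc i))"
    proof
      fix x
      let ?w = "\<phi> (Fm j (\<sigma> x))"
      let ?\<epsilon> = "tensor_map (idm (F (E i)) - (a \<circ> b)) (idm N)"
      have "thr (map (\<lambda>E. tensor_module E N) Cs) ?Y ?Y ?\<epsilon>"
        by (rule thr_tensor_right[OF N ab(5)]) auto
      then have "\<exists>Ds. set Ds \<subseteq> X ` {..i} \<and> thr Ds ?Y ?Y ?\<epsilon>"
      proof (rule thr_trans)
        fix V assume "V \<in> set (map (\<lambda>E. tensor_module E N) Cs)"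
        then show "\<exists>As. set As \<subseteq> X ` {..i} \<and> splits_through As V" using low' ab(4) by auto
      qed
      then obtain Ds where Ds: "set Ds \<subseteq> X ` {..i}" "thr Ds ?Y ?Y ?\<epsilon>" by blast
      have "thr Ds (X (Suc i)) (X (Suc i)) ((\<rho> \<circ> (Fm q \<circ> \<psi>)) \<circ> ?\<epsilon> \<circ> (\<phi> \<circ> (Fm j \<circ> \<sigma>)))"
        by (rule thr_comp[OF Ds(2)]; intro hom_comp[OF _ pp(1)] hom_comp[OF _ Fj] sr hom_comp[OF _ sr(2)] hom_comp[OF _ Fq] pp)
      from thr_zero[OF this, of x] Ds(1) have z: "\<rho> (Fm q (\<psi> (?\<epsilon> ?w))) = 0" by force
      have "(?q \<circ> ?j) x = \<rho> (Fm q (\<psi> (A (B ?w))))" by simp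
      also have "\<dots> = \<rho> (Fm q (\<psi> ?w)) - \<rho> (Fm q (\<psi> (?\<epsilon> ?w)))"
        by (simp add: AB1 hom_cod[OF pp(1)] lin_diff[OF hom_lin[OF pp(2)]] lin_diff[OF lin_Fm] lin_diff[OF hom_lin[OF sr(2)]])
      also have "\<psi> ?w = Fm j (\<sigma> x)" using fun_cong[OF pp(4), of "Fm j (\<sigma> x)"] by (simp add: hom_cod[OF Fj])
      also have "\<rho> (Fm q (Fm j (\<sigma> x))) = idm (X (Suc i)) x"
        using fun_cong[OF sr(3), of x] by (simp add: Fqj hom_cod[OF sr(1)])
      finally show "(?q \<circ> ?j) x = idm (X (Suc i)) x" unfolding z by (simp only: diff_zero)
    qed
    have FX: "\<exists>Es. set Es \<subseteq> X ` {..i} \<and> splits_through Es (F (X l))" if l: "l < i" for l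
    proof -
      obtain s r Bs where d: "s \<in> sl2_hom (X (Suc l)) (F (X l))" "r \<in> sl2_hom (F (X l)) (X (Suc l))"
         "set Bs \<subseteq> X ` {..l}" "thr Bs (F (X l)) (F (X l)) (idm (F (X l)) - (s \<circ> r))"
        by (rule F_X_decomposition)
      have "splits_through (X (Suc l) # Bs) (F (X l))"
        by (rule thr_Cons'[OF d(4) Xm d(2,1)]) (simp add: fun_eq_iff)
      then show ?thesis using d(3) l by (intro exI[of _ "X (Suc l) # Bs"]) auto
    qed
    have "thr (map F As) (F ?Z) (F ?Z) (Fm (idm ?Z - (j \<circ> q)))"
      unfolding F_def[abs_def] Fm_def by (rule thr_tensor_left[OF E_closed s(5) m(1) m(1)])
    then have "\<exists>Ds. set Ds \<subseteq> X ` {..i} \<and> thr Ds (F ?Z) (F ?Z) (Fm (idm ?Z - (j \<circ> q)))"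
    proof (rule thr_trans)
      fix V assume "V \<in> set (map F As)"
      then show "\<exists>Bs. set Bs \<subseteq> X ` {..i} \<and> splits_through Bs V" using FX s(4) by auto
    qed
    then obtain Ds where Ds: "set Ds \<subseteq> X ` {..i}" "thr Ds (F ?Z) (F ?Z) (Fm (idm ?Z - (j \<circ> q)))" by blast
    have t1: "thr Ds ?Z' ?Z' ((B \<circ> \<phi>) \<circ> Fm (idm ?Z - (j \<circ> q)) \<circ> (\<psi> \<circ> A))"
      by (rule thr_comp[OF Ds(2) hom_comp[OF AB(1) pp(2)] hom_comp[OF pp(1) AB(2)]])
    have t2: "thr Bs ?Z' ?Z' ((B \<circ> (\<phi> \<circ> Fm j)) \<circ> (idm (F (X i)) - (\<sigma> \<circ> \<rho>)) \<circ> (Fm q \<circ> (\<psi> \<circ> A)))"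
      by (rule thr_comp[OF sr(5)]; intro hom_comp[OF _ AB(2)] hom_comp[OF _ pp(1)] Fj hom_comp[OF _ Fq] hom_comp[OF AB(1) pp(2)])
    have Fzq: "Fm (idm ?Z - (j \<circ> q)) v = idm (F ?Z) v - Fm j (Fm q v)" for v
    proof -
      have "lin (idm ?Z - (j \<circ> q))" "lin j" "lin q" using hom_lin[OF s(1)] hom_lin[OF s(2)] by simp_all
      then show ?thesis by (simp add: Fm_apply idmF_apply tensor_vec_bilinear)
    qed
    have "thr (Bs @ Ds) ?Z' ?Z' (idm ?Z' - (?j \<circ> ?q))"
    proof -
      have "((B \<circ> (\<phi> \<circ> Fm j)) \<circ> (idm (F (X i)) - (\<sigma> \<circ> \<rho>)) \<circ> (Fm q \<circ> (\<psi> \<circ> A))) + ((B \<circ> \<phi>) \<circ> Fm (idm ?Z - (j \<circ> q)) \<circ> (\<psi> \<circ> A))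
          = idm ?Z' - (?j \<circ> ?q)"
      proof
        fix v
        have pa: "\<phi> (\<psi> (A v)) = A v" using fun_cong[OF pp(3), of "A v"] by (simp add: hom_cod[OF AB(1)])
        show "(((B \<circ> (\<phi> \<circ> Fm j)) \<circ> (idm (F (X i)) - (\<sigma> \<circ> \<rho>)) \<circ> (Fm q \<circ> (\<psi> \<circ> A))) + ((B \<circ> \<phi>) \<circ> Fm (idm ?Z - (j \<circ> q)) \<circ> (\<psi> \<circ> A))) v
          = (idm ?Z' - (?j \<circ> ?q)) v"
          by (simp add: Fzq lin_diff[OF hom_lin[OF AB(2)]] lin_diff[OF hom_lin[OF pp(1)]] lin_diff[OF lin_Fm]
              hom_cod[OF Fq] hom_cod[OF pp(2)] pa BA)
      qed
      then show ?thesis using thr_append[OF t2 t1] by (simp only:)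
    qed
    moreover have "set (Bs @ Ds) \<subseteq> X ` {..<Suc i}" using Ds(1) sr(4) by (simp add: lessThan_Suc_atMost)
    ultimately show ?thesis
      unfolding Suc
      by (rule_tac exI[of _ ?j], rule_tac exI[of _ ?q], rule_tac exI[of _ "Bs @ Ds"]) (intro conjI jh qh qj; assumption)
  qed
qed

end

section \<open>The enveloping algebra and its action on modules\<close>

lemma U_const_simps:
  "U_const 0 = 0" "U_const 1 = 1" "U_const (s + t) = U_const s + U_const t" "U_const (s * t) = U_const s * U_const t"
  by (transfer; simp add: sl2_ideal.zero zero_gen_word_def[symmetric] single_add mult_single flip: single_one)+

lemma U_const_of_nat: "U_const (of_nat n) = of_nat n"
  by (induction n) (simp_all add: U_const_simps)

lemma U_const_numeral: "U_const (numeral n) = numeral n"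
  using U_const_of_nat[of "numeral n"] by simp

lemma U_const_minus: "U_const (- t) = - U_const t"
  using U_const_simps(3)[of t "- t"] by (simp add: U_const_simps(1) eq_neg_iff_add_eq_0 add.commute)

lemma U_const_gen: "U_const t * U_gen g = U_gen g * U_const t"
  by transfer (simp add: free_gen_def mult_single sl2_ideal.zero)

lemma free_algebra_induct [case_names single add]:
  fixes x :: free_algebra
  assumes single: "\<And>k v. P (Poly_Mapping.single k v)" and add: "\<And>f g. P f \<Longrightarrow> P g \<Longrightarrow> P (f + g)"
  shows "P x"
proof (induction x rule: Poly_Mapping.update_induct)
  case const
  then show ?case using single[of 0 0] by simp
next
  case (update f a b)
  have "Poly_Mapping.update a b f = f + Poly_Mapping.single a b"
    using update(1) by (intro poly_mapping_eqI) (auto simp: lookup_update lookup_add lookup_single in_keys_iff when_def)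
  then show ?case using add[OF update(3) single] by simp
qed

lemma U_induct [case_names one add const gen]:
  assumes one: "P 1" and add: "\<And>u w. P u \<Longrightarrow> P w \<Longrightarrow> P (u + w)"
    and const: "\<And>t u. P u \<Longrightarrow> P (U_const t * u)" and gen: "\<And>g u. P u \<Longrightarrow> P (U_gen g * u)"
  shows "P u"
proof (induction u rule: U.abs_induct)
  fix x :: free_algebra
  have word: "P (abs_U (Poly_Mapping.single (Gen_Word w) 1))" for w
  proof (induction w)
    case Nil
    have "abs_U (Poly_Mapping.single (Gen_Word []) 1) = 1"
      by (simp add: one_U.abs_eq zero_gen_word_def flip: single_one)
    then show ?case using one by simp
  next
    case (Cons g w)
    have "abs_U (Poly_Mapping.single (Gen_Word (g # w)) 1) = U_gen g * abs_U (Poly_Mapping.single (Gen_Word w) 1)"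
      by (simp add: U_gen.abs_eq times_U.abs_eq free_gen_def mult_single)
    then show ?case using gen[OF Cons] by simp
  qed
  show "P (abs_U x)"
  proof (induction x rule: free_algebra_induct)
    case (single k v)
    obtain w where w: "k = Gen_Word w" by (cases k)
    have "abs_U (Poly_Mapping.single k v) = U_const v * abs_U (Poly_Mapping.single (Gen_Word w) 1)"
      by (simp add: w U_const.abs_eq times_U.abs_eq mult_single zero_gen_word_def)
    then show ?case using const[OF word] by simp
  next
    case (add f g)
    then show ?case using assms(2) by (simp add: plus_U.abs_eq[symmetric])
  qed
qed

lemma U_relations:
  "U_e * U_f = U_f * U_e + U_h" "U_h * U_e = U_e * U_h + 2 * U_e" "U_h * U_f = U_f * U_h - 2 * U_f"
proof -
  have r: "x \<in> sl2_relators \<Longrightarrow> abs_U x = 0" for x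
    using sl2_ideal.gen[of x 1 1] by (simp add: zero_U.abs_eq U.abs_eq_iff)
  have two: "abs_U 2 = 2" using plus_U.abs_eq[of 1 1] by (simp add: one_U.abs_eq[symmetric])
  note a = U_gen.abs_eq plus_U.abs_eq[symmetric] minus_U.abs_eq[symmetric] times_U.abs_eq[symmetric] two
  have "U_e * U_f - U_f * U_e - U_h = 0" "U_h * U_e - U_e * U_h - 2 * U_e = 0" "U_h * U_f - U_f * U_h + 2 * U_f = 0"
    unfolding a(1) by (simp_all only: two[symmetric] times_U.abs_eq minus_U.abs_eq plus_U.abs_eq; rule r; simp add: sl2_relators_def)+
  then show "U_e * U_f = U_f * U_e + U_h" "U_h * U_e = U_e * U_h + 2 * U_e" "U_h * U_f = U_f * U_h - 2 * U_f"
    by (simp_all add: algebra_simps)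
qed

section \<open>The action of the enveloping algebra on a module\<close>

fun gen_act :: "sl2_module \<Rightarrow> gen \<Rightarrow> vec \<Rightarrow> vec" where
  "gen_act V Gen_e = act_e V" | "gen_act V Gen_f = act_f V" | "gen_act V Gen_h = act_h V"

fun word_act :: "sl2_module \<Rightarrow> gen_word \<Rightarrow> vec \<Rightarrow> vec" where
  "word_act V (Gen_Word gs) v = foldr (gen_act V) gs v"

definition free_act :: "sl2_module \<Rightarrow> free_algebra \<Rightarrow> vec \<Rightarrow> vec" where
  "free_act V x v = (\<Sum>w\<in>Poly_Mapping.keys x. vscale (Poly_Mapping.lookup x w) (word_act V w v))"

text \<open>The action of a representative in the free algebra; \<open>free_act_ideal\<close> makes
  it independent of the representative.\<close>

definition U_act :: "sl2_module \<Rightarrow> U \<Rightarrow> vec \<Rightarrow> vec" where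
  "U_act V u v = free_act V (rep_U u) v"

lemma free_act_superset:
  assumes "finite A" "Poly_Mapping.keys x \<subseteq> A"
  shows "free_act V x v = (\<Sum>w\<in>A. vscale (Poly_Mapping.lookup x w) (word_act V w v))"
  unfolding free_act_def using assms by (intro sum.mono_neutral_left) (auto simp: in_keys_iff)

lemma free_act_zero: "free_act V 0 v = 0"
  by (simp add: free_act_def)

lemma free_act_add: "free_act V (x + y) v = free_act V x v + free_act V y v"
proof -
  let ?A = "Poly_Mapping.keys x \<union> Poly_Mapping.keys y"
  have "Poly_Mapping.keys (x + y) \<subseteq> ?A" by (rule Poly_Mapping.keys_add)
  then show ?thesis
    by (simp add: free_act_superset[of ?A] lookup_add vec.scale_left_distrib sum.distrib)
qed

lemma free_act_single: "free_act V (Poly_Mapping.single w t) v = vscale t (word_act V w v)"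
  by (simp add: free_act_superset[of "{w}"])

lemma word_act_plus: "word_act V (a + b) v = word_act V a (word_act V b v)"
  by (cases a; cases b) simp

context
  fixes V assumes V: "V \<in> sl2_modules"
begin

lemma lin_gen_act: "lin (gen_act V g)"
  by (cases g) (simp_all add: lin_sl2[OF V])

lemma lin_word_act: "lin (word_act V w)"
proof (cases w)
  case (Gen_Word gs)
  have "lin (foldr (gen_act V) gs)"
  proof (induction gs)
    case Nil
    show ?case by simp
  next
    case (Cons g gs)
    then show ?case unfolding foldr.simps by (intro lin_comp lin_gen_act) (simp only: o_apply)
  qed
  moreover have "word_act V w = foldr (gen_act V) gs" by (simp add: Gen_Word fun_eq_iff)
  ultimately show ?thesis by simp
qed

lemma lin_free_act: "lin (free_act V x)"
  by (rule linI) (simp_all add: free_act_def lin_add[OF lin_word_act] lin_scale[OF lin_word_act] vec.scale_right_distrib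
      sum.distrib vec.scale_sum_right mult.commute)

lemma free_act_mult: "free_act V (x * y) v = free_act V x (free_act V y v)"
proof (induction x rule: free_algebra_induct)
  case (single k s)
  show ?case
  proof (induction y rule: free_algebra_induct)
    case (single l t)
    then show ?case by (simp add: mult_single free_act_single word_act_plus lin_scale[OF lin_word_act])
  next
    case (add f g)
    then show ?case by (simp add: distrib_left free_act_add lin_add[OF lin_free_act])
  qed
next
  case (add f g)
  then show ?case by (simp add: distrib_right free_act_add)
qed

lemma free_act_gen: "free_act V (free_gen g) v = gen_act V g v"
  by (simp add: free_gen_def free_act_single)

lemma free_act_ideal: "x \<in> sl2_ideal \<Longrightarrow> free_act V x v = 0"
proof (induction arbitrary: v rule: sl2_ideal.induct)
  case zero
  show ?case by (simp add: free_act_zero)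
next
  case (gen r a b)
  have m: "free_act V (x - y) v = free_act V x v - free_act V y v" for x y v
    using free_act_add[of V "x - y" y v] by simp
  have two: "free_act V (2 * x) v = vscale 2 (free_act V x v)" for x v
    using free_act_add[of V x x v] vec.scale_left_distrib[of 1 1 "free_act V x v"] by (simp add: mult_2)
  have two2: "free_act V 2 v = vscale 2 v" for v
  proof -
    have "free_act V 1 v = v" by (simp add: free_act_single zero_gen_word_def flip: single_one)
    then show ?thesis using two[of 1 v] by simp
  qed
  have "free_act V r w = 0" for w
    using gen sl2_rels[OF V] unfolding sl2_relators_def
    by (auto simp: m free_act_add free_act_gen two2 free_act_mult)
  then show ?case by (simp add: free_act_mult lin_zero[OF lin_free_act])
next
  case (add x y)
  then show ?case by (simp add: free_act_add)
qed

lemma U_act_abs: "U_act V (abs_U x) v = free_act V x v"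
proof -
  have "abs_U (rep_U (abs_U x)) = abs_U x" by (rule Quotient3_abs_rep[OF Quotient3_U])
  then have "rep_U (abs_U x) - x \<in> sl2_ideal" by (simp add: U.abs_eq_iff)
  from free_act_ideal[OF this] have "free_act V (rep_U (abs_U x) - x) v = 0" .
  then show ?thesis using free_act_add[of V "rep_U (abs_U x) - x" x v] by (simp add: U_act_def)
qed

lemma U_act_simps:
  "U_act V 1 v = v" "U_act V (u + w) v = U_act V u v + U_act V w v" "U_act V (u * w) v = U_act V u (U_act V w v)"
  "U_act V (U_const t) v = vscale t v" "U_act V (U_gen g) v = gen_act V g v"
proof -
  show "U_act V 1 v = v"
    by (simp add: one_U.abs_eq U_act_abs free_act_single zero_gen_word_def flip: single_one)
  show "U_act V (u + w) v = U_act V u v + U_act V w v"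
    by (induction u rule: U.abs_induct; induction w rule: U.abs_induct) (simp add: plus_U.abs_eq U_act_abs free_act_add)
  show "U_act V (u * w) v = U_act V u (U_act V w v)"
    by (induction u rule: U.abs_induct; induction w rule: U.abs_induct) (simp add: times_U.abs_eq U_act_abs free_act_mult)
  show "U_act V (U_const t) v = vscale t v"
    by (simp add: U_const.abs_eq U_act_abs free_act_single zero_gen_word_def)
  show "U_act V (U_gen g) v = gen_act V g v"
    by (simp add: U_gen.abs_eq U_act_abs free_act_gen)
qed

lemma U_act_diff: "U_act V (u - w) v = U_act V u v - U_act V w v"
  using U_act_simps(2)[of "u - w" w v] by simp

lemma U_act_zero: "U_act V u 0 = 0"
  by (simp add: U_act_def lin_zero[OF lin_free_act])

lemma U_act_casimir: "v \<in> space V \<Longrightarrow> U_act V U_casimir v = cas V v"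
  by (simp add: U_casimir_def cas_def power2_eq_square U_act_simps U_act_simps(4)[of 4, unfolded U_const_numeral] lin_add[OF lin_sl2(3)[OF V]])

lemma U_quotientI:
  assumes "v0 \<in> space V" "\<And>v. v \<in> space V \<Longrightarrow> \<exists>u. U_act V u v0 = v"
  shows "U_quotient {u. U_act V u v0 = 0} V"
proof -
  have "U_act V u v0 \<in> space V" for u
  proof (induction u rule: U_induct)
    case (gen g u)
    then show ?case using V by (cases g) (simp_all add: U_act_simps)
  qed (use assms(1) in \<open>simp_all add: U_act_simps\<close>)
  then have "range (\<lambda>u. U_act V u v0) = space V" using assms(2) by (auto simp: image_iff) metis
  then show ?thesis
    unfolding U_quotient_def using V by (auto simp: U_act_simps intro!: exI[of _ "\<lambda>u. U_act V u v0"])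
qed

end

text \<open>The two surjections have the same kernel, so sending p u to q u is well defined and
  injective. Hence \<open>M_xi\<close>, chosen by its defining property, can be compared with an
  explicit model.\<close>

lemma U_quotient_unique:
  assumes "U_quotient I V" "U_quotient I W"
  shows "mod_iso V W"
proof -
  from assms(1) obtain p where V: "V \<in> sl2_modules" and p: "\<And>u w. p (u + w) = p u + p w" "\<And>t u. p (U_const t * u) = vscale t (p u)"
    "\<And>u. p (U_e * u) = act_e V (p u)" "\<And>u. p (U_f * u) = act_f V (p u)" "\<And>u. p (U_h * u) = act_h V (p u)"
    "range p = space V" "{u. p u = 0} = I"
    unfolding U_quotient_def by blast
  from assms(2) obtain q where W: "W \<in> sl2_modules" and q: "\<And>u w. q (u + w) = q u + q w" "\<And>t u. q (U_const t * u) = vscale t (q u)"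
    "\<And>u. q (U_e * u) = act_e W (q u)" "\<And>u. q (U_f * u) = act_f W (q u)" "\<And>u. q (U_h * u) = act_h W (q u)"
    "range q = space W" "{u. q u = 0} = I"
    unfolding U_quotient_def by blast
  have pd: "p (u - w) = p u - p w" and qd: "q (u - w) = q u - q w" for u w
    using p(1)[of "u - w" w] q(1)[of "u - w" w] by simp_all
  have pq: "p u = 0 \<longleftrightarrow> q u = 0" for u using p(7) q(7) by blast
  define s where "s v = (SOME u. p u = idm V v)" for v
  have s: "p (s v) = idm V v" for v
  proof -
    have "idm V v \<in> range p" by (simp add: p(6))
    then have "\<exists>u. p u = idm V v" by (metis imageE)
    then show ?thesis unfolding s_def by (rule someI_ex)
  qed
  define \<phi> where "\<phi> v = q (s v)" for v
  have qeq: "q u = q w" if "p u = p w" for u w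
    using that pq[of "u - w"] by (simp add: pd qd)
  have key: "\<phi> v = q u" if "p u = idm V v" for u v
    unfolding \<phi>_def by (rule qeq) (simp add: s that)
  have lin: "lin \<phi>"
  proof (rule linI)
    show "\<phi> (x + y) = \<phi> x + \<phi> y" for x y
      using key[of "s x + s y" "x + y"] by (simp add: p(1) q(1) s lin_add[OF lin_id_map] \<phi>_def)
    show "\<phi> (vscale c x) = vscale c (\<phi> x)" for c x
      using key[of "U_const c * s x" "vscale c x"] by (simp add: p(2) q(2) s lin_scale[OF lin_id_map] \<phi>_def)
  qed
  have \<phi>: "\<phi> \<in> sl2_hom V W"
  proof (intro sl2_homI linear_mapsI V lin)
    show "\<phi> (idm V v) = \<phi> v" for v
      using key[of "s v" "idm V v"] by (simp add: s \<phi>_def)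
    show "\<phi> v \<in> space W" for v unfolding \<phi>_def q(6)[symmetric] by simp
    fix v assume "v \<in> space V"
    then show "\<phi> (act_e V v) = act_e W (\<phi> v)" "\<phi> (act_f V v) = act_f W (\<phi> v)" "\<phi> (act_h V v) = act_h W (\<phi> v)"
      using key[of "U_e * s v" "act_e V v"] key[of "U_f * s v" "act_f V v"] key[of "U_h * s v" "act_h V v"]
      by (simp_all add: p(3-5) q(3-5) s \<phi>_def V)
  qed
  show ?thesis
  proof (rule bijective_hom_iso[OF \<phi> V W])
    show "inj_on \<phi> (space V)"
    proof (rule hom_injective_iff[OF \<phi>])
      fix v assume v: "v \<in> space V" "\<phi> v = 0"
      then have "p (s v) = 0" using pq[of "s v"] by (simp add: \<phi>_def)
      then show "v = 0" using v(1) by (simp add: s)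
    qed
    show "\<phi> ` space V = space W"
    proof
      show "\<phi> ` space V \<subseteq> space W" using hom_in[OF \<phi>] by auto
      show "space W \<subseteq> \<phi> ` space V"
      proof
        fix w assume "w \<in> space W"
        then obtain u where u: "w = q u" using q(6) by blast
        have "p u \<in> space V" unfolding p(6)[symmetric] by simp
        then show "w \<in> \<phi> ` space V" using key[of u "p u"] u by force
      qed
    qed
  qed
qed

section \<open>A polynomial model of \<open>M(\<xi>)\<close>\<close>

definition poly_vec :: "complex poly \<Rightarrow> vec" where
  "poly_vec p = (\<Sum>i\<le>degree p. vscale (coeff p i) (basis_vec i))"

definition vec_poly :: "vec \<Rightarrow> complex poly" where
  "vec_poly v = (\<Sum>i\<in>keys v. monom (lookup v i) i)"

lemma lookup_poly_vec [simp]: "lookup (poly_vec p) i = coeff p i"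
  by (auto simp: poly_vec_def lookup_sum lookup_basis_vec coeff_eq_0 if_distrib sum.delta cong: if_cong)

lemma coeff_vec_poly [simp]: "coeff (vec_poly v) i = lookup v i"
  by (auto simp: vec_poly_def coeff_sum sum.delta in_keys_iff)

lemma vec_poly_simps [simp]:
  "vec_poly (poly_vec p) = p" "poly_vec (vec_poly v) = v" "vec_poly (v + w) = vec_poly v + vec_poly w"
  "vec_poly (v - w) = vec_poly v - vec_poly w" "vec_poly (vscale c v) = smult c (vec_poly v)" "vec_poly 0 = 0"
  "vec_poly (basis_vec 0) = 1"
  by (rule poly_eqI vec_eqI; simp add: lookup_add lookup_minus lookup_basis_vec)+

lemma vec_poly_eqI: "(\<And>x. poly (vec_poly v) x = poly (vec_poly w) x) \<Longrightarrow> v = w"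
  by (metis ext poly_eq_poly_eq_iff vec_poly_simps(2))

text \<open>A basis of \<open>M(\<xi>)\<close> is given by the powers of \<open>h\<close> applied to the generator, on which \<open>e\<close>
  and \<open>f\<close> act by shifting the argument \<open>h\<close> by \<open>2\<close>.\<close>

definition shift_module :: "complex \<Rightarrow> sl2_module" where
  "shift_module \<xi> = \<lparr>basis = UNIV,
     act_e = (\<lambda>v. poly_vec (smult \<xi> (pcompose (vec_poly v) [:-2, 1:]))),
     act_f = (\<lambda>v. poly_vec (smult (- 1 / (4 * \<xi>)) ([:1, 1:] ^ 2 * pcompose (vec_poly v) [:2, 1:]))),
     act_h = (\<lambda>v. poly_vec ([:0, 1:] * vec_poly v))\<rparr>"

lemma basis_shift_module [simp]: "basis (shift_module \<xi>) = UNIV"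
  by (simp add: shift_module_def)

lemma idm_UNIV [simp]: "id_map UNIV v = v"
  by (rule vec_eqI) simp

lemma vec_space_UNIV [simp]: "v \<in> vec_space UNIV"
  by (simp add: in_vec_space_iff)

lemma poly_shift_module:
  "poly (vec_poly (act_e (shift_module \<xi>) v)) x = \<xi> * poly (vec_poly v) (x - 2)"
  "poly (vec_poly (act_f (shift_module \<xi>) v)) x = - ((x + 1) ^ 2 * poly (vec_poly v) (x + 2) / (4 * \<xi>))"
  "poly (vec_poly (act_h (shift_module \<xi>) v)) x = x * poly (vec_poly v) x"
  by (simp_all add: shift_module_def poly_pcompose algebra_simps)

text \<open>The element p(h) of the enveloping algebra.\<close>

definition U_poly :: "complex poly \<Rightarrow> U" where
  "U_poly p = fold_coeffs (\<lambda>a u. U_const a + U_h * u) p 0"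

lemma U_poly_simps: "U_poly 0 = 0" "U_poly (pCons a p) = U_const a + U_h * U_poly p"
proof -
  show "U_poly 0 = 0" by (simp add: U_poly_def)
  show "U_poly (pCons a p) = U_const a + U_h * U_poly p"
    by (cases "p = 0"; cases "a = 0") (simp_all add: U_poly_def U_const_simps)
qed

lemma U_poly_add: "U_poly (p + q) = U_poly p + U_poly q"
  by (induction p q rule: poly_induct2) (simp_all add: U_poly_simps U_const_simps algebra_simps)

lemma U_poly_smult: "U_poly (smult t p) = U_const t * U_poly p"
proof (induction p)
  case (pCons a p)
  have "U_const t * (U_h * U_poly p) = U_h * (U_const t * U_poly p)"
    by (metis U_const_gen mult.assoc)
  then show ?case using pCons by (simp add: U_poly_simps distrib_left U_const_simps(4))
qed (simp add: U_poly_simps)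

context
  fixes \<xi> :: complex assumes \<xi>: "\<xi> \<noteq> 0"
begin

lemma shift_module_closed: "shift_module \<xi> \<in> sl2_modules"
proof (intro sl2_modulesI linear_mapsI linI; (rule vec_poly_eqI)?)
qed (simp_all add: poly_shift_module \<xi> field_simps power2_eq_square)

text \<open>This dictates the coefficient of f in the model: with e acting on the generator by
  \<xi>, the Casimir element vanishes when 4 f e = - (h + 1)^2.\<close>

lemma cas_shift_module: "cas (shift_module \<xi>) v = 0"
  by (rule vec_poly_eqI) (simp add: cas_def poly_shift_module \<xi> field_simps power2_eq_square)

lemma act_h_basis_vec_shift: "act_h (shift_module \<xi>) (basis_vec k) = basis_vec (Suc k)"
  by (rule vec_eqI) (simp add: shift_module_def coeff_pCons lookup_basis_vec split: nat.split)

text \<open>The value at 0 is taken at every even natural number, so q - q(0) has infinitely many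
  roots.\<close>

lemma periodic_poly_const:
  fixes q :: "complex poly"
  assumes "\<And>x. poly q (x - 2) = poly q x"
  shows "q = [:poly q 0:]"
proof (rule ccontr)
  assume "q \<noteq> [:poly q 0:]"
  then have "finite {x. poly (q - [:poly q 0:]) x = 0}" by (intro poly_roots_finite) simp
  moreover have "poly q (of_nat (2 * n)) = poly q 0" for n
    using assms[of "of_nat (2 * Suc k)" for k] by (induction n) (simp_all add: algebra_simps)
  then have "range (\<lambda>n. of_nat (2 * n) :: complex) \<subseteq> {x. poly (q - [:poly q 0:]) x = 0}" by auto
  moreover have "inj_on (\<lambda>n. of_nat (2 * n) :: complex) UNIV" by (intro inj_onI) simp
  ultimately show False by (meson finite_imageD finite_subset infinite_UNIV_nat)
qed

text \<open>The image of the generator is again an eigenvector of e for \<xi>, that is, a polynomial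
  with p(x - 2) = p(x), and so a constant. Powers of h carry this to the whole basis.\<close>

lemma shift_module_endomorphism:
  assumes g: "g \<in> sl2_hom (shift_module \<xi>) (shift_module \<xi>)"
  shows "\<exists>\<alpha>. \<forall>v. g v = vscale \<alpha> (idm (shift_module \<xi>) v)"
proof -
  let ?q = "vec_poly (g (basis_vec 0))"
  note l = hom_lin[OF g]
  have "act_e (shift_module \<xi>) (basis_vec 0) = vscale \<xi> (basis_vec 0)"
    by (rule vec_poly_eqI) (simp add: poly_shift_module)
  then have "act_e (shift_module \<xi>) (g (basis_vec 0)) = vscale \<xi> (g (basis_vec 0))"
    by (simp flip: hom_e[OF g] add: lin_scale[OF l])
  then have "\<xi> * poly ?q (x - 2) = \<xi> * poly ?q x" for x
    using poly_shift_module(1)[of \<xi> "g (basis_vec 0)" x] by (simp only: vec_poly_simps poly_smult)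
  then have "poly ?q (x - 2) = poly ?q x" for x using \<xi> by (metis mult_left_cancel)
  then have q: "?q = [:poly ?q 0:]" by (rule periodic_poly_const)
  define \<alpha> where "\<alpha> = poly ?q 0"
  have "g (basis_vec k) = vscale \<alpha> (basis_vec k)" for k
  proof (induction k)
    case 0
    show ?case by (rule vec_poly_eqI, subst q) (simp add: \<alpha>_def)
  next
    case (Suc k)
    have "g (basis_vec (Suc k)) = act_h (shift_module \<xi>) (g (basis_vec k))"
      by (simp flip: act_h_basis_vec_shift hom_h[OF g])
    also have "\<dots> = vscale \<alpha> (basis_vec (Suc k))"
      by (simp add: Suc lin_scale[OF lin_sl2(3)[OF shift_module_closed]] act_h_basis_vec_shift)
    finally show ?case .
  qed
  then have "g = map_scale \<alpha> (idm (shift_module \<xi>))"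
    by (intro lin_ext) (simp_all add: l)
  then show ?thesis by (intro exI[of _ \<alpha>]) simp
qed

lemma U_act_U_poly: "U_act (shift_module \<xi>) (U_poly p) (basis_vec 0) = poly_vec p"
proof (induction p)
  case 0
  have "U_act (shift_module \<xi>) 0 (basis_vec 0) = 0"
    using U_act_diff[OF shift_module_closed, of 1 1 "basis_vec 0"] by simp
  then show ?case by (simp add: U_poly_simps) (rule vec_eqI, simp)
next
  case (pCons a p)
  show ?case
    by (rule vec_poly_eqI) (simp add: U_poly_simps U_act_simps[OF shift_module_closed] pCons poly_shift_module)
qed

section \<open>The left ideal defining M(\<xi>)\<close>

definition left_ideal :: "U set" where
  "left_ideal = {u * U_casimir + w * (U_e - U_const \<xi>) |u w. True}"

lemma left_ideal_closed:
  "x \<in> left_ideal \<Longrightarrow> y \<in> left_ideal \<Longrightarrow> x + y \<in> left_ideal" "x \<in> left_ideal \<Longrightarrow> u * x \<in> left_ideal"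
  "0 \<in> left_ideal" "U_casimir \<in> left_ideal" "U_e - U_const \<xi> \<in> left_ideal"
proof -
  show "x \<in> left_ideal \<Longrightarrow> y \<in> left_ideal \<Longrightarrow> x + y \<in> left_ideal"
  proof -
    assume "x \<in> left_ideal" "y \<in> left_ideal"
    then obtain u w u' w' where "x = u * U_casimir + w * (U_e - U_const \<xi>)" "y = u' * U_casimir + w' * (U_e - U_const \<xi>)"
      unfolding left_ideal_def by blast
    then have "x + y = (u + u') * U_casimir + (w + w') * (U_e - U_const \<xi>)" by (simp only: distrib_right add_ac)
    then show ?thesis unfolding left_ideal_def by blast
  qed
  show "x \<in> left_ideal \<Longrightarrow> u * x \<in> left_ideal"
  proof -
    assume "x \<in> left_ideal"
    then obtain a w where "x = a * U_casimir + w * (U_e - U_const \<xi>)" unfolding left_ideal_def by blast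
    then have "u * x = (u * a) * U_casimir + (u * w) * (U_e - U_const \<xi>)" by (simp only: distrib_left mult.assoc)
    then show ?thesis unfolding left_ideal_def by blast
  qed
  have "0 * U_casimir + 0 * (U_e - U_const \<xi>) \<in> left_ideal" "1 * U_casimir + 0 * (U_e - U_const \<xi>) \<in> left_ideal"
    "0 * U_casimir + 1 * (U_e - U_const \<xi>) \<in> left_ideal" unfolding left_ideal_def by blast+
  then show "0 \<in> left_ideal" "U_casimir \<in> left_ideal" "U_e - U_const \<xi> \<in> left_ideal" by simp_all
qed

text \<open>Congruence to a polynomial in h modulo the left ideal. In the model p(h) takes the
  generator to p, so once everything reduces, the ideal is the full annihilator of the
  generator.\<close>

definition reduces :: "U \<Rightarrow> bool" where
  "reduces u \<longleftrightarrow> (\<exists>p. u - U_poly p \<in> left_ideal)"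

lemma reduces_add: assumes "reduces u" "reduces w" shows "reduces (u + w)"
proof -
  obtain p q where "u - U_poly p \<in> left_ideal" "w - U_poly q \<in> left_ideal" using assms by (auto simp: reduces_def)
  from left_ideal_closed(1)[OF this] have "(u + w) - U_poly (p + q) \<in> left_ideal" by (simp add: U_poly_add algebra_simps)
  then show ?thesis unfolding reduces_def by blast
qed

lemma reduces_const: assumes "reduces u" shows "reduces (U_const t * u)"
proof -
  obtain p where "u - U_poly p \<in> left_ideal" using assms by (auto simp: reduces_def)
  from left_ideal_closed(2)[OF this, of "U_const t"] have "U_const t * u - U_poly (smult t p) \<in> left_ideal"
    by (simp add: U_poly_smult algebra_simps)
  then show ?thesis unfolding reduces_def by blast
qed

lemma reduces_h: assumes "reduces u" shows "reduces (U_h * u)"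
proof -
  obtain p where "u - U_poly p \<in> left_ideal" using assms by (auto simp: reduces_def)
  from left_ideal_closed(2)[OF this, of U_h] have "U_h * u - U_poly (pCons 0 p) \<in> left_ideal"
    by (simp add: U_poly_simps U_const_simps algebra_simps)
  then show ?thesis unfolding reduces_def by blast
qed

lemma reduces_ideal: "u \<in> left_ideal \<Longrightarrow> reduces u"
  unfolding reduces_def by (intro exI[of _ 0]) (simp add: U_poly_simps)

lemma reduces_one: "reduces 1"
  unfolding reduces_def by (intro exI[of _ "[:1:]"]) (simp add: U_poly_simps U_const_simps left_ideal_closed)

lemma reduces_e: "reduces U_e"
  unfolding reduces_def by (intro exI[of _ "[:\<xi>:]"]) (simp add: U_poly_simps U_const_simps left_ideal_closed)

text \<open>Subtracting 4 f (e - \<xi>) from the Casimir element leaves (h + 1)^2 + 4 \<xi> f, which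
  can be solved for f as \<xi> is nonzero.\<close>

lemma reduces_f: "reduces U_f"
proof -
  have "U_casimir + U_const (- 4) * U_f * (U_e - U_const \<xi>) \<in> left_ideal"
    by (intro left_ideal_closed)
  from reduces_ideal[OF this] have 1: "reduces (U_casimir + U_const (- 4) * U_f * (U_e - U_const \<xi>))" .
  have 2: "reduces (U_const (- 1) * (U_h * (U_h * 1) + U_const 2 * (U_h * 1) + 1))"
    by (intro reduces_const reduces_add reduces_h reduces_one)
  have "reduces (U_const (1 / (4 * \<xi>)) * (U_casimir + U_const (- 4) * U_f * (U_e - U_const \<xi>) +
      U_const (- 1) * (U_h * (U_h * 1) + U_const 2 * (U_h * 1) + 1)))"
    by (rule reduces_const[OF reduces_add[OF 1 2]])
  moreover have "U_casimir + U_const (- 4) * U_f * (U_e - U_const \<xi>) + U_const (- 1) * (U_h * (U_h * 1) + U_const 2 * (U_h * 1) + 1)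
      = 4 * (U_f * U_const \<xi>)"
    by (simp add: U_casimir_def power2_eq_square U_const_minus U_const_simps U_const_numeral algebra_simps mult_2[symmetric])
  moreover have "4 * (U_f * U_const \<xi>) = U_const (4 * \<xi>) * U_f"
    by (simp add: U_const_simps U_const_numeral mult.assoc U_const_gen)
  moreover have "U_const (1 / (4 * \<xi>)) * (U_const (4 * \<xi>) * U_f) = U_f"
    using \<xi> by (simp add: U_const_simps(2) mult.assoc[symmetric] flip: U_const_simps(4))
  ultimately show ?thesis by simp
qed

lemma reduces_e_mult: assumes "reduces u" shows "reduces (U_e * u)"
proof -
  have P: "reduces (U_e * U_poly p)" for p
  proof (induction p)
    case 0
    show ?case by (simp add: U_poly_simps reduces_ideal left_ideal_closed)
  next
    case (pCons a p)
    have "U_e * U_poly (pCons a p) = U_const a * U_e + (U_h * (U_e * U_poly p) + U_const (- 2) * (U_e * U_poly p))"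
    proof -
      have "U_e * U_h = U_h * U_e - 2 * U_e" using U_relations(2) by simp
      then have "U_e * (U_h * w) = U_h * (U_e * w) - 2 * (U_e * w)" for w
        by (simp only: mult.assoc[symmetric] left_diff_distrib)
      then show ?thesis by (simp add: U_poly_simps distrib_left U_const_gen U_const_minus U_const_numeral)
    qed
    then show ?case using pCons by (simp only:) (intro reduces_add reduces_const reduces_h reduces_e)
  qed
  obtain p where "u - U_poly p \<in> left_ideal" using assms by (auto simp: reduces_def)
  then have "reduces (U_e * (u - U_poly p) + U_e * U_poly p)"
    by (intro reduces_add P reduces_ideal left_ideal_closed)
  then show ?thesis by (simp flip: distrib_left)
qed

lemma reduces_f_mult: assumes "reduces u" shows "reduces (U_f * u)"
proof -
  have P: "reduces (U_f * U_poly p)" for p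
  proof (induction p)
    case 0
    show ?case by (simp add: U_poly_simps reduces_ideal left_ideal_closed)
  next
    case (pCons a p)
    have "U_f * U_poly (pCons a p) = U_const a * U_f + (U_h * (U_f * U_poly p) + U_const 2 * (U_f * U_poly p))"
    proof -
      have "U_f * U_h = U_h * U_f + 2 * U_f" using U_relations(3) by simp
      then have "U_f * (U_h * w) = U_h * (U_f * w) + 2 * (U_f * w)" for w
        by (simp only: mult.assoc[symmetric] distrib_right)
      then show ?thesis by (simp add: U_poly_simps distrib_left U_const_gen U_const_minus U_const_numeral)
    qed
    then show ?case using pCons by (simp only:) (intro reduces_add reduces_const reduces_h reduces_f)
  qed
  obtain p where "u - U_poly p \<in> left_ideal" using assms by (auto simp: reduces_def)
  then have "reduces (U_f * (u - U_poly p) + U_f * U_poly p)"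
    by (intro reduces_add P reduces_ideal left_ideal_closed)
  then show ?thesis by (simp flip: distrib_left)
qed

lemma reduces_all: "reduces u"
proof (induction u rule: U_induct)
  case (gen g u)
  then show ?case by (cases g) (simp_all add: reduces_e_mult reduces_f_mult reduces_h)
qed (simp_all add: reduces_one reduces_add reduces_const)

lemma shift_module_quotient: "U_quotient left_ideal (shift_module \<xi>)"
proof -
  let ?W = "shift_module \<xi>" and ?o = "basis_vec 0"
  note a = U_act_simps[OF shift_module_closed] U_act_diff[OF shift_module_closed] U_act_zero[OF shift_module_closed]
  have I: "U_act ?W u ?o = 0" if "u \<in> left_ideal" for u
  proof -
    obtain x w where u: "u = x * U_casimir + w * (U_e - U_const \<xi>)" using \<open>u \<in> left_ideal\<close> unfolding left_ideal_def by blast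
    have "act_e ?W ?o = vscale \<xi> ?o" by (rule vec_poly_eqI) (simp add: poly_shift_module)
    then show ?thesis
      by (simp add: u a U_act_casimir[OF shift_module_closed] cas_shift_module)
  qed
  have "{u. U_act ?W u ?o = 0} = left_ideal"
  proof (intro set_eqI iffI CollectI)
    fix u assume "u \<in> {u. U_act ?W u ?o = 0}"
    then have u0: "U_act ?W u ?o = 0" by simp
    obtain p where p: "u - U_poly p \<in> left_ideal" using reduces_all[of u] by (auto simp: reduces_def)
    have "poly_vec p = 0" using I[OF p] u0 by (simp add: a U_act_U_poly)
    then have "p = 0" using vec_poly_simps(1)[of p] by simp
    then show "u \<in> left_ideal" using p by (simp add: U_poly_simps)
  qed (use I in simp)
  moreover have "U_quotient {u. U_act ?W u ?o = 0} ?W"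
    by (rule U_quotientI[OF shift_module_closed])
      (simp, metis U_act_U_poly vec_poly_simps(2))
  ultimately show ?thesis by simp
qed

lemma M_xi_iso: "mod_iso (M_xi \<xi>) (shift_module \<xi>)" and M_xi_closed: "M_xi \<xi> \<in> sl2_modules"
proof -
  have "U_quotient left_ideal (M_xi \<xi>)"
    unfolding M_xi_def left_ideal_def[symmetric] by (rule someI) (rule shift_module_quotient)
  then show "mod_iso (M_xi \<xi>) (shift_module \<xi>)" "M_xi \<xi> \<in> sl2_modules"
    using shift_module_quotient by (rule U_quotient_unique, simp add: U_quotient_def)
qed

end

section \<open>The category \<open>K\<^sub>2\<close>\<close>

text \<open>On \<open>X l\<close> the operator \<open>D\<close> is c + 2 l d with c = l^2 - i^2
  nonzero and d nilpotent.\<close>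

lemma (in ladder_modules) casimir_square_injective:
  assumes y: "y \<in> space (X l)" and li: "l \<noteq> i"
    and D: "\<And>v. D v = cas (X l) v - vscale (of_nat i * of_nat i) v" and z: "D (D y) = 0"
  shows "y = 0"
proof -
  define c where "c = (of_nat l * of_nat l - of_nat i * of_nat i :: complex)"
  have c: "c \<noteq> 0"
  proof
    assume "c = 0"
    then have "(of_nat (l * l) :: complex) = of_nat (i * i)" by (simp add: c_def)
    then have "l * l = i * i" by (simp only: of_nat_eq_iff)
    then show False using li by (metis power2_eq_iff_nonneg power2_eq_square zero_le)
  qed
  have ld: "lin (d l)" by (rule hom_lin[OF dh])
  have Dv: "D v = vscale c v + vscale (2 * of_nat l) (d l v)" if "v \<in> space (X l)" for v
    using st[of l] that unfolding D by (simp add: stage_def c_def) (rule vec_eqI, simp add: lookup_add lookup_minus algebra_simps)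
  have Dy: "D y \<in> space (X l)" using y hom_in[OF dh, of l y] by (simp add: Dv)
  have "D (D y) = vscale (c * c) y + vscale (4 * of_nat l * c) (d l y)"
    unfolding Dv[OF Dy] by (simp add: Dv[OF y] lin_add[OF ld] lin_scale[OF ld] dd) (rule vec_eqI, simp add: lookup_add algebra_simps)
  then have "vscale c (vscale c y + vscale (4 * of_nat l) (d l y)) = 0"
    using z by (simp add: vec.scale_right_distrib mult_ac)
  then have e: "vscale c y + vscale (4 * of_nat l) (d l y) = 0" using c by simp
  have "d l (vscale c y + vscale (4 * of_nat l) (d l y)) = vscale c (d l y)"
    by (simp add: lin_add[OF ld] lin_scale[OF ld] dd)
  then have "d l y = 0" using e c by (simp add: lin_zero[OF ld])
  then show ?thesis using e c by simp
qed

context ladder_modules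
begin

text \<open>On \<open>X i\<close> the Casimir operator minus i^2 is 2 i d and squares to zero; on
  the other terms \<open>X l\<close>, l < i, the square is injective. So the kernel is exactly the
  copy of \<open>X i\<close> from \<open>tensor_structure\<close>.\<close>

lemma casimir_kernel_tensor:
  obtains J Q where "J \<in> sl2_hom (X i) (tensor_module (L_fd i) N)" "Q \<in> sl2_hom (tensor_module (L_fd i) N) (X i)"
    "Q \<circ> J = idm (X i)" "casimir_kernel i (tensor_module (L_fd i) N) = J ` space (X i)"
proof -
  let ?T = "tensor_module (L_fd i) N" and ?Z = "tensor_module (E i) N"
  have N: "N \<in> sl2_modules" using Xm[of 0] X0 by simp
  have T: "?T \<in> sl2_modules" by (intro tensor_module_closed L_fd_closed N)
  obtain f g where fg: "f \<in> sl2_hom ?Z ?T" "g \<in> sl2_hom ?T ?Z" "g \<circ> f = idm ?Z" "f \<circ> g = idm ?T"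
    using mod_iso_tensor[OF L_fd_iso E_closed L_fd_closed(1) N, of i] unfolding mod_iso_def by blast
  have gf: "g (f v) = idm ?Z v" "f (g w) = idm ?T w" for v w
    using fun_cong[OF fg(3), of v] fun_cong[OF fg(4), of w] by simp_all
  obtain j q As where j: "j \<in> sl2_hom (X i) ?Z" and q: "q \<in> sl2_hom ?Z (X i)" and qj: "q \<circ> j = idm (X i)"
     and As: "set As \<subseteq> X ` {..<i}" "thr As ?Z ?Z (idm ?Z - (j \<circ> q))"
    using tensor_structure[of i] by (elim exE conjE) (rule that)
  let ?J = "f \<circ> j" and ?Q = "q \<circ> g"
  have J: "?J \<in> sl2_hom (X i) ?T" and Q: "?Q \<in> sl2_hom ?T (X i)"
    by (rule hom_comp[OF j fg(1)], rule hom_comp[OF fg(2) q])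
  have QJ: "q (g (f (j x))) = idm (X i) x" for x
    using fun_cong[OF qj, of x] by (simp add: gf hom_cod[OF j])
  define D where "D W w = cas W w - vscale (of_nat i * of_nat i) w" for W w
  have D_hom: "a (D V v) = D W (a v)" if "a \<in> sl2_hom V W" for a V W v
    by (simp add: D_def lin_diff[OF hom_lin[OF that]] lin_scale[OF hom_lin[OF that]] hom_cas[OF that])
  have kernel: "casimir_kernel i ?T = {v \<in> space ?T. D ?T (D ?T v) = 0}"
  proof -
    have "casimir ?T v - vscale (of_nat (i ^ 2)) v = D ?T v" if "v \<in> space ?T" for v
      using that by (simp add: D_def cas_casimir power2_eq_square)
    moreover have "D ?T v \<in> space ?T" if "v \<in> space ?T" for v
      using that hom_in[OF cas_hom[OF T], of v] by (simp add: D_def)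
    ultimately show ?thesis
      unfolding casimir_kernel_def numeral_2_eq_2 One_nat_def by (intro Collect_cong conj_cong refl) simp
  qed
  have "casimir_kernel i ?T = ?J ` space (X i)"
  proof
    show "?J ` space (X i) \<subseteq> casimir_kernel i ?T"
    proof
      fix v assume "v \<in> ?J ` space (X i)"
      then obtain x where x: "x \<in> space (X i)" "v = ?J x" by blast
      have Dx: "D (X i) w = vscale (2 * of_nat i) (d i w)" if "w \<in> space (X i)" for w
        using st[of i] that by (simp add: D_def stage_def)
      have "D (X i) (D (X i) x) = 0"
        using x(1) hom_in[OF dh, of i x] by (simp add: Dx lin_scale[OF hom_lin[OF dh]] dd)
      then have "D ?T (D ?T (?J x)) = 0"
        by (simp only: D_hom[OF J, symmetric] lin_zero[OF hom_lin[OF J]])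
      then show "v \<in> casimir_kernel i ?T" unfolding kernel x(2) using hom_in[OF J, of x] by blast
    qed
    show "casimir_kernel i ?T \<subseteq> ?J ` space (X i)"
    proof
      fix v assume "v \<in> casimir_kernel i ?T"
      then have v: "v \<in> space ?T" "D ?T (D ?T v) = 0" unfolding kernel by auto
      let ?r = "f \<circ> (idm ?Z - (j \<circ> q)) \<circ> g"
      have "?r v = 0"
      proof (rule ccontr)
        assume nz: "?r v \<noteq> 0"
        from thr_nonzero[OF thr_comp[OF As(2) fg(2,1)] nz] obtain A a u
          where A: "A \<in> set As" "a \<in> sl2_hom ?T A" "u \<in> sl2_hom A ?T" "u (a v) \<noteq> 0" by blast
        then obtain l where l: "A = X l" "l \<noteq> i" using As(1) by auto
        have "a v = 0"
        proof (rule casimir_square_injective[OF _ l(2) D_def])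
          show "a v \<in> space (X l)" using hom_in[OF A(2)] l by simp
          show "D (X l) (D (X l) (a v)) = 0"
            using D_hom[OF A(2)[unfolded l(1)]] v(2) lin_zero[OF hom_lin[OF A(2)]] by metis
        qed
        then show False using A(4) lin_zero[OF hom_lin[OF A(3)]] by simp
      qed
      then have "v = ?J (?Q v)"
        using v(1) by (simp add: lin_diff[OF hom_lin[OF fg(1)]] gf hom_cod[OF fg(2)])
      then show "v \<in> ?J ` space (X i)" using hom_in[OF Q] by blast
    qed
  qed
  then show ?thesis using that[OF J Q] QJ by (simp add: fun_eq_iff)
qed

lemma casimir_kernel_copy:
  assumes "is_submodule_copy (casimir_kernel i (tensor_module (L_fd i) N)) (tensor_module (L_fd i) N) V"
  shows "mod_iso V (X i)"
proof -
  let ?T = "tensor_module (L_fd i) N"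
  obtain J Q where J: "J \<in> sl2_hom (X i) ?T" and Q: "Q \<in> sl2_hom ?T (X i)" and QJ: "Q \<circ> J = idm (X i)"
    and k: "casimir_kernel i ?T = J ` space (X i)" by (rule casimir_kernel_tensor)
  have QJ': "Q (J x) = idm (X i) x" for x using fun_cong[OF QJ, of x] by simp
  from assms obtain \<iota> where V: "V \<in> sl2_modules" and \<iota>: "\<iota> \<in> sl2_hom V ?T" "inj_on \<iota> (space V)" "\<iota> ` space V = J ` space (X i)"
    unfolding is_submodule_copy_def k by blast
  have \<phi>: "Q \<circ> \<iota> \<in> sl2_hom V (X i)" by (rule hom_comp[OF \<iota>(1) Q])
  show ?thesis
  proof (rule bijective_hom_iso[OF \<phi> V Xm])
    show "inj_on (Q \<circ> \<iota>) (space V)"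
    proof (rule hom_injective_iff[OF \<phi>])
      fix v assume v: "v \<in> space V" "(Q \<circ> \<iota>) v = 0"
      then obtain x where x: "x \<in> space (X i)" "\<iota> v = J x" using \<iota>(3) by blast
      then have "x = 0" using v(2) by (simp add: QJ')
      then have "\<iota> v = \<iota> 0" using x by (simp add: lin_zero[OF hom_lin[OF J]] lin_zero[OF hom_lin[OF \<iota>(1)]])
      then show "v = 0" by (rule inj_onD[OF \<iota>(2)]) (use v in simp_all)
    qed
    show "(Q \<circ> \<iota>) ` space V = space (X i)"
      unfolding image_comp[symmetric] \<iota>(3) by (simp add: image_comp image_image QJ' cong: image_cong)
  qed
qed

lemma casimir_kernel_copy_exists:
  "\<exists>V. is_submodule_copy (casimir_kernel i (tensor_module (L_fd i) N)) (tensor_module (L_fd i) N) V"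
proof -
  let ?T = "tensor_module (L_fd i) N"
  have N: "N \<in> sl2_modules" using Xm[of 0] X0 by simp
  have T: "?T \<in> sl2_modules" by (intro tensor_module_closed L_fd_closed N)
  obtain J Q where J: "J \<in> sl2_hom (X i) ?T" and k: "casimir_kernel i ?T = J ` space (X i)"
    by (rule casimir_kernel_tensor)
  have "submodule (casimir_kernel i ?T) ?T"
    unfolding k by (rule submodule_image[OF J Xm submodule_whole[OF Xm]])
  from submodule_copy[OF T this] obtain W \<iota> \<kappa> where W: "W \<in> sl2_modules" "\<iota> \<in> sl2_hom W ?T"
    "\<And>w. w \<in> space W \<Longrightarrow> \<iota> w \<in> casimir_kernel i ?T \<and> \<kappa> (\<iota> w) = w"
    "\<And>x. x \<in> casimir_kernel i ?T \<Longrightarrow> \<kappa> x \<in> space W \<and> \<iota> (\<kappa> x) = x" by metis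
  have "inj_on \<iota> (space W)" using W(3) by (intro inj_on_inverseI[of _ \<kappa>]) simp
  moreover have "\<iota> ` space W = casimir_kernel i ?T" using W(3,4) by force
  ultimately show ?thesis using W(1,2) unfolding is_submodule_copy_def by blast
qed

end

text \<open>The ladder has to start at the chosen module \<open>M_xi\<close> itself, because
  \<open>X_mod\<close> tensors with it; the properties of the model are carried over along an
  isomorphism.\<close>

lemma ladder_shift:
  assumes "\<xi> \<noteq> 0"
  obtains X d where "ladder (M_xi \<xi>) X d"
proof -
  let ?M = "M_xi \<xi>" and ?W = "shift_module \<xi>"
  obtain f g where fg: "f \<in> sl2_hom ?M ?W" "g \<in> sl2_hom ?W ?M" "g \<circ> f = idm ?M" "f \<circ> g = idm ?W"
    using M_xi_iso[OF assms] unfolding mod_iso_def by blast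
  have gf: "g (f v) = idm ?M v" "f (g w) = w" for v w
    using fun_cong[OF fg(3), of v] fun_cong[OF fg(4), of w] by simp_all
  have "\<exists>X d. ladder ?M X d"
  proof (rule ladder_exists)
    show M: "?M \<in> sl2_modules" by (rule M_xi_closed[OF assms])
    show "cas ?M v = 0" for v
    proof -
      have "cas ?M v = cas ?M (g (f v))" by (simp add: gf hom_dom[OF cas_hom[OF M]])
      also have "\<dots> = 0"
        by (simp add: hom_cas[OF fg(2), symmetric] cas_shift_module[OF assms] lin_zero[OF hom_lin[OF fg(2)]])
      finally show ?thesis .
    qed
    show "\<exists>\<alpha>. \<forall>v. k v = vscale \<alpha> (idm ?M v)" if k: "k \<in> sl2_hom ?M ?M" for k
    proof -
      have "f \<circ> (k \<circ> g) \<in> sl2_hom ?W ?W" by (intro hom_comp[OF _ fg(1)] hom_comp[OF fg(2) k])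
      from shift_module_endomorphism[OF assms this] obtain \<alpha> where \<alpha>: "\<And>v. f (k (g v)) = vscale \<alpha> v" by auto
      have "k v = vscale \<alpha> (idm ?M v)" for v
      proof -
        have "k v = g (f (k (g (f v))))" by (simp add: gf hom_cod[OF k] hom_dom[OF k])
        also have "\<dots> = vscale \<alpha> (idm ?M v)" by (subst \<alpha>) (simp add: lin_scale[OF hom_lin[OF fg(2)]] gf)
        finally show ?thesis .
      qed
      then show ?thesis by blast
    qed
    show "idm ?M (g (basis_vec 0)) \<noteq> 0"
    proof
      assume "idm ?M (g (basis_vec 0)) = 0"
      then have "f (g (basis_vec 0)) = 0" by (simp add: hom_cod[OF fg(2)] lin_zero[OF hom_lin[OF fg(1)]])
      then show False by (simp add: gf)
    qed
  qed blast
  then show ?thesis using that by blast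
qed

theorem K2_simple_transitive_type_C:
  assumes "\<xi> \<noteq> 0"
  shows "simple_transitive FD (K2 \<xi>)" "type_C_infinity FD (L_fd 1) (K2 \<xi>)"
proof -
  obtain X d where "ladder (M_xi \<xi>) X d" by (rule ladder_shift[OF assms])
  then interpret ladder_modules "M_xi \<xi>" X d by unfold_locales
  have iso: "mod_iso (X_mod \<xi> i) (X i)" and closed: "X_mod \<xi> i \<in> sl2_modules" for i
  proof -
    show "mod_iso (X_mod \<xi> i) (X i)"
    proof (cases "i = 0")
      case True
      then show ?thesis using mod_iso_refl[OF M_xi_closed[OF assms]] by (simp add: X_mod_def X0)
    next
      case False
      then show ?thesis unfolding X_mod_def
        using casimir_kernel_copy[OF someI_ex[OF casimir_kernel_copy_exists]] by simp
    qed
    show "X_mod \<xi> i \<in> sl2_modules"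
      using someI_ex[OF casimir_kernel_copy_exists[of i]] M_xi_closed[OF assms]
      by (simp add: X_mod_def is_submodule_copy_def)
  qed
  have "additive_closure (Mod sl2_modules) (range (X_mod \<xi>)) = K"
  proof (rule additive_closure_K)
    show "range (X_mod \<xi>) \<subseteq> sl2_modules" using closed by blast
    show "\<exists>i. mod_iso z (X i)" if "z \<in> range (X_mod \<xi>)" for z using iso that by blast
    show "\<exists>z\<in>range (X_mod \<xi>). mod_iso (X i) z" for i using mod_iso_sym[OF iso[of i]] by blast
  qed (simp_all add: K_sub)
  then have "K2 \<xi> = Mod K" unfolding K2_def Mod_sl2_modules[symmetric] by (simp only:)
  then show "simple_transitive FD (K2 \<xi>)" "type_C_infinity FD (L_fd 1) (K2 \<xi>)"
    using simple_transitive_K type_C_infinity_K by simp_all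
qed

section \<open>Category \<open>\<O>\<close>\<close>

definition weight_vectors :: "sl2_module \<Rightarrow> vec set" where
  "weight_vectors V = {v \<in> space V. \<exists>\<mu>. act_h V v = vscale \<mu> v}"

text \<open>The three conditions defining \<open>\<O>\<close>, relative to a subset of a module, so that they can be
  transported along sums of homomorphisms.\<close>

definition O_part :: "sl2_module \<Rightarrow> vec set \<Rightarrow> bool" where
  "O_part W T \<longleftrightarrow> (\<exists>S. finite S \<and> S \<subseteq> space W \<and> (\<forall>N. submodule N W \<and> S \<subseteq> N \<longrightarrow> T \<subseteq> N)) \<and>
     T \<subseteq> vec.span (weight_vectors W) \<and>
     (\<forall>v\<in>T. \<exists>B. finite B \<and> (\<forall>k. (act_e W ^^ k) v \<in> vec.span B))"

abbreviation O_modules :: "sl2_module set" where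
  "O_modules \<equiv> {V \<in> sl2_modules. finitely_generated V \<and> weight_module V \<and> locally_e_finite V}"

lemma category_O_Mod: "category_O = Mod O_modules"
  by (simp add: category_O_def)

lemma Ob_category_O: "Ob category_O = O_modules"
  by (simp add: category_O_def)

lemma span_weight_vectors: "vec.span (weight_vectors V) \<subseteq> space V"
  by (rule vec.span_minimal) (auto simp: weight_vectors_def)

lemma O_iff: "V \<in> O_modules \<longleftrightarrow> V \<in> sl2_modules \<and> O_part V (space V)"
proof -
  have fg: "finitely_generated V \<longleftrightarrow> (\<exists>S. finite S \<and> S \<subseteq> space V \<and> (\<forall>N. submodule N V \<and> S \<subseteq> N \<longrightarrow> space V \<subseteq> N))"
  proof -
    have "N = space V \<longleftrightarrow> space V \<subseteq> N" if "submodule N V" for N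
      using that by (auto simp: submodule_def)
    then show ?thesis unfolding finitely_generated_def
      by (intro ex_cong1 conj_cong refl all_cong1 imp_cong) simp
  qed
  have w: "weight_module V \<longleftrightarrow> space V \<subseteq> vec.span (weight_vectors V)"
    unfolding weight_module_def weight_vectors_def[symmetric] using span_weight_vectors[of V] by blast
  show ?thesis
    unfolding mem_Collect_eq O_part_def locally_e_finite_def fg w by blast
qed

lemma O_modulesD: "V \<in> O_modules \<Longrightarrow> V \<in> sl2_modules"
  by simp

lemma O_partI:
  assumes "finite S" "S \<subseteq> space W" "\<And>N. submodule N W \<Longrightarrow> S \<subseteq> N \<Longrightarrow> T \<subseteq> N"
    "T \<subseteq> vec.span (weight_vectors W)" "\<And>v. v \<in> T \<Longrightarrow> \<exists>B. finite B \<and> (\<forall>k. (act_e W ^^ k) v \<in> vec.span B)"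
  shows "O_part W T"
  unfolding O_part_def by (rule conjI, rule exI[of _ S]) (simp_all add: assms)

lemma O_partE:
  assumes "O_part W T"
  obtains S where "finite S" "S \<subseteq> space W" "\<And>N. submodule N W \<Longrightarrow> S \<subseteq> N \<Longrightarrow> T \<subseteq> N"
proof -
  from assms obtain S where S: "finite S" "S \<subseteq> space W" "\<forall>N. submodule N W \<and> S \<subseteq> N \<longrightarrow> T \<subseteq> N"
    unfolding O_part_def by (elim conjE exE) (rule that)
  show ?thesis by (rule that[OF S(1,2)]) (use S(3) in simp)
qed

lemma O_partD:
  assumes "O_part W T"
  shows "T \<subseteq> vec.span (weight_vectors W)" "v \<in> T \<Longrightarrow> \<exists>B. finite B \<and> (\<forall>k. (act_e W ^^ k) v \<in> vec.span B)"
  using assms unfolding O_part_def by simp_all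

lemma O_part_mono:
  assumes "O_part W T" "T' \<subseteq> T"
  shows "O_part W T'"
proof -
  obtain S where S: "finite S" "S \<subseteq> space W" "\<And>N. submodule N W \<Longrightarrow> S \<subseteq> N \<Longrightarrow> T \<subseteq> N" by (rule O_partE[OF assms(1)]) (rule that)
  show ?thesis
  proof (rule O_partI[OF S(1,2)])
    show "submodule N W \<Longrightarrow> S \<subseteq> N \<Longrightarrow> T' \<subseteq> N" for N using S(3) assms(2) by (rule subset_trans[rotated])
    show "v \<in> T' \<Longrightarrow> \<exists>B. finite B \<and> (\<forall>k. (act_e W ^^ k) v \<in> vec.span B)" for v
      by (rule O_partD(2)[OF assms(1)]) (use assms(2) in auto)
  qed (use O_partD(1)[OF assms(1)] assms(2) in auto)
qed

lemma power_add_lin: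
  assumes "lin T" shows "(T ^^ k) (a + b) = (T ^^ k) a + (T ^^ k) b"
  by (induction k) (simp_all add: lin_add[OF assms])

lemma power_zero_lin:
  assumes "lin T" shows "(T ^^ k) 0 = 0"
  by (induction k) (simp_all add: lin_zero[OF assms])

lemma O_part_sum:
  assumes W: "W \<in> sl2_modules" and T: "O_part W T" "O_part W T'"
  shows "O_part W {a + b |a b. a \<in> T \<and> b \<in> T'}"
proof -
  obtain S where S: "finite S" "S \<subseteq> space W" "\<And>N. submodule N W \<Longrightarrow> S \<subseteq> N \<Longrightarrow> T \<subseteq> N" by (rule O_partE[OF T(1)]) (rule that)
  obtain S' where S': "finite S'" "S' \<subseteq> space W" "\<And>N. submodule N W \<Longrightarrow> S' \<subseteq> N \<Longrightarrow> T' \<subseteq> N" by (rule O_partE[OF T(2)]) (rule that)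
  show ?thesis
  proof (rule O_partI[of "S \<union> S'"])
    show "{a + b |a b. a \<in> T \<and> b \<in> T'} \<subseteq> N" if N: "submodule N W" "S \<union> S' \<subseteq> N" for N
    proof -
      have "a + b \<in> N" if ab: "a \<in> T" "b \<in> T'" for a b
        using N S(3)[of N] S'(3)[of N] ab by (auto simp: submodule_def intro: vec.subspace_add)
      then show "{a + b |a b. a \<in> T \<and> b \<in> T'} \<subseteq> N" by blast
    qed
    show "{a + b |a b. a \<in> T \<and> b \<in> T'} \<subseteq> vec.span (weight_vectors W)"
      using O_partD(1)[OF T(1)] O_partD(1)[OF T(2)] by (auto intro!: vec.span_add)
    fix v assume "v \<in> {a + b |a b. a \<in> T \<and> b \<in> T'}"
    then obtain a b where ab: "v = a + b" "a \<in> T" "b \<in> T'" by blast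
    obtain B B' where B: "finite B" "\<And>k. (act_e W ^^ k) a \<in> vec.span B" and B': "finite B'" "\<And>k. (act_e W ^^ k) b \<in> vec.span B'"
      using O_partD(2)[OF T(1) ab(2)] O_partD(2)[OF T(2) ab(3)] by auto
    have "(act_e W ^^ k) v \<in> vec.span (B \<union> B')" for k
      unfolding ab(1) power_add_lin[OF lin_act_e[OF W]]
      using B(2)[of k] B'(2)[of k] vec.span_mono[of B "B \<union> B'"] vec.span_mono[of B' "B \<union> B'"] by (auto intro: vec.span_add)
    then show "\<exists>B. finite B \<and> (\<forall>k. (act_e W ^^ k) v \<in> vec.span B)" using B(1) B'(1) by blast
  qed (use S S' in auto)
qed

lemma hom_e_pow: "u \<in> sl2_hom A W \<Longrightarrow> u ((act_e A ^^ k) v) = (act_e W ^^ k) (u v)"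
  by (induction k) (simp_all add: hom_e)

lemma hom_f_pow: "u \<in> sl2_hom A W \<Longrightarrow> u ((act_f A ^^ k) v) = (act_f W ^^ k) (u v)"
  by (induction k) (simp_all add: hom_f)

lemma submodule_preimage:
  assumes u: "u \<in> sl2_hom A W" and A: "A \<in> sl2_modules" and N: "submodule N W"
  shows "submodule {a \<in> space A. u a \<in> N} A"
  using N A unfolding submodule_def vec.subspace_def
  by (auto simp: lin_simps[OF hom_lin[OF u]] sl2_homD(5-7)[OF u])

lemma O_part_image:
  assumes A: "A \<in> O_modules" and W: "W \<in> sl2_modules" and u: "u \<in> sl2_hom A W"
  shows "O_part W (u ` space A)"
proof -
  have A': "A \<in> sl2_modules" and p: "O_part A (space A)" using A O_iff[of A] by blast+
  obtain S where S: "finite S" "S \<subseteq> space A" "\<And>N. submodule N A \<Longrightarrow> S \<subseteq> N \<Longrightarrow> space A \<subseteq> N" by (rule O_partE[OF p]) (rule that)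
  show ?thesis
  proof (rule O_partI[of "u ` S"])
    show "u ` space A \<subseteq> N" if N: "submodule N W" "u ` S \<subseteq> N" for N
    proof -
      have "S \<subseteq> {a \<in> space A. u a \<in> N}" using N S(2) by blast
      from S(3)[OF submodule_preimage[OF u A' N(1)] this] show "u ` space A \<subseteq> N" by blast
    qed
    show "u ` space A \<subseteq> vec.span (weight_vectors W)"
    proof -
      have "u ` weight_vectors A \<subseteq> weight_vectors W"
        using hom_in[OF u] by (auto simp: weight_vectors_def lin_scale[OF hom_lin[OF u]] simp flip: hom_h[OF u])
      moreover have "u ` space A \<subseteq> u ` vec.span (weight_vectors A)" by (rule image_mono[OF O_partD(1)[OF p]])
      ultimately show ?thesis
        using vecp.linear_span_image[OF hom_lin[OF u], of "weight_vectors A"] vec.span_mono by blast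
    qed
    fix v assume "v \<in> u ` space A"
    then obtain a where a: "v = u a" "a \<in> space A" by blast
    obtain B where B: "finite B" "\<And>k. (act_e A ^^ k) a \<in> vec.span B" using O_partD(2)[OF p a(2)] by auto
    have "(act_e W ^^ k) v \<in> vec.span (u ` B)" for k
      unfolding a(1) hom_e_pow[OF u, symmetric] vecp.linear_span_image[OF hom_lin[OF u]] using B(2) by blast
    then show "\<exists>B. finite B \<and> (\<forall>k. (act_e W ^^ k) v \<in> vec.span B)" using B(1) by blast
  qed (use S hom_in[OF u] in auto)
qed

lemma O_quotient:
  assumes "A \<in> O_modules" "W \<in> sl2_modules" "u \<in> sl2_hom A W" "u ` space A = space W"
  shows "W \<in> O_modules"
  using O_part_image[OF assms(1-3)] assms(2,4) O_iff[of W] by simp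

text \<open>The three conditions pass to images and to sums of subsets, hence to everything covered
  by objects of O.\<close>

lemma O_part_thr:
  assumes "thr As V W g" "set As \<subseteq> O_modules" "W \<in> sl2_modules"
  shows "O_part W (range g)"
  using assms
proof (induction rule: thr.induct)
  case (thr_Nil V W)
  show ?case
    by (rule O_partI[of "{}"]) (auto simp: submodule_def vec.subspace_0 vec.span_zero power_zero_lin[OF lin_act_e[OF thr_Nil(2)]])
next
  case (thr_Cons As V W g A v u)
  have A: "A \<in> O_modules" using thr_Cons.prems by simp
  have "range ((u \<circ> v) + g) \<subseteq> {a + b |a b. a \<in> u ` space A \<and> b \<in> range g}"
    using hom_in[OF thr_Cons.hyps(3)] by auto
  moreover have "O_part W {a + b |a b. a \<in> u ` space A \<and> b \<in> range g}"
    using thr_Cons by (intro O_part_sum O_part_image[OF A]) auto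
  ultimately show ?case using O_part_mono by blast
qed

lemma O_splits:
  assumes "splits_through As V" "set As \<subseteq> O_modules" "V \<in> sl2_modules"
  shows "V \<in> O_modules"
proof -
  have "space V \<subseteq> range (idm V)" by (metis id_map_eq rangeI subsetI)
  then show ?thesis
    using O_part_mono[OF O_part_thr[OF assms]] assms(3) O_iff[of V] by blast
qed

lemma O_retract:
  assumes "A \<in> O_modules" "V \<in> sl2_modules" "s \<in> sl2_hom V A" "r \<in> sl2_hom A V" "r \<circ> s = idm V"
  shows "V \<in> O_modules"
  by (rule O_splits[of "[A]"]) (use thr_single[OF O_modulesD[OF assms(1)] assms(3,4)] assms in simp_all)

lemma span_image_subset:
  assumes "lin T" "T ` A \<subseteq> vec.span B" "x \<in> vec.span A"
  shows "T x \<in> vec.span B"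
proof -
  have "T ` vec.span A \<subseteq> vec.span B"
    unfolding vecp.linear_span_image[OF assms(1), symmetric] by (rule vec.span_minimal[OF assms(2)]) simp
  then show ?thesis using assms(3) by auto
qed

lemma O_F:
  assumes V: "V \<in> O_modules"
  shows "F V \<in> O_modules"
proof -
  have V': "V \<in> sl2_modules" and p: "O_part V (space V)" using V O_iff[of V] by blast+
  note lV = lin_sl2[OF V']
  note act = actF[OF V'] sl2_absorb[OF V'] lin_zero[OF lV(1)] lin_zero[OF lV(2)] lin_zero[OF lV(3)] lin_zero[OF lin_id_map] tensor_vec_bilinear
  have in_F: "incl 0 a \<in> space (F V)" "incl 1 a \<in> space (F V)" if "a \<in> space V" for a
    using that by (simp_all add: F_def basis_tensor_module tensor_vec_in)
  obtain S where S: "finite S" "S \<subseteq> space V" "\<And>N. submodule N V \<Longrightarrow> S \<subseteq> N \<Longrightarrow> space V \<subseteq> N" by (rule O_partE[OF p]) (rule that)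
  let ?S = "incl 0 ` S \<union> incl 1 ` S"
  \<comment> \<open>The vectors of \<open>V\<close> with both copies in \<open>N\<close> form a
    submodule: e and f on \<open>F V\<close> are those of \<open>V\<close> up to moving one copy to
    the other, and h up to adding or subtracting the vector.\<close>
  have gen: "a \<in> space V \<Longrightarrow> incl 0 a \<in> N \<and> incl 1 a \<in> N" if N: "submodule N (F V)" "?S \<subseteq> N" for N a
  proof -
    let ?N = "{v \<in> space V. incl 0 v \<in> N \<and> incl 1 v \<in> N}"
    have sub: "vec.subspace N" and cl: "\<And>x. x \<in> N \<Longrightarrow> act_e (F V) x \<in> N \<and> act_f (F V) x \<in> N \<and> act_h (F V) x \<in> N"
      using N(1) by (auto simp: submodule_def)
    have "submodule ?N V"
      unfolding submodule_def
    proof (intro conjI ballI)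
      show "vec.subspace ?N"
        using sub by (auto simp: vec.subspace_def tensor_vec_bilinear)
      fix v assume "v \<in> ?N"
      then have v: "v \<in> space V" "incl 0 v \<in> N" "incl 1 v \<in> N" by auto
      have "act_e (F V) (incl 1 v) - incl 0 v \<in> N" "act_f (F V) (incl 0 v) - incl 1 v \<in> N"
        "act_h (F V) (incl 0 v) - incl 0 v \<in> N" "act_h (F V) (incl 1 v) + incl 1 v \<in> N" "act_e (F V) (incl 0 v) \<in> N" "act_f (F V) (incl 1 v) \<in> N"
        using cl[OF v(2)] cl[OF v(3)] v sub by (auto intro: vec.subspace_diff vec.subspace_add)
      then show "act_e V v \<in> ?N" "act_f V v \<in> ?N" "act_h V v \<in> ?N"
        using v(1) V' by (simp_all add: act)
    qed auto
    moreover have "S \<subseteq> ?N" using N(2) S(2) by auto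
    ultimately show "a \<in> space V \<Longrightarrow> incl 0 a \<in> N \<and> incl 1 a \<in> N" using S(3) by blast
  qed

  have w: "incl 0 ` space V \<subseteq> vec.span (weight_vectors (F V))" "incl 1 ` space V \<subseteq> vec.span (weight_vectors (F V))"
  proof -
    have "incl 0 ` weight_vectors V \<subseteq> weight_vectors (F V)" "incl 1 ` weight_vectors V \<subseteq> weight_vectors (F V)"
    proof -
      have "act_h (F V) (incl 0 v) = vscale (\<mu> + 1) (incl 0 v)" "act_h (F V) (incl 1 v) = vscale (\<mu> - 1) (incl 1 v)"
        if "v \<in> space V" "act_h V v = vscale \<mu> v" for v \<mu>
        using that by (simp_all add: act vec.scale_left_distrib vec.scale_left_diff_distrib)
      then show "incl 0 ` weight_vectors V \<subseteq> weight_vectors (F V)" "incl 1 ` weight_vectors V \<subseteq> weight_vectors (F V)"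
        unfolding weight_vectors_def using in_F by blast+
    qed
    then have w: "incl 0 ` weight_vectors V \<subseteq> vec.span (weight_vectors (F V))" "incl 1 ` weight_vectors V \<subseteq> vec.span (weight_vectors (F V))"
      by (auto intro: vec.span_base)
    note p1 = subsetD[OF O_partD(1)[OF p]]
    show "incl 0 ` space V \<subseteq> vec.span (weight_vectors (F V))" "incl 1 ` space V \<subseteq> vec.span (weight_vectors (F V))"
      by (rule image_subsetI, rule span_image_subset[OF lin_tensor_vec(1) w(1) p1], assumption)
        (rule image_subsetI, rule span_image_subset[OF lin_tensor_vec(1) w(2) p1], assumption)
  qed
  have e0: "(act_e (F V) ^^ k) (incl 0 a) = incl 0 ((act_e V ^^ k) a)" for k a
    by (induction k) (simp_all add: act)
  have ea: "(act_e V ^^ k) a \<in> space V" if "a \<in> space V" for k a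
    using that V' by (induction k) simp_all
  \<comment> \<open>On L(1) the operator e takes b_1 to b_0 and has square zero, so the binomial
    expansion has two terms. At k = 0 the second one has coefficient 0.\<close>
  have e1: "(act_e (F V) ^^ k) (incl 1 a) = incl 1 ((act_e V ^^ k) a) + vscale (of_nat k) (incl 0 ((act_e V ^^ (k - 1)) a))" if "a \<in> space V" for k a
  proof (induction k)
    case (Suc k)
    have eF: "act_e (F V) (incl 0 x) = incl 0 (act_e V x)" for x
      by (simp add: act)
    have eF1: "act_e (F V) (incl 1 x) = incl 0 x + incl 1 (act_e V x)" if "x \<in> space V" for x
      using that by (simp add: act)
    have "(act_e (F V) ^^ Suc k) (incl 1 a) = incl 0 ((act_e V ^^ k) a) + incl 1 (act_e V ((act_e V ^^ k) a))
        + vscale (of_nat k) (incl 0 (act_e V ((act_e V ^^ (k - 1)) a)))"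
      by (simp only: funpow.simps o_apply Suc lin_add[OF lin_act_e[OF F_closed[OF V']]] lin_scale[OF lin_act_e[OF F_closed[OF V']]]
          eF eF1[OF ea[OF that]])
    then show ?case
      by (cases k) (simp_all add: vec.scale_left_distrib add_ac)
  qed simp
  have B: "\<exists>B. finite B \<and> (\<forall>k. (act_e (F V) ^^ k) (incl 0 a) \<in> vec.span B \<and> (act_e (F V) ^^ k) (incl 1 a) \<in> vec.span B)" if a: "a \<in> space V" for a
  proof -
    obtain B where B: "finite B" "\<And>k. (act_e V ^^ k) a \<in> vec.span B" using O_partD(2)[OF p a(1)] by auto
    let ?B = "incl 0 ` B \<union> incl 1 ` B"
    have "incl i ((act_e V ^^ k) a) \<in> vec.span (incl i ` B)" for i k
      unfolding vecp.linear_span_image[OF lin_tensor_vec(1)] using B(2) by blast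
    then have i: "incl 0 ((act_e V ^^ k) a) \<in> vec.span ?B" "incl 1 ((act_e V ^^ k) a) \<in> vec.span ?B" for k
      using vec.span_mono[of "incl 0 ` B" ?B] vec.span_mono[of "incl 1 ` B" ?B] by blast+
    then show ?thesis
      using B(1) by (intro exI[of _ ?B] conjI allI) (auto simp: e0 e1[OF a] intro: vec.span_add vec.span_scale)
  qed
  have parts: "O_part (F V) (incl 0 ` space V)" "O_part (F V) (incl 1 ` space V)"
  proof -
    show "O_part (F V) (incl 0 ` space V)"
    proof (rule O_partI[of ?S])
      show "\<exists>B. finite B \<and> (\<forall>k. (act_e (F V) ^^ k) v \<in> vec.span B)" if v: "v \<in> incl 0 ` space V" for v
      proof -
        obtain a where "a \<in> space V" "v = incl 0 a" using v by blast
        then show ?thesis using B[of a] by auto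
      qed
      show "incl 0 ` space V \<subseteq> N" if "submodule N (F V)" "?S \<subseteq> N" for N using gen[OF that] by blast
    qed (use S in_F w in auto)
    show "O_part (F V) (incl 1 ` space V)"
    proof (rule O_partI[of ?S])
      show "\<exists>B. finite B \<and> (\<forall>k. (act_e (F V) ^^ k) v \<in> vec.span B)" if v: "v \<in> incl 1 ` space V" for v
      proof -
        obtain a where "a \<in> space V" "v = incl 1 a" using v by blast
        then show ?thesis using B[of a] by auto
      qed
      show "incl 1 ` space V \<subseteq> N" if "submodule N (F V)" "?S \<subseteq> N" for N using gen[OF that] by blast
    qed (use S in_F w in auto)
  qed
  have "space (F V) \<subseteq> {a + b |a b. a \<in> incl 0 ` space V \<and> b \<in> incl 1 ` space V}"
  proof
    fix x assume "x \<in> space (F V)"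
    then have "x = incl 0 (idm V (prj 0 x)) + incl 1 (idm V (prj 1 x))" using idmF_apply[of V x] by simp
    moreover have "incl 0 (idm V (prj 0 x)) \<in> incl 0 ` space V" "incl 1 (idm V (prj 1 x)) \<in> incl 1 ` space V"
      by (intro imageI id_map_in)+
    ultimately show "x \<in> {a + b |a b. a \<in> incl 0 ` space V \<and> b \<in> incl 1 ` space V}"
      unfolding mem_Collect_eq by (intro exI conjI)
  qed
  from O_part_mono[OF O_part_sum[OF F_closed[OF V'] parts] this] show ?thesis
    using O_iff[of "F V"] V' by simp
qed

definition generated_by :: "sl2_module \<Rightarrow> vec \<Rightarrow> bool" where
  "generated_by V v \<longleftrightarrow> v \<in> space V \<and> (\<forall>N. submodule N V \<and> v \<in> N \<longrightarrow> space V \<subseteq> N)"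

text \<open>The span of the weight vectors is a submodule and contains the generator.\<close>

lemma O_generated:
  assumes V: "V \<in> sl2_modules" and g: "generated_by V v" and h: "act_h V v = vscale \<mu> v" and e: "locally_e_finite V"
  shows "V \<in> O_modules"
proof -
  have v: "v \<in> space V" using g by (simp add: generated_by_def)
  note l = lin_simps[OF lin_act_e[OF V]] lin_simps[OF lin_act_f[OF V]] lin_simps[OF lin_act_h[OF V]]
  have "submodule (vec.span (weight_vectors V)) V"
    unfolding submodule_def
  proof (intro conjI ballI span_weight_vectors vec.subspace_span)
    fix x assume x: "x \<in> vec.span (weight_vectors V)"
    have w: "act_e V a \<in> weight_vectors V" "act_f V a \<in> weight_vectors V" "act_h V a \<in> weight_vectors V" if a: "a \<in> weight_vectors V" for a
    proof -
      obtain \<nu> where a: "a \<in> space V" "act_h V a = vscale \<nu> a" using a by (auto simp: weight_vectors_def)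
      have "act_h V (act_e V a) = vscale (\<nu> + 2) (act_e V a)" "act_h V (act_f V a) = vscale (\<nu> - 2) (act_f V a)"
        by (simp_all add: sl2_rels[OF V] a l vec.scale_left_distrib vec.scale_left_diff_distrib)
      then show "act_e V a \<in> weight_vectors V" "act_f V a \<in> weight_vectors V" "act_h V a \<in> weight_vectors V"
        using V a by (auto simp: weight_vectors_def l)
    qed
    have "T ` vec.span (weight_vectors V) \<subseteq> vec.span (weight_vectors V)" if "lin T" "\<And>a. a \<in> weight_vectors V \<Longrightarrow> T a \<in> weight_vectors V" for T
      unfolding vecp.linear_span_image[OF that(1), symmetric] by (rule vec.span_mono) (use that(2) in blast)
    from this[OF lin_act_e[OF V] w(1)] this[OF lin_act_f[OF V] w(2)] this[OF lin_act_h[OF V] w(3)]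
    show "act_e V x \<in> vec.span (weight_vectors V)" "act_f V x \<in> vec.span (weight_vectors V)" "act_h V x \<in> vec.span (weight_vectors V)"
      using x by blast+
  qed
  moreover have "v \<in> vec.span (weight_vectors V)" using v h by (intro vec.span_base) (auto simp: weight_vectors_def)
  ultimately have "space V \<subseteq> vec.span (weight_vectors V)" using g by (simp add: generated_by_def)
  then have "O_part V (space V)"
    using g e by (intro O_partI[of "{v}"]) (simp_all add: generated_by_def locally_e_finite_def)
  then show ?thesis using V unfolding O_iff by simp
qed

text \<open>A product of factors \<open>h - \<lambda>\<close> with \<open>\<lambda> \<noteq> \<mu>\<close> extracts the component of weight \<open>\<mu>\<close> up to a
  nonzero scalar.\<close>

lemma weight_component:
  assumes V: "V \<in> O_modules" and w: "w \<in> space V"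
  shows "\<exists>ls. \<mu> \<notin> set ls \<and> act_h V (cvector_space.lprod vscale (act_h V) ls w) = vscale \<mu> (cvector_space.lprod vscale (act_h V) ls w)"
proof -
  have V': "V \<in> sl2_modules" and p: "O_part V (space V)" using V O_iff[of V] by blast+
  interpret R: sl2_rep vscale "act_e V" "act_f V" "act_h V" by (rule rep_vec[OF V'])
  note el = R.endo_simps[OF R.endo_lprod[OF R.h]]
  note hl = R.lprod_commute_T[OF R.h, symmetric]
  \<comment> \<open>The factors h - \<lambda> for \<lambda> in \<open>ls\<close> turn x into a
    vector of weight \<mu> or zero. Such x are closed under sums, as any list may be enlarged by
    roots other than \<mu>.\<close>
  define Q where "Q ls x \<longleftrightarrow> \<mu> \<notin> set ls \<and> R.lprod (act_h V) ls (act_h V x) = vscale \<mu> (R.lprod (act_h V) ls x)" for ls x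
  have mono: "Q (ms @ ls) x" if "Q ls x" "\<mu> \<notin> set ms" for ls ms x
    using that by (simp add: Q_def R.lprod_append el)
  have mono': "Q (ls @ ms) x" if "Q ls x" "\<mu> \<notin> set ms" for ls ms x
    using mono[OF that] by (simp add: Q_def R.lprod_append R.lprod_commute[OF R.h, of ls ms])
  have sub: "vec.subspace {x. \<exists>ls. Q ls x}"
    unfolding vec.subspace_def
  proof (intro conjI ballI allI)
    show "0 \<in> {x. \<exists>ls. Q ls x}" by (auto simp: Q_def R.lin intro!: exI[of _ "[]"])
    fix x assume "x \<in> {x. \<exists>ls. Q ls x}"
    then obtain ls where ls: "Q ls x" by blast
    show "vscale c x \<in> {x. \<exists>ls. Q ls x}" for c
      using ls by (auto simp: Q_def el R.lin intro!: exI[of _ ls])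
    fix y assume "y \<in> {x. \<exists>ls. Q ls x}"
    then obtain ms where ms: "Q ms y" by blast
    have "Q (ls @ ms) x" "Q (ls @ ms) y" using mono'[OF ls] mono[OF ms] ls ms by (simp_all add: Q_def)
    then have "Q (ls @ ms) (x + y)" by (simp add: Q_def el R.lin vec.scale_right_distrib)
    then show "x + y \<in> {x. \<exists>ls. Q ls x}" by blast
  qed
  have "a \<in> {x. \<exists>ls. Q ls x}" if aw: "a \<in> weight_vectors V" for a
  proof -
    obtain \<nu> where a: "act_h V a = vscale \<nu> a" using aw by (auto simp: weight_vectors_def)
    show ?thesis
    proof (cases "\<nu> = \<mu>")
      case True
      then have "Q [] a" using a by (simp add: Q_def)
      then show ?thesis by blast
    next
      case False
      then have "Q [\<nu>] a" using a by (simp add: Q_def R.lin)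
      then show ?thesis by blast
    qed
  qed
  then have "vec.span (weight_vectors V) \<subseteq> {x. \<exists>ls. Q ls x}" using sub by (intro vec.span_minimal) auto
  then have "w \<in> {x. \<exists>ls. Q ls x}" using O_partD(1)[OF p] w by blast
  then show ?thesis by (auto simp: Q_def R.lprod_commute_T[OF R.h])
qed

text \<open>The vectors e^k a span a finite dimensional space, stable under h, on which e raises
  eigenvalues of h by 2; so \<open>shift_nilpotent\<close> applies.\<close>

lemma weight_vector_nilpotent:
  assumes V: "V \<in> O_modules" and a: "a \<in> space V" "act_h V a = vscale \<mu> a"
  shows "\<exists>k. (act_e V ^^ k) a = 0"
proof -
  have V': "V \<in> sl2_modules" and p: "O_part V (space V)" using V O_iff[of V] by blast+
  interpret R: sl2_rep vscale "act_e V" "act_f V" "act_h V" by (rule rep_vec[OF V'])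
  obtain B where B: "finite B" "\<And>k. (act_e V ^^ k) a \<in> vec.span B" using O_partD(2)[OF p a(1)] by auto
  let ?R = "range (\<lambda>k. (act_e V ^^ k) a)"
  have hk: "act_h V ((act_e V ^^ k) a) = vscale (\<mu> + 2 * of_nat k) ((act_e V ^^ k) a)" for k
    by (induction k) (simp_all add: a R.he R.lin algebra_simps vec.scale_left_distrib)
  have img: "T ` vec.span ?R \<subseteq> vec.span ?R" if "lin T" "\<And>k. T ((act_e V ^^ k) a) \<in> vec.span ?R" for T
    unfolding vecp.linear_span_image[OF that(1), symmetric] by (rule vec.span_minimal) (use that(2) in auto)
  have h: "act_h V ((act_e V ^^ k) a) \<in> vec.span ?R" for k
    unfolding hk by (intro vec.span_scale vec.span_base) blast
  have e: "act_e V ((act_e V ^^ k) a) \<in> vec.span ?R" for k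
    by (rule vec.span_base, rule range_eqI[of _ _ "Suc k"]) simp
  show ?thesis
  proof (rule R.shift_nilpotent[OF R.h R.e R.he, of "vec.span ?R"])
    show "vec.span ?R \<subseteq> vec.span B" using B(2) by (intro vec.span_minimal) auto
    show "a \<in> vec.span ?R" by (rule vec.span_base, rule range_eqI[of _ _ 0]) simp
    show "x \<in> vec.span ?R \<Longrightarrow> act_h V x \<in> vec.span ?R" for x using img[OF lin_act_h[OF V'] h] by blast
    show "x \<in> vec.span ?R \<Longrightarrow> act_e V x \<in> vec.span ?R" for x using img[OF lin_act_e[OF V'] e] by blast
  qed (use B in simp_all)
qed

section \<open>Verma modules\<close>

text \<open>The basis vector k stands for f^k v, where v is a highest weight vector of weight
  \<mu>.\<close>

definition verma :: "complex \<Rightarrow> sl2_module" where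
  "verma \<mu> = \<lparr>basis = UNIV,
     act_e = linear_extension (\<lambda>k. vscale (of_nat k * (\<mu> - of_nat k + 1)) (basis_vec (k - 1))),
     act_f = linear_extension (\<lambda>k. basis_vec (Suc k)),
     act_h = linear_extension (\<lambda>k. vscale (\<mu> - 2 * of_nat k) (basis_vec k))\<rparr>"

lemma basis_verma [simp]: "basis (verma \<mu>) = UNIV"
  by (simp add: verma_def)

lemma lin_verma: "lin (act_e (verma \<mu>))" "lin (act_f (verma \<mu>))" "lin (act_h (verma \<mu>))"
  by (simp_all add: verma_def)

lemma act_verma:
  "act_e (verma \<mu>) (basis_vec k) = vscale (of_nat k * (\<mu> - of_nat k + 1)) (basis_vec (k - 1))"
  "act_f (verma \<mu>) (basis_vec k) = basis_vec (Suc k)"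
  "act_h (verma \<mu>) (basis_vec k) = vscale (\<mu> - 2 * of_nat k) (basis_vec k)"
  by (simp_all add: verma_def)

lemma verma_closed: "verma \<mu> \<in> sl2_modules"
proof (intro sl2_modulesI linear_mapsI; (simp add: lin_verma; fail)?)
  note l = lin_simps[OF lin_verma(1)] lin_simps[OF lin_verma(2)] lin_simps[OF lin_verma(3)]
  let ?e = "act_e (verma \<mu>)" and ?f = "act_f (verma \<mu>)" and ?h = "act_h (verma \<mu>)"
  have "?e \<circ> ?f = (?f \<circ> ?e) + ?h"
  proof (rule lin_ext)
    show "(?e \<circ> ?f) (basis_vec k) = ((?f \<circ> ?e) + ?h) (basis_vec k)" for k
      by (cases k; simp add: act_verma l; rule vec_eqI; simp add: lookup_add lookup_basis_vec; simp add: algebra_simps)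
  qed (simp_all add: lin_verma lin_comp lin_plus)
  then show "?e (?f v) = ?f (?e v) + ?h v" for v by (simp add: fun_eq_iff)
  have "?h \<circ> ?e = (?e \<circ> ?h) + map_scale 2 ?e"
  proof (rule lin_ext)
    show "(?h \<circ> ?e) (basis_vec k) = ((?e \<circ> ?h) + map_scale 2 ?e) (basis_vec k)" for k
      by (cases k; simp add: act_verma l; rule vec_eqI; simp add: lookup_add lookup_basis_vec; simp add: algebra_simps)
  qed (simp_all add: lin_verma lin_comp lin_plus)
  then show "?h (?e v) = ?e (?h v) + vscale 2 (?e v)" for v by (simp add: fun_eq_iff)
  have "?h \<circ> ?f = (?f \<circ> ?h) - map_scale 2 ?f"
  proof (rule lin_ext)
    show "(?h \<circ> ?f) (basis_vec k) = ((?f \<circ> ?h) - map_scale 2 ?f) (basis_vec k)" for k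
      by (simp add: act_verma l; rule vec_eqI; simp add: lookup_minus lookup_basis_vec; simp add: algebra_simps)
  qed (simp_all add: lin_verma lin_comp lin_minus)
  then show "?h (?f v) = ?f (?h v) - vscale 2 (?f v)" for v by (simp add: fun_eq_iff)
qed

text \<open>The zero \<mu> = -1 of this scalar is why \<open>verma (- 1)\<close> can be the bottom
  of a ladder.\<close>

lemma cas_verma: "cas (verma \<mu>) v = vscale ((\<mu> + 1) * (\<mu> + 1)) v"
proof -
  note l = lin_simps[OF lin_verma(1)] lin_simps[OF lin_verma(2)] lin_simps[OF lin_verma(3)]
  have "cas (verma \<mu>) = map_scale ((\<mu> + 1) * (\<mu> + 1)) id"
  proof (rule lin_ext)
    show "cas (verma \<mu>) (basis_vec k) = map_scale ((\<mu> + 1) * (\<mu> + 1)) id (basis_vec k)" for k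
      by (cases k; simp add: cas_def act_verma l; rule vec_eqI; simp add: lookup_add lookup_basis_vec; simp add: algebra_simps)
  qed (simp_all add: lin_Fstuff verma_closed)
  then show ?thesis by simp
qed

lemma verma_f_pow: "(act_f (verma \<mu>) ^^ k) (basis_vec 0) = basis_vec k"
  by (induction k) (simp_all add: act_verma)

lemma verma_hom:
  assumes V: "V \<in> sl2_modules" and v: "v \<in> space V" "act_e V v = 0" "act_h V v = vscale \<mu> v"
  obtains g where "g \<in> sl2_hom (verma \<mu>) V" "g (basis_vec 0) = v"
proof -
  interpret R: sl2_rep vscale "act_e V" "act_f V" "act_h V" by (rule rep_vec[OF V])
  define g where "g = linear_extension (\<lambda>k. (act_f V ^^ k) v)"
  have gb: "g (basis_vec k) = (act_f V ^^ k) v" for k by (simp add: g_def)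
  have lg: "lin g" by (simp add: g_def)
  have fk: "(act_f V ^^ k) v \<in> space V" for k using v(1) V by (induction k) simp_all
  have pl: "(act_f V ^^ k) (vscale c x) = vscale c ((act_f V ^^ k) x)" "(act_f V ^^ k) 0 = 0" for k c x
    by (induction k) (simp_all add: R.lin)
  have "g \<in> sl2_hom (verma \<mu>) V"
  proof (rule sl2_homI')
    show "g \<circ> idm (verma \<mu>) = g" by (simp add: fun_eq_iff)
    show "idm V \<circ> g = g"
      by (rule lin_ext) (simp_all add: lg gb fk)
    show "g \<circ> act_e (verma \<mu>) = act_e V \<circ> g"
    proof (rule lin_ext)
      fix k show "(g \<circ> act_e (verma \<mu>)) (basis_vec k) = (act_e V \<circ> g) (basis_vec k)"
      proof (cases k)
        case 0
        then show ?thesis by (simp add: act_verma gb v lin_simps[OF lg])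
      next
        case (Suc j)
        have "(act_e V \<circ> g) (basis_vec k) = act_e V ((act_f V ^^ Suc j) v)" by (simp only: o_apply gb Suc)
        also have "\<dots> = vscale (of_nat (Suc j)) ((act_f V ^^ j) (vscale (\<mu> - of_nat j) v))"
          unfolding R.e_fk v vec.scale_left_diff_distrib[symmetric] by (simp add: pl R.lin)
        also have "\<dots> = (g \<circ> act_e (verma \<mu>)) (basis_vec k)"
        proof -
          have "\<mu> - of_nat (Suc j) + 1 = \<mu> - of_nat j" by simp
          then show ?thesis by (simp only: Suc act_verma gb lin_simps[OF lg] pl o_apply vec.scale_scale diff_Suc_1)
        qed
        finally show ?thesis by (rule sym)
      qed
    qed (simp_all add: lg lin_verma lin_sl2[OF V] lin_comp)
    show "g \<circ> act_f (verma \<mu>) = act_f V \<circ> g"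
      by (rule lin_ext) (simp_all add: lg lin_verma lin_sl2[OF V] lin_comp act_verma gb)
    show "g \<circ> act_h (verma \<mu>) = act_h V \<circ> g"
    proof (rule lin_ext)
      fix k show "(g \<circ> act_h (verma \<mu>)) (basis_vec k) = (act_h V \<circ> g) (basis_vec k)"
        by (simp add: act_verma gb lin_simps[OF lg] R.h_fk v pl vec.scale_left_diff_distrib)
    qed (simp_all add: lg lin_verma lin_sl2[OF V] lin_comp)
  qed (rule lg)
  moreover have "g (basis_vec 0) = v" by (simp add: gb)
  ultimately show ?thesis by (rule that)
qed

lemma verma_hom_eq:
  assumes g: "g \<in> sl2_hom (verma \<mu>) V" "g' \<in> sl2_hom (verma \<mu>) V" "g (basis_vec 0) = g' (basis_vec 0)"
  shows "g = g'"
proof (rule lin_ext)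
  show "g (basis_vec k) = g' (basis_vec k)" for k
    using hom_f_pow[OF g(1), of k "basis_vec 0"] hom_f_pow[OF g(2), of k "basis_vec 0"] g(3) by (simp add: verma_f_pow)
qed (simp_all add: hom_lin[OF g(1)] hom_lin[OF g(2)])

lemma verma_generated:
  assumes "submodule N (verma \<mu>)" "basis_vec 0 \<in> N"
  shows "v \<in> N"
proof -
  have sub: "vec.subspace N" using assms by (simp add: submodule_def)
  have "basis_vec k \<in> N" for k
  proof (induction k)
    case (Suc k)
    then have "act_f (verma \<mu>) (basis_vec k) \<in> N" using assms by (simp add: submodule_def)
    then show ?case by (simp add: act_verma)
  qed (rule assms(2))
  then have "(\<Sum>i\<in>keys v. vscale (lookup v i) (basis_vec i)) \<in> N"
    by (intro vec.subspace_sum[OF sub] vec.subspace_scale[OF sub])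
  then show ?thesis using vec_expand[of v] by simp
qed

lemma verma_O: "verma \<mu> \<in> O_modules"
proof (rule O_generated[OF verma_closed])
  show "generated_by (verma \<mu>) (basis_vec 0)"
    using verma_generated unfolding generated_by_def by auto
  show "act_h (verma \<mu>) (basis_vec 0) = vscale \<mu> (basis_vec 0)"
    by (simp add: act_verma)
  show "locally_e_finite (verma \<mu>)"
    unfolding locally_e_finite_def
  proof
    fix v
    let ?n = "Max (insert 0 (keys v))"
    have "v \<in> vec_space {..?n}" unfolding vec_space_def by auto
    then have v: "v \<in> vec.span (basis_vec ` {..?n})" by (simp only: vec_space_span)
    have step: "act_e (verma \<mu>) x \<in> vec.span (basis_vec ` {..?n})" if "x \<in> vec.span (basis_vec ` {..?n})" for x
    proof (rule span_image_subset[OF lin_verma(1) _ that])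
      show "act_e (verma \<mu>) ` basis_vec ` {..?n} \<subseteq> vec.span (basis_vec ` {..?n})"
        unfolding image_image by (auto simp: act_verma intro!: vec.span_scale[OF vec.span_base])
    qed
    have "(act_e (verma \<mu>) ^^ k) v \<in> vec.span (basis_vec ` {..?n})" for k
      by (induction k) (simp_all add: v step)
    then show "\<exists>B. finite B \<and> (\<forall>k. (act_e (verma \<mu>) ^^ k) v \<in> vec.span B)"
      by (intro exI[of _ "basis_vec ` {..?n}"]) simp
  qed
qed

lemma lookup_act_e_verma: "lookup (act_e (verma \<mu>) y) j = of_nat (Suc j) * (\<mu> - of_nat j) * lookup y (Suc j)"
proof -
  have "(\<lambda>y. vscale (lookup (act_e (verma \<mu>) y) j) (basis_vec 0)) = (\<lambda>y. vscale (of_nat (Suc j) * (\<mu> - of_nat j) * lookup y (Suc j)) (basis_vec 0))"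
  proof (rule lin_ext)
    fix k
    show "vscale (lookup (act_e (verma \<mu>) (basis_vec k)) j) (basis_vec 0) = vscale (of_nat (Suc j) * (\<mu> - of_nat j) * lookup (basis_vec k) (Suc j)) (basis_vec 0)"
      by (cases k) (auto simp: act_verma lookup_basis_vec)
  qed (auto simp: lin_iff lin_simps(1,2)[OF lin_verma(1)] lookup_add vec.scale_left_distrib algebra_simps)
  then have "lookup (vscale (lookup (act_e (verma \<mu>) y) j) (basis_vec 0)) 0 = lookup (vscale (of_nat (Suc j) * (\<mu> - of_nat j) * lookup y (Suc j)) (basis_vec 0)) 0"
    by (simp add: fun_eq_iff)
  then show ?thesis by (simp add: lookup_basis_vec)
qed

text \<open>The coefficient (j + 1) (\<mu> - j) of e never vanishes, so e lowers the largest index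
  of a nonzero vector one by one until a multiple of the generator is left.\<close>

lemma verma_simple:
  assumes \<mu>: "\<And>j. \<mu> \<noteq> of_nat j"
  shows "simple_module (verma \<mu>)"
  unfolding simple_module_def
proof (intro conjI allI impI verma_closed)
  have "basis_vec 0 \<in> space (verma \<mu>)" by simp
  then show "space (verma \<mu>) \<noteq> {0}" by (metis basis_vec_nonzero singletonD)
  fix N assume N: "submodule N (verma \<mu>)"
  have sub: "vec.subspace N" using N by (simp add: submodule_def)
  have *: "basis_vec 0 \<in> N" if "v \<in> N" "v \<noteq> 0" "\<And>i. i > n \<Longrightarrow> lookup v i = 0" for v n
    using that
  proof (induction n arbitrary: v)
    case 0
    have v: "v = vscale (lookup v 0) (basis_vec 0)"
      by (rule vec_eqI) (auto simp: lookup_basis_vec 0(3))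
    then have "lookup v 0 \<noteq> 0" using 0(2) by auto
    moreover have "vscale (inverse (lookup v 0)) v \<in> N" by (rule vec.subspace_scale[OF sub 0(1)])
    ultimately show ?case using v by (metis left_inverse vec.scale_one vec.scale_scale)
  next
    case (Suc n)
    show ?case
    proof (cases "lookup v (Suc n) = 0")
      case True
      show ?thesis by (rule Suc.IH[OF Suc.prems(1,2)]) (metis True Suc.prems(3) Suc_lessI)
    next
      case False
      show ?thesis
      proof (rule Suc.IH[of "act_e (verma \<mu>) v"])
        show "act_e (verma \<mu>) v \<in> N" using N Suc.prems(1) by (simp add: submodule_def)
        have "lookup (act_e (verma \<mu>) v) n \<noteq> 0" using False \<mu>[of n] by (simp add: lookup_act_e_verma del: of_nat_Suc)
        then show "act_e (verma \<mu>) v \<noteq> 0" by auto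
        show "i > n \<Longrightarrow> lookup (act_e (verma \<mu>) v) i = 0" for i using Suc.prems(3)[of "Suc i"] by (simp add: lookup_act_e_verma)
      qed
    qed
  qed
  show "N = {0} \<or> N = space (verma \<mu>)"
  proof (cases "\<exists>v\<in>N. v \<noteq> 0")
    case True
    then obtain v where v: "v \<in> N" "v \<noteq> 0" by blast
    have "lookup v i = 0" if "i > Max (insert 0 (keys v))" for i
      using that by (metis Max_ge finite_insert finite_keys in_keys_iff insertI2 leD)
    then have "basis_vec 0 \<in> N" using *[OF v] by blast
    then have "space (verma \<mu>) \<subseteq> N" using verma_generated[OF N] by blast
    then show ?thesis using N by (auto simp: submodule_def)
  next
    case False
    then show ?thesis using vec.subspace_0[OF sub] by blast
  qed
qed

lemma verma_endomorphism:
  assumes g: "g \<in> sl2_hom (verma \<mu>) (verma \<mu>)"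
  shows "\<exists>\<alpha>. \<forall>v. g v = vscale \<alpha> (idm (verma \<mu>) v)"
proof -
  let ?w = "g (basis_vec 0)"
  have h: "act_h (verma \<mu>) ?w = vscale \<mu> ?w"
    by (simp flip: hom_h[OF g] add: act_verma lin_scale[OF hom_lin[OF g]])
  have lh: "lookup (act_h (verma \<mu>) y) j = (\<mu> - 2 * of_nat j) * lookup y j" for y j
  proof -
    have "(\<lambda>y. vscale (lookup (act_h (verma \<mu>) y) j) (basis_vec 0)) = (\<lambda>y. vscale ((\<mu> - 2 * of_nat j) * lookup y j) (basis_vec 0))"
    proof (rule lin_ext)
      show "vscale (lookup (act_h (verma \<mu>) (basis_vec k)) j) (basis_vec 0) = vscale ((\<mu> - 2 * of_nat j) * lookup (basis_vec k) j) (basis_vec 0)" for k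
        by (auto simp: act_verma lookup_basis_vec)
    qed (auto simp: lin_iff lin_simps(1,2)[OF lin_verma(3)] lookup_add vec.scale_left_distrib algebra_simps)
    from fun_cong[OF this, of y] have "lookup (vscale (lookup (act_h (verma \<mu>) y) j) (basis_vec 0)) 0 = lookup (vscale ((\<mu> - 2 * of_nat j) * lookup y j) (basis_vec 0)) 0"
      by simp
    then show ?thesis by (simp add: lookup_basis_vec)
  qed
  have "lookup ?w j = 0" if "j \<noteq> 0" for j
    using arg_cong[OF h, of "\<lambda>v. lookup v j"] that by (simp add: lh algebra_simps)
  then have w: "?w = vscale (lookup ?w 0) (basis_vec 0)"
    by (intro vec_eqI) (auto simp: lookup_basis_vec)
  have "g = map_scale (lookup ?w 0) (idm (verma \<mu>))"
    by (rule verma_hom_eq[OF g hom_scale[OF verma_closed hom_id[OF verma_closed]]]) (use w in simp)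
  then show ?thesis by (intro exI[of _ "lookup ?w 0"]) (metis map_scale_simps)
qed

section \<open>Projective covers and the category \<open>K\<^sub>1\<close>\<close>

lemma projective_lift:
  assumes "projective_in_O P" "A \<in> O_modules" "B \<in> O_modules" "g \<in> sl2_hom A B" "g ` space A = space B" "f \<in> sl2_hom P B"
  obtains k where "k \<in> sl2_hom P A" "g \<circ> k = f"
proof -
  have *: "\<forall>A\<in>O_modules. \<forall>B\<in>O_modules. \<forall>g f. (g \<in> sl2_hom A B \<and> g ` space A = space B) \<and> f \<in> sl2_hom P B \<longrightarrow>
      (\<exists>k\<in>sl2_hom P A. g \<circ> k = f)"
    using assms(1) unfolding projective_in_O_def surjective_hom_def Ob_category_O by (rule conjunct2)
  have "\<exists>k\<in>sl2_hom P A. g \<circ> k = f"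
    by (rule *[rule_format, OF assms(2,3)]) (intro conjI assms(4-6))
  then show ?thesis by (elim bexE) (rule that)
qed

lemma projective_inI:
  assumes "P \<in> O_modules"
    "\<And>A B g f. A \<in> O_modules \<Longrightarrow> B \<in> O_modules \<Longrightarrow> g \<in> sl2_hom A B \<Longrightarrow> g ` space A = space B \<Longrightarrow> f \<in> sl2_hom P B \<Longrightarrow>
       \<exists>k\<in>sl2_hom P A. g \<circ> k = f"
  shows "projective_in_O P"
  unfolding projective_in_O_def surjective_hom_def Ob_category_O
  by (intro conjI ballI allI impI assms(1)) (elim conjE, rule assms(2), assumption+)

lemma projective_O: "projective_in_O P \<Longrightarrow> P \<in> O_modules"
  by (simp add: projective_in_O_def Ob_category_O)

lemma projective_retract:
  assumes P: "projective_in_O P" and A: "A \<in> sl2_modules" "s \<in> sl2_hom A P" "r \<in> sl2_hom P A" "r \<circ> s = idm A"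
  shows "projective_in_O A"
proof (rule projective_inI)
  show "A \<in> O_modules" by (rule O_retract[OF projective_O[OF P] A])
  fix M B g f assume M: "M \<in> O_modules" "B \<in> O_modules" "g \<in> sl2_hom M B" "g ` space M = space B" and f: "f \<in> sl2_hom A B"
  obtain k where k: "k \<in> sl2_hom P M" "g \<circ> k = f \<circ> r" by (rule projective_lift[OF P M hom_comp[OF A(3) f]])
  have "g \<circ> (k \<circ> s) = f"
  proof
    fix x
    have "g (k (s x)) = f (r (s x))" using fun_cong[OF k(2), of "s x"] by simp
    also have "\<dots> = f x" using fun_cong[OF A(4), of x] by (simp add: hom_dom[OF f])
    finally show "(g \<circ> (k \<circ> s)) x = f x" by simp
  qed
  then show "\<exists>k\<in>sl2_hom A M. g \<circ> k = f" using hom_comp[OF A(2) k(1)] by (rule bexI)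
qed

text \<open>\<open>F\<close> is self-adjoint and preserves surjections: transpose the map, lift it,
  and transpose back. The minus sign of the lift cancels the one in \<open>zigzag\<close>.\<close>

lemma projective_F:
  assumes P: "projective_in_O P"
  shows "projective_in_O (F P)"
proof (rule projective_inI)
  have Pm: "P \<in> sl2_modules" using projective_O[OF P] by simp
  show "F P \<in> O_modules" by (rule O_F[OF projective_O[OF P]])
  fix M B g f assume M: "M \<in> O_modules" "B \<in> O_modules" and g: "g \<in> sl2_hom M B" "g ` space M = space B" and f: "f \<in> sl2_hom (F P) B"
  have m: "M \<in> sl2_modules" "B \<in> sl2_modules" using M by simp_all
  have sur: "Fm g ` space (F M) = space (F B)"
  proof
    show "Fm g ` space (F M) \<subseteq> space (F B)" using hom_in[OF Fm_hom[OF g(1) m]] by auto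
    show "space (F B) \<subseteq> Fm g ` space (F M)"
    proof
      fix y assume y: "y \<in> space (F B)"
      have "idm B (prj i y) \<in> g ` space M" for i unfolding g(2) by simp
      then have "\<exists>x. x \<in> space M \<and> g x = idm B (prj i y)" for i by (metis imageE)
      then obtain x where x: "\<And>i. x i \<in> space M" "\<And>i. g (x i) = idm B (prj i y)" by metis
      have "y = incl 0 (g (x 0)) + incl 1 (g (x 1))" using y idmF_apply[of B y] by (simp add: x(2))
      also have "\<dots> = Fm g (incl 0 (x 0) + incl 1 (x 1))" by (simp add: Fm_apply hom_lin[OF g(1)])
      also have "incl 0 (x 0) + incl 1 (x 1) \<in> space (F M)"
        using x(1) by (simp add: F_def basis_tensor_module tensor_vec_in)
      ultimately show "y \<in> Fm g ` space (F M)" by blast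
    qed
  qed
  have ft: "Fm f \<circ> coev P \<in> sl2_hom P (F B)"
    by (rule hom_comp[OF coev_hom[OF Pm] Fm_hom[OF f F_closed[OF Pm] m(2)]])
  obtain k where k: "k \<in> sl2_hom P (F M)" "Fm g \<circ> k = Fm f \<circ> coev P"
    by (rule projective_lift[OF P O_F[OF M(1)] O_F[OF M(2)] Fm_hom[OF g(1) m] sur ft])
  have h: "ev M \<circ> Fm k \<in> sl2_hom (F P) M"
    by (rule hom_comp[OF Fm_hom[OF k(1) Pm F_closed[OF m(1)]] ev_hom[OF m(1)]])
  have "g \<circ> - (ev M \<circ> Fm k) = f"
  proof
    fix v
    have "(g \<circ> - (ev M \<circ> Fm k)) v = - g (ev M (Fm k v))" by (simp add: lin_uminus[OF hom_lin[OF g(1)]])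
    also have "g (ev M (Fm k v)) = ev B (Fm (Fm g) (Fm k v))" using ev_nat[OF m g(1)] by simp
    also have "Fm (Fm g) (Fm k v) = Fm (\<lambda>v. Fm g (k v)) v"
      by (simp add: Fm_comp_apply hom_lin[OF k(1)])
    also have "(\<lambda>v. Fm g (k v)) = (\<lambda>v. Fm f (coev P v))" using k(2) by (simp add: fun_eq_iff)
    also have "Fm (\<lambda>v. Fm f (coev P v)) v = Fm (Fm f) (Fm (coev P) v)"
      by (simp add: Fm_comp_apply lin_Fstuff)
    also have "ev B (Fm (Fm f) (Fm (coev P) v)) = f (ev (F P) (Fm (coev P) v))"
      using ev_nat[OF F_closed[OF Pm] m(2) f] by simp
    also have "\<dots> = - f v" by (simp add: zigzag[OF Pm] lin_uminus[OF hom_lin[OF f]] hom_dom[OF f])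
    finally show "(g \<circ> - (ev M \<circ> Fm k)) v = f v" by simp
  qed
  then show "\<exists>k\<in>sl2_hom (F P) M. g \<circ> k = f" using hom_neg[OF m(1) h] by (rule bexI)
qed

section \<open>Projectivity of the Verma module of highest weight -1\<close>

context sl2_rep
begin

lemma lprod_cc_h: "lprod cc ls (h x) = h (lprod cc ls x)"
  by (induction ls) (simp_all add: lin cc_h)

lemma cc_highest_weight:
  assumes "e w = 0" "h w = l *c w"
  shows "cc w = ((l + 1) * (l + 1)) *c w"
  unfolding cc_kernel[OF assms(1)] assms(2) by (simp add: lin assms(2) algebra_simps scale_two)

text \<open>The vector e^j v has weight l + 2 j, and if it is the last nonzero one, its Casimir
  eigenvalue is (l + 2 j + 1)^2. These are the possible Casimir roots of v.\<close>

lemma cc_weight_product: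
  assumes "(e ^^ m) v = 0" "h v = l *c v"
  shows "lprod cc (map (\<lambda>j. (l + 2 * of_nat j + 1) * (l + 2 * of_nat j + 1)) [0..<m]) v = 0"
  using assms
proof (induction m arbitrary: v l)
  case (Suc m)
  let ?ls = "map (\<lambda>j. (l + 2 * of_nat j + 1) * (l + 2 * of_nat j + 1)) [1..<Suc m]"
  have "(e ^^ m) (e v) = 0" using Suc.prems(1) by (simp add: funpow_swap1)
  moreover have "h (e v) = (l + 2) *c e v" by (simp add: he Suc.prems(2) lin scale_left_distrib)
  ultimately have "lprod cc (map (\<lambda>j. (l + 2 + 2 * of_nat j + 1) * (l + 2 + 2 * of_nat j + 1)) [0..<m]) (e v) = 0"
    by (rule Suc.IH)
  moreover have "map (\<lambda>j. (l + 2 + 2 * of_nat j + 1) * (l + 2 + 2 * of_nat j + 1)) [0..<m] = ?ls"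
    unfolding One_nat_def map_Suc_upt[symmetric] map_map by (rule map_cong) (simp_all add: algebra_simps)
  ultimately have ew: "e (lprod cc ?ls v) = 0" by (simp add: e_lprod_cc)
  have hw: "h (lprod cc ?ls v) = l *c lprod cc ?ls v"
    unfolding lprod_cc_h[symmetric] Suc.prems(2) by (rule endo_simps(2)[OF endo_lprod[OF endo_cc]])
  have "cc (lprod cc ?ls v) = ((l + 1) * (l + 1)) *c lprod cc ?ls v"
    by (rule cc_highest_weight[OF ew hw])
  then have "lprod cc ([(l + 1) * (l + 1)] @ ?ls) v = 0" by (simp add: lprod_append)
  moreover have "map (\<lambda>j. (l + 2 * of_nat j + 1) * (l + 2 * of_nat j + 1)) [0..<Suc m] = [(l + 1) * (l + 1)] @ ?ls"
    by (subst upt_conv_Cons) (simp_all add: One_nat_def)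
  ultimately show ?case by (simp only:)
qed simp

end

text \<open>A highest weight vector of weight -1 has to be lifted along a surjection. A preimage is
  first cut down to weight -1. If e does not kill it yet, Casimir factors with the roots (2 j +
  2)^2, belonging to the weights 1 + 2 j, repair this. None of these roots is 0, the Casimir
  eigenvalue of the target vector, so its image changes only by a nonzero scalar.\<close>

lemma verma_projective: "projective_in_O (verma (- 1))"
proof (rule projective_inI[OF verma_O])
  fix A B g f
  assume A: "A \<in> O_modules" and B: "B \<in> O_modules" and g: "g \<in> sl2_hom A B" "g ` space A = space B"
    and f: "f \<in> sl2_hom (verma (- 1)) B"
  have m: "A \<in> sl2_modules" "B \<in> sl2_modules" using A B by simp_all
  interpret R: sl2_rep vscale "act_e A" "act_f A" "act_h A" by (rule rep_vec[OF m(1)])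
  interpret Q: sl2_rep vscale "act_e B" "act_f B" "act_h B" by (rule rep_vec[OF m(2)])
  let ?b = "f (basis_vec 0)"
  have b: "act_e B ?b = 0" "act_h B ?b = vscale (- 1) ?b" "?b \<in> space B"
    by (simp_all only: hom_e[OF f, symmetric] hom_h[OF f, symmetric] hom_in[OF f] act_verma) (simp_all add: lin_simps[OF hom_lin[OF f]])
  have g_lprod: "g (R.lprod (act_h A) ls x) = R.lprod (act_h B) ls (g x)" "g (R.lprod R.cc ls x) = R.lprod Q.cc ls (g x)" for ls x
    by (induction ls) (simp_all add: lin_simps[OF hom_lin[OF g(1)]] R.cc_def Q.cc_def sl2_homD(5-7)[OF g(1)])
  obtain a0 where a0: "a0 \<in> space A" "g a0 = ?b" using b(3) g(2) by (metis imageE)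
  obtain ls where ls: "- 1 \<notin> set ls" "act_h A (R.lprod (act_h A) ls a0) = vscale (- 1) (R.lprod (act_h A) ls a0)"
    using weight_component[OF A a0(1), of "- 1"] by blast
  let ?a1 = "R.lprod (act_h A) ls a0"
  have sp: "R.lprod (act_h A) ls x \<in> space A" "R.lprod R.cc ls x \<in> space A" if "x \<in> space A" for ls x
    using that m(1) by (induction ls) (simp_all add: R.cc_def)
  define c1 where "c1 = prod_list (map (\<lambda>l. - 1 - l) ls)"
  have c1: "c1 \<noteq> 0" using ls(1) by (auto simp: c1_def prod_list_zero_iff)
  have ga1: "g ?a1 = vscale c1 ?b"
    unfolding g_lprod a0 c1_def by (rule R.lprod_eigen[OF Q.h b(2)])
  obtain k where k: "(act_e A ^^ k) ?a1 = 0" using weight_vector_nilpotent[OF A sp(1)[OF a0(1)] ls(2)] by blast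
  then have "act_e A ((act_e A ^^ k) ?a1) = 0" by (simp add: R.lin)
  then have "(act_e A ^^ k) (act_e A ?a1) = 0" by (simp add: funpow_swap1)
  moreover have "act_h A (act_e A ?a1) = vscale 1 (act_e A ?a1)" by (simp add: R.he ls(2) R.lin)
  ultimately have z: "R.lprod R.cc (map (\<lambda>j. (1 + 2 * of_nat j + 1) * (1 + 2 * of_nat j + 1)) [0..<k]) (act_e A ?a1) = 0"
    by (rule R.cc_weight_product)
  let ?ms = "map (\<lambda>j. (1 + 2 * of_nat j + 1) * (1 + 2 * of_nat j + 1)) [0..<k] :: complex list"
  let ?a2 = "R.lprod R.cc ?ms ?a1"
  have ea2: "act_e A ?a2 = 0" using z by (simp add: R.e_lprod_cc)

  have ha2: "act_h A ?a2 = vscale (- 1) ?a2"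
    unfolding R.lprod_cc_h[symmetric] ls(2) by (rule R.endo_simps(2)[OF R.endo_lprod[OF R.endo_cc]])
  have "Q.cc ?b = vscale 0 ?b"
    using Q.cc_highest_weight[OF b(1,2)] by simp
  from R.lprod_eigen[OF Q.endo_cc this] have gb: "R.lprod Q.cc ?ms ?b = vscale (prod_list (map (\<lambda>m. 0 - m) ?ms)) ?b" .
  define c2 where "c2 = prod_list (map (\<lambda>m. 0 - m) ?ms)"
  have c2: "c2 \<noteq> 0"
  proof -
    have "1 + 2 * of_nat j + 1 \<noteq> (0 :: complex)" for j
    proof
      assume "1 + 2 * of_nat j + 1 = (0 :: complex)"
      then have "of_nat (2 * j + 2) = (0 :: complex)" by simp
      then show False by (simp only: of_nat_eq_0_iff)
    qed
    then show ?thesis by (auto simp: c2_def prod_list_zero_iff)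
  qed
  have ga2: "g ?a2 = vscale (c1 * c2) ?b"
    unfolding g_lprod(2) ga1 R.endo_simps(2)[OF R.endo_lprod[OF Q.endo_cc]] gb c2_def by simp
  obtain a2 where a2: "a2 \<in> space A" "act_e A a2 = 0" "act_h A a2 = vscale (- 1) a2" "g a2 = vscale (c1 * c2) ?b"
    by (rule that[OF sp(2)[OF sp(1)[OF a0(1)]] ea2 ha2 ga2])
  let ?a = "vscale (inverse (c1 * c2)) a2"
  have "?a \<in> space A" using a2(1) by simp
  moreover have "act_e A ?a = 0" by (simp add: R.lin a2(2))
  moreover have "act_h A ?a = vscale (- 1) ?a" by (simp add: R.lin a2(3))
  ultimately obtain p where p: "p \<in> sl2_hom (verma (- 1)) A" "p (basis_vec 0) = ?a" by (rule verma_hom[OF m(1)])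
  have "g \<circ> p = f"
  proof (rule verma_hom_eq[OF hom_comp[OF p(1) g(1)] f])
    show "(g \<circ> p) (basis_vec 0) = f (basis_vec 0)"
    proof -
      have "inverse (c1 * c2) * (c1 * c2) = 1" using c1 c2 by (intro left_inverse) simp
      then show ?thesis by (simp only: o_apply p(2) lin_scale[OF hom_lin[OF g(1)]] a2(4) vec.scale_scale vec.scale_one)
    qed
  qed
  then show "\<exists>k\<in>sl2_hom (verma (- 1)) A. g \<circ> k = f" using p(1) by (rule bexI)
qed

text \<open>Induction along the ladder. If v has weight - n - 2, then b_0 \<otimes> v is a highest
  weight vector of weight - n - 1 and Casimir eigenvalue n^2 in \<open>F V\<close>. The induction
  hypothesis maps \<open>X n\<close> into that eigenspace. The transpose F (X n) -> V is nonzero,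
  and only the summand \<open>X (Suc n)\<close> can carry it, as the others belong to different
  stages.\<close>

lemma highest_weight_hom:
  assumes "ladder (verma (- 1)) X d" "stage n V (\<lambda>v. 0)" "v \<in> space V" "v \<noteq> 0" "act_e V v = 0" "act_h V v = vscale (- of_nat (n + 1)) v"
  shows "\<exists>g\<in>sl2_hom (X n) V. \<exists>x. g x \<noteq> 0"
  using assms(2-6)
proof (induction n arbitrary: V v)
  interpret ladder_modules "verma (- 1)" X d by unfold_locales (rule assms(1))
  {
    case 0
    have "V \<in> sl2_modules" using 0(1) by (simp add: stage_def)
    then obtain g where "g \<in> sl2_hom (verma (- 1)) V" "g (basis_vec 0) = v"
      by (rule verma_hom[OF _ 0(2) 0(4), of "- 1"]) (use 0(5) in \<open>simp_all\<close>)
    then show ?case using 0(3) unfolding X0 by (intro bexI[of _ g] exI[of _ "basis_vec 0"]) simp_all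
  next
    case (Suc n)
    have V: "V \<in> sl2_modules" using Suc.prems(1) by (simp add: stage_def)
    note FV = F_closed[OF V]
    let ?w = "incl 0 v" and ?c = "of_nat n * of_nat n :: complex"
    have w: "?w \<in> space (F V)" using Suc.prems(2) by (simp add: F_def basis_tensor_module tensor_vec_in)
    have ew: "act_e (F V) ?w = 0" by (simp add: actF[OF V] Suc.prems lin_zero[OF lin_id_map] lin_zero[OF lin_act_e[OF V]] tensor_vec_bilinear)
    have hw: "act_h (F V) ?w = vscale (- of_nat (n + 1)) ?w"
      using Suc.prems(2,5) by (simp add: actF[OF V] lin_zero[OF lin_id_map] lin_zero[OF lin_act_h[OF V]] tensor_vec_bilinear)
        (rule vec_eqI, simp only: lk, simp add: algebra_simps)
    interpret R: sl2_rep vscale "act_e (F V)" "act_f (F V)" "act_h (F V)" by (rule rep_vec[OF FV])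
    have casw: "cas (F V) ?w = vscale ?c ?w"
    proof -
      have "cas (F V) ?w = R.cc ?w" using w by (simp add: cas_def R.cc_def)
      also have "\<dots> = vscale ?c ?w" unfolding R.cc_highest_weight[OF ew hw] by (simp add: algebra_simps)
      finally show ?thesis .
    qed
    define T where "T = cas (F V) - map_scale ?c (idm (F V))"
    have Th: "T \<in> sl2_hom (F V) (F V)" unfolding T_def by (intro hom_minus hom_scale hom_id cas_hom FV)
    define N where "N = {x \<in> space (F V). T x = 0}"
    have sub: "submodule N (F V)" unfolding N_def by (rule submodule_kernel[OF Th FV FV])
    obtain W \<iota> \<kappa> where W: "W \<in> sl2_modules" "\<iota> \<in> sl2_hom W (F V)"
       "\<And>y. y \<in> space W \<Longrightarrow> \<iota> y \<in> N \<and> \<kappa> (\<iota> y) = y" "\<And>x. x \<in> N \<Longrightarrow> \<kappa> x \<in> space W \<and> \<iota> (\<kappa> x) = x"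
      using submodule_copy[OF FV sub] by metis
    have wN: "?w \<in> N" using w casw by (simp add: N_def T_def)
    have incl\<iota>: "x = y" if "x \<in> space W" "y \<in> space W" "\<iota> x = \<iota> y" for x y
      using W(3) that by metis
    note l\<iota> = lin_simps[OF hom_lin[OF W(2)]]
    have casW: "cas W y = vscale ?c (idm W y)" for y
    proof (rule incl\<iota>)
      show "cas W y \<in> space W" by (rule hom_in[OF cas_hom[OF W(1)]])
      have "T (\<iota> (idm W y)) = 0" using W(3)[of "idm W y"] by (simp add: N_def)
      then show "\<iota> (cas W y) = \<iota> (vscale ?c (idm W y))"
        by (simp add: T_def hom_cas[OF W(2)] l\<iota> hom_dom[OF W(2)] hom_cod[OF W(2)])
    qed simp
    have "\<exists>g\<in>sl2_hom (X n) W. \<exists>x. g x \<noteq> 0"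
    proof (rule Suc.IH[of W "\<kappa> ?w"])
      show "stage n W (\<lambda>v. 0)"
        using hom_zero[OF W(1), of W] W(1) casW by (simp add: stage_def zero_fun_def)
      have k: "\<kappa> ?w \<in> space W" "\<iota> (\<kappa> ?w) = ?w" using W(4)[OF wN] by blast+
      show "\<kappa> ?w \<in> space W" by (rule k)
      show "\<kappa> ?w \<noteq> 0"
      proof
        assume "\<kappa> ?w = 0"
        then have "?w = 0" using k(2) l\<iota>(3) by simp
        then have "prj 0 ?w = 0" by simp
        then show False using Suc.prems(3) by simp
      qed
      show "act_e W (\<kappa> ?w) = 0"
        by (rule incl\<iota>) (use W(1) ew in \<open>simp_all add: hom_e[OF W(2)] k l\<iota>\<close>)
      show "act_h W (\<kappa> ?w) = vscale (- of_nat (n + 1)) (\<kappa> ?w)"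
        by (rule incl\<iota>) (use W(1) hw k in \<open>simp_all add: hom_h[OF W(2)] l\<iota>\<close>)
    qed
    then obtain g0 x where g0: "g0 \<in> sl2_hom (X n) W" "g0 x \<noteq> 0" by blast
    define k where "k = \<iota> \<circ> g0"
    have k: "k \<in> sl2_hom (X n) (F V)" unfolding k_def by (rule hom_comp[OF g0(1) W(2)])
    have kx: "k x \<noteq> 0"
    proof
      assume "k x = 0"
      then have "\<iota> (g0 x) = \<iota> 0" by (simp add: k_def l\<iota>)
      then have "g0 x = 0" by (rule incl\<iota>[rotated 2]) (use hom_in[OF g0(1)] in simp_all)
      then show False using g0(2) by simp
    qed
    let ?t = "ev V \<circ> Fm k"
    have t: "?t \<in> sl2_hom (F (X n)) V" by (rule hom_comp[OF Fm_hom[OF k Xm FV] ev_hom[OF V]])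
    have "\<exists>y. ?t y \<noteq> 0"
    proof (rule ccontr)
      assume "\<nexists>y. ?t y \<noteq> 0"
      then have t0: "ev V (Fm k y) = 0" for y by simp
      have "Fm (ev V) (coev (F V) (k x)) = Fm (ev V) (Fm (Fm k) (coev (X n) x))"
        using coev_nat[OF Xm FV k] by simp
      also have "\<dots> = Fm (\<lambda>y. ev V (Fm k y)) (coev (X n) x)" by (simp add: Fm_comp_apply lin_Fstuff)
      also have "\<dots> = 0" by (simp add: t0 Fm_zero_apply)
      finally have "idm (F V) (k x) = 0" using zigzag(2)[OF V, of "k x"] by simp
      then show False using kx by (simp add: hom_cod[OF k])
    qed
    then obtain y where y: "?t y \<noteq> 0" by blast
    obtain s r As where sr: "s \<in> sl2_hom (X (Suc n)) (F (X n))" "r \<in> sl2_hom (F (X n)) (X (Suc n))" "r \<circ> s = idm (X (Suc n))"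
      "set As \<subseteq> X ` {..n}" "thr As (F (X n)) (F (X n)) (idm (F (X n)) - (s \<circ> r))" by (rule F_X_decomposition)
    have lt: "lin ?t" by (rule hom_lin[OF t])
    have "?t ((idm (F (X n)) - (s \<circ> r)) y) = 0"
    proof (rule ccontr)
      assume "?t ((idm (F (X n)) - (s \<circ> r)) y) \<noteq> 0"
      from thr_nonzero_comp[OF sr(5) lt this] obtain A a u where A: "A \<in> set As" "a \<in> sl2_hom (F (X n)) A" "u \<in> sl2_hom A (F (X n))"
        "?t (u (a y)) \<noteq> 0" by blast
      obtain l where l: "A = X l" "l \<le> n" using A(1) sr(4) by auto
      have "(?t \<circ> u) (a y) = 0"
        by (rule stage_hom_zero[OF st Suc.prems(1) _ hom_comp[OF _ t]]) (use A(3) l in simp_all)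
      then show False using A(4) by simp
    qed
    then have "?t (s (r y)) = ?t y" by (simp add: lin_diff[OF lt, simplified] hom_dom[OF t, simplified])
    then have "(?t \<circ> s) (r y) \<noteq> 0" using y by simp
    then show ?case using hom_comp[OF sr(1) t] by blast
  }
qed

definition essential :: "sl2_module \<Rightarrow> sl2_module \<Rightarrow> (vec \<Rightarrow> vec) \<Rightarrow> bool" where
  "essential P V p \<longleftrightarrow> p \<in> sl2_hom P V \<and> p ` space P = space V \<and> (\<forall>N. submodule N P \<and> p ` N = space V \<longrightarrow> N = space P)"

lemma projective_cover_iff:
  "projective_cover_in_O P V \<longleftrightarrow> projective_in_O P \<and> (\<exists>p. essential P V p)"
  unfolding projective_cover_in_O_def essential_def surjective_hom_def conj_assoc ..

text \<open>Lift p along q to a map g. It is onto because q is essential, it has a section because Q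
  is projective, and the section is onto because p is essential.\<close>

lemma projective_cover_unique:
  assumes P: "projective_in_O P" "essential P L p" and Q: "projective_in_O Q" "essential Q L q" and L: "L \<in> O_modules"
  shows "mod_iso P Q"
proof -
  have m: "P \<in> sl2_modules" "Q \<in> sl2_modules" using projective_O[OF P(1)] projective_O[OF Q(1)] by simp_all
  have p: "p \<in> sl2_hom P L" "p ` space P = space L" and pe: "\<And>N. submodule N P \<Longrightarrow> p ` N = space L \<Longrightarrow> N = space P"
    using P(2) by (simp_all add: essential_def)
  have q: "q \<in> sl2_hom Q L" "q ` space Q = space L" and qe: "\<And>N. submodule N Q \<Longrightarrow> q ` N = space L \<Longrightarrow> N = space Q"
    using Q(2) by (simp_all add: essential_def)
  obtain g where g: "g \<in> sl2_hom P Q" "q \<circ> g = p"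
    by (rule projective_lift[OF P(1) projective_O[OF Q(1)] L q p(1)])
  have gs: "g ` space P = space Q"
    by (rule qe[OF submodule_image[OF g(1) m(1) submodule_whole[OF m(1)]]]) (simp only: image_comp g(2) p(2))
  obtain s where s: "s \<in> sl2_hom Q P" "g \<circ> s = idm Q"
    by (rule projective_lift[OF Q(1) projective_O[OF P(1)] projective_O[OF Q(1)] g(1) gs hom_id[OF m(2)]])
  have gs': "g (s y) = idm Q y" for y using fun_cong[OF s(2), of y] by simp
  have ps: "p (s y) = q y" for y
    using fun_cong[OF g(2), of "s y"] by (simp add: gs' hom_dom[OF q(1)])
  have ss: "s ` space Q = space P"
    by (rule pe[OF submodule_image[OF s(1) m(2) submodule_whole[OF m(2)]]]) (simp only: image_image ps q(2))
  have "inj_on s (space Q)"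
    by (rule hom_injective_iff[OF s(1)]) (metis gs' id_map_eq lin_zero[OF hom_lin[OF g(1)]])
  then show ?thesis by (intro mod_iso_sym[OF bijective_hom_iso[OF s(1) m(2,1) _ ss]])
qed

lemma hull_submodule:
  assumes V: "V \<in> sl2_modules" and v: "v \<in> space V"
  defines "N \<equiv> \<Inter>{N. submodule N V \<and> v \<in> N}"
  shows "submodule N V" "v \<in> N"
proof -
  have "space V \<in> {N. submodule N V \<and> v \<in> N}" using submodule_whole[OF V] v by simp
  then show "submodule N V" "v \<in> N"
    unfolding N_def submodule_def vec.subspace_def by (auto; blast)+
qed

text \<open>A submodule mapping onto the top contains a cyclic one that does; lifting through it gives an
  endomorphism \<open>\<alpha> + \<beta> d\<close> with \<open>\<alpha> \<noteq> 0\<close>, which is invertible.\<close>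

lemma essential_simple_quotient:
  assumes P: "projective_in_O P" and L: "L \<in> O_modules" "simple_module L" and p: "p \<in> sl2_hom P L" "p x \<noteq> 0"
    and d: "d \<in> sl2_hom P P" "\<And>v. d (d v) = 0" "scalar_end P d"
    and l: "l \<in> space L" "l \<noteq> 0" "act_h L l = vscale \<mu> l"
  shows "essential P L p"
proof -
  have PO: "P \<in> O_modules" by (rule projective_O[OF P])
  have m: "P \<in> sl2_modules" "L \<in> sl2_modules" using PO L by simp_all
  have sur: "p ` space P = space L" by (rule simple_hom(2)[OF p(1) m p(2) L(2)])
  have "N = space P" if N: "submodule N P" "p ` N = space L" for N
  proof -
    interpret R: sl2_rep vscale "act_e P" "act_f P" "act_h P" by (rule rep_vec[OF m(1)])
    interpret Q: sl2_rep vscale "act_e L" "act_f L" "act_h L" by (rule rep_vec[OF m(2)])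
    have NP: "N \<subseteq> space P" and sub: "vec.subspace N" using N(1) by (simp_all add: submodule_def)
    \<comment> \<open>A preimage of l is cut down to a weight vector, so that the cyclic submodule
      it generates belongs to O by \<open>O_generated\<close>.\<close>
    obtain w where w: "w \<in> N" "p w = l" using N(2) l(1) by (metis imageE)
    obtain ls where ls: "\<mu> \<notin> set ls" "act_h P (R.lprod (act_h P) ls w) = vscale \<mu> (R.lprod (act_h P) ls w)"
      using weight_component[OF PO, of w \<mu>] w NP by blast
    let ?v = "R.lprod (act_h P) ls w"
    have vN: "?v \<in> N"
      using w(1) N(1) by (induction ls) (auto simp: submodule_def intro: vec.subspace_diff vec.subspace_scale)
    have "p (R.lprod (act_h P) ls w) = R.lprod (act_h L) ls (p w)"
      by (induction ls) (simp_all add: lin_simps[OF hom_lin[OF p(1)]] sl2_homD(5-7)[OF p(1)])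
    then have pv: "p ?v = vscale (prod_list (map (\<lambda>k. \<mu> - k) ls)) l"
      unfolding w(2) R.lprod_eigen[OF Q.h l(3)] .
    have pv0: "p ?v \<noteq> 0" using ls(1) l(2) by (auto simp: pv prod_list_zero_iff)
    have vP: "?v \<in> space P" using vN NP by blast
    define M where "M = \<Inter>{N. submodule N P \<and> ?v \<in> N}"
    have M: "submodule M P" "?v \<in> M" unfolding M_def by (rule hull_submodule[OF m(1) vP])+
    have Mmin: "M \<subseteq> N'" if "submodule N' P" "?v \<in> N'" for N' using that unfolding M_def by blast
    obtain W \<iota> \<kappa> where W: "W \<in> sl2_modules" "\<iota> \<in> sl2_hom W P" "lin \<kappa>"
       "\<And>y. y \<in> space W \<Longrightarrow> \<iota> y \<in> M \<and> \<kappa> (\<iota> y) = y" "\<And>x. x \<in> M \<Longrightarrow> \<kappa> x \<in> space W \<and> \<iota> (\<kappa> x) = x"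
      using submodule_copy[OF m(1) M(1)] by metis
    have incl\<iota>: "x = y" if "x \<in> space W" "y \<in> space W" "\<iota> x = \<iota> y" for x y
      using W(4) that by metis
    let ?w = "\<kappa> ?v"
    have kw: "?w \<in> space W" "\<iota> ?w = ?v" using W(5)[OF M(2)] by blast+
    have "W \<in> O_modules"
    proof (rule O_generated[OF W(1)])
      show "generated_by W ?w"
        unfolding generated_by_def
      proof (intro conjI allI impI kw subsetI)
        fix N' y assume N': "submodule N' W \<and> ?w \<in> N'" and y: "y \<in> space W"
        have "?v \<in> \<iota> ` N'" using N' kw(2) by (metis imageI)
        then have "M \<subseteq> \<iota> ` N'" by (intro Mmin submodule_image[OF W(2,1)]) (use N' in blast)+
        then obtain y' where "y' \<in> N'" "\<iota> y = \<iota> y'" using W(4)[OF y] by blast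
        moreover from this have "y' \<in> space W" using N' by (auto simp: submodule_def)
        ultimately show "y \<in> N'" using incl\<iota>[OF y] by simp
      qed
      show "act_h W ?w = vscale \<mu> ?w"
        by (rule incl\<iota>) (use W(1) kw ls(2) in \<open>simp_all add: hom_h[OF W(2)] lin_simps[OF hom_lin[OF W(2)]]\<close>)
      show "locally_e_finite W"
        unfolding locally_e_finite_def
      proof
        fix y assume y: "y \<in> space W"
        obtain B where B: "finite B" "\<And>k. (act_e P ^^ k) (\<iota> y) \<in> vec.span B"
          using PO hom_in[OF W(2), of y] by (auto simp: locally_e_finite_def)
        have "(act_e W ^^ k) y \<in> space W" for k using y W(1) by (induction k) simp_all
        then have "(act_e W ^^ k) y = \<kappa> ((act_e P ^^ k) (\<iota> y))" for k
          using W(4)[of "(act_e W ^^ k) y"] by (simp add: hom_e_pow[OF W(2)])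
        then have "(act_e W ^^ k) y \<in> vec.span (\<kappa> ` B)" for k
          by (simp only:) (rule span_image_subset[OF W(3) _ B(2)], auto intro: vec.span_base)
        then show "\<exists>B. finite B \<and> (\<forall>k. (act_e W ^^ k) y \<in> vec.span B)" using B(1) by blast
      qed
    qed
    note WO = this
    have pi: "p \<circ> \<iota> \<in> sl2_hom W L" by (rule hom_comp[OF W(2) p(1)])
    have "(p \<circ> \<iota>) ?w \<noteq> 0" using pv0 kw(2) by simp
    then have pis: "(p \<circ> \<iota>) ` space W = space L" by (rule simple_hom(2)[OF pi W(1) m(2) _ L(2)])
    obtain g where g: "g \<in> sl2_hom P W" "(p \<circ> \<iota>) \<circ> g = p"
      by (rule projective_lift[OF P WO L(1) pi pis p(1)])
    have pig: "p (\<iota> (g v)) = p v" for v using fun_cong[OF g(2), of v] by simp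
    obtain \<alpha> \<beta> where ab: "\<And>v. \<iota> (g v) = vscale \<alpha> (idm P v) + vscale \<beta> (d v)"
      using d(3) hom_comp[OF g(1) W(2)] unfolding scalar_end_def by (metis comp_apply)
    note lp = lin_simps[OF hom_lin[OF p(1)]]
    have ld: "d (vscale c v) = vscale c (d v)" "d (v + v') = d v + d v'" for c v v'
      using lin_simps[OF hom_lin[OF d(1)]] by simp_all
    \<comment> \<open>With \<alpha> = 0 one would have p = \<beta> p d, and applying this twice
      gives p = \<beta>^2 p d^2 = 0.\<close>
    have "\<alpha> \<noteq> 0"
    proof
      assume "\<alpha> = 0"
      then have "p v = vscale \<beta> (p (d v))" for v using pig[of v] by (simp add: ab lp)
      from this[of x] this[of "d x"] have "p x = 0" by (simp add: d(2) lp)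
      then show False using p(2) by simp
    qed
    have "x \<in> N" if x: "x \<in> space P" for x
    proof -
      \<comment> \<open>The preimage of x under \<alpha> + \<beta> d, again by d^2 = 0.\<close>
      let ?y = "vscale (inverse \<alpha>) x - vscale (inverse \<alpha> * inverse \<alpha> * \<beta>) (d x)"
      have y: "?y \<in> space P" using x hom_in[OF d(1), of x] by simp
      have "d ?y = vscale (inverse \<alpha>) (d x)"
        using lin_simps[OF hom_lin[OF d(1)]] by (simp add: d(2))
      then have "\<iota> (g ?y) = x"
        unfolding ab using y \<open>\<alpha> \<noteq> 0\<close> by simp (rule vec_eqI, simp add: lookup_add lookup_minus field_simps)
      moreover have "\<iota> (g ?y) \<in> M" using W(4)[OF hom_in[OF g(1)]] by blast
      ultimately have "x \<in> M" by simp
      then show "x \<in> N" using Mmin[OF N(1) vN] by blast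
    qed
    then show ?thesis using NP by blast
  qed
  then show ?thesis unfolding essential_def using p(1) sur by blast
qed

lemma ladder_verma:
  obtains X d where "ladder (verma (- 1)) X d"
  using ladder_exists[OF verma_closed[of "- 1"] _ verma_endomorphism, of "basis_vec 0"] by (simp add: cas_verma) blast

text \<open>The Verma module of highest weight - n - 1 is simple and so a candidate for the choice
  \<open>L_hw\<close>. The chosen module is a quotient of it, hence in O. The Casimir eigenspace
  that contains the highest weight vector is a nonzero submodule, hence everything.\<close>

lemma L_hw_properties:
  assumes \<mu>: "\<mu> = - of_nat (n + 1)"
  obtains l where "simple_module (L_hw \<mu>)" "L_hw \<mu> \<in> O_modules" "stage n (L_hw \<mu>) (\<lambda>v. 0)"
    "l \<in> space (L_hw \<mu>)" "l \<noteq> 0" "act_e (L_hw \<mu>) l = 0" "act_h (L_hw \<mu>) l = vscale \<mu> l"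
proof -
  have "\<mu> \<noteq> of_nat j" for j
  proof
    assume "\<mu> = of_nat j"
    have "of_nat (j + (n + 1)) = \<mu> + of_nat (n + 1)" unfolding \<open>\<mu> = of_nat j\<close> by (rule of_nat_add)
    also have "\<dots> = 0" unfolding \<mu> by (rule left_minus)
    finally have "of_nat (j + (n + 1)) = (0 :: complex)" .
    then show False by (simp only: of_nat_eq_0_iff)
  qed
  then have "simple_module (verma \<mu>)" by (rule verma_simple)
  moreover have "\<exists>v\<in>space (verma \<mu>). v \<noteq> 0 \<and> act_e (verma \<mu>) v = 0 \<and> act_h (verma \<mu>) v = vscale \<mu> v"
    by (intro bexI[of _ "basis_vec 0"]) (simp_all add: act_verma)
  ultimately have ex: "\<exists>V. simple_module V \<and> (\<exists>v\<in>space V. v \<noteq> 0 \<and> act_e V v = 0 \<and> act_h V v = vscale \<mu> v)" by blast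
  define L where "L = L_hw \<mu>"
  have "simple_module L \<and> (\<exists>v\<in>space L. v \<noteq> 0 \<and> act_e L v = 0 \<and> act_h L v = vscale \<mu> v)"
    unfolding L_def L_hw_def by (rule someI_ex[OF ex])
  then obtain l where s: "simple_module L" and l: "l \<in> space L" "l \<noteq> 0" "act_e L l = 0" "act_h L l = vscale \<mu> l" by blast
  have L: "L \<in> sl2_modules" using s by (simp add: simple_module_def)
  obtain g where g: "g \<in> sl2_hom (verma \<mu>) L" "g (basis_vec 0) = l" by (rule verma_hom[OF L l(1,3,4)])
  have "g (basis_vec 0) \<noteq> 0" using g(2) l(2) by simp
  then have "g ` space (verma \<mu>) = space L" by (rule simple_hom(2)[OF g(1) verma_closed L _ s])
  then have LO: "L \<in> O_modules" by (rule O_quotient[OF verma_O L g(1)])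
  interpret R: sl2_rep vscale "act_e L" "act_f L" "act_h L" by (rule rep_vec[OF L])
  let ?c = "of_nat n * of_nat n :: complex"
  have cl: "cas L l = vscale ?c l"
  proof -
    have "cas L l = R.cc l" using l(1) by (simp add: cas_def R.cc_def)
    also have "\<dots> = vscale ?c l" unfolding R.cc_highest_weight[OF l(3,4)] by (simp add: \<mu>)
    finally show ?thesis .
  qed
  define T where "T = cas L - map_scale ?c (idm L)"
  have Th: "T \<in> sl2_hom L L" unfolding T_def by (intro hom_minus hom_scale hom_id cas_hom L)
  have "l \<in> {x \<in> space L. T x = 0}" using l(1) cl by (simp add: T_def)
  then have "{x \<in> space L. T x = 0} = space L"
    using s submodule_kernel[OF Th L L] l(2) unfolding simple_module_def by blast
  then have "T (idm L v) = 0" for v using id_map_in[of "basis L" v] by blast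
  then have "T v = 0" for v by (simp only: hom_dom[OF Th])
  then have "cas L v = vscale ?c (idm L v)" for v by (simp add: T_def)
  then have "stage n L (\<lambda>v. 0)"
    using hom_zero[OF L, of L] L by (simp add: stage_def zero_fun_def)
  then show ?thesis using that s LO l unfolding L_def by blast
qed

theorem K1_simple_transitive_type_C: "simple_transitive FD K1" "type_C_infinity FD (L_fd 1) K1"
proof -
  obtain X d where lad: "ladder (verma (- 1)) X d" by (rule ladder_verma)
  then interpret ladder_modules "verma (- 1)" X d by unfold_locales
  have proj: "projective_in_O (X n)" for n
  proof (induction n)
    case 0
    show ?case unfolding X0 by (rule verma_projective)
  next
    case (Suc n)
    obtain s r As where "s \<in> sl2_hom (X (Suc n)) (F (X n))" "r \<in> sl2_hom (F (X n)) (X (Suc n))" "r \<circ> s = idm (X (Suc n))"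
      by (rule F_X_decomposition)
    then show ?case by (rule projective_retract[OF projective_F[OF Suc] Xm])
  qed
  have cover: "\<exists>p. essential (X n) (L_hw (- of_nat (n + 1))) p" and LO: "L_hw (- of_nat (n + 1)) \<in> O_modules" for n
  proof -
    obtain l where l: "simple_module (L_hw (- of_nat (n + 1)))" "L_hw (- of_nat (n + 1)) \<in> O_modules" "stage n (L_hw (- of_nat (n + 1))) (\<lambda>v. 0)"
      "l \<in> space (L_hw (- of_nat (n + 1)))" "l \<noteq> 0" "act_e (L_hw (- of_nat (n + 1))) l = 0"
      "act_h (L_hw (- of_nat (n + 1))) l = vscale (- of_nat (n + 1)) l"
      by (rule L_hw_properties[OF refl])
    obtain g x where g: "g \<in> sl2_hom (X n) (L_hw (- of_nat (n + 1)))" "g x \<noteq> 0"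
      using highest_weight_hom[OF lad l(3-7)] by blast
    have "essential (X n) (L_hw (- of_nat (n + 1))) g"
      by (rule essential_simple_quotient[OF proj l(2,1) g dh dd sc l(4,5,7)])
    then show "\<exists>p. essential (X n) (L_hw (- of_nat (n + 1))) p" by blast
    show "L_hw (- of_nat (n + 1)) \<in> O_modules" by (rule l(2))
  qed
  \<comment> \<open>\<open>P_cover\<close> is a choice among projective covers; by uniqueness it is
    isomorphic to \<open>X n\<close>.\<close>
  have P: "mod_iso (P_cover (- of_nat (n + 1))) (X n)" "P_cover (- of_nat (n + 1)) \<in> O_modules" for n
  proof -
    have "projective_cover_in_O (X n) (L_hw (- of_nat (n + 1)))"
      unfolding projective_cover_iff using proj cover by blast
    then have "projective_cover_in_O (P_cover (- of_nat (n + 1))) (L_hw (- of_nat (n + 1)))"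
      unfolding P_cover_def by (rule someI)
    then obtain p where p: "projective_in_O (P_cover (- of_nat (n + 1)))" "essential (P_cover (- of_nat (n + 1))) (L_hw (- of_nat (n + 1))) p"
      unfolding projective_cover_iff by blast
    obtain q where q: "essential (X n) (L_hw (- of_nat (n + 1))) q" using cover by blast
    show "mod_iso (P_cover (- of_nat (n + 1))) (X n)" by (rule projective_cover_unique[OF p proj q LO])
    show "P_cover (- of_nat (n + 1)) \<in> O_modules" by (rule projective_O[OF p(1)])
  qed
  let ?Z = "{P_cover (- of_nat n) |n. n \<ge> 1}"
  \<comment> \<open>The projective modules are numbered from 1, the ladder from 0.\<close>
  have Z: "?Z = range (\<lambda>n. P_cover (- of_nat (n + 1)))"
  proof (intro set_eqI iffI)
    fix z assume "z \<in> ?Z"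
    then obtain n where n: "z = P_cover (- of_nat n)" "n \<ge> 1" by blast
    then show "z \<in> range (\<lambda>n. P_cover (- of_nat (n + 1)))" by (intro range_eqI[of _ _ "n - 1"]) simp
  next
    fix z assume "z \<in> range (\<lambda>n. P_cover (- of_nat (n + 1)))"
    then obtain n where "z = P_cover (- of_nat (n + 1))" by blast
    moreover have "n + 1 \<ge> 1" by simp
    ultimately show "z \<in> ?Z" by blast
  qed
  have "additive_closure (Mod O_modules) ?Z = K"
    unfolding Z
  proof (rule additive_closure_K)
    show "O_modules \<subseteq> sl2_modules" by blast
    show "K \<subseteq> O_modules"
    proof
      fix V assume "V \<in> K"
      then obtain As where As: "V \<in> sl2_modules" "set As \<subseteq> range X" "splits_through As V" by (auto simp: K_def)
      have "set As \<subseteq> O_modules" using As(2) projective_O[OF proj] by blast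
      then show "V \<in> O_modules" by (rule O_splits[OF As(3) _ As(1)])
    qed
    show "range (\<lambda>n. P_cover (- of_nat (n + 1))) \<subseteq> O_modules" using P(2) by (rule image_subsetI)
    fix z assume "z \<in> range (\<lambda>n. P_cover (- of_nat (n + 1)))"
    then obtain n where "z = P_cover (- of_nat (n + 1))" by blast
    then show "\<exists>i. mod_iso z (X i)" using P(1)[of n] by (intro exI[of _ n]) simp
  next
    show "\<exists>z\<in>range (\<lambda>n. P_cover (- of_nat (n + 1))). mod_iso (X i) z" for i
      by (rule bexI[of _ "P_cover (- of_nat (i + 1))"], rule mod_iso_sym[OF P(1)]) (rule range_eqI[of _ _ i], rule refl)
  qed
  then have "K1 = Mod K" unfolding K1_def category_O_Mod by (simp only:)
  then show "simple_transitive FD K1" "type_C_infinity FD (L_fd 1) K1"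
    using simple_transitive_K type_C_infinity_K by simp_all
qed

theorem proposition16:
  fixes \<xi> :: complex
  assumes "\<xi> \<noteq> 0"
  shows "simple_transitive finite_dimensional_sl2_modules K1 \<and>
     type_C_infinity finite_dimensional_sl2_modules (L_fd 1) K1 \<and>
     simple_transitive finite_dimensional_sl2_modules (K2 \<xi>) \<and>
     type_C_infinity finite_dimensional_sl2_modules (L_fd 1) (K2 \<xi>)"
  using K1_simple_transitive_type_C K2_simple_transitive_type_C[OF assms] by blast

end
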